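(* Let $\omega\subset\mathbb{R}^2$ be a bounded domain, $\Omega=\omega\times\mathbb{R}$, let $\gamma$ be a nonempty open subset of $\partial\omega$, and for $L>0$ put $\Gamma=\gamma\times(-2L,2L)\subset\partial\Omega$. For $L>0$, $\underline{t}>0$ and $M>0$ fixed, let $\alpha_i\in W^{1,\infty}(\mathbb{R})$, $i=1,2$, satisfy $\alpha_1(x_3)=\alpha_2(x_3)$ for $|x_3|>L$, $\alpha_i\ge \underline{t}$ and $\|\alpha_i\|_{W^{1,\infty}(\mathbb{R})}\le M$. Then there exists a constant $C>0$ depending only on $\omega$, $M$ and $L$, such that $$\|\alpha_1-\alpha_2\|_{L^\infty(\mathbb{R})}\le C\,\big\|(\Lambda^\bullet_{\alpha_1})^\Gamma-(\Lambda^\bullet_{\alpha_2})^\Gamma\big\|_{\mathscr{L}(\widetilde{H}^{1/2}(\partial\Omega),\widetilde{H}^{-1/2}(\partial\Omega))},$$ where $(\Lambda^\bullet_{\alpha_i})^\Gamma$ is the restriction of the Dirichlet-to-Neumann map $\Lambda^\bullet_{\alpha_i}$ to $\widetilde{H}^{1/2}_\Gamma(\partial\Omega)$, $i=1,2$.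
   Context: Points of $\Omega=\omega\times\mathbb{R}$ are written $x=(x',x_3)$ with $x'=(x_1,x_2)\in\omega$. The boundary of $\omega$ is assumed regular enough for the traces below and the outward unit normal $\nu$ to $\partial\Omega=\partial\omega\times\mathbb{R}$ to make sense. Trace spaces: $\widetilde{H}^{1/2}(\partial\Omega)$ is the space of $g\in L^2(\mathbb{R},H^{1/2}(\partial\omega))$ for which there is $G\in H^1(\Omega)$ with $G=g$ on $\partial\Omega$ in the trace sense, with norm $\|g\|_{\widetilde{H}^{1/2}(\partial\Omega)}=\min\{\|G\|_{H^1(\Omega)};\ G\in H^1(\Omega),\ G=g \text{ on }\partial\Omega\}$. $\widetilde{H}^{-1/2}(\partial\Omega)$ is its dual, with duality pairing $\langle\cdot,\cdot\rangle$. $\widetilde{H}^{1/2}_\Gamma(\partial\Omega)=\{f\in\widetilde{H}^{1/2}(\partial\Omega);\ \mathrm{supp} f\subset\Gamma\}$ carries the norm of $\widetilde{H}^{1/2}(\partial\Omega)$. The norm of $(\Lambda^\bullet_{\alpha_1})^\Gamma-(\Lambda^\bullet_{\alpha_2})^\Gamma$ is its operator norm from $\widetilde{H}^{1/2}_\Gamma(\partial\Omega)$ (as a subspace of $\widetilde{H}^{1/2}(\partial\Omega)$) into $\widetilde{H}^{-1/2}(\partial\Omega)$. Matrix: for $x'\in\omega$, $t\in\mathbb{R}$, $$A^\bullet(x',t)=t\begin{pmatrix}1+x_2^2&-x_2x_1&-x_2\\-x_2x_1&1+x_1^2&x_1\\-x_2&x_1&1\end{pmatrix}.$$ DN map: for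 $\alpha\in W^{1,\infty}(\mathbb{R})$ bounded below by a positive constant and $f\in\widetilde{H}^{1/2}(\partial\Omega)$, let $u\in H^1(\Omega)$ be the unique weak solution to $\mathrm{div}(A^\bullet(x',\alpha(x_3))\nabla u)=0$ in $\Omega$, $u=f$ on $\partial\Omega$. Then $\Lambda^\bullet_\alpha f=A^\bullet(x',\alpha(x_3))\nabla u\cdot\nu\in\widetilde{H}^{-1/2}(\partial\Omega)$, i.e. $\langle\Lambda^\bullet_\alpha f,g\rangle=\int_\Omega A^\bullet(x',\alpha(x_3))\nabla u\cdot\nabla G\,dx$ for all $g\in\widetilde{H}^{1/2}(\partial\Omega)$ and all $G\in H^1(\Omega)$ with $G=g$ on $\partial\Omega$. *)

theory Defs
  imports "HOL-Probability.Essential_Supremum"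
begin

section \<open>One-dimensional Hausdorff measure\<close>

text \<open>
  On the boundary of a Lipschitz domain in the plane this is arc length. The library has no
  surface measure, so the measure is built here by Caratheodory's construction; the theorem
  \<open>emeasure_hausdorff1\<close> shows that \<open>measure_of\<close> does not degenerate to the zero measure.
\<close>

definition hausdorff1_pre :: "real \<Rightarrow> 'a::metric_space set \<Rightarrow> ennreal" where
  "hausdorff1_pre \<delta> S =
     (INF A\<in>{A :: nat \<Rightarrow> 'a set. S \<subseteq> (\<Union>i. A i) \<and> (\<forall>i. bounded (A i) \<and> diameter (A i) \<le> \<delta>)}.
        \<Sum>i. ennreal (diameter (A i)))"

definition hausdorff1_outer :: "'a::metric_space set \<Rightarrow> ennreal" where
  "hausdorff1_outer S = (SUP \<delta>\<in>{0<..}. hausdorff1_pre \<delta> S)"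

definition hausdorff1 :: "'a::metric_space measure" where
  "hausdorff1 = measure_of UNIV (sets borel) hausdorff1_outer"

lemma hausdorff1_pre_antimono: "\<delta> \<le> \<delta>' \<Longrightarrow> hausdorff1_pre \<delta>' S \<le> hausdorff1_pre \<delta> S"
  unfolding hausdorff1_pre_def by (rule INF_superset_mono) (auto intro: order_trans)

lemma hausdorff1_pre_mono: "S \<subseteq> T \<Longrightarrow> hausdorff1_pre \<delta> S \<le> hausdorff1_pre \<delta> T"
  unfolding hausdorff1_pre_def by (rule INF_superset_mono) auto

lemma hausdorff1_pre_le_outer: "\<delta> > 0 \<Longrightarrow> hausdorff1_pre \<delta> S \<le> hausdorff1_outer S"
  unfolding hausdorff1_outer_def by (rule SUP_upper) auto

lemma hausdorff1_outer_mono: "S \<subseteq> T \<Longrightarrow> hausdorff1_outer S \<le> hausdorff1_outer T"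
  unfolding hausdorff1_outer_def by (rule SUP_mono) (auto intro: hausdorff1_pre_mono)

lemma hausdorff1_outer_empty [simp]: "hausdorff1_outer {} = 0"
proof -
  have "hausdorff1_pre \<delta> ({}::'a set) \<le> 0" if "\<delta> > 0" for \<delta> :: real
    unfolding hausdorff1_pre_def
    by (rule INF_lower2[of "\<lambda>_. {}"]) (use that in auto)
  then show ?thesis
    unfolding hausdorff1_outer_def by (intro antisym SUP_least) auto
qed

lemma hausdorff1_pre_UN:
  fixes A :: "nat \<Rightarrow> 'a::metric_space set"
  shows "hausdorff1_pre \<delta> (\<Union>i. A i) \<le> (\<Sum>i. hausdorff1_pre \<delta> (A i))"
proof (rule ennreal_le_epsilon)
  fix e :: real assume fin: "(\<Sum>i. hausdorff1_pre \<delta> (A i)) < top" and e: "0 < e"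
  have *: "hausdorff1_pre \<delta> (A i) < top" for i
    using fin ennreal_suminf_lessD by blast
  have "\<exists>C. A i \<subseteq> (\<Union>j. C j) \<and> (\<forall>j. bounded (C j) \<and> diameter (C j) \<le> \<delta>) \<and>
          (\<Sum>j. ennreal (diameter (C j))) \<le> hausdorff1_pre \<delta> (A i) + e * (1/2)^Suc i" for i
  proof -
    have "hausdorff1_pre \<delta> (A i) < hausdorff1_pre \<delta> (A i) + ennreal (e * (1/2)^Suc i)"
      using *[of i] e
      by (cases "hausdorff1_pre \<delta> (A i)") (auto simp flip: ennreal_plus intro!: ennreal_lessI add_nonneg_pos)
    then show ?thesis
      unfolding hausdorff1_pre_def[of \<delta> "A i"] INF_less_iff
      by auto
  qed
  then obtain C where C: "\<And>i. A i \<subseteq> (\<Union>j. C i j)" "\<And>i j. bounded (C i j)" "\<And>i j. diameter (C i j) \<le> \<delta>"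
      "\<And>i. (\<Sum>j. ennreal (diameter (C i j))) \<le> hausdorff1_pre \<delta> (A i) + e * (1/2)^Suc i"
    by metis
  let ?D = "\<lambda>n. case prod_decode n of (i, j) \<Rightarrow> C i j"
  have cov: "(\<Union>i. A i) \<subseteq> (\<Union>n. ?D n)"
  proof
    fix x assume "x \<in> (\<Union>i. A i)"
    then obtain i j where "x \<in> C i j" using C(1) by blast
    then have "x \<in> ?D (prod_encode (i, j))" by simp
    then show "x \<in> (\<Union>n. ?D n)" by (rule UN_I[OF UNIV_I])
  qed
  have "hausdorff1_pre \<delta> (\<Union>i. A i) \<le> (\<Sum>n. ennreal (diameter (?D n)))"
    unfolding hausdorff1_pre_def
    by (rule INF_lower) (use cov C in \<open>auto split: prod.split\<close>)
  also have "\<dots> = (\<Sum>n. case prod_decode n of (i, j) \<Rightarrow> ennreal (diameter (C i j)))"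
    by (intro suminf_cong) (auto split: prod.split)
  also have "\<dots> = (\<Sum>i. \<Sum>j. ennreal (diameter (C i j)))"
    using suminf_ennreal_2dimen[of "\<lambda>i. \<Sum>j. ennreal (diameter (C i j))" "\<lambda>(i,j). ennreal (diameter (C i j))"]
    by (simp add: o_def)
  also have "\<dots> \<le> (\<Sum>i. hausdorff1_pre \<delta> (A i) + ennreal (e * (1/2)^Suc i))"
    by (intro suminf_le C) auto
  also have "\<dots> = (\<Sum>i. hausdorff1_pre \<delta> (A i)) + (\<Sum>i. ennreal (e * (1/2)^Suc i))"
    by (intro suminf_add[symmetric]) auto
  also have "(\<Sum>i. ennreal (e * (1/2)^Suc i)) = ennreal e"
    using e sums_mult[OF power_half_series, of e] by (intro suminf_ennreal_eq) auto
  finally show "hausdorff1_pre \<delta> (\<Union>i. A i) \<le> (\<Sum>i. hausdorff1_pre \<delta> (A i)) + ennreal e" .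
qed

lemma hausdorff1_outer_UN:
  fixes A :: "nat \<Rightarrow> 'a::metric_space set"
  shows "hausdorff1_outer (\<Union>i. A i) \<le> (\<Sum>i. hausdorff1_outer (A i))"
  unfolding hausdorff1_outer_def[of "\<Union>i. A i"]
proof (rule SUP_least)
  fix \<delta> :: real assume "\<delta> \<in> {0<..}"
  then show "hausdorff1_pre \<delta> (\<Union>i. A i) \<le> (\<Sum>i. hausdorff1_outer (A i))"
    by (intro order_trans[OF hausdorff1_pre_UN] suminf_le hausdorff1_pre_le_outer) auto
qed

lemma outer_measure_space_hausdorff1:
  "outer_measure_space UNIV (hausdorff1_outer :: 'a::metric_space set \<Rightarrow> ennreal)"
  unfolding outer_measure_space_def positive_def increasing_def countably_subadditive_def
  by (auto intro: hausdorff1_outer_mono hausdorff1_outer_UN)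

lemma hausdorff1_outer_Un: "hausdorff1_outer (A \<union> B) \<le> hausdorff1_outer A + hausdorff1_outer B"
proof -
  let ?F = "\<lambda>i::nat. if i = 0 then A else if i = 1 then B else {}"
  have "hausdorff1_outer (\<Union>i. ?F i) \<le> (\<Sum>i. hausdorff1_outer (?F i))"
    by (rule hausdorff1_outer_UN)
  also have "(\<Sum>i. hausdorff1_outer (?F i)) = (\<Sum>i\<in>{0,1}. hausdorff1_outer (?F i))"
    by (rule suminf_finite) auto
  also have "(\<Union>i. ?F i) = A \<union> B" by (auto split: if_splits) 
  finally show ?thesis by simp
qed

lemma hausdorff1_pre_separated:
  fixes A B :: "'a::metric_space set"
  assumes sep: "\<And>x y. x \<in> A \<Longrightarrow> y \<in> B \<Longrightarrow> e \<le> dist x y" and "0 < \<delta>" "\<delta> < e"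
  shows "hausdorff1_pre \<delta> A + hausdorff1_pre \<delta> B \<le> hausdorff1_pre \<delta> (A \<union> B)"
  unfolding hausdorff1_pre_def[of \<delta> "A \<union> B"]
proof (rule INF_greatest, safe)
  fix C :: "nat \<Rightarrow> 'a set"
  assume cov: "A \<union> B \<subseteq> (\<Union>i. C i)" and C: "\<forall>i. bounded (C i) \<and> diameter (C i) \<le> \<delta>"
  let ?A = "\<lambda>i. if C i \<inter> A = {} then {} else C i"
  let ?B = "\<lambda>i. if C i \<inter> A = {} then C i else {}"
  have disj: "C i \<inter> B = {}" if "C i \<inter> A \<noteq> {}" for i
  proof (rule ccontr)
    assume "C i \<inter> B \<noteq> {}"
    then obtain x y where "x \<in> C i" "x \<in> A" "y \<in> C i" "y \<in> B" using \<open>C i \<inter> A \<noteq> {}\<close> by blast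
    then have "dist x y \<le> diameter (C i)" "e \<le> dist x y"
      using C by (auto intro: diameter_bounded_bound sep)
    then show False using C[rule_format, of i] \<open>\<delta> < e\<close> by linarith
  qed
  have "hausdorff1_pre \<delta> A \<le> (\<Sum>i. ennreal (diameter (?A i)))"
    unfolding hausdorff1_pre_def
    by (rule INF_lower) (use cov C \<open>0 < \<delta>\<close> in \<open>auto; blast\<close>)
  moreover have "hausdorff1_pre \<delta> B \<le> (\<Sum>i. ennreal (diameter (?B i)))"
    unfolding hausdorff1_pre_def
    by (rule INF_lower) (use cov C \<open>0 < \<delta>\<close> disj in \<open>auto; blast\<close>)
  ultimately have "hausdorff1_pre \<delta> A + hausdorff1_pre \<delta> B
      \<le> (\<Sum>i. ennreal (diameter (?A i))) + (\<Sum>i. ennreal (diameter (?B i)))"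
    by (rule add_mono)
  also have "\<dots> = (\<Sum>i. ennreal (diameter (?A i)) + ennreal (diameter (?B i)))"
    by (rule suminf_add) auto
  also have "\<dots> = (\<Sum>i. ennreal (diameter (C i)))"
    by (intro suminf_cong) auto
  finally show "hausdorff1_pre \<delta> A + hausdorff1_pre \<delta> B \<le> (\<Sum>i. ennreal (diameter (C i)))" .
qed

lemma hausdorff1_outer_separated:
  fixes A B :: "'a::metric_space set"
  assumes sep: "\<And>x y. x \<in> A \<Longrightarrow> y \<in> B \<Longrightarrow> e \<le> dist x y" and "0 < e"
  shows "hausdorff1_outer A + hausdorff1_outer B \<le> hausdorff1_outer (A \<union> B)"
proof -
  have *: "hausdorff1_pre d A + hausdorff1_pre d' B \<le> hausdorff1_outer (A \<union> B)"
    if "d > 0" "d' > 0" for d d'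
  proof -
    let ?m = "min (min d d') (e/2)"
    have "hausdorff1_pre d A + hausdorff1_pre d' B \<le> hausdorff1_pre ?m A + hausdorff1_pre ?m B"
      by (intro add_mono hausdorff1_pre_antimono) auto
    also have "\<dots> \<le> hausdorff1_pre ?m (A \<union> B)"
      by (rule hausdorff1_pre_separated[where e = e]) (use that \<open>0 < e\<close> in \<open>auto intro: sep\<close>)
    also have "\<dots> \<le> hausdorff1_outer (A \<union> B)"
      by (rule hausdorff1_pre_le_outer) (use that \<open>0 < e\<close> in auto)
    finally show ?thesis .
  qed
  have "hausdorff1_outer A + hausdorff1_pre d' B \<le> hausdorff1_outer (A \<union> B)" if "d' > 0" for d'
    unfolding hausdorff1_outer_def[of A]
    by (subst ennreal_SUP_add_left[symmetric]) (auto intro!: SUP_least * that)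
  then show ?thesis
    unfolding hausdorff1_outer_def[of B] add.commute[of "hausdorff1_outer A"]
    by (subst ennreal_SUP_add_left[symmetric]) (auto intro!: SUP_least simp: add.commute)
qed

lemma hausdorff1_outer_closed_split:
  fixes F S :: "'a::metric_space set"
  assumes "closed F"
  shows "hausdorff1_outer (S \<inter> F) + hausdorff1_outer (S - F) \<le> hausdorff1_outer S"
proof (cases "F = {} \<or> hausdorff1_outer S = top")
  case True
  then show ?thesis by auto
next
  case False
  then have F: "F \<noteq> {}" and fin: "hausdorff1_outer S < top" by (auto simp: less_top)
  define T where "T n = {x\<in>S. 1 / real (Suc n) \<le> infdist x F}" for n
  define R where "R n = T (Suc n) - T n" for n
  have T_mono: "T m \<subseteq> T n" if "m \<le> n" for m n
    proof -
    have "1 / real (Suc n) \<le> 1 / real (Suc m)" using that by (intro frac_le) auto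
    then show ?thesis by (auto simp: T_def simp del: of_nat_Suc)
  qed
  have sepT: "1 / real (Suc m) - 1 / real (Suc n) \<le> dist x y" if "x \<in> T m" "y \<notin> T n" "y \<in> S" for x y m n
    using that infdist_triangle[of x F y] by (auto simp: T_def)
  have pos: "1 / real (Suc m) - 1 / real (Suc n) > 0" if "m < n" for m n
    using that by (auto intro: divide_strict_left_mono)
  have fin_sum: "(\<Sum>j<m. hausdorff1_outer (R (2*j+c))) \<le> hausdorff1_outer (\<Union>j<m. R (2*j+c))" for c m
  proof (induction m)
    case (Suc m)
    have "hausdorff1_outer (\<Union>j<m. R (2*j+c)) + hausdorff1_outer (R (2*m+c))
        \<le> hausdorff1_outer ((\<Union>j<m. R (2*j+c)) \<union> R (2*m+c))"
    proof (cases "m = 0")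
      case False
      show ?thesis
      proof (rule hausdorff1_outer_separated)
        fix x y assume x: "x \<in> (\<Union>j<m. R (2*j+c))" and y: "y \<in> R (2*m+c)"
        from x obtain j where j: "j < m" "x \<in> T (Suc (2*j+c))" by (auto simp: R_def)
        moreover have "Suc (2*j+c) \<le> 2*m+c-1" using j(1) by linarith
        ultimately have "x \<in> T (2*m+c-1)" by (metis T_mono subsetD)
        then show "1 / real (Suc (2*m+c-1)) - 1 / real (Suc (2*m+c)) \<le> dist x y"
          using y by (intro sepT) (auto simp: R_def T_def)
      qed (use False in \<open>intro pos, simp\<close>)
    qed auto
    also have "(\<Union>j<m. R (2*j+c)) \<union> R (2*m+c) = (\<Union>j<Suc m. R (2*j+c))"
      by (auto simp: less_Suc_eq)
    finally show ?case using Suc by (auto intro: order_trans add_right_mono)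
  qed auto
  have fin_sum': "(\<Sum>j. hausdorff1_outer (R (2*j+c))) \<le> hausdorff1_outer S" for c
    by (intro suminf_le_const summableI order_trans[OF fin_sum] hausdorff1_outer_mono)
       (auto simp: R_def T_def)
  have "(\<Sum>k. hausdorff1_outer (R k)) \<le> hausdorff1_outer S + hausdorff1_outer S"
  proof (rule suminf_le_const[OF summableI])
    fix n
    have "(\<Sum>k<n. hausdorff1_outer (R k)) \<le> (\<Sum>k<2*n. hausdorff1_outer (R k))"
      by (intro sum_mono2) auto
    also have "\<dots> = (\<Sum>j<n. hausdorff1_outer (R (2*j+0))) + (\<Sum>j<n. hausdorff1_outer (R (2*j+1)))"
      by (induction n) (simp_all add: add.assoc add.left_commute)
    also have "\<dots> \<le> hausdorff1_outer S + hausdorff1_outer S"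
      by (intro add_mono order_trans[OF sum_le_suminf fin_sum']) (auto intro: summableI)
    finally show "(\<Sum>k<n. hausdorff1_outer (R k)) \<le> hausdorff1_outer S + hausdorff1_outer S" .
  qed
  also have "\<dots> < top" using fin by simp
  finally have sumR: "(\<Sum>k. hausdorff1_outer (R k)) \<noteq> top" by simp
  have tail: "(\<lambda>n. \<Sum>k. hausdorff1_outer (R (k + n))) \<longlonglongrightarrow> 0"
  proof -
    have r: "hausdorff1_outer (R k) \<noteq> top" for k
      using sumR ennreal_suminf_lessD[of "\<lambda>k. hausdorff1_outer (R k)" top k] by (auto simp: less_top)
    let ?r = "\<lambda>k. enn2real (hausdorff1_outer (R k))"
    have eq: "hausdorff1_outer (R k) = ennreal (?r k)" for k using r[of k] by (simp add: less_top)
    have s: "summable ?r"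
      by (rule summable_suminf_not_top) (use sumR eq in auto)
    have s': "summable (\<lambda>k. ?r (k + n))" for n
      using s by (subst summable_iff_shift)
    have "(\<lambda>n. ennreal (\<Sum>k. ?r (k + n))) \<longlonglongrightarrow> ennreal 0"
      by (intro tendsto_ennrealI suminf_exist_split2 s)
    moreover have "(\<Sum>k. hausdorff1_outer (R (k + n))) = ennreal (\<Sum>k. ?r (k + n))" for n
      by (subst eq, rule suminf_ennreal2) (use s' in auto)
    ultimately show ?thesis by simp
  qed
  have main: "hausdorff1_outer (S \<inter> F) + hausdorff1_outer (S - F)
      \<le> hausdorff1_outer S + (\<Sum>k. hausdorff1_outer (R (k + n)))" for n
  proof -
    have sub: "S - F \<subseteq> T n \<union> (\<Union>k. R (k + n))"
    proof
      fix x assume x: "x \<in> S - F"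
      then have "infdist x F > 0"
        using \<open>closed F\<close> F infdist_nonneg[of x F] in_closed_iff_infdist_zero[of F x] by (auto simp: order_less_le)
      then obtain m where "1 / real (Suc m) < infdist x F" using nat_approx_posE by metis
      then have ex: "x \<in> T m" using x by (auto simp: T_def)
      show "x \<in> T n \<union> (\<Union>k. R (k + n))"
      proof (cases "x \<in> T n")
        case False
        define l where "l = (LEAST m. x \<in> T m)"
        have l: "x \<in> T l" unfolding l_def using ex by (rule LeastI)
        then have "n < l" using False T_mono[of l n] by (meson leI subsetD)
        then obtain k where k: "l = Suc k" "n \<le> k" by (cases l) auto
        then have "x \<notin> T k" using not_less_Least[of k "\<lambda>m. x \<in> T m"] by (auto simp: l_def)
        then have "x \<in> R ((k - n) + n)" using l k by (auto simp: R_def)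
        then show ?thesis by blast
      qed auto
    qed
    have "hausdorff1_outer (S - F) \<le> hausdorff1_outer (T n) + (\<Sum>k. hausdorff1_outer (R (k + n)))"
      by (rule order_trans[OF hausdorff1_outer_mono[OF sub]], rule order_trans[OF hausdorff1_outer_Un])
         (intro add_left_mono hausdorff1_outer_UN)
    moreover have "hausdorff1_outer (S \<inter> F) + hausdorff1_outer (T n) \<le> hausdorff1_outer S"
    proof -
      have "hausdorff1_outer (S \<inter> F) + hausdorff1_outer (T n) \<le> hausdorff1_outer ((S \<inter> F) \<union> T n)"
      proof (rule hausdorff1_outer_separated[where e = "1 / real (Suc n)"])
        fix x y assume "x \<in> S \<inter> F" "y \<in> T n"
        then show "1 / real (Suc n) \<le> dist x y"
          using infdist_le[of x F y] by (auto simp: T_def dist_commute)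
      qed auto
      also have "\<dots> \<le> hausdorff1_outer S" by (rule hausdorff1_outer_mono) (auto simp: T_def)
      finally show ?thesis .
    qed
    ultimately show ?thesis
      by (smt (verit) add.assoc add_left_mono add_right_mono order_trans)
  qed
  have "(\<lambda>n. hausdorff1_outer S + (\<Sum>k. hausdorff1_outer (R (k + n)))) \<longlonglongrightarrow> hausdorff1_outer S + 0"
    by (intro tendsto_add tail tendsto_const)
  then show ?thesis
    using main by (intro LIMSEQ_le_const) auto
qed

theorem emeasure_hausdorff1:
  fixes X :: "'a::metric_space set"
  assumes "X \<in> sets borel"
  shows "emeasure hausdorff1 X = hausdorff1_outer X"
proof -
  interpret S: sigma_algebra "UNIV :: 'a set" UNIV by (simp add: sigma_algebra_iff2)
  let ?L = "lambda_system UNIV UNIV (hausdorff1_outer :: 'a set \<Rightarrow> ennreal)"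
  have ms: "measure_space UNIV ?L (hausdorff1_outer :: 'a set \<Rightarrow> ennreal)"
    by (rule S.caratheodory_lemma[OF outer_measure_space_hausdorff1])
  then have sa: "sigma_algebra UNIV ?L" by (simp add: measure_space_def)
  have "F \<in> ?L" if "closed F" for F :: "'a set"
    unfolding S.lambda_system_eq
  proof (auto intro!: antisym hausdorff1_outer_closed_split that)
    fix S :: "'a set"
    have "hausdorff1_outer S \<le> hausdorff1_outer ((S \<inter> F) \<union> (S - F))" by (simp add: Int_Diff_Un)
    then show "hausdorff1_outer S \<le> hausdorff1_outer (S \<inter> F) + hausdorff1_outer (S - F)"
      using hausdorff1_outer_Un order_trans by blast
  qed
  then have "sets (borel :: 'a measure) \<subseteq> ?L"
    unfolding borel_eq_closed
    by (subst sets_measure_of) (auto intro!: sigma_algebra.sigma_sets_subset[OF sa])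
  then have "countably_additive (sets (borel :: 'a measure)) hausdorff1_outer"
    using ms by (auto simp: measure_space_def countably_additive_def)
  then show ?thesis
    using assms unfolding hausdorff1_def
    by (intro emeasure_measure_of_sigma)
       (auto simp: positive_def sets.sigma_algebra_axioms intro: sets.sigma_algebra_axioms[of borel, simplified])
qed

lemma sets_hausdorff1 [simp, measurable_cong]: "sets hausdorff1 = sets borel"
  unfolding hausdorff1_def using sets.sigma_sets_eq[of borel] by (simp add: sets_measure_of)

lemma space_hausdorff1 [simp]: "space hausdorff1 = UNIV"
  by (simp add: hausdorff1_def)


section \<open>Sobolev spaces\<close>

text \<open>
  Elements of function spaces are represented by Borel functions; equality of classes is equality
  almost everywhere, and values outside the underlying set are irrelevant. All functions are
  real-valued.
\<close>

abbreviation vol :: "'a::euclidean_space set \<Rightarrow> 'a measure" where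
  "vol \<Omega> \<equiv> restrict_space lborel \<Omega>"

definition L2 :: "'a measure \<Rightarrow> ('a \<Rightarrow> 'b::euclidean_space) set" where
  "L2 M = {f \<in> borel_measurable M. integrable M (\<lambda>x. (norm (f x))\<^sup>2)}"

definition L2_norm :: "'a measure \<Rightarrow> ('a \<Rightarrow> 'b::euclidean_space) \<Rightarrow> real" where
  "L2_norm M f = sqrt (LINT x|M. (norm (f x))\<^sup>2)"

definition Linf_norm :: "(real \<Rightarrow> real) \<Rightarrow> ereal" where
  "Linf_norm f = esssup lborel (\<lambda>s. ereal \<bar>f s\<bar>)"

text \<open>The continuously differentiable functions with compact support contained in \<open>\<Omega>\<close>.\<close>

definition C1c :: "'a::euclidean_space set \<Rightarrow> ('a \<Rightarrow> real) set" where
  "C1c \<Omega> = {\<phi>. (\<forall>x. \<phi> differentiable (at x)) \<and>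
              (\<forall>b\<in>Basis. continuous_on UNIV (\<lambda>x. frechet_derivative \<phi> (at x) b)) \<and>
              compact (closure {x. \<phi> x \<noteq> 0}) \<and> closure {x. \<phi> x \<noteq> 0} \<subseteq> \<Omega>}"

text \<open>
  Weak gradients of locally integrable functions on an open set. As in Gilbarg and Trudinger, the
  test functions are of class \<open>C\<^sup>1\<close>; by mollification, smooth test functions give the same notion.
\<close>

definition has_weak_grad ::
    "'a::euclidean_space set \<Rightarrow> ('a \<Rightarrow> real) \<Rightarrow> ('a \<Rightarrow> 'a) \<Rightarrow> bool" where
  "has_weak_grad \<Omega> u g \<longleftrightarrow>
     (\<forall>K. compact K \<and> K \<subseteq> \<Omega> \<longrightarrow> set_integrable lborel K u \<and> set_integrable lborel K g) \<and>
     (\<forall>\<phi>\<in>C1c \<Omega>. \<forall>b\<in>Basis.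
        (LINT x|vol \<Omega>. u x * frechet_derivative \<phi> (at x) b) = - (LINT x|vol \<Omega>. (g x \<bullet> b) * \<phi> x))"

text \<open>The weak gradient is unique up to a null set, so that the choice is immaterial.\<close>

definition wgrad :: "'a::euclidean_space set \<Rightarrow> ('a \<Rightarrow> real) \<Rightarrow> 'a \<Rightarrow> 'a" where
  "wgrad \<Omega> u = (SOME g. has_weak_grad \<Omega> u g)"

definition H1 :: "'a::euclidean_space set \<Rightarrow> ('a \<Rightarrow> real) set" where
  "H1 \<Omega> = {u \<in> L2 (vol \<Omega>). \<exists>g \<in> L2 (vol \<Omega>). has_weak_grad \<Omega> u g}"

definition H1_norm :: "'a::euclidean_space set \<Rightarrow> ('a \<Rightarrow> real) \<Rightarrow> real" where
  "H1_norm \<Omega> u = sqrt ((L2_norm (vol \<Omega>) u)\<^sup>2 + (L2_norm (vol \<Omega>) (wgrad \<Omega> u))\<^sup>2)"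

definition W1inf :: "(real \<Rightarrow> real) set" where
  "W1inf = {\<alpha> \<in> borel_measurable borel. Linf_norm \<alpha> < \<infinity> \<and>
              (\<exists>\<beta>. has_weak_grad UNIV \<alpha> \<beta> \<and> Linf_norm \<beta> < \<infinity>)}"

definition W1inf_norm :: "(real \<Rightarrow> real) \<Rightarrow> ereal" where
  "W1inf_norm \<alpha> = Linf_norm \<alpha> + Linf_norm (wgrad UNIV \<alpha>)"


section \<open>The waveguide and its trace spaces\<close>

text \<open>
  Around each boundary point, after an orthogonal change of coordinates, the domain is the region
  above the graph of a Lipschitz function.
\<close>

definition lipschitz_boundary :: "(real^2) set \<Rightarrow> bool" where
  "lipschitz_boundary \<omega> \<longleftrightarrow>
     (\<forall>p\<in>frontier \<omega>. \<exists>r>0. \<exists>T h K. orthogonal_transformation T \<and> K-lipschitz_on UNIV h \<and>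
        \<omega> \<inter> ball p r = {x \<in> ball p r. (h :: real \<Rightarrow> real) (T x $ 1) < (T x :: real^2) $ 2})"

text \<open>A point of \<open>\<Omega> = \<omega> \<times> \<real>\<close> is a pair \<open>(x', x\<^sub>3)\<close>.\<close>

definition waveguide :: "(real^2) set \<Rightarrow> ((real^2) \<times> real) set" where
  "waveguide \<omega> = \<omega> \<times> UNIV"

definition arc_length :: "(real^2) set \<Rightarrow> (real^2) measure" where
  "arc_length \<omega> = restrict_space hausdorff1 (frontier \<omega>)"

text \<open>Surface measure on \<open>\<partial>\<Omega> = \<partial>\<omega> \<times> \<real>\<close>.\<close>

definition surface :: "(real^2) set \<Rightarrow> ((real^2) \<times> real) measure" where
  "surface \<omega> = arc_length \<omega> \<Otimes>\<^sub>M lborel"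

text \<open>
  \<open>G = g\<close> on \<open>\<partial>\<Omega>\<close> in the trace sense: the graph of the trace operator is the closure, in
  \<open>H\<^sup>1(\<Omega>) \<times> L\<^sup>2(\<partial>\<Omega>)\<close>, of the graph of the restriction map on \<open>C\<^sup>1\<close> functions with compact support
  in the whole space.
\<close>

definition has_trace ::
    "(real^2) set \<Rightarrow> ((real^2) \<times> real \<Rightarrow> real) \<Rightarrow> ((real^2) \<times> real \<Rightarrow> real) \<Rightarrow> bool" where
  "has_trace \<omega> G g \<longleftrightarrow> G \<in> H1 (waveguide \<omega>) \<and> g \<in> L2 (surface \<omega>) \<and>
     (\<exists>\<phi>. (\<forall>n. \<phi> n \<in> C1c UNIV) \<and>
        (\<lambda>n. H1_norm (waveguide \<omega>) (\<lambda>x. \<phi> n x - G x)) \<longlonglongrightarrow> 0 \<and>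
        (\<lambda>n. L2_norm (surface \<omega>) (\<lambda>x. \<phi> n x - g x)) \<longlonglongrightarrow> 0)"

text \<open>
  The square of the Sobolev-Slobodeckij norm of \<open>H\<^sup>1\<^sup>/\<^sup>2(\<partial>\<omega>)\<close>; the exponent in the denominator is
  \<open>dim \<partial>\<omega> + 2 * (1/2) = 2\<close>.
\<close>

definition Hhalf_norm_sq :: "(real^2) set \<Rightarrow> (real^2 \<Rightarrow> real) \<Rightarrow> ennreal" where
  "Hhalf_norm_sq \<omega> h = (\<integral>\<^sup>+x. ennreal ((h x)\<^sup>2) \<partial>arc_length \<omega>) +
     (\<integral>\<^sup>+x. (\<integral>\<^sup>+y. ennreal ((h x - h y)\<^sup>2 / (dist x y)\<^sup>2) \<partial>arc_length \<omega>) \<partial>arc_length \<omega>)"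

definition L2_Hhalf :: "(real^2) set \<Rightarrow> ((real^2) \<times> real \<Rightarrow> real) set" where
  "L2_Hhalf \<omega> = {g \<in> borel_measurable (surface \<omega>).
     (\<integral>\<^sup>+s. Hhalf_norm_sq \<omega> (\<lambda>x'. g (x', s)) \<partial>lborel) < \<infinity>}"

definition Htilde :: "(real^2) set \<Rightarrow> ((real^2) \<times> real \<Rightarrow> real) set" where
  "Htilde \<omega> = {g \<in> L2_Hhalf \<omega>. \<exists>G \<in> H1 (waveguide \<omega>). has_trace \<omega> G g}"

definition Htilde_norm :: "(real^2) set \<Rightarrow> ((real^2) \<times> real \<Rightarrow> real) \<Rightarrow> real" where
  "Htilde_norm \<omega> g = Inf {H1_norm (waveguide \<omega>) G | G. G \<in> H1 (waveguide \<omega>) \<and> has_trace \<omega> G g}"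

text \<open>The support of a class of functions on \<open>\<partial>\<Omega>\<close>: the complement in \<open>\<partial>\<Omega>\<close> of the largest relatively
  open set on which it vanishes almost everywhere.\<close>

definition bsupp :: "(real^2) set \<Rightarrow> ((real^2) \<times> real \<Rightarrow> real) \<Rightarrow> ((real^2) \<times> real) set" where
  "bsupp \<omega> f = {x \<in> frontier \<omega> \<times> UNIV.
     \<forall>U. open U \<and> x \<in> U \<longrightarrow> \<not> (AE y in surface \<omega>. y \<in> U \<longrightarrow> f y = 0)}"

definition Htilde_supp ::
    "(real^2) set \<Rightarrow> ((real^2) \<times> real) set \<Rightarrow> ((real^2) \<times> real \<Rightarrow> real) set" where
  "Htilde_supp \<omega> \<Gamma> = {f \<in> Htilde \<omega>. bsupp \<omega> f \<subseteq> \<Gamma>}"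

text \<open>The norm of the dual space of \<open>Htilde \<omega>\<close>, and the operator norm of a map from a subspace \<open>V\<close> of
  \<open>Htilde \<omega>\<close>, with the induced norm, into that dual space. Both take values in the extended reals, so
  that no boundedness has to be assumed for the suprema to be meaningful.\<close>

definition dual_norm ::
    "(real^2) set \<Rightarrow> (((real^2) \<times> real \<Rightarrow> real) \<Rightarrow> real) \<Rightarrow> ereal" where
  "dual_norm \<omega> \<Phi> = (SUP g\<in>{g \<in> Htilde \<omega>. Htilde_norm \<omega> g \<le> 1}. ereal \<bar>\<Phi> g\<bar>)"

definition op_norm ::
    "(real^2) set \<Rightarrow> ((real^2) \<times> real \<Rightarrow> real) set \<Rightarrow>
     (((real^2) \<times> real \<Rightarrow> real) \<Rightarrow> ((real^2) \<times> real \<Rightarrow> real) \<Rightarrow> real) \<Rightarrow> ereal" where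
  "op_norm \<omega> V T = (SUP f\<in>{f \<in> V. Htilde_norm \<omega> f \<le> 1}. dual_norm \<omega> (T f))"


section \<open>The Dirichlet-to-Neumann map\<close>

definition A_mat :: "real^2 \<Rightarrow> real \<Rightarrow> real^3^3" where
  "A_mat x t = t *\<^sub>R vector
     [vector [1 + (x$2)\<^sup>2, - (x$2 * x$1), - (x$2)],
      vector [- (x$2 * x$1), 1 + (x$1)\<^sup>2, x$1],
      vector [- (x$2), x$1, 1]]"

definition vec3 :: "(real^2) \<times> real \<Rightarrow> real^3" where
  "vec3 v = vector [fst v $ 1, fst v $ 2, snd v]"

definition energy_form ::
    "(real^2) set \<Rightarrow> (real \<Rightarrow> real) \<Rightarrow> ((real^2) \<times> real \<Rightarrow> real) \<Rightarrow> ((real^2) \<times> real \<Rightarrow> real) \<Rightarrow> real" where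
  "energy_form \<omega> \<alpha> u v = (LINT x|vol (waveguide \<omega>).
     (A_mat (fst x) (\<alpha> (snd x)) *v vec3 (wgrad (waveguide \<omega>) u x)) \<bullet> vec3 (wgrad (waveguide \<omega>) v x))"

text \<open>Weak solutions of \<open>div (A(x', \<alpha>(x\<^sub>3)) \<nabla>u) = 0\<close> in \<open>\<Omega>\<close>, \<open>u = f\<close> on \<open>\<partial>\<Omega>\<close>, tested with the functions
  in \<open>H\<^sup>1(\<Omega>)\<close> of zero trace.\<close>

definition weak_solution ::
    "(real^2) set \<Rightarrow> (real \<Rightarrow> real) \<Rightarrow> ((real^2) \<times> real \<Rightarrow> real) \<Rightarrow> ((real^2) \<times> real \<Rightarrow> real) \<Rightarrow> bool" where
  "weak_solution \<omega> \<alpha> f u \<longleftrightarrow> u \<in> H1 (waveguide \<omega>) \<and> has_trace \<omega> u f \<and>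
     (\<forall>v \<in> H1 (waveguide \<omega>). has_trace \<omega> v (\<lambda>_. 0) \<longrightarrow> energy_form \<omega> \<alpha> u v = 0)"

text \<open>\<open>DN \<omega> \<alpha> f\<close> is a functional on \<open>Htilde \<omega>\<close>. The weak solution is unique up to a null set, and the
  functional is determined on \<open>Htilde \<omega>\<close>, so that the choices are immaterial.\<close>

definition DN ::
    "(real^2) set \<Rightarrow> (real \<Rightarrow> real) \<Rightarrow> ((real^2) \<times> real \<Rightarrow> real) \<Rightarrow> ((real^2) \<times> real \<Rightarrow> real) \<Rightarrow> real" where
  "DN \<omega> \<alpha> f = (let u = (SOME u. weak_solution \<omega> \<alpha> f u) in
     SOME \<Phi>. \<forall>g \<in> Htilde \<omega>. \<forall>G \<in> H1 (waveguide \<omega>). has_trace \<omega> G g \<longrightarrow> \<Phi> g = energy_form \<omega> \<alpha> u G)"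

end

theory Submission imports Defs begin

text \<open>
  Let \<open>\<Delta> = \<parallel>\<alpha>\<^sub>1 - \<alpha>\<^sub>2\<parallel>\<^sub>\<infinity>\<close> and let \<open>\<alpha>\<^sub>1 - \<alpha>\<^sub>2 \<ge> \<Delta>/2\<close> (up to exchanging the two coefficients) on an interval \<open>I\<close> around
  some \<open>s\<^sub>0\<close> with \<open>\<bar>s\<^sub>0\<bar> \<le> L\<close>. Since the solution for \<open>\<alpha>\<^sub>2\<close> minimises its energy, any datum \<open>f\<close> and its solution \<open>u\<close>
  for \<open>\<alpha>\<^sub>1\<close> satisfy \<open>\<langle>(\<Lambda>\<^sub>1 - \<Lambda>\<^sub>2)f, f\<rangle> \<ge> \<integral>(\<alpha>\<^sub>1 - \<alpha>\<^sub>2) A\<^sup>\<bullet>(x', 1)\<nabla>u \<cdot> \<nabla>u\<close>, so it suffices to find data supported in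
  \<open>\<gamma> \<times> I\<close> whose solution carries almost all of its energy in \<open>\<omega> \<times> I\<close>. By Caccioppoli the energy outside is
  bounded by \<open>\<parallel>u\<parallel>\<^sup>2\<close> on a compact part \<open>\<omega> \<times> J\<close> away from the support of the datum. There \<open>u\<close> is small
  compared with \<open>\<nabla>u\<close> as soon as finitely many means of \<open>u\<close> vanish: close to \<open>\<partial>\<omega>\<close> because its trace vanishes,
  elsewhere by Poincare-Wirtinger on small cubes. Linear algebra produces such a datum among the
  combinations of sufficiently many bumps in \<open>I\<close>. The datum is normalised by the \<open>H\<^sup>1\<close> norm of a cut-off
  of \<open>u\<close>, which the energy controls with an absolute constant; hence the constant depends only on the
  ellipticity of \<open>A\<^sup>\<bullet>(x', 1)\<close>.
\<close>

section \<open>Square-integrable functions\<close>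

text \<open>No quantity attached to the datum has to be uniform. The interval, the cut-offs, the
  number of bumps and the smallness parameter depend on both coefficients, but they only have to
  push the energy outside the interval below a fixed fraction of the total; none of them survives
  the normalisation. In exchange the datum is not explicit and is only known to be nonzero as a
  boundary function: that its solution has energy at all is a separate step, because vanishing
  energy would force a zero trace. Vanishing means do not make \<open>u\<close> small up to the
  boundary. There the zero trace is used on thin strips in directions transversal to
  \<open>\<partial>\<omega>\<close>. All cut-offs depend on the axial variable alone, so they leave
  derivatives in these directions undisturbed. The constant is \<open>80 / ellip\<close>: the
  squared \<open>H1\<close> norm of the cut-off of \<open>u\<close> is at most 4^2 + 2^2 = 20 times
  the squared norm of the gradient of \<open>u\<close>, and of the surviving fraction 1/2 -
  (3/2)(1/8) = 5/16 only 1/4 is kept.\<close>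

lemma L2I: "f \<in> borel_measurable M \<Longrightarrow> integrable M (\<lambda>x. (norm (f x))\<^sup>2) \<Longrightarrow> f \<in> L2 M"
  by (auto simp: L2_def)

lemma L2_norm_nonneg [simp]: "0 \<le> L2_norm M f"
  by (simp add: L2_norm_def)

lemma L2_norm_power2: "(L2_norm M f)\<^sup>2 = (LINT x|M. (norm (f x))\<^sup>2)"
  by (simp add: L2_norm_def)

lemma L2_norm_sq_nn:
  assumes "f \<in> L2 M"
  shows "(\<integral>\<^sup>+x. ennreal ((norm (f x))\<^sup>2) \<partial>M) = ennreal ((L2_norm M f)\<^sup>2)"
  unfolding L2_norm_power2 by (rule nn_integral_eq_integral) (use assms in \<open>auto simp: L2_def\<close>)

text \<open>Membership and bound come together, because monotone comparison, Fatou and Fubini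
  deliver a bound on a nonnegative integral before integrability is known.\<close>

lemma L2_nnI:
  assumes "f \<in> borel_measurable M" "(\<integral>\<^sup>+x. ennreal ((norm (f x))\<^sup>2) \<partial>M) \<le> ennreal (c\<^sup>2)" "0 \<le> c"
  shows "f \<in> L2 M" "L2_norm M f \<le> c"
proof -
  have i: "integrable M (\<lambda>x. (norm (f x))\<^sup>2)"
    by (rule integrableI_nonneg) (use assms in \<open>auto simp: less_top[symmetric] top_unique\<close>)
  show L: "f \<in> L2 M" by (rule L2I[OF assms(1) i])
  from assms(2) have "(L2_norm M f)\<^sup>2 \<le> c\<^sup>2" unfolding L2_norm_sq_nn[OF L] by (simp add: ennreal_le_iff)
  then show "L2_norm M f \<le> c" using assms(3) by (simp add: power2_le_iff_abs_le)
qed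

lemma L2_bound:
  assumes "g \<in> L2 M" "f \<in> borel_measurable M" "AE x in M. norm (f x) \<le> c * norm (g x)" "0 \<le> c"
  shows "f \<in> L2 M" "L2_norm M f \<le> c * L2_norm M g"
proof -
  have "(\<integral>\<^sup>+x. ennreal ((norm (f x))\<^sup>2) \<partial>M) \<le> (\<integral>\<^sup>+x. ennreal (c\<^sup>2) * ennreal ((norm (g x))\<^sup>2) \<partial>M)"
  proof (rule nn_integral_mono_AE)
    show "AE x in M. ennreal ((norm (f x))\<^sup>2) \<le> ennreal (c\<^sup>2) * ennreal ((norm (g x))\<^sup>2)"
      using assms(3)
    proof eventually_elim
      case (elim x)
      then have "(norm (f x))\<^sup>2 \<le> (c * norm (g x))\<^sup>2" by (intro power_mono) auto
      then show ?case by (simp add: ennreal_mult'[symmetric] power_mult_distrib ennreal_leI)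
    qed
  qed
  also have "\<dots> = ennreal (c\<^sup>2) * ennreal ((L2_norm M g)\<^sup>2)"
    by (subst nn_integral_cmult) (use assms L2_norm_sq_nn[OF assms(1)] in \<open>auto simp: L2_def\<close>)
  also have "\<dots> = ennreal ((c * L2_norm M g)\<^sup>2)"
    by (simp add: ennreal_mult'[symmetric] power_mult_distrib)
  finally have "(\<integral>\<^sup>+x. ennreal ((norm (f x))\<^sup>2) \<partial>M) \<le> ennreal ((c * L2_norm M g)\<^sup>2)" .
  from L2_nnI[OF assms(2) this] assms(4) show "f \<in> L2 M" "L2_norm M f \<le> c * L2_norm M g" by auto
qed

lemma L2_zero [simp]: "(\<lambda>x. 0) \<in> L2 M" "L2_norm M (\<lambda>x. 0) = 0"
  by (auto simp: L2_def L2_norm_def)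

lemma L2_norm_mono_AE:
  assumes "g \<in> L2 M" "f \<in> borel_measurable M" "AE x in M. norm (f x) \<le> norm (g x)"
  shows "f \<in> L2 M" "L2_norm M f \<le> L2_norm M g"
  using L2_bound[of g M f 1] assms by auto

lemma L2_norm_cong_AE:
  assumes "AE x in M. f x = g x" "f \<in> borel_measurable M" "g \<in> borel_measurable M"
  shows "L2_norm M f = L2_norm M g"
proof -
  have "(LINT x|M. (norm (f x))\<^sup>2) = (LINT x|M. (norm (g x))\<^sup>2)"
    by (rule integral_cong_AE) (use assms in auto)
  then show ?thesis by (simp add: L2_norm_def)
qed

lemma L2_cong_AE:
  assumes "AE x in M. f x = g x" "f \<in> borel_measurable M" "g \<in> L2 M"
  shows "f \<in> L2 M"
  by (rule L2_norm_mono_AE[OF assms(3,2)]) (use assms(1) in auto)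

lemma L2_scaleR:
  assumes "f \<in> L2 M" shows "(\<lambda>x. c *\<^sub>R f x) \<in> L2 M" "L2_norm M (\<lambda>x. c *\<^sub>R f x) = \<bar>c\<bar> * L2_norm M f"
  using assms by (auto simp: L2_def L2_norm_def power_mult_distrib real_sqrt_mult)

lemma L2_uminus:
  assumes "f \<in> L2 M" shows "(\<lambda>x. - f x) \<in> L2 M"
  using assms by (auto simp: L2_def)

lemma L2_norm_minus: "L2_norm M (\<lambda>x. f x - g x) = L2_norm M (\<lambda>x. g x - f x)"
  by (simp add: L2_norm_def norm_minus_commute)

lemma L2_add:
  assumes "f \<in> L2 M" "g \<in> L2 M" shows "(\<lambda>x. f x + g x) \<in> L2 M"
proof (rule L2I)
  have [measurable]: "f \<in> borel_measurable M" "g \<in> borel_measurable M" using assms by (auto simp: L2_def)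
  show "(\<lambda>x. f x + g x) \<in> borel_measurable M" by measurable
  show "integrable M (\<lambda>x. (norm (f x + g x))\<^sup>2)"
  proof (rule Bochner_Integration.integrable_bound)
    show "integrable M (\<lambda>x. 2 * (norm (f x))\<^sup>2 + 2 * (norm (g x))\<^sup>2)"
      using assms by (auto simp: L2_def)
    show "AE x in M. norm ((norm (f x + g x))\<^sup>2) \<le> norm (2 * (norm (f x))\<^sup>2 + 2 * (norm (g x))\<^sup>2)"
    proof (rule AE_I2)
      fix x
      have "(norm (f x + g x))\<^sup>2 \<le> (norm (f x) + norm (g x))\<^sup>2"
        by (intro power_mono norm_triangle_ineq) auto
      also have "\<dots> \<le> 2 * (norm (f x))\<^sup>2 + 2 * (norm (g x))\<^sup>2"
        using sum_squares_bound[of "norm (f x)" "norm (g x)"] by (simp add: power2_sum)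
      finally show "norm ((norm (f x + g x))\<^sup>2) \<le> norm (2 * (norm (f x))\<^sup>2 + 2 * (norm (g x))\<^sup>2)" by simp
    qed
  qed measurable
qed

lemma L2_diff: "f \<in> L2 M \<Longrightarrow> g \<in> L2 M \<Longrightarrow> (\<lambda>x. f x - g x) \<in> L2 M"
  using L2_add[of f M "\<lambda>x. - g x"] L2_uminus[of g M] by simp

lemma L2_sum: "(\<And>i. i \<in> A \<Longrightarrow> f i \<in> L2 M) \<Longrightarrow> (\<lambda>x. \<Sum>i\<in>A. f i x) \<in> L2 M"
proof (induction A rule: infinite_finite_induct)
  case (insert i A)
  then show ?case by (simp add: L2_add)
qed auto

lemma L2_norm_sqnorm: "L2_norm M (\<lambda>x. norm (f x)) = L2_norm M f"
  by (simp add: L2_norm_def)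

lemma L2_norm_fun: "f \<in> L2 M \<Longrightarrow> (\<lambda>x. norm (f x)) \<in> L2 M"
  by (auto simp: L2_def)

lemma L2_norm_eq_0:
  assumes "f \<in> L2 M" shows "L2_norm M f = 0 \<longleftrightarrow> (AE x in M. f x = 0)"
proof -
  have "L2_norm M f = 0 \<longleftrightarrow> (LINT x|M. (norm (f x))\<^sup>2) = 0" by (simp add: L2_norm_def)
  also have "\<dots> \<longleftrightarrow> (AE x in M. (norm (f x))\<^sup>2 = 0)"
    by (rule integral_nonneg_eq_0_iff_AE) (use assms in \<open>auto simp: L2_def\<close>)
  finally show ?thesis by simp
qed

section \<open>Cauchy-Schwarz, triangle inequality and convergence in the mean\<close>

lemma L2_mult_integrable:
  fixes f g :: "'a \<Rightarrow> real"
  assumes "f \<in> L2 M" "g \<in> L2 M"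
  shows "integrable M (\<lambda>x. f x * g x)" "\<bar>LINT x|M. f x * g x\<bar> \<le> L2_norm M f * L2_norm M g"
proof -
  have [measurable]: "f \<in> borel_measurable M" "g \<in> borel_measurable M" using assms by (auto simp: L2_def)
  have I: "integrable M (\<lambda>x. (f x)\<^sup>2)" "integrable M (\<lambda>x. (g x)\<^sup>2)" using assms by (auto simp: L2_def)
  show i: "integrable M (\<lambda>x. f x * g x)"
  proof (rule Bochner_Integration.integrable_bound)
    show "integrable M (\<lambda>x. (f x)\<^sup>2 + (g x)\<^sup>2)" using I by auto
    show "AE x in M. norm (f x * g x) \<le> norm ((f x)\<^sup>2 + (g x)\<^sup>2)"
    proof (rule AE_I2)
      fix x show "norm (f x * g x) \<le> norm ((f x)\<^sup>2 + (g x)\<^sup>2)"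
        using sum_squares_bound[of "\<bar>f x\<bar>" "\<bar>g x\<bar>"] mult_nonneg_nonneg[of "\<bar>f x\<bar>" "\<bar>g x\<bar>"]
        by (simp add: abs_mult del: mult_nonneg_nonneg)
    qed
  qed measurable
  let ?a = "L2_norm M f" and ?b = "L2_norm M g"
  show "\<bar>LINT x|M. f x * g x\<bar> \<le> ?a * ?b"
  proof (cases "?a = 0 \<or> ?b = 0")
    case True
    then have "AE x in M. f x * g x = 0" using L2_norm_eq_0[OF assms(1)] L2_norm_eq_0[OF assms(2)] by auto
    then have "(LINT x|M. f x * g x) = 0"
      using integral_cong_AE[of "\<lambda>x. f x * g x" M "\<lambda>x. 0"] by simp
    then show ?thesis by simp
  next
    case False
    then have p: "?a > 0" "?b > 0" by (simp_all add: less_le)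
    have "\<bar>LINT x|M. f x * g x\<bar> \<le> (LINT x|M. \<bar>f x * g x\<bar>)" by (rule integral_abs_bound)
    \<comment> \<open>Young's inequality after scaling both functions to norm one; the vanishing
      norms were split off so that this division is possible.\<close>
    also have "\<dots> \<le> (LINT x|M. (?a * ?b / 2) * ((1 / ?a\<^sup>2) * (f x)\<^sup>2 + (1 / ?b\<^sup>2) * (g x)\<^sup>2))"
    proof (rule integral_mono)
      show "integrable M (\<lambda>x. \<bar>f x * g x\<bar>)" using i by auto
      show "integrable M (\<lambda>x. (?a * ?b / 2) * ((1 / ?a\<^sup>2) * (f x)\<^sup>2 + (1 / ?b\<^sup>2) * (g x)\<^sup>2))" using I by auto
      fix x
      have "2 * (\<bar>f x\<bar> / ?a) * (\<bar>g x\<bar> / ?b) \<le> (\<bar>f x\<bar> / ?a)\<^sup>2 + (\<bar>g x\<bar> / ?b)\<^sup>2" by (rule sum_squares_bound)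
      then have "(?a * ?b / 2) * (2 * (\<bar>f x\<bar> / ?a) * (\<bar>g x\<bar> / ?b)) \<le> (?a * ?b / 2) * ((\<bar>f x\<bar> / ?a)\<^sup>2 + (\<bar>g x\<bar> / ?b)\<^sup>2)"
        using p by (intro mult_left_mono) auto
      then show "\<bar>f x * g x\<bar> \<le> (?a * ?b / 2) * ((1 / ?a\<^sup>2) * (f x)\<^sup>2 + (1 / ?b\<^sup>2) * (g x)\<^sup>2)"
        using p by (simp add: abs_mult power_divide)
    qed
    also have "\<dots> = (?a * ?b / 2) * ((1 / ?a\<^sup>2) * (LINT x|M. (f x)\<^sup>2) + (1 / ?b\<^sup>2) * (LINT x|M. (g x)\<^sup>2))"
      using I by simp
    also have "(LINT x|M. (f x)\<^sup>2) = ?a\<^sup>2" by (simp add: L2_norm_power2)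
    also have "(LINT x|M. (g x)\<^sup>2) = ?b\<^sup>2" by (simp add: L2_norm_power2)
    also have "(?a * ?b / 2) * ((1 / ?a\<^sup>2) * ?a\<^sup>2 + (1 / ?b\<^sup>2) * ?b\<^sup>2) = ?a * ?b" using p by simp
    finally show ?thesis .
  qed
qed

lemma L2_inner_integrable:
  assumes "f \<in> L2 M" "g \<in> L2 M"
  shows "integrable M (\<lambda>x. f x \<bullet> g x)" "\<bar>LINT x|M. f x \<bullet> g x\<bar> \<le> L2_norm M f * L2_norm M g"
proof -
  have [measurable]: "f \<in> borel_measurable M" "g \<in> borel_measurable M" using assms by (auto simp: L2_def)
  have i: "integrable M (\<lambda>x. norm (f x) * norm (g x))"
    by (rule L2_mult_integrable) (use assms L2_norm_fun in auto)
  show j: "integrable M (\<lambda>x. f x \<bullet> g x)"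
    by (rule Bochner_Integration.integrable_bound[OF i]) (auto intro!: AE_I2 Cauchy_Schwarz_ineq2)
  have "\<bar>LINT x|M. f x \<bullet> g x\<bar> \<le> (LINT x|M. \<bar>f x \<bullet> g x\<bar>)" by (rule integral_abs_bound)
  also have "\<dots> \<le> (LINT x|M. norm (f x) * norm (g x))"
    by (rule integral_mono) (use i j in \<open>auto intro: Cauchy_Schwarz_ineq2\<close>)
  also have "\<dots> \<le> L2_norm M (\<lambda>x. norm (f x)) * L2_norm M (\<lambda>x. norm (g x))"
    using L2_mult_integrable(2)[OF L2_norm_fun[OF assms(1)] L2_norm_fun[OF assms(2)]] by linarith
  finally show "\<bar>LINT x|M. f x \<bullet> g x\<bar> \<le> L2_norm M f * L2_norm M g" by (simp add: L2_norm_sqnorm)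
qed

lemma L2_norm_triangle:
  assumes "f \<in> L2 M" "g \<in> L2 M"
  shows "L2_norm M (\<lambda>x. f x + g x) \<le> L2_norm M f + L2_norm M g"
proof -
  have I: "integrable M (\<lambda>x. (norm (f x))\<^sup>2)" "integrable M (\<lambda>x. (norm (g x))\<^sup>2)" "integrable M (\<lambda>x. f x \<bullet> g x)"
    using assms L2_inner_integrable by (auto simp: L2_def)
  have "(L2_norm M (\<lambda>x. f x + g x))\<^sup>2 = (LINT x|M. (norm (f x))\<^sup>2 + (norm (g x))\<^sup>2 + 2 * (f x \<bullet> g x))"
    unfolding L2_norm_power2
    by (intro Bochner_Integration.integral_cong refl) (simp add: power2_norm_eq_inner inner_add inner_commute)
  also have "\<dots> = (L2_norm M f)\<^sup>2 + (L2_norm M g)\<^sup>2 + 2 * (LINT x|M. f x \<bullet> g x)"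
    using I by (simp add: L2_norm_power2)
  also have "\<dots> \<le> (L2_norm M f + L2_norm M g)\<^sup>2"
    using L2_inner_integrable(2)[OF assms] by (simp add: power2_sum)
  finally show ?thesis by (rule power2_le_imp_le) simp
qed

lemma L2_norm_triangle_diff:
  assumes "f \<in> L2 M" "g \<in> L2 M" "h \<in> L2 M"
  shows "L2_norm M (\<lambda>x. f x - h x) \<le> L2_norm M (\<lambda>x. f x - g x) + L2_norm M (\<lambda>x. g x - h x)"
  using L2_norm_triangle[OF L2_diff[OF assms(1,2)] L2_diff[OF assms(2,3)]] by simp

lemma L2_norm_le_diff:
  assumes "f \<in> L2 M" "g \<in> L2 M"
  shows "\<bar>L2_norm M f - L2_norm M g\<bar> \<le> L2_norm M (\<lambda>x. f x - g x)"
  using L2_norm_triangle[OF L2_diff[OF assms] assms(2)]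
    L2_norm_triangle[OF L2_diff[OF assms(2,1)] assms(1)] L2_norm_minus[of M f g] by simp

lemma L2_norm_tendsto:
  assumes "\<And>n. f n \<in> L2 M" "g \<in> L2 M" "(\<lambda>n. L2_norm M (\<lambda>x. f n x - g x)) \<longlonglongrightarrow> 0"
  shows "(\<lambda>n. L2_norm M (f n)) \<longlonglongrightarrow> L2_norm M g"
  by (rule LIM_zero_cancel, rule Lim_null_comparison[OF _ assms(3)], rule always_eventually)
     (use L2_norm_le_diff[OF assms(1,2)] in auto)

lemma L2_inner_tendsto:
  assumes "\<And>n. f n \<in> L2 M" "g \<in> L2 M" "h \<in> L2 M" "(\<lambda>n. L2_norm M (\<lambda>x. f n x - g x)) \<longlonglongrightarrow> 0"
  shows "(\<lambda>n. LINT x|M. f n x \<bullet> h x) \<longlonglongrightarrow> (LINT x|M. g x \<bullet> h x)"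
proof (rule LIM_zero_cancel, rule Lim_null_comparison)
  show "(\<lambda>n. L2_norm M (\<lambda>x. f n x - g x) * L2_norm M h) \<longlonglongrightarrow> 0"
    using tendsto_mult_right[OF assms(4), of "L2_norm M h"] by simp
  have "(LINT x|M. f n x \<bullet> h x) - (LINT x|M. g x \<bullet> h x) = (LINT x|M. (f n x - g x) \<bullet> h x)" for n
    using L2_inner_integrable(1)[OF assms(1)[of n] assms(3)] L2_inner_integrable(1)[OF assms(2,3)]
    by (simp add: inner_diff_left)
  then show "\<forall>\<^sub>F n in sequentially. norm ((LINT x|M. f n x \<bullet> h x) - (LINT x|M. g x \<bullet> h x))
      \<le> L2_norm M (\<lambda>x. f n x - g x) * L2_norm M h"
    using L2_inner_integrable(2)[OF L2_diff[OF assms(1,2)] assms(3)] by auto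
qed

text \<open>Riesz-Fischer. Along a subsequence with increments below powers of 1/2 the sum of the
  absolute increments is square integrable by monotone convergence, hence finite almost everywhere,
  and the subsequence converges there. Fatou turns the Cauchy bound into a bound on the distance to
  the limit.\<close>

lemma L2_complete:
  fixes f :: "nat \<Rightarrow> 'a \<Rightarrow> 'b::euclidean_space"
  assumes f: "\<And>n. f n \<in> L2 M"
    and C: "\<And>e. e > 0 \<Longrightarrow> \<exists>N. \<forall>m\<ge>N. \<forall>n\<ge>N. L2_norm M (\<lambda>x. f m x - f n x) < e"
  obtains g where "g \<in> L2 M" "(\<lambda>n. L2_norm M (\<lambda>x. f n x - g x)) \<longlonglongrightarrow> 0"
proof -
  have [measurable]: "f n \<in> borel_measurable M" for n using f[of n] by (auto simp: L2_def)
  have "\<exists>N. \<forall>m\<ge>N. \<forall>n\<ge>N. L2_norm M (\<lambda>x. f m x - f n x) < (1/2)^k" for k :: nat by (rule C) simp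
  then obtain N where N: "\<And>k m n. m \<ge> N k \<Longrightarrow> n \<ge> N k \<Longrightarrow> L2_norm M (\<lambda>x. f m x - f n x) < (1/2)^k" by metis
  \<comment> \<open>The sum makes \<open>r\<close> monotone and at least \<open>N k\<close>; the
    summand \<open>k\<close> makes it tend to infinity.\<close>
  define r where "r k = k + (\<Sum>j\<le>k. N j)" for k
  have rN: "r k \<ge> N k" for k using member_le_sum[of k "{..k}" N] by (simp add: r_def)
  have rm: "r k \<le> r (Suc k)" for k by (simp add: r_def)
  have rk: "r k \<ge> k" for k by (simp add: r_def)
  define d where "d k x = norm (f (r (Suc k)) x - f (r k) x)" for k x
  have [measurable]: "d k \<in> borel_measurable M" for k unfolding d_def by measurable
  have dL: "d k \<in> L2 M" for k unfolding d_def by (intro L2_norm_fun L2_diff f)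
  have dn: "L2_norm M (d k) \<le> (1/2)^k" for k
  proof -
    have "L2_norm M (d k) = L2_norm M (\<lambda>x. f (r (Suc k)) x - f (r k) x)"
      unfolding d_def by (rule L2_norm_sqnorm)
    also have "\<dots> < (1/2)^k" by (rule N) (use rN[of k] rm[of k] in auto)
    finally show ?thesis by simp
  qed
  define S where "S n x = (\<Sum>k<n. d k x)" for n x
  have SL: "S n \<in> L2 M" for n unfolding S_def by (intro L2_sum dL)
  have [measurable]: "S n \<in> borel_measurable M" for n unfolding S_def by measurable
  have "L2_norm M (S n) \<le> (\<Sum>k<n. (1/2)^k)" for n
  proof (induction n)
    case (Suc n)
    have "L2_norm M (S (Suc n)) \<le> L2_norm M (S n) + L2_norm M (d n)"
      using L2_norm_triangle[OF SL[of n] dL[of n]] by (simp add: S_def[abs_def])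
    then show ?case using Suc dn[of n] by simp
  qed (simp add: S_def)
  moreover have "(\<Sum>k<n. (1/2)^k) \<le> (2::real)" for n
    using sum_le_suminf[of "\<lambda>k. (1/2::real)^k" "{..<n}"] by (simp add: suminf_geometric)
  ultimately have S2: "L2_norm M (S n) \<le> 2" for n using order_trans by blast
  have "(\<integral>\<^sup>+x. (SUP n. ennreal ((S n x)\<^sup>2)) \<partial>M) = (SUP n. \<integral>\<^sup>+x. ennreal ((S n x)\<^sup>2) \<partial>M)"
  proof (rule nn_integral_monotone_convergence_SUP)
    show "incseq (\<lambda>n x. ennreal ((S n x)\<^sup>2))"
      by (rule incseq_SucI, rule le_funI, rule ennreal_leI, rule power_mono)
         (auto simp: S_def d_def intro!: sum_nonneg)
  qed measurable
  also have "\<dots> \<le> 4"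
  proof (rule SUP_least)
    fix n
    have "(\<integral>\<^sup>+x. ennreal ((S n x)\<^sup>2) \<partial>M) = ennreal ((L2_norm M (S n))\<^sup>2)"
      using L2_norm_sq_nn[OF SL[of n]] by simp
    also have "(L2_norm M (S n))\<^sup>2 \<le> 4" using power_mono[OF S2[of n], of 2] by simp
    finally show "(\<integral>\<^sup>+x. ennreal ((S n x)\<^sup>2) \<partial>M) \<le> 4" by (metis ennreal_leI ennreal_numeral zero_le_numeral)
  qed
  finally have fin: "(\<integral>\<^sup>+x. (SUP n. ennreal ((S n x)\<^sup>2)) \<partial>M) \<noteq> \<infinity>"
    by (auto simp: top_unique)
  have "AE x in M. (SUP n. ennreal ((S n x)\<^sup>2)) \<noteq> \<infinity>"
    by (rule nn_integral_noteq_infinite[OF _ fin]) measurable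
  then have conv: "AE x in M. convergent (\<lambda>k. f (r k) x)"
  proof eventually_elim
    case (elim x)
    then obtain B where B: "B \<ge> 0" "(SUP n. ennreal ((S n x)\<^sup>2)) = ennreal B"
      by (cases "SUP n. ennreal ((S n x)\<^sup>2)") auto
    have "ennreal ((S n x)\<^sup>2) \<le> ennreal B" for n unfolding B(2)[symmetric] by (rule SUP_upper) simp
    then have "(S n x)\<^sup>2 \<le> B" for n using B by (simp add: ennreal_le_iff)
    then have "S n x \<le> sqrt B" for n by (simp add: real_le_rsqrt)
    then have "(\<Sum>k\<le>n. d k x) \<le> sqrt B" for n by (metis S_def lessThan_Suc_atMost)
    then have "summable (\<lambda>k. d k x)"
      by (intro bounded_imp_summable[where B="sqrt B"]) (auto simp: d_def)
    then have "summable (\<lambda>k. f (r (Suc k)) x - f (r k) x)"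
      unfolding d_def by (rule summable_norm_cancel)
    then have "convergent (\<lambda>n. \<Sum>k<n. f (r (Suc k)) x - f (r k) x)" by (simp add: summable_iff_convergent)
    then have "convergent (\<lambda>n. f (r n) x - f (r 0) x)"
      by (simp add: sum_lessThan_telescope[of "\<lambda>k. f (r k) x" for x])
    then have "convergent (\<lambda>n. (f (r n) x - f (r 0) x) + f (r 0) x)"
      by (intro convergent_add convergent_const)
    then show ?case by simp
  qed
  define g where "g x = lim (\<lambda>k. f (r k) x)" for x
  have [measurable]: "g \<in> borel_measurable M" unfolding g_def by measurable
  have lim: "AE x in M. (\<lambda>k. f (r k) x) \<longlonglongrightarrow> g x"
    using conv by eventually_elim (simp add: g_def convergent_LIMSEQ_iff)
  \<comment> \<open>Fatou along the subsequence; it gives the membership of the limit and the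
    convergence at once.\<close>
  have est: "(\<lambda>x. f m x - g x) \<in> L2 M \<and> L2_norm M (\<lambda>x. f m x - g x) \<le> e"
    if "e > 0" "\<forall>n\<ge>K. L2_norm M (\<lambda>x. f m x - f n x) \<le> e" for m K e
  proof -
    have "(\<integral>\<^sup>+x. ennreal ((norm (f m x - g x))\<^sup>2) \<partial>M) \<le>
        (\<integral>\<^sup>+x. liminf (\<lambda>k. ennreal ((norm (f m x - f (r k) x))\<^sup>2)) \<partial>M)"
    proof (rule nn_integral_mono_AE)
      show "AE x in M. ennreal ((norm (f m x - g x))\<^sup>2) \<le> liminf (\<lambda>k. ennreal ((norm (f m x - f (r k) x))\<^sup>2))"
        using lim
      proof eventually_elim
        case (elim x)
        have "(\<lambda>k. ennreal ((norm (f m x - f (r k) x))\<^sup>2)) \<longlonglongrightarrow> ennreal ((norm (f m x - g x))\<^sup>2)"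
          by (intro tendsto_intros elim)
        then show ?case using lim_imp_Liminf[OF sequentially_bot] by (metis order_refl)
      qed
    qed
    also have "\<dots> \<le> liminf (\<lambda>k. \<integral>\<^sup>+x. ennreal ((norm (f m x - f (r k) x))\<^sup>2) \<partial>M)"
      by (rule nn_integral_liminf) measurable
    also have "\<dots> \<le> ennreal (e\<^sup>2)"
    proof (rule order_trans[OF Liminf_le_Limsup[OF sequentially_bot]], rule Limsup_bounded, rule eventually_sequentiallyI[of K])
      fix k assume "K \<le> k"
      then have "L2_norm M (\<lambda>x. f m x - f (r k) x) \<le> e" using that(2) rk[of k] by auto
      then have "(L2_norm M (\<lambda>x. f m x - f (r k) x))\<^sup>2 \<le> e\<^sup>2" by (intro power_mono) auto
      then show "(\<integral>\<^sup>+x. ennreal ((norm (f m x - f (r k) x))\<^sup>2) \<partial>M) \<le> ennreal (e\<^sup>2)"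
        unfolding L2_norm_sq_nn[OF L2_diff[OF f f]] by (rule ennreal_leI)
    qed
    finally have *: "(\<integral>\<^sup>+x. ennreal ((norm (f m x - g x))\<^sup>2) \<partial>M) \<le> ennreal (e\<^sup>2)" .
    show ?thesis using L2_nnI[OF _ *] that(1) by auto
  qed
  have gL: "g \<in> L2 M"
  proof -
    obtain K where "\<forall>m\<ge>K. \<forall>n\<ge>K. L2_norm M (\<lambda>x. f m x - f n x) < 1" using C[of 1] by auto
    then have "\<forall>n\<ge>K. L2_norm M (\<lambda>x. f K x - f n x) \<le> 1" using less_imp_le by auto
    from est[OF _ this] have "(\<lambda>x. f K x - g x) \<in> L2 M" by simp
    from L2_diff[OF f[of K] this] show ?thesis by simp
  qed
  moreover have "(\<lambda>n. L2_norm M (\<lambda>x. f n x - g x)) \<longlonglongrightarrow> 0"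
  proof (rule LIMSEQ_I)
    fix e :: real assume "e > 0"
    then obtain K where K: "\<forall>m\<ge>K. \<forall>n\<ge>K. L2_norm M (\<lambda>x. f m x - f n x) < e/2" using C[of "e/2"] by auto
    have "L2_norm M (\<lambda>x. f n x - g x) \<le> e/2" if "n \<ge> K" for n
      using est[of "e/2" K n] K that \<open>e > 0\<close> less_imp_le by auto
    then have "\<forall>n\<ge>K. norm (L2_norm M (\<lambda>x. f n x - g x) - 0) < e" using \<open>e > 0\<close> by fastforce
    then show "\<exists>K. \<forall>n\<ge>K. norm (L2_norm M (\<lambda>x. f n x - g x) - 0) < e" by blast
  qed
  ultimately show ?thesis by (rule that)
qed

section \<open>Test functions\<close>

text \<open>The elementary C1 building block: \<open>sstep\<close> is a combination of three
  translates of this function.\<close>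

lemma has_derivative_pos_part_sq:
  "((\<lambda>t::real. (max 0 t)\<^sup>2) has_real_derivative 2 * max 0 t) (at t)"
proof -
  consider "t > 0" | "t < 0" | "t = 0" by linarith
  then show ?thesis
  proof cases
    case 1
    have "((\<lambda>t::real. t\<^sup>2) has_real_derivative 2 * t) (at t)"
      by (auto intro!: derivative_eq_intros)
    then have "((\<lambda>t::real. (max 0 t)\<^sup>2) has_real_derivative 2 * t) (at t)"
      by (rule has_field_derivative_transform_within_open[of _ _ _ "{0<..}"]) (use 1 in auto)
    then show ?thesis using 1 by simp
  next
    case 2
    have "((\<lambda>t::real. (0::real)) has_real_derivative 0) (at t)" by simp
    then have "((\<lambda>t::real. (max 0 t)\<^sup>2) has_real_derivative 0) (at t)"
      by (rule has_field_derivative_transform_within_open[of _ _ _ "{..<0}"]) (use 2 in auto)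
    then show ?thesis using 2 by simp
  next
    case 3
    have "((\<lambda>h. ((max 0 (0 + h))\<^sup>2 - (max 0 (0::real))\<^sup>2) / h) \<longlongrightarrow> 0) (at 0)"
    proof (rule Lim_null_comparison)
      show "\<forall>\<^sub>F h in at 0. norm (((max 0 (0 + h))\<^sup>2 - (max 0 (0::real))\<^sup>2) / h) \<le> \<bar>h\<bar>"
        by (rule always_eventually) (auto simp: max_def power2_eq_square)
      show "((\<lambda>h::real. \<bar>h\<bar>) \<longlongrightarrow> 0) (at 0)" by (rule tendsto_rabs_zero) simp
    qed
    then show ?thesis using 3 by (simp add: DERIV_def)
  qed
qed

text \<open>A \<open>C\<^sup>1\<close> transition from 0 to 1 on the unit interval, the primitive of a hat function.\<close>

definition sstep :: "real \<Rightarrow> real" where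
  "sstep t = 2 * (max 0 t)\<^sup>2 - 4 * (max 0 (t - 1/2))\<^sup>2 + 2 * (max 0 (t - 1))\<^sup>2"

definition sstep' :: "real \<Rightarrow> real" where
  "sstep' t = 4 * max 0 t - 8 * max 0 (t - 1/2) + 4 * max 0 (t - 1)"

lemma sstep_deriv: "(sstep has_real_derivative sstep' t) (at t)"
proof -
  have *: "((\<lambda>t. (max 0 (t - c))\<^sup>2) has_real_derivative 2 * max 0 (t - c)) (at t)" for c t :: real
    using DERIV_shift[of "\<lambda>t. (max 0 t)\<^sup>2" "2 * max 0 (t - c)" t "- c"] has_derivative_pos_part_sq[of "t - c"] by simp
  show ?thesis
    unfolding sstep_def[abs_def] sstep'_def
    by (rule derivative_eq_intros has_derivative_pos_part_sq * refl)+ simp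
qed

lemma continuous_sstep': "continuous_on UNIV sstep'"
  unfolding sstep'_def[abs_def] by (intro continuous_intros)

lemma sstep_eq_0: "t \<le> 0 \<Longrightarrow> sstep t = 0" "t \<le> 0 \<Longrightarrow> sstep' t = 0"
  by (auto simp: sstep_def sstep'_def)

lemma sstep_eq_1: "t \<ge> 1 \<Longrightarrow> sstep t = 1" "t \<ge> 1 \<Longrightarrow> sstep' t = 0"
  by (auto simp: sstep_def sstep'_def max_def power2_eq_square algebra_simps)

lemma sstep'_bounds: "0 \<le> sstep' t" "sstep' t \<le> 2"
  by (auto simp: sstep'_def max_def)

lemma sstep_bounds: "0 \<le> sstep t" "sstep t \<le> 1"
proof -
  have m: "sstep s \<le> sstep t" if "s \<le> t" for s t
    by (rule DERIV_nonneg_imp_nondecreasing[OF that]) (use sstep_deriv sstep'_bounds in blast)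
  show "0 \<le> sstep t" using m[of "min t 0" t] sstep_eq_0(1)[of "min t 0"] by simp
  show "sstep t \<le> 1" using m[of t "max t 1"] sstep_eq_1(1)[of "max t 1"] by simp
qed

text \<open>Names the gradient, so that the calculus rules below produce explicit gradients instead
  of Frechet derivatives; no condition on the support is included, since multipliers such as
  coordinates and cut-offs in one variable are not compactly supported.\<close>

definition C1_grad :: "('a::euclidean_space \<Rightarrow> real) \<Rightarrow> ('a \<Rightarrow> 'a) \<Rightarrow> bool" where
  "C1_grad \<phi> g \<longleftrightarrow> continuous_on UNIV g \<and> (\<forall>x. (\<phi> has_derivative (\<lambda>v. g x \<bullet> v)) (at x))"

lemma C1_gradD:
  assumes "C1_grad \<phi> g"
  shows "continuous_on UNIV g" "(\<phi> has_derivative (\<lambda>v. g x \<bullet> v)) (at x)" "continuous_on UNIV \<phi>"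
    "frechet_derivative \<phi> (at x) = (\<lambda>v. g x \<bullet> v)"
    "\<phi> \<in> borel_measurable borel" "g \<in> borel_measurable borel"
proof -
  show 1: "continuous_on UNIV g" "\<And>x. (\<phi> has_derivative (\<lambda>v. g x \<bullet> v)) (at x)"
    using assms by (auto simp: C1_grad_def)
  show 2: "continuous_on UNIV \<phi>"
    using 1(2) has_derivative_continuous continuous_at_imp_continuous_on by blast
  show "frechet_derivative \<phi> (at x) = (\<lambda>v. g x \<bullet> v)"
    using frechet_derivative_at[OF 1(2)[of x]] by simp
  show "\<phi> \<in> borel_measurable borel" "g \<in> borel_measurable borel"
    using 1 2 borel_measurable_continuous_onI by auto
qed

section \<open>Calculus of C1 functions with explicit gradients\<close>

lemma C1_grad_const: "C1_grad (\<lambda>x. c) (\<lambda>x. 0)"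
  by (auto simp: C1_grad_def)

lemma C1_grad_add: "C1_grad f g \<Longrightarrow> C1_grad f' g' \<Longrightarrow> C1_grad (\<lambda>x. f x + f' x) (\<lambda>x. g x + g' x)"
  unfolding C1_grad_def by (auto intro!: continuous_intros derivative_eq_intros simp: inner_add_left)

lemma C1_grad_diff: "C1_grad f g \<Longrightarrow> C1_grad f' g' \<Longrightarrow> C1_grad (\<lambda>x. f x - f' x) (\<lambda>x. g x - g' x)"
  unfolding C1_grad_def by (auto intro!: continuous_intros derivative_eq_intros simp: inner_diff_left)

lemma C1_grad_mult: "C1_grad f g \<Longrightarrow> C1_grad f' g' \<Longrightarrow> C1_grad (\<lambda>x. f x * f' x) (\<lambda>x. f x *\<^sub>R g' x + f' x *\<^sub>R g x)"
  using C1_gradD(3)[of f g] C1_gradD(3)[of f' g']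
  unfolding C1_grad_def
  by (auto intro!: continuous_intros derivative_eq_intros ext simp: inner_add_left algebra_simps)

lemma C1_grad_sum:
  "(\<And>i. i \<in> A \<Longrightarrow> C1_grad (f i) (g i)) \<Longrightarrow> C1_grad (\<lambda>x. \<Sum>i\<in>A. f i x) (\<lambda>x. \<Sum>i\<in>A. g i x)"
  by (induction A rule: infinite_finite_induct) (auto simp: C1_grad_const intro: C1_grad_add)

lemma C1_grad_prod_ex:
  "(\<And>i. i \<in> A \<Longrightarrow> \<exists>g. C1_grad (f i) g) \<Longrightarrow> \<exists>g. C1_grad (\<lambda>x. \<Prod>i\<in>A. f i x) g"
proof (induction A rule: infinite_finite_induct)
  case (insert i A)
  from insert obtain g where g: "C1_grad (\<lambda>x. \<Prod>i\<in>A. f i x) g" by (metis insertCI)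
  from insert obtain h where h: "C1_grad (f i) h" by (metis insertCI)
  show ?case using C1_grad_mult[OF h g] insert(1,2) by auto
qed (use C1_grad_const[of "1::real"] in auto)

lemma C1_grad_compose:
  assumes "C1_grad f g" "\<And>t. (h has_real_derivative h' t) (at t)" "continuous_on UNIV h'"
  shows "C1_grad (\<lambda>x. h (f x)) (\<lambda>x. h' (f x) *\<^sub>R g x)"
proof -
  note f = C1_gradD[OF assms(1)]
  have "continuous_on UNIV (\<lambda>x. h' (f x))"
    using continuous_on_compose2[OF assms(3) f(3)] by simp
  moreover have "((\<lambda>x. h (f x)) has_derivative (\<lambda>v. (h' (f x) *\<^sub>R g x) \<bullet> v)) (at x)" for x
    using has_derivative_compose[OF f(2) assms(2)[unfolded has_field_derivative_def]]
    by (simp add: mult.commute)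
  ultimately show ?thesis unfolding C1_grad_def
    using continuous_on_scaleR[OF _ f(1), of "\<lambda>x. h' (f x)"] by blast
qed

lemma C1_grad_inner: "C1_grad (\<lambda>x. x \<bullet> b) (\<lambda>x. b)"
  unfolding C1_grad_def by (auto intro!: derivative_eq_intros ext simp: inner_commute)

lemma C1_grad_normsq: "C1_grad (\<lambda>x. (norm (x - c))\<^sup>2) (\<lambda>x. 2 *\<^sub>R (x - c))"
  unfolding C1_grad_def power2_norm_eq_inner
  by (auto intro!: continuous_intros derivative_eq_intros ext simp: inner_commute)

lemma C1_grad_scale: "C1_grad f g \<Longrightarrow> C1_grad (\<lambda>x. c * f x) (\<lambda>x. c *\<^sub>R g x)"
  using C1_grad_mult[OF C1_grad_const[of c]] by simp

lemma C1_grad_fst: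
  assumes "C1_grad f g" shows "C1_grad (\<lambda>x. f (fst x)) (\<lambda>x. (g (fst x), 0))"
proof -
  have "((\<lambda>x. f (fst x)) has_derivative (\<lambda>v. g (fst x) \<bullet> fst v)) (at x)" for x :: "'a \<times> 'b"
    by (rule has_derivative_compose[OF has_derivative_fst[OF has_derivative_ident]]) (rule C1_gradD(2)[OF assms])
  moreover have "continuous_on UNIV (\<lambda>x::'a \<times> 'b. (g (fst x), 0::'b))"
    by (intro continuous_intros continuous_on_compose2[OF C1_gradD(1)[OF assms]]) auto
  ultimately show ?thesis by (simp add: C1_grad_def inner_prod_def)
qed

lemma C1_grad_snd:
  assumes "C1_grad f g" shows "C1_grad (\<lambda>x. f (snd x)) (\<lambda>x. (0, g (snd x)))"
proof -
  have "((\<lambda>x. f (snd x)) has_derivative (\<lambda>v. g (snd x) \<bullet> snd v)) (at x)" for x :: "'b \<times> 'a"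
    by (rule has_derivative_compose[OF has_derivative_snd[OF has_derivative_ident]]) (rule C1_gradD(2)[OF assms])
  moreover have "continuous_on UNIV (\<lambda>x::'b \<times> 'a. (0::'b, g (snd x)))"
    by (intro continuous_intros continuous_on_compose2[OF C1_gradD(1)[OF assms]]) auto
  ultimately show ?thesis by (simp add: C1_grad_def inner_prod_def)
qed

lemma C1_grad_real:
  assumes "\<And>t. (h has_real_derivative h' t) (at t)" "continuous_on UNIV h'"
  shows "C1_grad h h'"
  using assms unfolding C1_grad_def has_field_derivative_def by (simp add: mult_commute_abs)

text \<open>The gradient is assembled from the partial derivatives in the definition of
  \<open>C1c\<close>; their continuity is its continuity.\<close>

lemma C1c_iff:
  "\<phi> \<in> C1c \<Omega> \<longleftrightarrow> (\<exists>g. C1_grad \<phi> g) \<and> compact (closure {x. \<phi> x \<noteq> 0}) \<and> closure {x. \<phi> x \<noteq> 0} \<subseteq> \<Omega>"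
proof (intro iffI)
  assume L: "\<phi> \<in> C1c \<Omega>"
  define g where "g x = (\<Sum>b\<in>Basis. frechet_derivative \<phi> (at x) b *\<^sub>R b)" for x
  have "(\<phi> has_derivative (\<lambda>v. g x \<bullet> v)) (at x)" for x
  proof -
    have d: "(\<phi> has_derivative frechet_derivative \<phi> (at x)) (at x)"
      using L by (auto simp: C1c_def frechet_derivative_works)
    interpret linear "frechet_derivative \<phi> (at x)" using d has_derivative_linear by blast
    have "frechet_derivative \<phi> (at x) v = g x \<bullet> v" for v
    proof -
      have "frechet_derivative \<phi> (at x) v = frechet_derivative \<phi> (at x) (\<Sum>b\<in>Basis. (v \<bullet> b) *\<^sub>R b)"
        by (simp add: euclidean_representation)
      also have "\<dots> = g x \<bullet> v"
        unfolding sum scale g_def inner_sum_left by (simp add: inner_commute mult.commute)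
      finally show ?thesis .
    qed
    then show ?thesis using d by (metis ext)
  qed
  moreover have "continuous_on UNIV g"
    unfolding g_def using L by (auto simp: C1c_def intro!: continuous_intros)
  ultimately show "(\<exists>g. C1_grad \<phi> g) \<and> compact (closure {x. \<phi> x \<noteq> 0}) \<and> closure {x. \<phi> x \<noteq> 0} \<subseteq> \<Omega>"
    using L by (auto simp: C1_grad_def C1c_def)
next
  assume R: "(\<exists>g. C1_grad \<phi> g) \<and> compact (closure {x. \<phi> x \<noteq> 0}) \<and> closure {x. \<phi> x \<noteq> 0} \<subseteq> \<Omega>"
  then obtain g where g: "C1_grad \<phi> g" by blast
  have "\<phi> differentiable (at x)" for x using C1_gradD(2)[OF g] by (auto simp: differentiable_def)
  moreover have "continuous_on UNIV (\<lambda>x. frechet_derivative \<phi> (at x) b)" for b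
    unfolding C1_gradD(4)[OF g] using C1_gradD(1)[OF g] by (intro continuous_intros)
  ultimately show "\<phi> \<in> C1c \<Omega>" using R by (auto simp: C1c_def)
qed

lemma C1c_obtain:
  assumes "\<phi> \<in> C1c \<Omega>" obtains g where "C1_grad \<phi> g"
  using assms C1c_iff by blast

lemma C1c_I:
  assumes "C1_grad \<phi> g" "compact K" "K \<subseteq> \<Omega>" "\<And>x. x \<notin> K \<Longrightarrow> \<phi> x = 0"
  shows "\<phi> \<in> C1c \<Omega>"
proof -
  have "closure {x. \<phi> x \<noteq> 0} \<subseteq> K"
    using assms(2,4) by (intro closure_minimal) (auto intro: compact_imp_closed)
  moreover from this have "compact (closure {x. \<phi> x \<noteq> 0})"
    using assms(2) by (meson bounded_subset closed_closure compact_eq_bounded_closed)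
  ultimately show ?thesis using assms(1,3) unfolding C1c_iff by blast
qed

text \<open>Off the closure of the support the function vanishes on an open set, so one compact set
  serves for the function and for its gradient.\<close>

lemma C1c_support:
  assumes "\<phi> \<in> C1c \<Omega>" "C1_grad \<phi> g"
  obtains K where "compact K" "K \<subseteq> \<Omega>" "\<And>x. x \<notin> K \<Longrightarrow> \<phi> x = 0" "\<And>x. x \<notin> K \<Longrightarrow> g x = 0"
proof
  let ?K = "closure {x. \<phi> x \<noteq> 0}"
  show "compact ?K" "?K \<subseteq> \<Omega>" using assms by (auto simp: C1c_iff)
  show 0: "\<phi> x = 0" if "x \<notin> ?K" for x
    using that closure_subset[of "{x. \<phi> x \<noteq> 0}"] by (metis (mono_tags, lifting) mem_Collect_eq subsetD)
  show "g x = 0" if "x \<notin> ?K" for x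
  proof -
    have "((\<lambda>_. 0::real) has_derivative (\<lambda>v. 0)) (at x)" by simp
    then have "(\<phi> has_derivative (\<lambda>v. 0)) (at x)"
    proof (rule has_derivative_transform_within_open)
      show "open (- ?K)" by (rule open_Compl[OF closed_closure])
      show "x \<in> - ?K" using that by blast
      show "0 = \<phi> y" if "y \<in> - ?K" for y using 0[of y] that by force
    qed
    from has_derivative_unique[OF this C1_gradD(2)[OF assms(2)]]
    have "g x \<bullet> g x = 0" by metis
    then show ?thesis by simp
  qed
qed

lemma C1c_mono: "\<phi> \<in> C1c A \<Longrightarrow> A \<subseteq> B \<Longrightarrow> \<phi> \<in> C1c B"
  by (auto simp: C1c_def)

lemma C1c_mult:
  assumes "\<phi> \<in> C1c \<Omega>" "C1_grad m h"
  shows "(\<lambda>x. m x * \<phi> x) \<in> C1c \<Omega>"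
proof -
  obtain g where g: "C1_grad \<phi> g" using C1c_obtain[OF assms(1)] .
  obtain K where "compact K" "K \<subseteq> \<Omega>" "\<And>x. x \<notin> K \<Longrightarrow> \<phi> x = 0" using C1c_support[OF assms(1) g] by metis
  then show ?thesis using C1c_I[OF C1_grad_mult[OF assms(2) g]] by force
qed

lemma C1c_add:
  assumes "\<phi> \<in> C1c \<Omega>" "\<psi> \<in> C1c \<Omega>"
  shows "(\<lambda>x. \<phi> x + \<psi> x) \<in> C1c \<Omega>"
proof -
  obtain g where g: "C1_grad \<phi> g" using C1c_obtain[OF assms(1)] .
  obtain h where h: "C1_grad \<psi> h" using C1c_obtain[OF assms(2)] .
  obtain K where "compact K" "K \<subseteq> \<Omega>" "\<And>x. x \<notin> K \<Longrightarrow> \<phi> x = 0" using C1c_support[OF assms(1) g] by metis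
  moreover obtain K' where "compact K'" "K' \<subseteq> \<Omega>" "\<And>x. x \<notin> K' \<Longrightarrow> \<psi> x = 0" using C1c_support[OF assms(2) h] by metis
  ultimately show ?thesis
    using C1c_I[OF C1_grad_add[OF g h], of "K \<union> K'" \<Omega>] by (simp add: compact_Un)
qed

lemma C1c_scale: "\<phi> \<in> C1c \<Omega> \<Longrightarrow> (\<lambda>x. c * \<phi> x) \<in> C1c \<Omega>"
  using C1c_mult[OF _ C1_grad_const[of c]] .

lemma integrable_compact_support:
  fixes f :: "'a::euclidean_space \<Rightarrow> 'b::euclidean_space"
  assumes "continuous_on UNIV f" "compact K" "\<And>x. x \<notin> K \<Longrightarrow> f x = 0"
  shows "integrable lborel f"
proof -
  have "integrable lborel (\<lambda>x. indicator K x *\<^sub>R f x)"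
    using borel_integrable_compact[OF assms(2)] assms(1) continuous_on_subset by blast
  also have "(\<lambda>x. indicator K x *\<^sub>R f x) = f" using assms(3) by (auto simp: indicator_def)
  finally show ?thesis .
qed

lemma bounded_compact_support:
  fixes f :: "'a::euclidean_space \<Rightarrow> 'b::euclidean_space"
  assumes "continuous_on UNIV f" "compact K" "\<And>x. x \<notin> K \<Longrightarrow> f x = 0"
  obtains B where "B > 0" "\<And>x. norm (f x) \<le> B"
proof -
  have "bounded (f ` K)"
    using assms(1,2) by (intro compact_imp_bounded compact_continuous_image) (auto intro: continuous_on_subset)
  then obtain B where "B > 0" "\<forall>x\<in>f ` K. norm x \<le> B" by (auto simp: bounded_pos)
  then have "norm (f x) \<le> B" for x using assms(3)[of x] by (cases "x \<in> K") auto
  then show ?thesis using \<open>B > 0\<close> that by blast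
qed

section \<open>Integration by parts for test functions\<close>

lemma integral_translation:
  fixes f :: "'a::euclidean_space \<Rightarrow> 'b::euclidean_space"
  assumes [measurable]: "f \<in> borel_measurable borel"
  shows "(LINT x|lborel. f (x + c)) = (LINT x|lborel. f x)"
proof -
  have "(LINT x|lborel. f x) = (LINT x|distr lborel borel ((+) c). f x)" by (simp add: lborel_distr_plus)
  also have "\<dots> = (LINT x|lborel. f (c + x))" by (rule integral_distr) auto
  finally show ?thesis by (simp add: add.commute)
qed

lemma integrable_translation:
  fixes f :: "'a::euclidean_space \<Rightarrow> 'b::euclidean_space"
  assumes "integrable lborel f"
  shows "integrable lborel (\<lambda>x. f (x + c))"
proof -
  have "integrable (distr lborel borel ((+) c)) f" using assms by (simp add: lborel_distr_plus)
  then have "integrable lborel (\<lambda>x. f (c + x))"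
    using assms by (subst (asm) integrable_distr_eq) (auto dest: borel_measurable_integrable)
  then show ?thesis by (simp add: add.commute)
qed

text \<open>Difference quotients have integral zero by translation invariance, and dominated
  convergence carries this to the derivative. Applied to products it yields every integration by
  parts between C1 functions.\<close>

lemma integral_gradient_eq_0:
  fixes \<theta> :: "'a::euclidean_space \<Rightarrow> real"
  assumes "C1_grad \<theta> g" "\<theta> \<in> C1c UNIV"
  shows "(LINT x|lborel. g x \<bullet> b) = 0"
proof -
  obtain K where K: "compact K" "\<And>x. x \<notin> K \<Longrightarrow> \<theta> x = 0" "\<And>x. x \<notin> K \<Longrightarrow> g x = 0"
    using C1c_support[OF assms(2,1)] by metis
  note C = C1_gradD[OF assms(1)]
  obtain B where B: "B > 0" "\<And>x. norm (g x) \<le> B" using bounded_compact_support[OF C(1) K(1,3)] by metis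
  obtain R where R: "\<And>x. x \<in> K \<Longrightarrow> norm x \<le> R" using compact_imp_bounded[OF K(1)] by (auto simp: bounded_iff)
  define h where "h n = inverse (real (Suc n))" for n
  have h: "h n > 0" "h n \<le> 1" for n by (auto simp: h_def field_simps)
  define D where "D n x = (\<theta> (x + h n *\<^sub>R b) - \<theta> x) / h n" for n x
  have [measurable]: "\<theta> \<in> borel_measurable borel" "g \<in> borel_measurable borel" using C by auto
  have meas [measurable]: "D n \<in> borel_measurable lborel" for n unfolding D_def by measurable
  have "(\<lambda>n. LINT x|lborel. D n x) \<longlonglongrightarrow> (LINT x|lborel. g x \<bullet> b)"
  proof (rule integral_dominated_convergence)
    \<comment> \<open>The increments are at most \<open>b\<close> in length because
      \<open>h n \<le> 1\<close>; hence all difference quotients vanish off this one ball, and the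
      gradient bound \<open>B\<close> dominates them on it.\<close>
    show "integrable lborel (\<lambda>x. indicator (cball 0 (R + norm b)) x *\<^sub>R (B * norm b))"
      by (rule borel_integrable_compact) auto
    show "AE x in lborel. (\<lambda>n. D n x) \<longlonglongrightarrow> g x \<bullet> b"
    proof (rule AE_I2)
      fix x
      have "((\<lambda>t. \<theta> (x + t *\<^sub>R b)) has_derivative (\<lambda>t. g (x + 0 *\<^sub>R b) \<bullet> (t *\<^sub>R b))) (at 0)"
        by (rule has_derivative_compose[of "\<lambda>t. x + t *\<^sub>R b" "\<lambda>t. t *\<^sub>R b" 0 UNIV \<theta>])
           (auto intro!: derivative_eq_intros C(2))
      then have "((\<lambda>t. \<theta> (x + t *\<^sub>R b)) has_real_derivative (g x \<bullet> b)) (at 0)"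
        by (simp add: has_field_derivative_def mult_commute_abs)
      then have "((\<lambda>t. (\<theta> (x + t *\<^sub>R b) - \<theta> x) / t) \<longlongrightarrow> g x \<bullet> b) (at 0)"
        by (simp add: DERIV_def)
      moreover have "filterlim h (at 0) sequentially"
        unfolding filterlim_at using h LIMSEQ_inverse_real_of_nat by (auto simp: h_def[abs_def])
      ultimately show "(\<lambda>n. D n x) \<longlonglongrightarrow> g x \<bullet> b"
        unfolding D_def by (rule filterlim_compose)
    qed
    fix n
    show "AE x in lborel. norm (D n x) \<le> indicator (cball 0 (R + norm b)) x *\<^sub>R (B * norm b)"
    proof (rule AE_I2)
      fix x
      have hb: "norm (h n *\<^sub>R b) \<le> norm b" using h[of n] by (simp add: mult_left_le_one_le)
      show "norm (D n x) \<le> indicator (cball 0 (R + norm b)) x *\<^sub>R (B * norm b)"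
      proof (cases "x \<in> cball 0 (R + norm b)")
        case False
        then have "x \<notin> K" using R[of x] by (auto simp: order_trans add_increasing2)
        moreover have "x + h n *\<^sub>R b \<notin> K"
        proof
          assume "x + h n *\<^sub>R b \<in> K"
          then have "norm x \<le> R + norm (h n *\<^sub>R b)" using R[of "x + h n *\<^sub>R b"]
            norm_triangle_ineq4[of "x + h n *\<^sub>R b" "h n *\<^sub>R b"] by simp
          then show False using False hb by simp
        qed
        ultimately show ?thesis using K(2) False by (simp add: D_def)
      next
        case True
        have "norm (\<theta> (x + h n *\<^sub>R b) - \<theta> x) \<le> B * norm ((x + h n *\<^sub>R b) - x)"
        proof (rule differentiable_bound[of UNIV])
          fix y show "(\<theta> has_derivative (\<lambda>v. g y \<bullet> v)) (at y within UNIV)" using C(2) by simp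
          show "onorm ((\<bullet>) (g y)) \<le> B"
          proof (rule onorm_le)
            fix v
            have "norm (g y \<bullet> v) \<le> norm (g y) * norm v" using Cauchy_Schwarz_ineq2[of "g y" v] by simp
            also have "\<dots> \<le> B * norm v" by (rule mult_right_mono[OF B(2)]) simp
            finally show "norm (g y \<bullet> v) \<le> B * norm v" .
          qed
        qed auto
        then have "norm (D n x) \<le> B * norm b" using h[of n] by (simp add: D_def divide_le_eq mult.commute mult.left_commute)
        then show ?thesis using True by simp
      qed
    qed
  qed measurable
  moreover have "(LINT x|lborel. D n x) = 0" for n
  proof -
    have "integrable lborel \<theta>" using integrable_compact_support[OF C(3) K(1,2)] .
    then have "(LINT x|lborel. \<theta> (x + h n *\<^sub>R b) - \<theta> x)
        = (LINT x|lborel. \<theta> (x + h n *\<^sub>R b)) - (LINT x|lborel. \<theta> x)"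
      by (intro Bochner_Integration.integral_diff integrable_translation)
    also have "\<dots> = 0" by (simp add: integral_translation)
    finally show ?thesis unfolding D_def by simp
  qed
  ultimately show ?thesis by (simp add: LIMSEQ_const_iff)
qed

section \<open>Weak gradients\<close>

lemma LINT_vol: "open \<Omega> \<Longrightarrow> (LINT x|vol \<Omega>. f x) = (LINT x|lborel. indicator \<Omega> x *\<^sub>R f x)"
  for f :: "'a::euclidean_space \<Rightarrow> 'b::euclidean_space"
  by (rule integral_restrict_space) auto

lemma LINT_vol_support:
  fixes f :: "'a::euclidean_space \<Rightarrow> 'b::euclidean_space"
  assumes "open \<Omega>" "\<And>x. x \<notin> \<Omega> \<Longrightarrow> f x = 0"
  shows "(LINT x|vol \<Omega>. f x) = (LINT x|lborel. f x)"
  unfolding LINT_vol[OF assms(1)]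
  by (rule Bochner_Integration.integral_cong) (use assms(2) in \<open>auto simp: indicator_def\<close>)

lemma AE_vol: "open \<Omega> \<Longrightarrow> (AE x in vol \<Omega>. P x) \<longleftrightarrow> (AE x in lborel. x \<in> \<Omega> \<longrightarrow> P x)"
  by (rule AE_restrict_space_iff) auto

text \<open>The product with the test function has compact support even where \<phi> has none, so
  \<open>integral_gradient_eq_0\<close> applies to it.\<close>

lemma has_weak_grad_C1:
  assumes "open \<Omega>" "C1_grad \<phi> g"
  shows "has_weak_grad \<Omega> \<phi> g"
  unfolding has_weak_grad_def
proof (intro conjI allI impI ballI)
  note C = C1_gradD[OF assms(2)]
  fix K :: "'a set" assume "compact K \<and> K \<subseteq> \<Omega>"
  then show "set_integrable lborel K \<phi>" "set_integrable lborel K g"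
    unfolding set_integrable_def
    by (intro borel_integrable_compact continuous_on_subset[OF C(3)] continuous_on_subset[OF C(1)]; simp)+
next
  note C = C1_gradD[OF assms(2)]
  fix \<psi> :: "'a \<Rightarrow> real" and b :: 'a assume p: "\<psi> \<in> C1c \<Omega>" and "b \<in> Basis"
  obtain h where h: "C1_grad \<psi> h" using C1c_obtain[OF p] .
  note D = C1_gradD[OF h]
  obtain K where K: "compact K" "K \<subseteq> \<Omega>" "\<And>x. x \<notin> K \<Longrightarrow> \<psi> x = 0" "\<And>x. x \<notin> K \<Longrightarrow> h x = 0"
    using C1c_support[OF p h] by metis
  have z: "x \<notin> \<Omega> \<Longrightarrow> \<psi> x = 0" "x \<notin> \<Omega> \<Longrightarrow> h x = 0" for x using K by blast+
  have "(\<lambda>x. \<phi> x * \<psi> x) \<in> C1c UNIV" using C1c_mono[OF C1c_mult[OF p assms(2)]] by simp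
  from integral_gradient_eq_0[OF C1_grad_mult[OF assms(2) h] this, of b]
  have "0 = (LINT x|lborel. \<phi> x * (h x \<bullet> b) + (g x \<bullet> b) * \<psi> x)" by (simp add: inner_add_left mult.commute)
  also have "\<dots> = (LINT x|lborel. \<phi> x * (h x \<bullet> b)) + (LINT x|lborel. (g x \<bullet> b) * \<psi> x)"
    by (rule Bochner_Integration.integral_add; rule integrable_compact_support[OF _ K(1)])
       (use C D K in \<open>auto intro!: continuous_intros\<close>)
  also have "(LINT x|lborel. \<phi> x * (h x \<bullet> b)) = (LINT x|vol \<Omega>. \<phi> x * frechet_derivative \<psi> (at x) b)"
    unfolding D(4) by (rule LINT_vol_support[symmetric]) (use assms(1) z in auto)
  also have "(LINT x|lborel. (g x \<bullet> b) * \<psi> x) = (LINT x|vol \<Omega>. (g x \<bullet> b) * \<psi> x)"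
    by (rule LINT_vol_support[symmetric]) (use assms(1) z in auto)
  finally show "(LINT x|vol \<Omega>. \<phi> x * frechet_derivative \<psi> (at x) b) = - (LINT x|vol \<Omega>. (g x \<bullet> b) * \<psi> x)" by simp
qed

section \<open>The fundamental lemma of the calculus of variations\<close>

lemma AE_cbox_box: "AE x in lborel. x \<in> cbox a b \<longleftrightarrow> x \<in> box a (b::'a::euclidean_space)"
proof -
  have "emeasure lborel (cbox a b - box a b) = emeasure lborel (cbox a b) - emeasure lborel (box a b)"

    using emeasure_lborel_box_finite[of a b] by (intro emeasure_Diff) (auto simp: box_subset_cbox)
  also have "\<dots> = 0" by (simp add: emeasure_lborel_cbox_eq emeasure_lborel_box_eq)
  finally have "cbox a b - box a b \<in> null_sets lborel" by auto
  from AE_not_in[OF this] show ?thesis by eventually_elim (use box_subset_cbox in auto)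
qed

text \<open>A product of two \<open>sstep\<close> profiles per coordinate, starting at the faces and
  of slope proportional to n. They are zero on the faces themselves, which is why the limit is the
  open box.\<close>

lemma box_approximation:
  fixes a c :: "'a::euclidean_space"
  assumes "cbox a c \<subseteq> \<Omega>"
  obtains \<beta> where "\<And>n::nat. \<beta> n \<in> C1c \<Omega>" "\<And>n x. 0 \<le> \<beta> n x" "\<And>n x. \<beta> n x \<le> indicator (cbox a c) x"
    "\<And>x. (\<lambda>n. \<beta> n x) \<longlonglongrightarrow> indicator (box a c) x"
proof -
  define \<beta> where "\<beta> n x = (\<Prod>b\<in>Basis. sstep (real n * ((x - a) \<bullet> b)) * sstep (real n * ((c - x) \<bullet> b)))"
    for n :: nat and x
  have C: "\<exists>g. C1_grad (\<lambda>x. sstep (real n * ((x - a) \<bullet> b)) * sstep (real n * ((c - x) \<bullet> b))) g" for n b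
  proof -
    have 1: "C1_grad (\<lambda>x. real n * (x \<bullet> b - a \<bullet> b)) (\<lambda>x. real n *\<^sub>R (b - 0))"
      by (intro C1_grad_scale C1_grad_diff C1_grad_const C1_grad_inner)
    have 2: "C1_grad (\<lambda>x. real n * (c \<bullet> b - x \<bullet> b)) (\<lambda>x. real n *\<^sub>R (0 - b))"
      by (intro C1_grad_scale C1_grad_diff C1_grad_const C1_grad_inner)
    show ?thesis
      using C1_grad_mult[OF C1_grad_compose[OF 1 sstep_deriv continuous_sstep'] C1_grad_compose[OF 2 sstep_deriv continuous_sstep']]
      by (auto simp: inner_diff_left)
  qed
  have z: "\<beta> n x = 0" if "x \<notin> cbox a c" for n x
  proof -
    from that obtain b where b: "b \<in> Basis" "x \<bullet> b < a \<bullet> b \<or> c \<bullet> b < x \<bullet> b" by (auto simp: mem_box not_le)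
    then have "real n * ((x - a) \<bullet> b) \<le> 0 \<or> real n * ((c - x) \<bullet> b) \<le> 0"
      by (auto simp: inner_diff_left mult_le_0_iff)
    then have "sstep (real n * ((x - a) \<bullet> b)) * sstep (real n * ((c - x) \<bullet> b)) = 0"
      using sstep_eq_0(1) by auto
    then show ?thesis unfolding \<beta>_def using b(1) by (intro prod_zero) auto
  qed
  have "\<beta> n \<in> C1c \<Omega>" for n
  proof -
    from C1_grad_prod_ex[of "Basis", OF C, of "\<lambda>_. n" "\<lambda>b. b"] obtain g where "C1_grad (\<beta> n) g" unfolding \<beta>_def[abs_def] by blast
    then show ?thesis using assms z by (intro C1c_I[of _ _ "cbox a c"]) auto
  qed
  moreover have nn: "0 \<le> \<beta> n x" for n x unfolding \<beta>_def by (intro prod_nonneg) (simp add: sstep_bounds)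
  moreover have "\<beta> n x \<le> indicator (cbox a c) x" for n x
  proof (cases "x \<in> cbox a c")
    case True
    have "\<beta> n x \<le> 1" unfolding \<beta>_def by (intro prod_le_1) (simp add: sstep_bounds mult_le_one)
    then show ?thesis using True by simp
  qed (simp add: z)
  moreover have "(\<lambda>n. \<beta> n x) \<longlonglongrightarrow> indicator (box a c) x" for x
  proof (cases "x \<in> box a c")
    case True
    have lim: "(\<lambda>n. sstep (real n * t)) \<longlonglongrightarrow> 1" if "t > 0" for t
    proof (rule tendsto_eventually)
      obtain N where N: "real N \<ge> 1 / t" using real_arch_simple by blast
      show "\<forall>\<^sub>F n in sequentially. sstep (real n * t) = 1"
      proof (rule eventually_sequentiallyI[of N])
        fix n assume "N \<le> n"
        then have "1 / t \<le> real n" using N by simp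
        then show "sstep (real n * t) = 1" using that by (intro sstep_eq_1) (simp add: divide_le_eq)
      qed
    qed
    have "(\<lambda>n. \<beta> n x) \<longlonglongrightarrow> (\<Prod>b\<in>(Basis::'a set). 1 * 1)"
      unfolding \<beta>_def
      by (intro tendsto_prod tendsto_mult lim) (use True in \<open>auto simp: mem_box inner_diff_left\<close>)
    then show ?thesis using True by simp
  next
    case False
    then obtain b where b: "b \<in> Basis" "x \<bullet> b \<le> a \<bullet> b \<or> c \<bullet> b \<le> x \<bullet> b" by (auto simp: mem_box not_less)
    then have "sstep (real n * ((x - a) \<bullet> b)) * sstep (real n * ((c - x) \<bullet> b)) = 0" for n
      using sstep_eq_0(1) by (auto simp: inner_diff_left mult_le_0_iff)
    then have "\<beta> n x = 0" for n unfolding \<beta>_def using b(1) by (intro prod_zero) auto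
    then show ?thesis using False by simp
  qed
  ultimately show ?thesis by (rule that)
qed

lemma fundamental_lemma_box:
  fixes f :: "'a::euclidean_space \<Rightarrow> real"
  assumes "open \<Omega>" "cbox a c \<subseteq> \<Omega>" "set_integrable lborel (cbox a c) f"
    and 0: "\<And>\<psi>. \<psi> \<in> C1c \<Omega> \<Longrightarrow> (LINT x|vol \<Omega>. f x * \<psi> x) = 0"
  shows "(LINT x:box a c|lborel. f x) = 0"
proof -
  obtain \<beta> where b: "\<And>n::nat. \<beta> n \<in> C1c \<Omega>" "\<And>n x. 0 \<le> \<beta> n x" "\<And>n x. \<beta> n x \<le> indicator (cbox a c) x"
    "\<And>x. (\<lambda>n. \<beta> n x) \<longlonglongrightarrow> indicator (box a c) x" using box_approximation[OF assms(2)] by metis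
  define F where "F x = indicator (cbox a c) x *\<^sub>R f x" for x
  have FI: "integrable lborel F" using assms(3) by (simp add: F_def[abs_def] set_integrable_def)
  then have [measurable]: "F \<in> borel_measurable borel" by (simp add: borel_measurable_integrable)
  have [measurable]: "\<beta> n \<in> borel_measurable borel" for n using b(1)[of n] C1_gradD(5) C1c_obtain by metis
  have z: "\<beta> n x = 0" if "x \<notin> cbox a c" for n x using b(2,3)[of n x] that by simp
  have "(\<lambda>n. LINT x|lborel. F x * \<beta> n x) \<longlonglongrightarrow> (LINT x|lborel. F x * indicator (box a c) x)"
  proof (rule integral_dominated_convergence)
    show "integrable lborel (\<lambda>x. norm (F x))" using FI by simp
    show "AE x in lborel. (\<lambda>n. F x * \<beta> n x) \<longlonglongrightarrow> F x * indicator (box a c) x"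
      by (intro AE_I2 tendsto_intros b)
    show "AE x in lborel. norm (F x * \<beta> n x) \<le> norm (F x)" for n
    proof (rule AE_I2)
      fix x
      have "\<beta> n x \<le> 1" using b(3)[of n x] by (rule order_trans) (simp add: indicator_def)
      then show "norm (F x * \<beta> n x) \<le> norm (F x)" using b(2)[of n x] by (simp add: abs_mult mult_left_le)
    qed
  qed measurable
  moreover have "(LINT x|lborel. F x * \<beta> n x) = 0" for n
  proof -
    have "(LINT x|lborel. F x * \<beta> n x) = (LINT x|vol \<Omega>. F x * \<beta> n x)"
      by (rule LINT_vol_support[symmetric]) (use assms(1,2) z in auto)
    also have "\<dots> = (LINT x|vol \<Omega>. f x * \<beta> n x)"
      by (rule Bochner_Integration.integral_cong) (use z in \<open>auto simp: F_def indicator_def\<close>)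
    finally show ?thesis using 0[OF b(1)] by simp
  qed
  ultimately have "(LINT x|lborel. F x * indicator (box a c) x) = 0" by (simp add: LIMSEQ_const_iff)
  also have "(\<lambda>x. F x * indicator (box a c) x) = (\<lambda>x. indicator (box a c) x *\<^sub>R f x)"
    by (rule ext) (use box_subset_cbox[of a c] in \<open>auto simp: F_def indicator_def\<close>)
  finally show ?thesis by (simp add: set_lebesgue_integral_def)
qed

text \<open>Testing with approximate indicators kills the integral over every box. Boxes are stable
  under intersection and generate the Borel sets, so the integral over every Borel set vanishes, and
  with it the function.\<close>

lemma fundamental_lemma:
  fixes f :: "'a::euclidean_space \<Rightarrow> real"
  assumes O: "open \<Omega>" and I: "\<And>K. compact K \<Longrightarrow> K \<subseteq> \<Omega> \<Longrightarrow> set_integrable lborel K f"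
    and 0: "\<And>\<psi>. \<psi> \<in> C1c \<Omega> \<Longrightarrow> (LINT x|vol \<Omega>. f x * \<psi> x) = 0"
  shows "AE x in lborel. x \<in> \<Omega> \<longrightarrow> f x = 0"
proof -
  \<comment> \<open>Only local integrability is given, so the measure-theoretic argument runs inside
    one closed box; countably many of them exhaust \<Omega>.\<close>
  have *: "AE x in lborel. x \<in> cbox a c \<longrightarrow> f x = 0" if sub: "cbox a c \<subseteq> \<Omega>" for a c
  proof -
    define F where "F x = indicator (cbox a c) x *\<^sub>R f x" for x
    have FI: "integrable lborel F" using I[OF compact_cbox sub] by (simp add: F_def[abs_def] set_integrable_def)
    then have [measurable]: "F \<in> borel_measurable borel" by (simp add: borel_measurable_integrable)
    have bx: "(LINT x:box p q|lborel. F x) = 0" for p q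
    proof -
      have "(LINT x:box p q|lborel. F x) = (LINT x:box p q \<inter> box a c|lborel. f x)"
      proof -
        have "(LINT x|lborel. indicator (box p q) x *\<^sub>R F x) = (LINT x|lborel. indicator (box p q \<inter> box a c) x *\<^sub>R F x)"
        proof (rule integral_cong_AE)
          show "AE x in lborel. indicator (box p q) x *\<^sub>R F x = indicator (box p q \<inter> box a c) x *\<^sub>R F x"
            using AE_cbox_box[of a c] by eventually_elim (auto simp: F_def indicator_def)
        qed measurable
        also have "(\<lambda>x. indicator (box p q \<inter> box a c) x *\<^sub>R F x) = (\<lambda>x. indicator (box p q \<inter> box a c) x *\<^sub>R f x)"
          by (rule ext) (use box_subset_cbox[of a c] in \<open>auto simp: F_def indicator_def\<close>)
        finally show ?thesis by (simp add: set_lebesgue_integral_def)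
      qed
      also have "\<dots> = 0"
      proof -
        obtain p' q' where pq: "box p q \<inter> box a c = box p' q'"
          by (rule that) (rule box_Int_box)
        show ?thesis
        proof (cases "box p' q' = {}")
          case True then show ?thesis by (simp add: pq set_lebesgue_integral_def)
        next
          case False
          have "box p' q' \<subseteq> cbox a c" using pq box_subset_cbox[of a c] by blast
          then have "closure (box p' q') \<subseteq> cbox a c" by (rule closure_minimal) (rule closed_cbox)
          then have "cbox p' q' \<subseteq> cbox a c" using closure_box[OF False] by simp
          then have "cbox p' q' \<subseteq> \<Omega>" using sub by blast
          from fundamental_lemma_box[OF O this I[OF compact_cbox this] 0] show ?thesis by (simp add: pq)
        qed
      qed
      finally show ?thesis .
    qed
    have SI: "set_integrable lborel A F" if "A \<in> sets borel" for A
      using integrable_mult_indicator[OF _ FI, of A] that by (simp add: set_integrable_def)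
    have F0: "(LINT x|lborel. F x) = 0"
    proof -
      have "(LINT x|lborel. F x) = (LINT x:box a c|lborel. F x)"
        unfolding set_lebesgue_integral_def
      proof (rule integral_cong_AE)
        show "AE x in lborel. F x = indicator (box a c) x *\<^sub>R F x"
          using AE_cbox_box[of a c] by eventually_elim (auto simp: F_def indicator_def)
      qed measurable
      then show ?thesis using bx by simp
    qed
    have A: "(LINT x:A|lborel. F x) = 0" if "A \<in> sets borel" for A
    proof -
      have "Int_stable (range (\<lambda> (a, b). box a b :: 'a set))"
        unfolding Int_stable_def by (auto simp: box_Int_box)
      moreover have "range (\<lambda> (a, b). box a b :: 'a set) \<subseteq> Pow UNIV" by simp
      moreover have s: "sets borel = sigma_sets UNIV (range (\<lambda> (a, b). box a b :: 'a set))"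
        by (subst borel_eq_box) (simp add: sets_measure_of)
      then have "A \<in> sigma_sets UNIV (range (\<lambda> (a, b). box a b :: 'a set))" using that by simp
      ultimately show ?thesis
      proof (induction rule: sigma_sets_induct_disjoint)
        case (basic A) then show ?case using bx by auto
      next
        case empty then show ?case by (simp add: set_lebesgue_integral_def)
      next
        case (compl A)
        then have [measurable]: "A \<in> sets borel" by (simp add: s)
        have "(LINT x:A \<union> (UNIV - A)|lborel. F x) = (LINT x:A|lborel. F x) + (LINT x:(UNIV - A)|lborel. F x)"
          by (rule set_integral_Un) (auto intro!: SI)
        then show ?case using compl F0 by (simp add: set_lebesgue_integral_def)
      next
        case (union A)
        then have m: "A i \<in> sets borel" for i by (auto simp: s)
        have "(LINT x:(\<Union>i. A i)|lborel. F x) = (\<Sum>i. (LINT x:(A i)|lborel. F x))"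
          using union(1) m by (intro lebesgue_integral_countable_add) (auto simp: disjoint_family_on_def intro!: SI)
        then show ?case using union by simp
      qed
    qed
    have "AE x in lborel. F x = 0"
      by (rule density_unique_real[OF FI]) (use A in \<open>auto simp: set_lebesgue_integral_def\<close>)
    then show ?thesis by eventually_elim (auto simp: F_def indicator_def)
  qed
  obtain \<D> where D: "countable \<D>" "\<D> \<subseteq> Pow \<Omega>" "\<And>X. X \<in> \<D> \<Longrightarrow> \<exists>a b. X = cbox a b" "\<Union>\<D> = \<Omega>"
    using open_countable_Union_open_cbox[OF O] by metis
  have "AE x in lborel. \<forall>X\<in>\<D>. x \<in> X \<longrightarrow> f x = 0"
    unfolding AE_ball_countable[OF D(1)]
  proof
    fix X assume "X \<in> \<D>"
    moreover then obtain a b where "X = cbox a b" using D(3) by blast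
    ultimately show "AE x in lborel. x \<in> X \<longrightarrow> f x = 0" using *[of a b] D(2) by blast
  qed
  then show ?thesis by eventually_elim (use D(4) in blast)
qed

text \<open>Integrability on compact sets includes measurability there, and countably many closed
  boxes cover \<Omega>. The arbitrary choice in \<open>wgrad\<close> is thereby measurable.\<close>

lemma weak_grad_measurable:
  fixes g :: "'a::euclidean_space \<Rightarrow> 'b::euclidean_space"
  assumes O: "open \<Omega>" and I: "\<And>K. compact K \<Longrightarrow> K \<subseteq> \<Omega> \<Longrightarrow> set_integrable lborel K g"
  shows "g \<in> borel_measurable (vol \<Omega>)"
proof -
  obtain \<D> where D: "countable \<D>" "\<D> \<subseteq> Pow \<Omega>" "\<And>X. X \<in> \<D> \<Longrightarrow> \<exists>a b. X = cbox a b" "\<Union>\<D> = \<Omega>"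
    using open_countable_Union_open_cbox[OF O] by metis
  have O': "\<Omega> \<in> sets borel" using O by simp
  show ?thesis
  proof (rule measurable_piecewise_restrict[OF D(1)])
    show "space (vol \<Omega>) \<subseteq> \<Union> \<D>" using D(4) by (simp add: space_restrict_space)
    fix X assume X: "X \<in> \<D>"
    then obtain a b where ab: "X = cbox a b" "X \<subseteq> \<Omega>" using D by blast
    show "X \<inter> space (vol \<Omega>) \<in> sets (vol \<Omega>)"
      using ab O' by (auto simp: sets_restrict_space space_restrict_space intro!: image_eqI[of _ _ X])
    have "restrict_space (vol \<Omega>) X = restrict_space lborel X"
      using ab O' by (subst restrict_restrict_space) (auto simp: Int_absorb1)
    moreover have "g \<in> borel_measurable (restrict_space lborel X)"
      using I[of X] ab unfolding set_integrable_def
      by (subst borel_measurable_restrict_space_iff) (auto dest: borel_measurable_integrable)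
    ultimately show "g \<in> borel_measurable (restrict_space (vol \<Omega>) X)" by simp
  qed
qed

lemma L2_vol_set_integrable:
  fixes f :: "'a::euclidean_space \<Rightarrow> 'b::euclidean_space"
  assumes O: "open \<Omega>" and f: "f \<in> L2 (vol \<Omega>)" and K: "compact K" "K \<subseteq> \<Omega>"
  shows "set_integrable lborel K f"
proof -
  have Om: "\<Omega> \<in> sets borel" and Km: "K \<in> sets borel" using O borel_compact[OF K(1)] by auto
  have fm [measurable]: "f \<in> borel_measurable (vol \<Omega>)" using f by (simp add: L2_def)
  have mO: "(\<lambda>x. indicator \<Omega> x *\<^sub>R f x) \<in> borel_measurable lborel"
    using fm Om by (subst (asm) borel_measurable_restrict_space_iff) auto
  have "(\<lambda>x. indicator K x *\<^sub>R (indicator \<Omega> x *\<^sub>R f x)) \<in> borel_measurable lborel"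
    using mO Km by measurable
  also have "(\<lambda>x. indicator K x *\<^sub>R (indicator \<Omega> x *\<^sub>R f x)) = (\<lambda>x. indicator K x *\<^sub>R f x)"
    by (rule ext) (use K(2) in \<open>auto simp: indicator_def\<close>)
  finally have m: "(\<lambda>x. indicator K x *\<^sub>R f x) \<in> borel_measurable lborel" .
  have "integrable lborel (\<lambda>x. indicator \<Omega> x *\<^sub>R (norm (f x))\<^sup>2)"
    using f Om by (subst integrable_restrict_space[symmetric]) (auto simp: L2_def)
  moreover have "integrable lborel (\<lambda>x. indicator K x *\<^sub>R (1::real))"
    by (rule borel_integrable_compact) (use K in auto)
  ultimately have i: "integrable lborel (\<lambda>x. indicator \<Omega> x *\<^sub>R (norm (f x))\<^sup>2 + indicator K x *\<^sub>R (1::real))"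
    by (rule Bochner_Integration.integrable_add)
  show ?thesis unfolding set_integrable_def
  proof (rule Bochner_Integration.integrable_bound[OF i m], rule AE_I2)
    fix x
    \<comment> \<open>On a compact set the constant 1 is integrable, so this bound turns square
      integrability into integrability.\<close>
    have "norm (f x) \<le> (norm (f x))\<^sup>2 + 1"
      using sum_squares_bound[of "norm (f x)" 1] by (smt (verit) norm_ge_zero one_power2 mult_cancel_left1)
    then show "norm (indicator K x *\<^sub>R f x) \<le> norm (indicator \<Omega> x *\<^sub>R (norm (f x))\<^sup>2 + indicator K x *\<^sub>R (1::real))"
      using K(2) by (auto simp: indicator_def)
  qed
qed

section \<open>Uniqueness and limits of weak gradients\<close>

lemma has_weak_gradD:
  assumes "has_weak_grad \<Omega> u g"
  shows "compact K \<Longrightarrow> K \<subseteq> \<Omega> \<Longrightarrow> set_integrable lborel K u" "compact K \<Longrightarrow> K \<subseteq> \<Omega> \<Longrightarrow> set_integrable lborel K g"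
    "\<phi> \<in> C1c \<Omega> \<Longrightarrow> b \<in> Basis \<Longrightarrow>
      (LINT x|vol \<Omega>. u x * frechet_derivative \<phi> (at x) b) = - (LINT x|vol \<Omega>. (g x \<bullet> b) * \<phi> x)"
  using assms by (auto simp: has_weak_grad_def)

lemma set_integrable_times_test:
  fixes f :: "'a::euclidean_space \<Rightarrow> real"
  assumes O: "open \<Omega>" and I: "\<And>K. compact K \<Longrightarrow> K \<subseteq> \<Omega> \<Longrightarrow> set_integrable lborel K f"
    and p: "continuous_on UNIV p" "compact K" "K \<subseteq> \<Omega>" "\<And>x. x \<notin> K \<Longrightarrow> p x = 0"
  shows "integrable (vol \<Omega>) (\<lambda>x. f x * p x)"
proof -
  obtain B where B: "B > 0" "\<And>x. norm (p x) \<le> B" using bounded_compact_support[OF p(1,2,4)] by metis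
  have [measurable]: "p \<in> borel_measurable borel" using p(1) by (rule borel_measurable_continuous_onI)
  have i: "integrable lborel (\<lambda>x. indicator K x *\<^sub>R f x)" using I[OF p(2,3)] by (simp add: set_integrable_def)
  have [measurable]: "(\<lambda>x. indicator K x *\<^sub>R f x) \<in> borel_measurable borel"
    using borel_measurable_integrable[OF i] by simp
  have "integrable lborel (\<lambda>x. (indicator K x *\<^sub>R f x) * p x)"
  proof (rule Bochner_Integration.integrable_bound)
    show "integrable lborel (\<lambda>x. B * (indicator K x *\<^sub>R f x))" using i by auto
    show "AE x in lborel. norm ((indicator K x *\<^sub>R f x) * p x) \<le> norm (B * (indicator K x *\<^sub>R f x))"
    proof (rule AE_I2)
      fix x
      have "\<bar>indicator K x * f x\<bar> * \<bar>p x\<bar> \<le> \<bar>indicator K x * f x\<bar> * B"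
        by (rule mult_left_mono) (use B(2)[of x] in auto)
      then show "norm ((indicator K x *\<^sub>R f x) * p x) \<le> norm (B * (indicator K x *\<^sub>R f x))"
        using B(1) by (simp add: abs_mult mult.commute)
    qed
  qed measurable
  also have "(\<lambda>x. (indicator K x *\<^sub>R f x) * p x) = (\<lambda>x. indicator \<Omega> x *\<^sub>R (f x * p x))"
    by (rule ext) (use p(3,4) in \<open>auto simp: indicator_def\<close>)
  finally show ?thesis using O by (subst integrable_restrict_space) auto
qed

lemma weak_grad_AE_eq:
  assumes O: "open \<Omega>" and g: "has_weak_grad \<Omega> u g" "has_weak_grad \<Omega> u h"
  shows "AE x in vol \<Omega>. g x = h x"
proof -
  have "AE x in lborel. \<forall>b\<in>Basis. x \<in> \<Omega> \<longrightarrow> (g x - h x) \<bullet> b = 0"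
    unfolding AE_ball_countable[OF countable_finite[OF finite_Basis]]
  proof
    fix b :: 'a assume b: "b \<in> Basis"
    have I: "set_integrable lborel K (\<lambda>x. g x \<bullet> b)" "set_integrable lborel K (\<lambda>x. h x \<bullet> b)"
      if "compact K" "K \<subseteq> \<Omega>" for K
      using has_weak_gradD(2)[OF g(1) that] has_weak_gradD(2)[OF g(2) that] integrable_inner_left[of b]
      unfolding set_integrable_def by fastforce+
    show "AE x in lborel. x \<in> \<Omega> \<longrightarrow> (g x - h x) \<bullet> b = 0"
    proof (rule fundamental_lemma[OF O])
      show "set_integrable lborel K (\<lambda>x. (g x - h x) \<bullet> b)" if "compact K" "K \<subseteq> \<Omega>" for K
        using set_integral_diff(1)[OF I[OF that]] by (simp add: inner_diff_left)
      fix \<psi> assume p: "\<psi> \<in> C1c \<Omega>"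
      obtain G where G: "C1_grad \<psi> G" using C1c_obtain[OF p] .
      obtain K where K: "compact K" "K \<subseteq> \<Omega>" "\<And>x. x \<notin> K \<Longrightarrow> \<psi> x = 0" using C1c_support[OF p G] by metis
      have "integrable (vol \<Omega>) (\<lambda>x. (g x \<bullet> b) * \<psi> x)" "integrable (vol \<Omega>) (\<lambda>x. (h x \<bullet> b) * \<psi> x)"
        using set_integrable_times_test[OF O _ C1_gradD(3)[OF G] K] I by blast+
      then have "(LINT x|vol \<Omega>. ((g x - h x) \<bullet> b) * \<psi> x) = (LINT x|vol \<Omega>. (g x \<bullet> b) * \<psi> x) - (LINT x|vol \<Omega>. (h x \<bullet> b) * \<psi> x)"
        by (simp add: inner_diff_left left_diff_distrib)
      then show "(LINT x|vol \<Omega>. ((g x - h x) \<bullet> b) * \<psi> x) = 0"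
        using has_weak_gradD(3)[OF g(1) p b] has_weak_gradD(3)[OF g(2) p b] by simp
    qed
  qed
  then show ?thesis unfolding AE_vol[OF O] by eventually_elim (metis eq_iff_diff_eq_0 euclidean_all_zero_iff)
qed

lemma has_weak_grad_wgrad: "has_weak_grad \<Omega> u g \<Longrightarrow> has_weak_grad \<Omega> u (wgrad \<Omega> u)"
  unfolding wgrad_def by (rule someI[of "has_weak_grad \<Omega> u"])

lemma wgrad_AE_eq: "open \<Omega> \<Longrightarrow> has_weak_grad \<Omega> u g \<Longrightarrow> AE x in vol \<Omega>. wgrad \<Omega> u x = g x"
  by (rule weak_grad_AE_eq[OF _ has_weak_grad_wgrad])

lemma wgrad_measurable: "open \<Omega> \<Longrightarrow> has_weak_grad \<Omega> u g \<Longrightarrow> wgrad \<Omega> u \<in> borel_measurable (vol \<Omega>)"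
  by (rule weak_grad_measurable) (use has_weak_gradD(2)[OF has_weak_grad_wgrad] in auto)

lemma wgrad_L2:
  assumes "u \<in> H1 \<Omega>" "open \<Omega>"
  shows "has_weak_grad \<Omega> u (wgrad \<Omega> u)" "wgrad \<Omega> u \<in> L2 (vol \<Omega>)"
proof -
  obtain g where g: "g \<in> L2 (vol \<Omega>)" "has_weak_grad \<Omega> u g" using assms by (auto simp: H1_def)
  show "has_weak_grad \<Omega> u (wgrad \<Omega> u)" using has_weak_grad_wgrad[OF g(2)] .
  show "wgrad \<Omega> u \<in> L2 (vol \<Omega>)"
    by (rule L2_cong_AE[OF wgrad_AE_eq[OF assms(2) g(2)] wgrad_measurable[OF assms(2) g(2)] g(1)])
qed

lemma H1_L2: "u \<in> H1 \<Omega> \<Longrightarrow> u \<in> L2 (vol \<Omega>)" by (simp add: H1_def)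

lemma H1_I:
  "u \<in> L2 (vol \<Omega>) \<Longrightarrow> g \<in> L2 (vol \<Omega>) \<Longrightarrow> has_weak_grad \<Omega> u g \<Longrightarrow> u \<in> H1 \<Omega>"
  by (auto simp: H1_def)

lemma test_L2:
  fixes p :: "'a::euclidean_space \<Rightarrow> 'b::euclidean_space"
  assumes O: "open \<Omega>" and p: "continuous_on UNIV p" "compact K" "\<And>x. x \<notin> K \<Longrightarrow> p x = 0"
  shows "p \<in> L2 (vol \<Omega>)"
proof (rule L2I)
  have [measurable]: "p \<in> borel_measurable borel" using p(1) by (rule borel_measurable_continuous_onI)
  show "p \<in> borel_measurable (vol \<Omega>)" by (intro measurable_restrict_space1) simp
  have "integrable lborel (\<lambda>x. (norm (p x))\<^sup>2)"
    by (rule integrable_compact_support[OF _ p(2)]) (use p in \<open>auto intro!: continuous_intros\<close>)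
  from integrable_mult_indicator[OF _ this, of \<Omega>] O
  have "integrable lborel (\<lambda>x. indicator \<Omega> x *\<^sub>R (norm (p x))\<^sup>2)" by simp
  then show "integrable (vol \<Omega>) (\<lambda>x. (norm (p x))\<^sup>2)" using O by (subst integrable_restrict_space) auto
qed

text \<open>For a fixed test function both sides of the defining identity are inner products with a
  fixed square-integrable function, hence continuous in the mean.\<close>

lemma has_weak_grad_limit:
  fixes u :: "'a::euclidean_space \<Rightarrow> real"
  assumes O: "open \<Omega>" and w: "\<And>n. has_weak_grad \<Omega> (v n) (h n)"
    and L: "\<And>n. v n \<in> L2 (vol \<Omega>)" "\<And>n. h n \<in> L2 (vol \<Omega>)" "u \<in> L2 (vol \<Omega>)" "g \<in> L2 (vol \<Omega>)"
    and lim: "(\<lambda>n. L2_norm (vol \<Omega>) (\<lambda>x. v n x - u x)) \<longlonglongrightarrow> 0" "(\<lambda>n. L2_norm (vol \<Omega>) (\<lambda>x. h n x - g x)) \<longlonglongrightarrow> 0"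
  shows "has_weak_grad \<Omega> u g"
  unfolding has_weak_grad_def
proof (intro conjI allI impI ballI)
  fix K :: "'a set" assume "compact K \<and> K \<subseteq> \<Omega>"
  then show "set_integrable lborel K u" "set_integrable lborel K g"
    using L2_vol_set_integrable[OF O] L by auto
next
  fix \<psi> :: "'a \<Rightarrow> real" and b :: 'a assume p: "\<psi> \<in> C1c \<Omega>" and b: "b \<in> Basis"
  obtain G where G: "C1_grad \<psi> G" using C1c_obtain[OF p] .
  note D = C1_gradD[OF G]
  obtain K where K: "compact K" "\<And>x. x \<notin> K \<Longrightarrow> \<psi> x = 0" "\<And>x. x \<notin> K \<Longrightarrow> G x = 0"
    using C1c_support[OF p G] by metis
  have 1: "(\<lambda>x. G x \<bullet> b) \<in> L2 (vol \<Omega>)"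
    by (rule test_L2[OF O _ K(1)]) (use D(1) K in \<open>auto intro!: continuous_intros\<close>)
  have 2: "(\<lambda>x. \<psi> x *\<^sub>R b) \<in> L2 (vol \<Omega>)"
    by (rule test_L2[OF O _ K(1)]) (use D(3) K in \<open>auto intro!: continuous_intros\<close>)
  have "(\<lambda>n. LINT x|vol \<Omega>. v n x \<bullet> (G x \<bullet> b)) \<longlonglongrightarrow> (LINT x|vol \<Omega>. u x \<bullet> (G x \<bullet> b))"
    by (rule L2_inner_tendsto[OF L(1,3) 1 lim(1)])
  moreover have "(\<lambda>n. LINT x|vol \<Omega>. h n x \<bullet> (\<psi> x *\<^sub>R b)) \<longlonglongrightarrow> (LINT x|vol \<Omega>. g x \<bullet> (\<psi> x *\<^sub>R b))"
    by (rule L2_inner_tendsto[OF L(2,4) 2 lim(2)])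
  then have "(\<lambda>n. - (LINT x|vol \<Omega>. h n x \<bullet> (\<psi> x *\<^sub>R b))) \<longlonglongrightarrow> - (LINT x|vol \<Omega>. g x \<bullet> (\<psi> x *\<^sub>R b))"
    by (rule tendsto_minus)
  moreover have "(LINT x|vol \<Omega>. v n x \<bullet> (G x \<bullet> b)) = - (LINT x|vol \<Omega>. h n x \<bullet> (\<psi> x *\<^sub>R b))" for n
    using has_weak_gradD(3)[OF w p b, of n] by (simp add: D(4) mult.commute)
  ultimately have "(LINT x|vol \<Omega>. u x \<bullet> (G x \<bullet> b)) = - (LINT x|vol \<Omega>. g x \<bullet> (\<psi> x *\<^sub>R b))"
    by (auto intro: LIMSEQ_unique)
  then show "(LINT x|vol \<Omega>. u x * frechet_derivative \<psi> (at x) b) = - (LINT x|vol \<Omega>. (g x \<bullet> b) * \<psi> x)"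
    by (simp add: D(4) mult.commute)
qed

lemma has_weak_grad_diff:
  fixes u :: "'a::euclidean_space \<Rightarrow> real"
  assumes O: "open \<Omega>" and w: "has_weak_grad \<Omega> u g" "has_weak_grad \<Omega> v h"
  shows "has_weak_grad \<Omega> (\<lambda>x. u x - v x) (\<lambda>x. g x - h x)"
  unfolding has_weak_grad_def
proof (intro conjI allI impI ballI)
  fix K :: "'a set" assume "compact K \<and> K \<subseteq> \<Omega>"
  then show "set_integrable lborel K (\<lambda>x. u x - v x)" "set_integrable lborel K (\<lambda>x. g x - h x)"
    using has_weak_gradD[OF w(1)] has_weak_gradD[OF w(2)] by auto
next
  fix \<psi> :: "'a \<Rightarrow> real" and b :: 'a assume p: "\<psi> \<in> C1c \<Omega>" and b: "b \<in> Basis"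
  obtain G where G: "C1_grad \<psi> G" using C1c_obtain[OF p] .
  note D = C1_gradD[OF G]
  obtain K where K: "compact K" "K \<subseteq> \<Omega>" "\<And>x. x \<notin> K \<Longrightarrow> \<psi> x = 0" "\<And>x. x \<notin> K \<Longrightarrow> G x = 0"
    using C1c_support[OF p G] by metis
  have c: "continuous_on UNIV (\<lambda>x. G x \<bullet> b)" using D(1) by (intro continuous_intros)
  have i: "integrable (vol \<Omega>) (\<lambda>x. w x * (G x \<bullet> b))" if "has_weak_grad \<Omega> w k" for w k
    by (rule set_integrable_times_test[OF O _ c K(1,2)]) (use K that has_weak_gradD in auto)
  have j: "integrable (vol \<Omega>) (\<lambda>x. (k x \<bullet> b) * \<psi> x)" if "has_weak_grad \<Omega> w k" for w k
  proof (rule set_integrable_times_test[OF O _ D(3) K(1,2,3)])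
    fix K assume "compact K" "K \<subseteq> \<Omega>"
    from has_weak_gradD(2)[OF that this] show "set_integrable lborel K (\<lambda>x. k x \<bullet> b)"
      using integrable_inner_left[of b] unfolding set_integrable_def by fastforce
  qed
  show "(LINT x|vol \<Omega>. (u x - v x) * frechet_derivative \<psi> (at x) b) = - (LINT x|vol \<Omega>. ((g x - h x) \<bullet> b) * \<psi> x)"
    using has_weak_gradD(3)[OF w(1) p b] has_weak_gradD(3)[OF w(2) p b] i[OF w(1)] i[OF w(2)] j[OF w(1)] j[OF w(2)]
    by (simp add: D(4) left_diff_distrib inner_diff_left)
qed

section \<open>Geometry of the cross section\<close>

text \<open>The definition describes \<omega> alone. That the region below the graph avoids the
  closure follows because this region is open and disjoint from \<omega>; frontier points are then
  squeezed onto the graph.\<close>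

lemma lipschitz_chart:
  assumes "open \<omega>" "lipschitz_boundary \<omega>" "p \<in> frontier \<omega>"
  obtains r T K h where "r > 0" "orthogonal_transformation T" "K-lipschitz_on UNIV h"
    "continuous_on UNIV (\<lambda>x. T x $ 2 - h (T x $ 1))"
    "\<And>x. x \<in> ball p r \<Longrightarrow> x \<in> \<omega> \<longleftrightarrow> T x $ 2 - (h :: real \<Rightarrow> real) (T x $ 1) > (0::real)"
    "\<And>x. x \<in> ball p r \<Longrightarrow> T x $ 2 - h (T x $ 1) < 0 \<Longrightarrow> x \<notin> closure \<omega>"
    "\<And>x. x \<in> ball p r \<Longrightarrow> x \<in> frontier \<omega> \<Longrightarrow> T x $ 2 = h ((T x :: real^2) $ 1)"
proof -
  from bspec[OF assms(2)[unfolded lipschitz_boundary_def] assms(3)]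
  obtain r T h K where c: "r > 0" "orthogonal_transformation T" "K-lipschitz_on UNIV h"
    and eq: "\<omega> \<inter> ball p r = {x \<in> ball p r. (h :: real \<Rightarrow> real) (T x $ 1) < (T x :: real^2) $ 2}"
    by (elim exE conjE) (rule that)
  have "bounded_linear T" using orthogonal_transformation_linear[OF c(2)] by (simp only: linear_conv_bounded_linear)
  then have "continuous_on UNIV T" by (rule linear_continuous_on)
  moreover have "continuous_on UNIV h" using c(3) by (rule lipschitz_on_continuous_on)
  ultimately have cont: "continuous_on UNIV (\<lambda>x. T x $ 2 - h (T x $ 1))"
    by (intro continuous_on_diff continuous_on_component continuous_on_compose2[of UNIV h UNIV "\<lambda>x. T x $ 1"]) simp_all
  have iff: "x \<in> \<omega> \<longleftrightarrow> T x $ 2 - h (T x $ 1) > 0" if "x \<in> ball p r" for x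
    using eq that by (auto simp: set_eq_iff)
  have neg: "x \<notin> closure \<omega>" if "x \<in> ball p r" "T x $ 2 - h (T x $ 1) < 0" for x
  proof -
    have "open ({x. T x $ 2 - h (T x $ 1) < 0} \<inter> ball p r)"
      by (intro open_Int open_Collect_less cont continuous_on_const open_ball)
    moreover have "({x. T x $ 2 - h (T x $ 1) < 0} \<inter> ball p r) \<inter> \<omega> = {}" using iff by force
    ultimately have "({x. T x $ 2 - h (T x $ 1) < 0} \<inter> ball p r) \<inter> closure \<omega> = {}"
      by (simp add: open_Int_closure_eq_empty)
    then show ?thesis using that by blast
  qed
  have "T x $ 2 = h (T x $ 1)" if "x \<in> ball p r" "x \<in> frontier \<omega>" for x
  proof -
    have "x \<notin> \<omega>" "x \<in> closure \<omega>" using that(2) assms(1) by (auto simp: frontier_def interior_open)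
    then show ?thesis using neg[OF that(1)] iff[OF that(1)] by force
  qed
  from that[OF c cont iff neg this] show ?thesis by blast
qed

text \<open>One direction \<open>e\<close> has to serve all distances \<open>\<rho>\<close>: the number of directions needed to cover the boundary
  must not depend on the width of the boundary layer, which is chosen afterwards.\<close>

lemma exterior_directions:
  assumes "open \<omega>" "lipschitz_boundary \<omega>" "p \<in> frontier \<omega>"
  obtains U e where "open U" "p \<in> U" "norm (e::real^2) = 1"
    "\<And>q \<rho>. q \<in> U \<Longrightarrow> q \<in> frontier \<omega> \<Longrightarrow> \<rho> > 0 \<Longrightarrow>
      \<exists>W. open W \<and> q \<in> W \<and> (\<forall>x\<in>W \<inter> \<omega>. \<exists>t. 0 < t \<and> t < \<rho> \<and> x - t *\<^sub>R e \<notin> closure \<omega>)"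
proof -
  obtain r T K h where c: "r > 0" "orthogonal_transformation T" "K-lipschitz_on UNIV h"
    and cont: "continuous_on UNIV (\<lambda>x. T x $ 2 - h (T x $ 1))"
    and iff: "\<And>x. x \<in> ball p r \<Longrightarrow> x \<in> \<omega> \<longleftrightarrow> T x $ 2 - (h :: real \<Rightarrow> real) (T x $ 1) > (0::real)"
    and neg: "\<And>x. x \<in> ball p r \<Longrightarrow> T x $ 2 - h (T x $ 1) < 0 \<Longrightarrow> x \<notin> closure \<omega>"
    and gr: "\<And>x. x \<in> ball p r \<Longrightarrow> x \<in> frontier \<omega> \<Longrightarrow> T x $ 2 = h ((T x :: real^2) $ 1)"
    by (rule lipschitz_chart[OF assms]) (rule that, assumption, assumption, assumption, assumption, blast+)
  have lin: "linear T" using c(2) by (rule orthogonal_transformation_linear)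
  obtain e where e: "T e = axis 2 1" using surjD[OF orthogonal_transformation_surj[OF c(2)], of "axis 2 1"] by metis
  have ne: "norm e = 1" using orthogonal_transformation_norm[OF c(2), of e] e by (simp add: norm_axis_1)
  define U where "U = ball p (r/2)"
  have "\<exists>W. open W \<and> q \<in> W \<and> (\<forall>x\<in>W \<inter> \<omega>. \<exists>t. 0 < t \<and> t < \<rho> \<and> x - t *\<^sub>R e \<notin> closure \<omega>)"
    if q: "q \<in> U" "q \<in> frontier \<omega>" and \<rho>: "\<rho> > 0" for q \<rho>
  proof -
    \<comment> \<open>A step of length \<open>t\<close> must be shorter than \<rho> and must not
      leave the chart when it starts in the half-sized ball.\<close>
    define t where "t = min \<rho> r / 4"
    have t: "t > 0" "t < \<rho>" "t < r/2" using \<rho> c(1) by (auto simp: t_def min_def)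
    define W where "W = U \<inter> {x. T x $ 2 - h (T x $ 1) < t}"
    have "open W" unfolding W_def U_def by (intro open_Int open_Collect_less cont continuous_on_const open_ball)
    moreover have "q \<in> W" using gr[of q] q c(1) t(1) by (auto simp: W_def U_def)
    moreover have "\<exists>t. 0 < t \<and> t < \<rho> \<and> x - t *\<^sub>R e \<notin> closure \<omega>" if "x \<in> W" for x
    proof -
      have "dist p (x - t *\<^sub>R e) \<le> dist p x + dist x (x - t *\<^sub>R e)" by (rule dist_triangle)
      also have "\<dots> < r" using that t ne by (simp add: W_def U_def dist_norm)
      finally have 1: "x - t *\<^sub>R e \<in> ball p r" by simp
      have "T (x - t *\<^sub>R e) = T x - t *\<^sub>R axis 2 1" by (simp add: linear_diff[OF lin] linear_scale[OF lin] e)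
      then have "T (x - t *\<^sub>R e) $ 2 = T x $ 2 - t" "T (x - t *\<^sub>R e) $ 1 = T x $ 1"
        by (auto simp: axis_def)
      then have "T (x - t *\<^sub>R e) $ 2 - h (T (x - t *\<^sub>R e) $ 1) < 0" using that by (simp add: W_def)
      from neg[OF 1 this] show ?thesis using t by blast
    qed
    ultimately show ?thesis by blast
  qed
  moreover have "open U" "p \<in> U" using c(1) by (simp_all add: U_def)
  ultimately show ?thesis using that ne by blast
qed

text \<open>Over an interval of length w the graph has diameter at most (1 + K) w. Cutting the base
  into N equal pieces gives arbitrarily fine covers whose total diameter does not depend on
  N.\<close>

lemma hausdorff1_outer_graph:
  fixes T :: "real^2 \<Rightarrow> real^2" and h :: "real \<Rightarrow> real"
  assumes T: "orthogonal_transformation T" and h: "K-lipschitz_on UNIV h" and r: "r > 0"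
  shows "hausdorff1_outer {x. \<bar>T x $ 1 - c\<bar> \<le> r \<and> T x $ 2 = h (T x $ 1)} \<le> ennreal ((1 + K) * (2 * r))"
    (is "hausdorff1_outer ?S \<le> _")
  unfolding hausdorff1_outer_def
proof (rule SUP_least)
  fix \<delta> :: real assume "\<delta> \<in> {0<..}"
  then have \<delta>: "\<delta> > 0" by simp
  have K: "K \<ge> 0" using h by (rule lipschitz_on_nonneg)
  define l where "l = (1 + K) * (2 * r)"
  have l: "l > 0" using K r by (simp add: l_def)
  obtain N :: nat where N: "l / \<delta> < real N" using reals_Archimedean2 by blast
  have N0: "real N > 0" using N l \<delta> by (meson divide_pos_pos less_trans)
  define w where "w = 2 * r / real N"
  have w: "w > 0" using r N0 by (simp add: w_def)
  define A where "A i = (if i < N then {x. c - r + w * real i \<le> T x $ 1 \<and> T x $ 1 \<le> c - r + w * (real i + 1) \<and> T x $ 2 = h (T x $ 1)} else {})" for i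
  have lw: "(1 + K) * w = l / real N" by (simp add: l_def w_def)
  have dA: "norm (x - y) \<le> (1 + K) * w" if "x \<in> A i" "y \<in> A i" for x y i
  proof -
    have lin: "linear T" using T by (rule orthogonal_transformation_linear)
    have i: "i < N" using that by (auto simp: A_def split: if_splits)
    have 1: "\<bar>T x $ 1 - T y $ 1\<bar> \<le> w" using that i by (auto simp: A_def abs_le_iff algebra_simps)
    have "\<bar>h (T x $ 1) - h (T y $ 1)\<bar> \<le> K * \<bar>T x $ 1 - T y $ 1\<bar>"
      using lipschitz_onD[OF h, of "T x $ 1" "T y $ 1"] by (simp add: dist_real_def)
    also have "\<dots> \<le> K * w" by (rule mult_left_mono[OF 1 K])
    finally have 2: "\<bar>T x $ 2 - T y $ 2\<bar> \<le> K * w" using that i by (auto simp: A_def)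
    have "norm (x - y) = norm (T x - T y)"
      using orthogonal_transformation_norm[OF T, of "x - y"] by (simp add: linear_diff[OF lin])
    also have "\<dots> \<le> (\<Sum>i\<in>UNIV. \<bar>(T x - T y) $ i\<bar>)" by (rule norm_le_l1_cart)
    also have "\<dots> \<le> (1 + K) * w" using 1 2 by (simp add: UNIV_2 algebra_simps)
    finally show ?thesis .
  qed
  have "?S \<subseteq> (\<Union>i. A i)"
  proof
    fix x assume x: "x \<in> ?S"
    define s where "s = (T x $ 1 - (c - r)) / w"
    have s0: "0 \<le> s" using x w by (auto simp: s_def)
    have sN: "s \<le> real N"
    proof -
      have "T x $ 1 - (c - r) \<le> 2 * r" using x by auto
      also have "2 * r = real N * w" using N0 by (simp add: w_def)
      finally show ?thesis using w by (simp add: s_def divide_le_eq)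
    qed
    have xs: "T x $ 1 = c - r + w * s" using w by (simp add: s_def)
    obtain i where i: "i < N" "real i \<le> s" "s \<le> real i + 1"
    proof (cases "s = real N")
      case True
      \<comment> \<open>The right end point of the base is assigned to the last piece; the floor
        would produce the missing index N.\<close>
      then show ?thesis using that[of "N - 1"] N0 by (auto simp: of_nat_diff)
    next
      case False
      then have "s < real N" using sN by simp
      then have "nat \<lfloor>s\<rfloor> < N" using s0 by linarith
      moreover have "real (nat \<lfloor>s\<rfloor>) \<le> s" "s \<le> real (nat \<lfloor>s\<rfloor>) + 1" using s0 by linarith+
      ultimately show ?thesis by (rule that)
    qed
    have "w * real i \<le> w * s" "w * s \<le> w * (real i + 1)" using i w by (auto intro!: mult_left_mono)
    then have "x \<in> A i" using x i(1) xs by (auto simp: A_def)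
    then show "x \<in> (\<Union>i. A i)" by blast
  qed
  moreover have bA: "bounded (A i)" for i
  proof (cases "A i = {}")
    case False
    then obtain x where "x \<in> A i" by blast
    then have "\<forall>y\<in>A i. dist x y \<le> (1 + K) * w" using dA by (auto simp: dist_norm)
    then show ?thesis unfolding bounded_def by blast
  qed simp
  moreover have diamA: "diameter (A i) \<le> l / real N" for i
  proof (rule diameter_le)
    show "A i \<noteq> {} \<or> 0 \<le> l / real N" using l N0 by simp
    show "norm (x - y) \<le> l / real N" if "x \<in> A i" "y \<in> A i" for x y
      using dA[OF that] by (simp add: lw)
  qed
  moreover have "l / real N \<le> \<delta>" using N N0 \<delta> by (simp add: field_simps)
  then have "diameter (A i) \<le> \<delta>" for i using diamA[of i] by (rule order_trans[rotated])
  ultimately have "hausdorff1_pre \<delta> ?S \<le> (\<Sum>i. ennreal (diameter (A i)))"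
    unfolding hausdorff1_pre_def by (intro INF_lower) (auto intro: order_trans)
  also have "\<dots> = (\<Sum>i<N. ennreal (diameter (A i)))"
    by (rule suminf_finite) (auto simp: A_def)
  also have "\<dots> \<le> (\<Sum>i<N. ennreal (l / real N))"
    by (intro sum_mono ennreal_leI diamA)
  also have "\<dots> = ennreal l" using l N0 by (simp add: ennreal_of_nat_eq_real_of_nat ennreal_mult'[symmetric])
  finally show "hausdorff1_pre \<delta> ?S \<le> ennreal ((1 + K) * (2 * r))" by (simp add: l_def)
qed

text \<open>Finitely many charts cover the compact frontier. Finiteness is what makes Fubini
  available on \<open>surface \<omega>\<close> and gives test functions finite norms there.\<close>

lemma hausdorff1_outer_frontier_finite:
  assumes "open \<omega>" "bounded \<omega>" "lipschitz_boundary \<omega>"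
  shows "hausdorff1_outer (frontier \<omega>) < \<infinity>"
proof -
  have "\<exists>r>0. hausdorff1_outer (frontier \<omega> \<inter> ball p r) < \<infinity>" if p: "p \<in> frontier \<omega>" for p
  proof -
    obtain r T h K where c: "r > 0" "orthogonal_transformation T" "K-lipschitz_on UNIV h"
      and "continuous_on UNIV (\<lambda>x. T x $ 2 - h (T x $ 1))"
      and "\<And>x. x \<in> ball p r \<Longrightarrow> x \<in> \<omega> \<longleftrightarrow> T x $ 2 - (h :: real \<Rightarrow> real) (T x $ 1) > (0::real)"
      and "\<And>x. x \<in> ball p r \<Longrightarrow> T x $ 2 - h (T x $ 1) < 0 \<Longrightarrow> x \<notin> closure \<omega>"
      and gr: "\<And>x. x \<in> ball p r \<Longrightarrow> x \<in> frontier \<omega> \<Longrightarrow> T x $ 2 = h ((T x :: real^2) $ 1)"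
      by (rule lipschitz_chart[OF assms(1,3) p]) (rule that, assumption, assumption, assumption, assumption, blast+)
    have lin: "linear T" using c(2) by (rule orthogonal_transformation_linear)
    have "frontier \<omega> \<inter> ball p r \<subseteq> {x. \<bar>T x $ 1 - T p $ 1\<bar> \<le> r \<and> T x $ 2 = h (T x $ 1)}"
    proof safe
      fix x assume x: "x \<in> frontier \<omega>" "x \<in> ball p r"
      show "T x $ 2 = h (T x $ 1)" using gr x by blast
      have "\<bar>(T x - T p) $ 1\<bar> \<le> norm (T x - T p)" by (rule component_le_norm_cart)
      also have "\<dots> = norm (x - p)"
        using orthogonal_transformation_norm[OF c(2), of "x - p"] by (simp add: linear_diff[OF lin])
      also have "\<dots> \<le> r" using x(2) by (simp add: dist_norm norm_minus_commute)
      finally show "\<bar>T x $ 1 - T p $ 1\<bar> \<le> r" by simp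
    qed
    from order_trans[OF hausdorff1_outer_mono[OF this] hausdorff1_outer_graph[OF c(2,3,1)]] c(1)
    show ?thesis using ennreal_less_top le_less_trans unfolding infinity_ennreal_def by blast
  qed
  then obtain r where r: "\<And>p. p \<in> frontier \<omega> \<Longrightarrow> r p > 0"
    "\<And>p. p \<in> frontier \<omega> \<Longrightarrow> hausdorff1_outer (frontier \<omega> \<inter> ball p (r p)) < \<infinity>" by metis
  have "compact (frontier \<omega>)" using assms(2) by (rule compact_frontier_bounded)
  then obtain F where F: "F \<subseteq> frontier \<omega>" "finite F" "frontier \<omega> \<subseteq> (\<Union>p\<in>F. ball p (r p))"
    by (rule compactE_image[of _ "frontier \<omega>" "\<lambda>p. ball p (r p)"]) (use r(1) in auto)
  have "hausdorff1_outer (\<Union>p\<in>F. frontier \<omega> \<inter> ball p (r p)) < \<infinity>"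
    using F(2,1)
  proof (induction F)
    case (insert p F)
    have "hausdorff1_outer (\<Union>p\<in>insert p F. frontier \<omega> \<inter> ball p (r p))
        \<le> hausdorff1_outer (frontier \<omega> \<inter> ball p (r p)) + hausdorff1_outer (\<Union>p\<in>F. frontier \<omega> \<inter> ball p (r p))"
      using hausdorff1_outer_Un by simp
    also have "\<dots> < \<infinity>" using insert r(2)[of p] by simp
    finally show ?case .
  qed simp
  moreover have "frontier \<omega> \<subseteq> (\<Union>p\<in>F. frontier \<omega> \<inter> ball p (r p))" using F(3) by blast
  ultimately show ?thesis using hausdorff1_outer_mono le_less_trans by blast
qed

section \<open>Arc length and surface measure of the domain\<close>

locale lipschitz_domain =
  fixes \<omega> :: "(real^2) set"
  assumes open_om: "open \<omega>" and nonempty_om: "\<omega> \<noteq> {}" and bounded_om: "bounded \<omega>"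
    and lipschitz_om: "lipschitz_boundary \<omega>"
begin

lemma open_waveguide: "open (waveguide \<omega>)"
  unfolding waveguide_def using open_om by (intro open_Times) auto

lemma space_arc_length: "space (arc_length \<omega>) = frontier \<omega>"
  by (simp add: arc_length_def space_restrict_space)

lemma finite_arc_length: "finite_measure (arc_length \<omega>)"
proof
  have "emeasure (arc_length \<omega>) (space (arc_length \<omega>)) = emeasure hausdorff1 (frontier \<omega>)"
    unfolding space_arc_length unfolding arc_length_def by (rule emeasure_restrict_space) auto
  also have "\<dots> = hausdorff1_outer (frontier \<omega>)" by (rule emeasure_hausdorff1) simp
  also have "\<dots> < \<infinity>" by (rule hausdorff1_outer_frontier_finite[OF open_om bounded_om lipschitz_om])
  finally show "emeasure (arc_length \<omega>) (space (arc_length \<omega>)) \<noteq> \<infinity>" by simp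
qed

lemma sigma_finite_arc_length: "sigma_finite_measure (arc_length \<omega>)"
  using finite_arc_length by (simp add: finite_measure_def)

lemma space_surface: "space (surface \<omega>) = frontier \<omega> \<times> UNIV"
  by (simp add: surface_def space_pair_measure space_arc_length)

lemma ident_measurable_arc_length: "(\<lambda>x. x) \<in> arc_length \<omega> \<rightarrow>\<^sub>M borel"
  unfolding arc_length_def by (rule measurable_restrict_space1) (simp add: measurable_ident_sets)

lemma ident_measurable_surface: "(\<lambda>x. x) \<in> surface \<omega> \<rightarrow>\<^sub>M borel"
proof -
  have "(\<lambda>x. (fst x, snd x)) \<in> surface \<omega> \<rightarrow>\<^sub>M borel \<Otimes>\<^sub>M borel"
    unfolding surface_def
    by (intro measurable_Pair measurable_compose[OF measurable_fst ident_measurable_arc_length]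
        measurable_compose[OF measurable_snd]) (simp add: measurable_ident_sets)
  then show ?thesis by (simp add: borel_prod)
qed

lemma borel_measurable_surface: "f \<in> borel_measurable borel \<Longrightarrow> f \<in> borel_measurable (surface \<omega>)"
  using measurable_compose[OF ident_measurable_surface, of f borel] .

lemma emeasure_surface_strip: "emeasure (surface \<omega>) (frontier \<omega> \<times> {a..b}) < \<infinity>"
proof -
  interpret A: sigma_finite_measure "arc_length \<omega>" by (rule sigma_finite_arc_length)
  interpret F: finite_measure "arc_length \<omega>" by (rule finite_arc_length)
  have fr: "frontier \<omega> \<in> sets (arc_length \<omega>)" using sets.top[of "arc_length \<omega>"] by (simp only: space_arc_length)
  have "emeasure (surface \<omega>) (frontier \<omega> \<times> {a..b}) = emeasure (arc_length \<omega>) (frontier \<omega>) * emeasure lborel {a..b}"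
    unfolding surface_def by (rule lborel.emeasure_pair_measure_Times[OF fr]) simp
  also have "\<dots> < \<infinity>" using F.emeasure_finite[of "frontier \<omega>"] emeasure_lborel_Icc_eq[of a b]
    by (auto simp: ennreal_mult_eq_top_iff less_top[symmetric] split: if_splits)
  finally show ?thesis .
qed

lemma test_L2_surface:
  fixes \<phi> :: "(real^2) \<times> real \<Rightarrow> real"
  assumes "continuous_on UNIV \<phi>" "compact K" "\<And>x. x \<notin> K \<Longrightarrow> \<phi> x = 0"
  shows "\<phi> \<in> L2 (surface \<omega>)"
proof -
  obtain B where B: "B > 0" "\<And>x. norm (\<phi> x) \<le> B" using bounded_compact_support[OF assms] by metis
  have "bounded (snd ` K)" using assms(2) by (intro compact_imp_bounded compact_continuous_image continuous_intros)
  then obtain R where R: "\<And>x. x \<in> K \<Longrightarrow> \<bar>snd x\<bar> \<le> R" by (auto simp: bounded_iff)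
  have [measurable]: "\<phi> \<in> borel_measurable (surface \<omega>)"
    by (intro borel_measurable_surface borel_measurable_continuous_onI assms)
  let ?S = "frontier \<omega> \<times> {-R..R}"
  have S [measurable]: "?S \<in> sets (surface \<omega>)"
    using sets.top[of "arc_length \<omega>"] unfolding surface_def space_arc_length by (intro pair_measureI) auto
  show ?thesis
  proof (rule L2I)
    show "integrable (surface \<omega>) (\<lambda>x. (norm (\<phi> x))\<^sup>2)"
    proof (rule Bochner_Integration.integrable_bound)
      show "integrable (surface \<omega>) (\<lambda>x. indicator ?S x *\<^sub>R B\<^sup>2)"
        using emeasure_surface_strip[of "-R" R] S by (intro integrable_indicator) auto
      show "AE x in surface \<omega>. norm ((norm (\<phi> x))\<^sup>2) \<le> norm (indicator ?S x *\<^sub>R B\<^sup>2)"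
      proof (rule AE_I2)
        fix x assume x: "x \<in> space (surface \<omega>)"
        show "norm ((norm (\<phi> x))\<^sup>2) \<le> norm (indicator ?S x *\<^sub>R B\<^sup>2)"
        proof (cases "x \<in> K")
          case True
          then have "x \<in> ?S" using R[OF True] x by (cases x) (auto simp: space_surface abs_le_iff)
          then show ?thesis using B(2)[of x] power_mono[of "norm (\<phi> x)" B 2] by simp
        qed (simp add: assms)
      qed
    qed measurable
  qed measurable
qed

end

section \<open>Traces\<close>

lemma L2_lim_add:
  assumes "\<And>n. f n \<in> L2 M" "f' \<in> L2 M" "\<And>n. g n \<in> L2 M" "g' \<in> L2 M"
    and "(\<lambda>n. L2_norm M (\<lambda>x. f n x - f' x)) \<longlonglongrightarrow> 0" "(\<lambda>n. L2_norm M (\<lambda>x. g n x - g' x)) \<longlonglongrightarrow> 0"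
  shows "(\<lambda>n. L2_norm M (\<lambda>x. (f n x + g n x) - (f' x + g' x))) \<longlonglongrightarrow> 0"
proof (rule tendsto_sandwich[OF _ _ tendsto_const])
  show "(\<lambda>n. L2_norm M (\<lambda>x. f n x - f' x) + L2_norm M (\<lambda>x. g n x - g' x)) \<longlonglongrightarrow> 0"
    using tendsto_add[OF assms(5,6)] by simp
  show "\<forall>\<^sub>F n in sequentially. L2_norm M (\<lambda>x. (f n x + g n x) - (f' x + g' x))
      \<le> L2_norm M (\<lambda>x. f n x - f' x) + L2_norm M (\<lambda>x. g n x - g' x)"
    using L2_norm_triangle[OF L2_diff[OF assms(1,2)] L2_diff[OF assms(3,4)]]
    by (intro always_eventually allI) (simp add: algebra_simps)
qed simp

lemma L2_lim_bound:
  assumes "\<And>n. f n \<in> L2 M" "f' \<in> L2 M" "\<And>n. h n \<in> borel_measurable M"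
    and "\<And>n x. x \<in> space M \<Longrightarrow> norm (h n x) \<le> c * norm (f n x - f' x)" "0 \<le> c"
    and "(\<lambda>n. L2_norm M (\<lambda>x. f n x - f' x)) \<longlonglongrightarrow> 0"
  shows "(\<lambda>n. L2_norm M (h n)) \<longlonglongrightarrow> 0"
proof (rule tendsto_sandwich[OF _ _ tendsto_const])
  show "(\<lambda>n. c * L2_norm M (\<lambda>x. f n x - f' x)) \<longlonglongrightarrow> 0"
    using tendsto_mult_left[OF assms(6), of c] by simp
  show "\<forall>\<^sub>F n in sequentially. L2_norm M (h n) \<le> c * L2_norm M (\<lambda>x. f n x - f' x)"
    using L2_bound(2)[OF L2_diff[OF assms(1,2)] assms(3) AE_I2[OF assms(4)] assms(5)] by simp
qed simp

context lipschitz_domain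
begin

abbreviation "\<Omega> \<equiv> waveguide \<omega>"

text \<open>
  The triples \<open>(u, g, f)\<close> where \<open>u\<close> has weak gradient \<open>g\<close> and trace \<open>f\<close>: the closure of the set of the
  triples \<open>(\<phi>, \<nabla>\<phi>, \<phi>)\<close> in \<open>L\<^sup>2(\<Omega>) \<times> L\<^sup>2(\<Omega>) \<times> L\<^sup>2(\<partial>\<Omega>)\<close>.
\<close>

definition tr where
  "tr u g f \<longleftrightarrow> u \<in> L2 (vol \<Omega>) \<and> g \<in> L2 (vol \<Omega>) \<and> f \<in> L2 (surface \<omega>) \<and>
     (\<exists>\<phi> G. (\<forall>n. \<phi> n \<in> C1c UNIV \<and> C1_grad (\<phi> n) (G n)) \<and>
        (\<lambda>n. L2_norm (vol \<Omega>) (\<lambda>x. \<phi> n x - u x)) \<longlonglongrightarrow> 0 \<and>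
        (\<lambda>n. L2_norm (vol \<Omega>) (\<lambda>x. G n x - g x)) \<longlonglongrightarrow> 0 \<and>
        (\<lambda>n. L2_norm (surface \<omega>) (\<lambda>x. \<phi> n x - f x)) \<longlonglongrightarrow> 0)"

lemma trD:
  assumes "tr u g f" shows "u \<in> L2 (vol \<Omega>)" "g \<in> L2 (vol \<Omega>)" "f \<in> L2 (surface \<omega>)"
  using assms by (auto simp: tr_def)

lemma trE:
  assumes "tr u g f"
  obtains \<phi> G where "\<And>n::nat. \<phi> n \<in> C1c UNIV" "\<And>n. C1_grad (\<phi> n) (G n)"
    "(\<lambda>n. L2_norm (vol \<Omega>) (\<lambda>x. \<phi> n x - u x)) \<longlonglongrightarrow> 0"
    "(\<lambda>n. L2_norm (vol \<Omega>) (\<lambda>x. G n x - g x)) \<longlonglongrightarrow> 0"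
    "(\<lambda>n. L2_norm (surface \<omega>) (\<lambda>x. \<phi> n x - f x)) \<longlonglongrightarrow> 0"
  using assms unfolding tr_def by blast

lemma C1c_L2:
  assumes "\<phi> \<in> C1c UNIV" "C1_grad \<phi> G"
  shows "\<phi> \<in> L2 (vol \<Omega>)" "G \<in> L2 (vol \<Omega>)" "\<phi> \<in> L2 (surface \<omega>)"
proof -
  obtain K where K: "compact K" "K \<subseteq> UNIV" "\<And>x. x \<notin> K \<Longrightarrow> \<phi> x = 0" "\<And>x. x \<notin> K \<Longrightarrow> G x = 0"
    by (rule C1c_support[OF assms]) (rule that)
  note D = C1_gradD[OF assms(2)]
  show "\<phi> \<in> L2 (vol \<Omega>)" by (rule test_L2[OF open_waveguide D(3) K(1,3)])
  show "G \<in> L2 (vol \<Omega>)" by (rule test_L2[OF open_waveguide D(1) K(1,4)])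
  show "\<phi> \<in> L2 (surface \<omega>)" by (rule test_L2_surface[OF D(3) K(1,3)])
qed

lemma trI:
  assumes "u \<in> L2 (vol \<Omega>)" "g \<in> L2 (vol \<Omega>)" "f \<in> L2 (surface \<omega>)"
    "\<And>n::nat. \<phi> n \<in> C1c UNIV" "\<And>n. C1_grad (\<phi> n) (G n)"
    "(\<lambda>n. L2_norm (vol \<Omega>) (\<lambda>x. \<phi> n x - u x)) \<longlonglongrightarrow> 0"
    "(\<lambda>n. L2_norm (vol \<Omega>) (\<lambda>x. G n x - g x)) \<longlonglongrightarrow> 0"
    "(\<lambda>n. L2_norm (surface \<omega>) (\<lambda>x. \<phi> n x - f x)) \<longlonglongrightarrow> 0"
  shows "tr u g f"
  unfolding tr_def using assms by blast

lemma tr_test: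
  assumes "\<phi> \<in> C1c UNIV" "C1_grad \<phi> G" shows "tr \<phi> G \<phi>"
  by (rule trI[where \<phi>="\<lambda>_. \<phi>" and G="\<lambda>_. G"]) (use assms C1c_L2[OF assms] in simp_all)

lemma tr_zero: "tr (\<lambda>x. 0) (\<lambda>x. 0) (\<lambda>x. 0)"
  by (rule tr_test[OF C1c_I[of _ _ "{}"] C1_grad_const]) (auto intro: C1_grad_const)

lemma tr_add:
  assumes "tr u g f" "tr u' g' f'"
  shows "tr (\<lambda>x. u x + u' x) (\<lambda>x. g x + g' x) (\<lambda>x. f x + f' x)"
proof -
  obtain \<phi> G where 1: "\<And>n::nat. \<phi> n \<in> C1c UNIV" "\<And>n. C1_grad (\<phi> n) (G n)"
    "(\<lambda>n. L2_norm (vol \<Omega>) (\<lambda>x. \<phi> n x - u x)) \<longlonglongrightarrow> 0"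
    "(\<lambda>n. L2_norm (vol \<Omega>) (\<lambda>x. G n x - g x)) \<longlonglongrightarrow> 0"
    "(\<lambda>n. L2_norm (surface \<omega>) (\<lambda>x. \<phi> n x - f x)) \<longlonglongrightarrow> 0" by (rule trE[OF assms(1)]) (rule that)
  obtain \<phi>' G' where 2: "\<And>n::nat. \<phi>' n \<in> C1c UNIV" "\<And>n. C1_grad (\<phi>' n) (G' n)"
    "(\<lambda>n. L2_norm (vol \<Omega>) (\<lambda>x. \<phi>' n x - u' x)) \<longlonglongrightarrow> 0"
    "(\<lambda>n. L2_norm (vol \<Omega>) (\<lambda>x. G' n x - g' x)) \<longlonglongrightarrow> 0"
    "(\<lambda>n. L2_norm (surface \<omega>) (\<lambda>x. \<phi>' n x - f' x)) \<longlonglongrightarrow> 0" by (rule trE[OF assms(2)]) (rule that)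
  note L = trD[OF assms(1)] trD[OF assms(2)] C1c_L2[OF 1(1,2)] C1c_L2[OF 2(1,2)]
  show ?thesis
    by (rule trI[OF L2_add[OF L(1,4)] L2_add[OF L(2,5)] L2_add[OF L(3,6)] C1c_add[OF 1(1) 2(1)] C1_grad_add[OF 1(2) 2(2)]
      L2_lim_add[OF L(7,1,10,4) 1(3) 2(3)] L2_lim_add[OF L(8,2,11,5) 1(4) 2(4)] L2_lim_add[OF L(9,3,12,6) 1(5) 2(5)]])
qed

text \<open>The approximating sequence is exported, not merely the resulting \<open>tr\<close>: it
  has the form cut-off times test function and therefore vanishes exactly where the cut-off does,
  which \<open>axial_poincare\<close> needs.\<close>

lemma tr_mult_approx:
  assumes t: "tr u g f" and m: "\<And>t. (m has_real_derivative m' t) (at t)" "continuous_on UNIV m'"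
    and b: "\<And>t. \<bar>m t\<bar> \<le> B" "\<And>t. \<bar>m' t\<bar> \<le> B"
  obtains \<phi> G where "(\<lambda>x. m (snd x) * u x) \<in> L2 (vol \<Omega>)"
    "(\<lambda>x. m (snd x) *\<^sub>R g x + u x *\<^sub>R (0, m' (snd x))) \<in> L2 (vol \<Omega>)" "(\<lambda>x. m (snd x) * f x) \<in> L2 (surface \<omega>)"
    "\<And>n::nat. (\<lambda>x. m (snd x) * \<phi> n x) \<in> C1c UNIV"
    "\<And>n. C1_grad (\<lambda>x. m (snd x) * \<phi> n x) (\<lambda>x. m (snd x) *\<^sub>R G n x + \<phi> n x *\<^sub>R (0, m' (snd x)))"
    "(\<lambda>n. L2_norm (vol \<Omega>) (\<lambda>x. m (snd x) * \<phi> n x - m (snd x) * u x)) \<longlonglongrightarrow> 0"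
    "(\<lambda>n. L2_norm (vol \<Omega>) (\<lambda>x. m (snd x) *\<^sub>R G n x + \<phi> n x *\<^sub>R (0, m' (snd x)) -
        (m (snd x) *\<^sub>R g x + u x *\<^sub>R (0, m' (snd x))))) \<longlonglongrightarrow> 0"
    "(\<lambda>n. L2_norm (surface \<omega>) (\<lambda>x. m (snd x) * \<phi> n x - m (snd x) * f x)) \<longlonglongrightarrow> 0"
proof -
  obtain \<phi> G where 1: "\<And>n::nat. \<phi> n \<in> C1c UNIV" "\<And>n. C1_grad (\<phi> n) (G n)"
    "(\<lambda>n. L2_norm (vol \<Omega>) (\<lambda>x. \<phi> n x - u x)) \<longlonglongrightarrow> 0"
    "(\<lambda>n. L2_norm (vol \<Omega>) (\<lambda>x. G n x - g x)) \<longlonglongrightarrow> 0"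
    "(\<lambda>n. L2_norm (surface \<omega>) (\<lambda>x. \<phi> n x - f x)) \<longlonglongrightarrow> 0" by (rule trE[OF t]) (rule that)
  have B: "B \<ge> 0" using b(1)[of 0] by linarith
  note M = C1_grad_real[OF m, THEN C1_gradD(5)] borel_measurable_continuous_onI[OF m(2)]
  note [measurable] = M
  have s: "(snd :: (real^2) \<times> real \<Rightarrow> real) \<in> borel_measurable borel"
    by (intro borel_measurable_continuous_onI continuous_intros)
  have ms [measurable]: "(\<lambda>x. m (snd x)) \<in> borel_measurable (vol \<Omega>)" "(\<lambda>x. m' (snd x)) \<in> borel_measurable (vol \<Omega>)"
    "(\<lambda>x. m (snd x)) \<in> borel_measurable (surface \<omega>)"
    using measurable_compose[OF s M(1)] measurable_compose[OF s M(2)]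
    by (auto intro!: measurable_restrict_space1 borel_measurable_surface)
  note C = C1c_L2[OF 1(1,2)]
  note T = trD[OF t]
  have [measurable]: "u \<in> borel_measurable (vol \<Omega>)" "g \<in> borel_measurable (vol \<Omega>)" "f \<in> borel_measurable (surface \<omega>)"
    "\<phi> n \<in> borel_measurable (vol \<Omega>)" "G n \<in> borel_measurable (vol \<Omega>)" "\<phi> n \<in> borel_measurable (surface \<omega>)" for n
    using T C by (auto simp: L2_def)
  have bm: "\<bar>m t\<bar> * \<bar>a\<bar> \<le> B * \<bar>a\<bar>" "\<bar>m' t\<bar> * \<bar>a\<bar> \<le> B * \<bar>a\<bar>" "\<bar>m t\<bar> * norm c \<le> B * norm c"
    "\<bar>a\<bar> * \<bar>m' t\<bar> \<le> B * \<bar>a\<bar>" for t a and c :: "(real^2) \<times> real"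
    using b by (auto intro!: mult_right_mono simp: mult.commute[of "\<bar>a\<bar>" "\<bar>m' t\<bar>"])
  have [measurable]: "(\<lambda>x. (0::real^2, m' (snd x))) \<in> borel_measurable (vol \<Omega>)"
    unfolding borel_prod[symmetric] by (intro measurable_Pair) measurable
  have e: "norm (a *\<^sub>R (0::real^2, c)) = \<bar>c\<bar> * \<bar>a\<bar>" for a c :: real
    by (simp add: norm_Pair abs_mult)
  have L1: "(\<lambda>x. m (snd x) * u x) \<in> L2 (vol \<Omega>)"
    by (rule L2_bound(1)[OF T(1), of _ B]) (use bm B in \<open>auto simp: abs_mult\<close>)
  have L2: "(\<lambda>x. m (snd x) *\<^sub>R g x) \<in> L2 (vol \<Omega>)"
    by (rule L2_bound(1)[OF T(2), of _ B]) (use bm B in \<open>auto simp: abs_mult\<close>)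
  have L3: "(\<lambda>x. u x *\<^sub>R (0::real^2, m' (snd x))) \<in> L2 (vol \<Omega>)"
    by (rule L2_bound(1)[OF T(1), of _ B]) (use bm B e in \<open>auto simp: abs_mult simp del: scaleR_Pair\<close>)
  have L4: "(\<lambda>x. m (snd x) * f x) \<in> L2 (surface \<omega>)"
    by (rule L2_bound(1)[OF T(3), of _ B]) (use bm B in \<open>auto simp: abs_mult\<close>)
  have L2': "(\<lambda>x. m (snd x) *\<^sub>R G n x) \<in> L2 (vol \<Omega>)" for n
    by (rule L2_bound(1)[OF C(2)[of n], of _ B]) (use bm B in \<open>auto simp: abs_mult\<close>)
  have L3': "(\<lambda>x. \<phi> n x *\<^sub>R (0::real^2, m' (snd x))) \<in> L2 (vol \<Omega>)" for n
    by (rule L2_bound(1)[OF C(1)[of n], of _ B]) (use bm B e in \<open>auto simp: abs_mult simp del: scaleR_Pair\<close>)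
  have g: "C1_grad (\<lambda>x. m (snd x) * \<phi> n x) (\<lambda>x. m (snd x) *\<^sub>R G n x + \<phi> n x *\<^sub>R (0, m' (snd x)))" for n
    by (rule C1_grad_mult[OF C1_grad_snd[OF C1_grad_real[OF m]] 1(2)])
  have t: "(\<lambda>x. m (snd x) * \<phi> n x) \<in> C1c UNIV" for n
    by (rule C1c_mult[OF 1(1) C1_grad_snd[OF C1_grad_real[OF m]]])
  have l1: "(\<lambda>n. L2_norm (vol \<Omega>) (\<lambda>x. m (snd x) * \<phi> n x - m (snd x) * u x)) \<longlonglongrightarrow> 0"
    by (rule L2_lim_bound[OF C(1) T(1) _ _ B 1(3)])
       (measurable, use bm in \<open>auto simp: abs_mult right_diff_distrib[symmetric]\<close>)
  have l3: "(\<lambda>n. L2_norm (surface \<omega>) (\<lambda>x. m (snd x) * \<phi> n x - m (snd x) * f x)) \<longlonglongrightarrow> 0"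
    by (rule L2_lim_bound[OF C(3) T(3) _ _ B 1(5)])
       (measurable, use bm in \<open>auto simp: abs_mult right_diff_distrib[symmetric]\<close>)
  have a: "(\<lambda>n. L2_norm (vol \<Omega>) (\<lambda>x. m (snd x) *\<^sub>R G n x - m (snd x) *\<^sub>R g x)) \<longlonglongrightarrow> 0"
    by (rule L2_lim_bound[OF C(2) T(2) _ _ B 1(4)])
       (measurable, use bm in \<open>auto simp: abs_mult scaleR_right_diff_distrib[symmetric]\<close>)
  have b: "(\<lambda>n. L2_norm (vol \<Omega>) (\<lambda>x. \<phi> n x *\<^sub>R (0::real^2, m' (snd x)) - u x *\<^sub>R (0::real^2, m' (snd x)))) \<longlonglongrightarrow> 0"
    by (rule L2_lim_bound[OF C(1) T(1) _ _ B 1(3)])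
       (measurable, use bm e in \<open>auto simp: abs_mult scaleR_left_diff_distrib[symmetric] simp del: scaleR_Pair\<close>)
  show ?thesis
    by (rule that[OF L1 L2_add[OF L2 L3] L4 t g l1 L2_lim_add[OF L2' L2 L3' L3 a b] l3])
qed

lemma tr_mult:
  assumes t: "tr u g f" and m: "\<And>t. (m has_real_derivative m' t) (at t)" "continuous_on UNIV m'"
    and b: "\<And>t. \<bar>m t\<bar> \<le> B" "\<And>t. \<bar>m' t\<bar> \<le> B"
  shows "tr (\<lambda>x. m (snd x) * u x) (\<lambda>x. m (snd x) *\<^sub>R g x + u x *\<^sub>R (0, m' (snd x))) (\<lambda>x. m (snd x) * f x)"
  by (rule tr_mult_approx[OF assms]) (rule trI)

lemma tr_scale:
  assumes "tr u g f" shows "tr (\<lambda>x. c * u x) (\<lambda>x. c *\<^sub>R g x) (\<lambda>x. c * f x)"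
  using tr_mult[OF assms, of "\<lambda>_. c" "\<lambda>_. 0" "\<bar>c\<bar>"] by (simp add: zero_prod_def[symmetric])

lemma tr_diff:
  assumes "tr u g f" "tr u' g' f'"
  shows "tr (\<lambda>x. u x - u' x) (\<lambda>x. g x - g' x) (\<lambda>x. f x - f' x)"
  using tr_add[OF assms(1) tr_scale[OF assms(2), of "-1"]] by simp

text \<open>Diagonal sequence: from the approximants of the nth triple pick one within 1/(n+1). The
  boundary function is the same for all n, so the functions with given trace form a closed set; this
  supplies the limits in the existence proof.\<close>

lemma tr_closed:
  assumes t: "\<And>n. tr (u n) (g n) f" and L: "u' \<in> L2 (vol \<Omega>)" "g' \<in> L2 (vol \<Omega>)"
    and lim: "(\<lambda>n. L2_norm (vol \<Omega>) (\<lambda>x. u n x - u' x)) \<longlonglongrightarrow> 0" "(\<lambda>n. L2_norm (vol \<Omega>) (\<lambda>x. g n x - g' x)) \<longlonglongrightarrow> 0"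
  shows "tr u' g' f"
proof -
  define Q where "Q n \<phi> G \<longleftrightarrow> \<phi> \<in> C1c UNIV \<and> C1_grad \<phi> G \<and> L2_norm (vol \<Omega>) (\<lambda>x. \<phi> x - u n x) < inverse (real (Suc n)) \<and>
     L2_norm (vol \<Omega>) (\<lambda>x. G x - g n x) < inverse (real (Suc n)) \<and> L2_norm (surface \<omega>) (\<lambda>x. \<phi> x - f x) < inverse (real (Suc n))" for n \<phi> G
  have ex: "\<exists>\<phi> G. Q n \<phi> G" for n
  proof -
    obtain \<phi> G where 1: "\<And>k::nat. \<phi> k \<in> C1c UNIV" "\<And>k. C1_grad (\<phi> k) (G k)"
      "(\<lambda>k. L2_norm (vol \<Omega>) (\<lambda>x. \<phi> k x - u n x)) \<longlonglongrightarrow> 0"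
      "(\<lambda>k. L2_norm (vol \<Omega>) (\<lambda>x. G k x - g n x)) \<longlonglongrightarrow> 0"
      "(\<lambda>k. L2_norm (surface \<omega>) (\<lambda>x. \<phi> k x - f x)) \<longlonglongrightarrow> 0" by (rule trE[OF t]) (rule that)
    have p: "inverse (real (Suc n)) > 0" by simp
    from order_tendstoD(2)[OF 1(3) p] order_tendstoD(2)[OF 1(4) p] order_tendstoD(2)[OF 1(5) p]
    have "\<forall>\<^sub>F k in sequentially. L2_norm (vol \<Omega>) (\<lambda>x. \<phi> k x - u n x) < inverse (real (Suc n)) \<and>
      L2_norm (vol \<Omega>) (\<lambda>x. G k x - g n x) < inverse (real (Suc n)) \<and> L2_norm (surface \<omega>) (\<lambda>x. \<phi> k x - f x) < inverse (real (Suc n))"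
      by eventually_elim simp
    then obtain N where "L2_norm (vol \<Omega>) (\<lambda>x. \<phi> N x - u n x) < inverse (real (Suc n)) \<and>
      L2_norm (vol \<Omega>) (\<lambda>x. G N x - g n x) < inverse (real (Suc n)) \<and> L2_norm (surface \<omega>) (\<lambda>x. \<phi> N x - f x) < inverse (real (Suc n))"
      unfolding eventually_sequentially by blast
    then show ?thesis unfolding Q_def using 1(1)[of N] 1(2)[of N] by blast
  qed
  from ex obtain \<phi> where "\<And>n. \<exists>G. Q n (\<phi> n) G" by metis
  then obtain G where Q: "\<And>n. Q n (\<phi> n) (G n)" by metis
  then have P: "\<And>n. \<phi> n \<in> C1c UNIV" "\<And>n. C1_grad (\<phi> n) (G n)"
    and Q: "\<And>n. L2_norm (vol \<Omega>) (\<lambda>x. \<phi> n x - u n x) < inverse (real (Suc n))"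
     "\<And>n. L2_norm (vol \<Omega>) (\<lambda>x. G n x - g n x) < inverse (real (Suc n))"
     "\<And>n. L2_norm (surface \<omega>) (\<lambda>x. \<phi> n x - f x) < inverse (real (Suc n))" by (simp_all only: Q_def)
  have L': "u n \<in> L2 (vol \<Omega>)" "g n \<in> L2 (vol \<Omega>)" "f \<in> L2 (surface \<omega>)" for n using trD[OF t] by auto
  note C = C1c_L2[OF P]
  note inv = LIMSEQ_inverse_real_of_nat
  show ?thesis
  proof (rule trI[OF L L'(3) P])
    show "(\<lambda>n. L2_norm (vol \<Omega>) (\<lambda>x. \<phi> n x - u' x)) \<longlonglongrightarrow> 0"
    proof (rule tendsto_sandwich[OF _ _ tendsto_const])
      show "(\<lambda>n. inverse (real (Suc n)) + L2_norm (vol \<Omega>) (\<lambda>x. u n x - u' x)) \<longlonglongrightarrow> 0"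
        using tendsto_add[OF inv lim(1)] by simp
      show "\<forall>\<^sub>F n in sequentially. L2_norm (vol \<Omega>) (\<lambda>x. \<phi> n x - u' x) \<le> inverse (real (Suc n)) + L2_norm (vol \<Omega>) (\<lambda>x. u n x - u' x)"
        using L2_norm_triangle_diff[OF C(1) L'(1) L(1)] Q(1)
        by (intro always_eventually allI) (meson add_right_mono less_imp_le order_trans)
    qed simp
    show "(\<lambda>n. L2_norm (vol \<Omega>) (\<lambda>x. G n x - g' x)) \<longlonglongrightarrow> 0"
    proof (rule tendsto_sandwich[OF _ _ tendsto_const])
      show "(\<lambda>n. inverse (real (Suc n)) + L2_norm (vol \<Omega>) (\<lambda>x. g n x - g' x)) \<longlonglongrightarrow> 0"
        using tendsto_add[OF inv lim(2)] by simp
      show "\<forall>\<^sub>F n in sequentially. L2_norm (vol \<Omega>) (\<lambda>x. G n x - g' x) \<le> inverse (real (Suc n)) + L2_norm (vol \<Omega>) (\<lambda>x. g n x - g' x)"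
        using L2_norm_triangle_diff[OF C(2) L'(2) L(2)] Q(2)
        by (intro always_eventually allI) (meson add_right_mono less_imp_le order_trans)
    qed simp
    show "(\<lambda>n. L2_norm (surface \<omega>) (\<lambda>x. \<phi> n x - f x)) \<longlonglongrightarrow> 0"
      by (rule tendsto_sandwich[OF _ _ tendsto_const inv]) (use Q(3) in \<open>auto intro!: always_eventually less_imp_le\<close>)
  qed
qed

lemma tr_weak_grad:
  assumes "tr u g f" shows "has_weak_grad \<Omega> u g"
proof -
  obtain \<phi> G where 1: "\<And>n::nat. \<phi> n \<in> C1c UNIV" "\<And>n. C1_grad (\<phi> n) (G n)"
    "(\<lambda>n. L2_norm (vol \<Omega>) (\<lambda>x. \<phi> n x - u x)) \<longlonglongrightarrow> 0"
    "(\<lambda>n. L2_norm (vol \<Omega>) (\<lambda>x. G n x - g x)) \<longlonglongrightarrow> 0"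
    "(\<lambda>n. L2_norm (surface \<omega>) (\<lambda>x. \<phi> n x - f x)) \<longlonglongrightarrow> 0" by (rule trE[OF assms]) (rule that)
  show ?thesis
    by (rule has_weak_grad_limit[OF open_waveguide has_weak_grad_C1[OF open_waveguide 1(2)] C1c_L2(1,2)[OF 1(1,2)]
      trD(1,2)[OF assms] 1(3,4)])
qed

section \<open>Agreement with the trace relation \<open>has_trace\<close>\<close>

lemma H1_norm_eq:
  assumes "has_weak_grad \<Omega> u g" "g \<in> L2 (vol \<Omega>)"
  shows "H1_norm \<Omega> u = sqrt ((L2_norm (vol \<Omega>) u)\<^sup>2 + (L2_norm (vol \<Omega>) g)\<^sup>2)"
  unfolding H1_norm_def
  using L2_norm_cong_AE[OF wgrad_AE_eq[OF open_waveguide assms(1)] wgrad_measurable[OF open_waveguide assms(1)]] assms(2)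
  by (simp add: L2_def)

lemma H1_norm_ge:
  assumes "has_weak_grad \<Omega> u g" "g \<in> L2 (vol \<Omega>)"
  shows "L2_norm (vol \<Omega>) u \<le> H1_norm \<Omega> u" "L2_norm (vol \<Omega>) g \<le> H1_norm \<Omega> u"
  unfolding H1_norm_eq[OF assms] by (auto intro: real_le_rsqrt)

text \<open>With \<open>has_trace_tr\<close> this is the dictionary between \<open>tr\<close>, where
  the gradient is explicit, and \<open>has_trace\<close>, where it is chosen; uniqueness of weak
  gradients makes the two notions of convergence the same.\<close>

lemma tr_H1:
  assumes "tr u g f"
  shows "u \<in> H1 \<Omega>" "AE x in vol \<Omega>. wgrad \<Omega> u x = g x" "has_trace \<omega> u f"
proof -
  obtain \<phi> G where 1: "\<And>n::nat. \<phi> n \<in> C1c UNIV" "\<And>n. C1_grad (\<phi> n) (G n)"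
    "(\<lambda>n. L2_norm (vol \<Omega>) (\<lambda>x. \<phi> n x - u x)) \<longlonglongrightarrow> 0"
    "(\<lambda>n. L2_norm (vol \<Omega>) (\<lambda>x. G n x - g x)) \<longlonglongrightarrow> 0"
    "(\<lambda>n. L2_norm (surface \<omega>) (\<lambda>x. \<phi> n x - f x)) \<longlonglongrightarrow> 0" by (rule trE[OF assms]) (rule that)
  note T = trD[OF assms]
  note w = tr_weak_grad[OF assms]
  show h: "u \<in> H1 \<Omega>" by (rule H1_I[OF T(1,2) w])
  show "AE x in vol \<Omega>. wgrad \<Omega> u x = g x" by (rule wgrad_AE_eq[OF open_waveguide w])
  have "H1_norm \<Omega> (\<lambda>x. \<phi> n x - u x) = sqrt ((L2_norm (vol \<Omega>) (\<lambda>x. \<phi> n x - u x))\<^sup>2 + (L2_norm (vol \<Omega>) (\<lambda>x. G n x - g x))\<^sup>2)" for n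
    by (rule H1_norm_eq[OF has_weak_grad_diff[OF open_waveguide has_weak_grad_C1[OF open_waveguide 1(2)] w]
         L2_diff[OF C1c_L2(2)[OF 1(1,2)] T(2)]])
  moreover have "(\<lambda>n. sqrt ((L2_norm (vol \<Omega>) (\<lambda>x. \<phi> n x - u x))\<^sup>2 + (L2_norm (vol \<Omega>) (\<lambda>x. G n x - g x))\<^sup>2)) \<longlonglongrightarrow> sqrt (0\<^sup>2 + 0\<^sup>2)"
    by (intro tendsto_intros 1)
  ultimately have "(\<lambda>n. H1_norm \<Omega> (\<lambda>x. \<phi> n x - u x)) \<longlonglongrightarrow> 0" by simp
  then show "has_trace \<omega> u f" unfolding has_trace_def using h T(3) 1(1,5) by blast
qed

lemma has_trace_tr:
  assumes "has_trace \<omega> u f" shows "tr u (wgrad \<Omega> u) f"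
proof -
  have h: "u \<in> H1 \<Omega>" and f: "f \<in> L2 (surface \<omega>)" using assms by (auto simp: has_trace_def)
  obtain \<phi> where 1: "\<And>n::nat. \<phi> n \<in> C1c UNIV" "(\<lambda>n. H1_norm \<Omega> (\<lambda>x. \<phi> n x - u x)) \<longlonglongrightarrow> 0"
    "(\<lambda>n. L2_norm (surface \<omega>) (\<lambda>x. \<phi> n x - f x)) \<longlonglongrightarrow> 0"
    using assms unfolding has_trace_def by blast
  have "\<forall>n. \<exists>G. C1_grad (\<phi> n) G" using 1(1) by (simp add: C1c_iff)
  then obtain G where G: "\<And>n. C1_grad (\<phi> n) (G n)" by metis
  note w = wgrad_L2[OF h open_waveguide]
  have "has_weak_grad \<Omega> (\<lambda>x. \<phi> n x - u x) (\<lambda>x. G n x - wgrad \<Omega> u x)" "(\<lambda>x. G n x - wgrad \<Omega> u x) \<in> L2 (vol \<Omega>)" for n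
    by (rule has_weak_grad_diff[OF open_waveguide has_weak_grad_C1[OF open_waveguide G] w(1)],
        rule L2_diff[OF C1c_L2(2)[OF 1(1) G] w(2)])
  note b = H1_norm_ge[OF this]
  show ?thesis
  proof (rule trI[OF H1_L2[OF h] w(2) f 1(1) G])
    show "(\<lambda>n. L2_norm (vol \<Omega>) (\<lambda>x. \<phi> n x - u x)) \<longlonglongrightarrow> 0"
      by (rule tendsto_sandwich[OF _ _ tendsto_const 1(2)]) (auto intro!: always_eventually b)
    show "(\<lambda>n. L2_norm (vol \<Omega>) (\<lambda>x. G n x - wgrad \<Omega> u x)) \<longlonglongrightarrow> 0"
      by (rule tendsto_sandwich[OF _ _ tendsto_const 1(2)]) (auto intro!: always_eventually b)
    show "(\<lambda>n. L2_norm (surface \<omega>) (\<lambda>x. \<phi> n x - f x)) \<longlonglongrightarrow> 0" by (rule 1)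
  qed
qed

text \<open>A constant sequence converges in the mean to every function equal to it almost
  everywhere, so this is an instance of \<open>tr_closed\<close>.\<close>

lemma tr_cong_AE:
  assumes t: "tr u g f" and u: "AE x in vol \<Omega>. u x = u' x" "u' \<in> borel_measurable (vol \<Omega>)"
    and g: "AE x in vol \<Omega>. g x = g' x" "g' \<in> borel_measurable (vol \<Omega>)"
  shows "tr u' g' f"
proof (rule tr_closed[OF t])
  note T = trD[OF t]
  show "u' \<in> L2 (vol \<Omega>)" by (rule L2_cong_AE[OF _ u(2) T(1)]) (use u in auto)
  show "g' \<in> L2 (vol \<Omega>)" by (rule L2_cong_AE[OF _ g(2) T(2)]) (use g in auto)
  have "L2_norm (vol \<Omega>) (\<lambda>x. u x - u' x) = L2_norm (vol \<Omega>) (\<lambda>x. 0::real)"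
    by (rule L2_norm_cong_AE) (use u T in \<open>auto simp: L2_def\<close>)
  then show "(\<lambda>n. L2_norm (vol \<Omega>) (\<lambda>x. u x - u' x)) \<longlonglongrightarrow> 0" by simp
  have "L2_norm (vol \<Omega>) (\<lambda>x. g x - g' x) = L2_norm (vol \<Omega>) (\<lambda>x. 0::(real^2) \<times> real)"
    by (rule L2_norm_cong_AE) (use g T in \<open>auto simp: L2_def\<close>)
  then show "(\<lambda>n. L2_norm (vol \<Omega>) (\<lambda>x. g x - g' x)) \<longlonglongrightarrow> 0" by simp
qed

end

section \<open>Strip inequalities\<close>

text \<open>Cauchy-Schwarz in the fundamental theorem of calculus. The interval is half open because
  a segment running to the boundary lies in the domain only before its exit point.\<close>

lemma FTC_square:
  fixes F k :: "real \<Rightarrow> real"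
  assumes F: "\<And>t. (F has_real_derivative k t) (at t)" and k: "continuous_on UNIV k" and l: "0 \<le> l"
  shows "ennreal ((F l - F 0)\<^sup>2) \<le> ennreal l * (\<integral>\<^sup>+t. indicator {0..<l} t * ennreal ((k t)\<^sup>2) \<partial>lborel)"
proof -
  have km [measurable]: "k \<in> borel_measurable borel" using k by (rule borel_measurable_continuous_onI)
  have I: "set_integrable lborel {0..l} k"
    by (rule borel_integrable_atLeastAtMost') (rule continuous_on_subset[OF k], simp)
  have "F l - F 0 = (\<integral>t. indicator {0..l} t *\<^sub>R k t \<partial>lborel)"
    by (rule integral_FTC_atLeastAtMost[symmetric, OF l])
       (use F in \<open>auto intro: has_vector_derivative_at_within has_field_derivative_at_within continuous_on_subset[OF k] simp: has_real_derivative_iff_has_vector_derivative[symmetric]\<close>)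
  then have "\<bar>F l - F 0\<bar> \<le> (\<integral>t. norm (indicator {0..l} t *\<^sub>R k t) \<partial>lborel)"
    by (metis integral_norm_bound real_norm_def)
  then have "ennreal \<bar>F l - F 0\<bar> \<le> ennreal (\<integral>t. norm (indicator {0..l} t *\<^sub>R k t) \<partial>lborel)" by (rule ennreal_leI)
  also have "\<dots> = (\<integral>\<^sup>+t. ennreal (norm (indicator {0..l} t *\<^sub>R k t)) \<partial>lborel)"
    by (rule nn_integral_eq_integral[symmetric]) (use I in \<open>auto simp: set_integrable_def\<close>)
  also have "\<dots> = (\<integral>\<^sup>+t. indicator {0..<l} t * ennreal \<bar>indicator {0..<l} t * k t\<bar> \<partial>lborel)"
  proof (rule nn_integral_cong_AE)
    show "AE t in lborel. ennreal (norm (indicator {0..l} t *\<^sub>R k t)) = indicator {0..<l} t * ennreal \<bar>indicator {0..<l} t * k t\<bar>"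
      using AE_lborel_singleton[of l] by eventually_elim (auto simp: indicator_def)
  qed
  finally have "(ennreal \<bar>F l - F 0\<bar>)\<^sup>2 \<le> (\<integral>\<^sup>+t. indicator {0..<l} t * ennreal \<bar>indicator {0..<l} t * k t\<bar> \<partial>lborel)\<^sup>2"
    by (rule power_mono) simp
  also have "\<dots> \<le> (\<integral>\<^sup>+t. (indicator {0..<l} t)^2 \<partial>lborel) * (\<integral>\<^sup>+t. (ennreal \<bar>indicator {0..<l} t * k t\<bar>)^2 \<partial>lborel)"
    by (rule Cauchy_Schwarz_nn_integral) measurable
  also have "(\<integral>\<^sup>+t. (indicator {0..<l} t)^2 \<partial>lborel) = (\<integral>\<^sup>+t. indicator {0..<l} t \<partial>lborel)"
    by (rule nn_integral_cong) (auto simp: indicator_def)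
  also have "\<dots> = ennreal l" using l by (subst nn_integral_indicator) auto
  also have "(\<integral>\<^sup>+t. (ennreal \<bar>indicator {0..<l} t * k t\<bar>)^2 \<partial>lborel) = (\<integral>\<^sup>+t. indicator {0..<l} t * ennreal ((k t)\<^sup>2) \<partial>lborel)"
    by (rule nn_integral_cong) (auto simp: indicator_def ennreal_power)
  finally show ?thesis by (simp add: ennreal_power)
qed

lemma L2_vol_subset:
  fixes f :: "'a::euclidean_space \<Rightarrow> 'b::euclidean_space"
  assumes f: "f \<in> L2 (vol A)" and S: "S \<subseteq> A" "S \<in> sets borel" "A \<in> sets borel"
  shows "f \<in> L2 (vol S)" "L2_norm (vol S) f \<le> L2_norm (vol A) f"
proof -
  have "vol S = restrict_space (vol A) S"
    using S by (subst restrict_restrict_space) (auto simp: Int_absorb1)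
  then have m: "f \<in> borel_measurable (vol S)" using f by (auto simp: L2_def intro: measurable_restrict_space1)
  have "(\<integral>\<^sup>+x. ennreal ((norm (f x))\<^sup>2) \<partial>vol S) \<le> (\<integral>\<^sup>+x. ennreal ((norm (f x))\<^sup>2) \<partial>vol A)"
    using S by (subst (1 2) nn_integral_restrict_space) (auto intro!: nn_integral_mono simp: indicator_def)
  also have "\<dots> = ennreal ((L2_norm (vol A) f)\<^sup>2)" by (rule L2_norm_sq_nn[OF f])
  finally show "f \<in> L2 (vol S)" "L2_norm (vol S) f \<le> L2_norm (vol A) f"
    using L2_nnI[OF m] by auto
qed

section \<open>Area swept by segments, compared with length\<close>

lemma nn_integral_translation:
  fixes f :: "'a::euclidean_space \<Rightarrow> ennreal"
  assumes [measurable]: "f \<in> borel_measurable borel"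
  shows "(\<integral>\<^sup>+x. f (x + c) \<partial>lborel) = (\<integral>\<^sup>+x. f x \<partial>lborel)"
proof -
  have "(\<integral>\<^sup>+x. f x \<partial>lborel) = (\<integral>\<^sup>+x. f x \<partial>distr lborel borel ((+) c))" by (simp add: lborel_distr_plus)
  also have "\<dots> = (\<integral>\<^sup>+x. f (c + x) \<partial>lborel)" by (rule nn_integral_distr) auto
  finally show ?thesis by (simp add: add.commute)
qed

text \<open>Centres spaced by d along a segment of length D carry discs of radius 2 d that cover the
  tube. About D/d + 1 discs of area \<open>4 * pi * d\<^sup>2\<close> give a bound linear in d, the
  radius of the set from which the segments start.\<close>

lemma tube_measure:
  fixes p e :: "real^2"
  assumes e: "norm e = 1" and d: "0 < d" "d \<le> 1" and D: "D \<ge> 0"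
  obtains B where "B \<in> sets borel" "emeasure lborel B \<le> ennreal (4 * pi * (D + 2)) * ennreal d"
    "\<And>q t. norm (q - p) \<le> d \<Longrightarrow> 0 \<le> t \<Longrightarrow> t \<le> D \<Longrightarrow> q + t *\<^sub>R e \<in> B"
proof
  define N where "N = nat \<lfloor>D / d\<rfloor>"
  have N: "real N \<le> D / d" "D / d < real N + 1" using D d by (auto simp: N_def)
  define B where "B = (\<Union>k\<le>N. cball (p + (real k * d) *\<^sub>R e) (2 * d))"
  show "B \<in> sets borel" unfolding B_def by (intro sets.finite_UN) auto
  have "emeasure lborel B \<le> (\<Sum>k\<le>N. emeasure lborel (cball (p + (real k * d) *\<^sub>R e) (2 * d)))"
    unfolding B_def by (rule emeasure_subadditive_finite) auto
  also have "\<dots> = (\<Sum>k\<le>N. ennreal (pi * (2 * d)^2))"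
    using d by (intro sum.cong refl) (simp add: emeasure_cball unit_ball_vol_2)
  also have "\<dots> = ennreal ((real N + 1) * (pi * (2 * d)^2))"
    by (simp add: ennreal_of_nat_eq_real_of_nat ennreal_mult'[symmetric] add.commute flip: of_nat_Suc)
  also have "\<dots> \<le> ennreal ((4 * pi * (D + 2)) * d)"
  proof (rule ennreal_leI)
    have "(real N + 1) * d \<le> D + 2"
    proof -
      have "real N * d \<le> D" using N(1) d by (simp add: le_divide_eq)
      then show ?thesis using d by (simp add: algebra_simps)
    qed
    then have "(4 * pi * d) * ((real N + 1) * d) \<le> (4 * pi * d) * (D + 2)"
      using d by (intro mult_left_mono) auto
    then show "(real N + 1) * (pi * (2 * d)^2) \<le> 4 * pi * (D + 2) * d" by (simp add: power2_eq_square algebra_simps)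
  qed
  also have "\<dots> = ennreal (4 * pi * (D + 2)) * ennreal d" using d D by (subst ennreal_mult') auto
  finally show "emeasure lborel B \<le> ennreal (4 * pi * (D + 2)) * ennreal d" .
  fix q t assume q: "norm (q - p) \<le> d" and t: "0 \<le> t" "t \<le> D"
  define k where "k = nat \<lfloor>t / d\<rfloor>"
  have k: "real k \<le> t / d" "t / d < real k + 1" using t d by (auto simp: k_def)
  have "k \<le> N" unfolding k_def N_def using t d by (intro nat_mono floor_mono divide_right_mono) auto
  have kt: "\<bar>t - real k * d\<bar> \<le> d" using k d by (auto simp: field_simps abs_le_iff)
  have "norm ((q + t *\<^sub>R e) - (p + (real k * d) *\<^sub>R e)) = norm ((q - p) + (t - real k * d) *\<^sub>R e)"
    by (simp add: algebra_simps)
  also have "\<dots> \<le> norm (q - p) + norm ((t - real k * d) *\<^sub>R e)" by (rule norm_triangle_ineq)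
  also have "\<dots> \<le> 2 * d" using q kt e by simp
  finally have "q + t *\<^sub>R e \<in> cball (p + (real k * d) *\<^sub>R e) (2 * d)"
    by (simp add: dist_norm norm_minus_commute)
  then show "q + t *\<^sub>R e \<in> B" unfolding B_def using \<open>k \<le> N\<close> by blast
qed

text \<open>Each member of a fine cover of \<open>A\<close> sweeps out a tube of area proportional
  to its diameter; summing over the cover and taking the infimum leaves the Hausdorff measure of
  \<open>A\<close>.\<close>

lemma tube_measure_hausdorff1:
  fixes e :: "real^2" and E A :: "(real^2) set"
  assumes e: "norm e = 1" and D: "D \<ge> 0" and E: "\<And>x. x \<in> E \<Longrightarrow> \<exists>q\<in>A. \<exists>t. 0 \<le> t \<and> t \<le> D \<and> x = q + t *\<^sub>R e"
  shows "emeasure lborel E \<le> ennreal (4 * pi * (D + 2)) * hausdorff1_outer A"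
proof -
  let ?C = "ennreal (4 * pi * (D + 2))"
  have C: "?C > 0" "?C < top" using D by (auto simp: add_nonneg_pos)
  \<comment> \<open>The scale 1/2 leaves room for the slack added below, at most 1/2, within the
    bound \<open>d \<le> 1\<close> of \<open>tube_measure\<close>.\<close>
  have "emeasure lborel E / ?C \<le> hausdorff1_pre (1/2) A"
    unfolding hausdorff1_pre_def
  proof (rule INF_greatest, safe)
    fix F :: "nat \<Rightarrow> (real^2) set"
    assume cov: "A \<subseteq> (\<Union>i. F i)" and F: "\<forall>i. bounded (F i) \<and> diameter (F i) \<le> 1/2"
    show "emeasure lborel E / ?C \<le> (\<Sum>i. ennreal (diameter (F i)))"
    proof (rule ennreal_le_epsilon)
      fix \<epsilon> :: real assume \<epsilon>: "\<epsilon> > 0"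
      define \<eta> where "\<eta> = min \<epsilon> 1"
      have \<eta>: "\<eta> > 0" "\<eta> \<le> 1" "\<eta> \<le> \<epsilon>" using \<epsilon> by (auto simp: \<eta>_def)
      \<comment> \<open>Members of the cover may be single points, but tubes need a positive radius;
        the summable slack costs only \<eta> in total.\<close>
      define d where "d i = diameter (F i) + \<eta> * (1/2)^Suc i" for i
      have d: "0 < d i" "d i \<le> 1" for i
      proof -
        have "0 \<le> diameter (F i)" using F diameter_ge_0 by blast
        then show "0 < d i" using \<eta> by (simp add: d_def add_nonneg_pos)
        have "\<eta> * (1/2)^Suc i \<le> 1 * (1/2)" using \<eta> power_le_one[of "1/2::real" i] by (intro mult_mono) auto
        then show "d i \<le> 1" using F[rule_format, of i] by (simp add: d_def)
      qed
      have "\<exists>B. B \<in> sets borel \<and> emeasure lborel B \<le> ?C * ennreal (d i) \<and>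
          (\<forall>q t. q \<in> F i \<longrightarrow> 0 \<le> t \<longrightarrow> t \<le> D \<longrightarrow> q + t *\<^sub>R e \<in> B)" for i
      proof (cases "F i = {}")
        case True then show ?thesis by (intro exI[of _ "{}"]) auto
      next
        case False
        then obtain p where p: "p \<in> F i" by blast
        obtain B where B: "B \<in> sets borel" "emeasure lborel B \<le> ?C * ennreal (d i)"
           "\<And>q t. norm (q - p) \<le> d i \<Longrightarrow> 0 \<le> t \<Longrightarrow> t \<le> D \<Longrightarrow> q + t *\<^sub>R e \<in> B"
          by (rule tube_measure[OF e d D]) (rule that)
        have "norm (q - p) \<le> d i" if "q \<in> F i" for q
        proof -
          have "dist q p \<le> diameter (F i)" using F that p by (auto intro: diameter_bounded_bound)
          then show ?thesis using \<eta> by (simp add: d_def dist_norm add_increasing2)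
        qed
        then show ?thesis using B by blast
      qed
      then obtain B where B: "\<And>i. B i \<in> sets borel" "\<And>i. emeasure lborel (B i) \<le> ?C * ennreal (d i)"
        "\<And>i q t. q \<in> F i \<Longrightarrow> 0 \<le> t \<Longrightarrow> t \<le> D \<Longrightarrow> q + t *\<^sub>R e \<in> B i" by metis
      have "E \<subseteq> (\<Union>i. B i)"
      proof
        fix x assume "x \<in> E"
        then obtain q t where q: "q \<in> A" "0 \<le> t" "t \<le> D" "x = q + t *\<^sub>R e" using E by blast
        moreover then obtain i where "q \<in> F i" using cov by blast
        ultimately show "x \<in> (\<Union>i. B i)" using B(3) by blast
      qed
      then have "emeasure lborel E \<le> emeasure lborel (\<Union>i. B i)" by (rule emeasure_mono) (use B in auto)
      also have "\<dots> \<le> (\<Sum>i. emeasure lborel (B i))" by (rule emeasure_subadditive_countably) (use B in auto)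
      also have "\<dots> \<le> (\<Sum>i. ?C * ennreal (d i))" by (intro suminf_le B) auto
      also have "\<dots> = ?C * (\<Sum>i. ennreal (d i))" by simp
      also have "(\<Sum>i. ennreal (d i)) = (\<Sum>i. ennreal (diameter (F i)) + ennreal (\<eta> * (1/2)^Suc i))"
        using F \<eta> by (intro suminf_cong) (auto simp: d_def diameter_ge_0)
      also have "\<dots> = (\<Sum>i. ennreal (diameter (F i))) + (\<Sum>i. ennreal (\<eta> * (1/2)^Suc i))"
        by (intro suminf_add[symmetric]) auto
      also have "(\<Sum>i. ennreal (\<eta> * (1/2)^Suc i)) = ennreal \<eta>"
        using \<eta> sums_mult[OF power_half_series, of \<eta>] by (intro suminf_ennreal_eq) auto
      finally have "emeasure lborel E / ?C \<le> (\<Sum>i. ennreal (diameter (F i))) + ennreal \<eta>"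
        using C by (intro divide_le_posI_ennreal) auto
      also have "\<dots> \<le> (\<Sum>i. ennreal (diameter (F i))) + ennreal \<epsilon>" using \<eta> by (intro add_left_mono ennreal_leI)
      finally show "emeasure lborel E / ?C \<le> (\<Sum>i. ennreal (diameter (F i))) + ennreal \<epsilon>" .
    qed
  qed
  also have "\<dots> \<le> hausdorff1_outer A" by (rule hausdorff1_pre_le_outer) simp
  finally have "?C * (emeasure lborel E / ?C) \<le> ?C * hausdorff1_outer A" by (intro mult_left_mono) auto
  moreover have "?C * (emeasure lborel E / ?C) = emeasure lborel E"
  proof -
    have "?C * (emeasure lborel E / ?C) = (emeasure lborel E * ?C) / ?C"
      by (simp only: ennreal_times_divide mult.commute)
    also have "\<dots> = emeasure lborel E" by (rule mult_divide_eq_ennreal) (use C in auto)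
    finally show ?thesis .
  qed
  ultimately show ?thesis by simp
qed

section \<open>First exit from the cross section along a direction\<close>

context lipschitz_domain
begin

text \<open>The way is followed backwards along \<open>e\<close>. Outside \<omega> the value is 0,
  so the function is defined on the whole plane.\<close>

definition exitlen where "exitlen e x = Inf {t. 0 \<le> t \<and> x - t *\<^sub>R e \<notin> \<omega>}"
definition exitpt where "exitpt e x = x - exitlen e x *\<^sub>R e"
text \<open>The factor 2 lets one number bound both the length of segments inside \<omega> and the
  norm of its points, which enters the ellipticity.\<close>

definition width where "width = (SOME D. D > 0 \<and> (\<forall>x\<in>\<omega>. 2 * norm x < D))"

lemma width: "width > 0" "x \<in> \<omega> \<Longrightarrow> 2 * norm x < width"
proof -
  obtain R where "R > 0" "\<forall>x\<in>\<omega>. norm x \<le> R" using bounded_om by (auto simp: bounded_pos)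
  then have "2 * R + 1 > 0 \<and> (\<forall>x\<in>\<omega>. 2 * norm x < 2 * R + 1)" by force
  from someI[of "\<lambda>D. D > 0 \<and> (\<forall>x\<in>\<omega>. 2 * norm x < D)", OF this]
  show "width > 0" "x \<in> \<omega> \<Longrightarrow> 2 * norm x < width" unfolding width_def by auto
qed

context
  fixes e :: "real^2"
  assumes e: "norm e = 1"
begin

lemma exits: "x \<in> \<omega> \<Longrightarrow> x - width *\<^sub>R e \<notin> \<omega>"
proof
  assume "x \<in> \<omega>" "x - width *\<^sub>R e \<in> \<omega>"
  then have "2 * norm x < width" "2 * norm (x - width *\<^sub>R e) < width" using width by auto
  moreover have "norm (width *\<^sub>R e) \<le> norm x + norm (x - width *\<^sub>R e)"
    using norm_triangle_ineq4[of x "x - width *\<^sub>R e"] by simp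
  ultimately show False using e width(1) by simp
qed

lemma exitlen_props:
  shows "0 \<le> exitlen e x" "x - exitlen e x *\<^sub>R e \<notin> \<omega>"
    "0 \<le> t \<Longrightarrow> t < exitlen e x \<Longrightarrow> x - t *\<^sub>R e \<in> \<omega>"
    "0 \<le> t \<Longrightarrow> x - t *\<^sub>R e \<notin> \<omega> \<Longrightarrow> exitlen e x \<le> t"
    "x \<in> \<omega> \<Longrightarrow> exitlen e x \<le> width" "x \<in> \<omega> \<Longrightarrow> 0 < exitlen e x"
proof -
  let ?Z = "{t. 0 \<le> t \<and> x - t *\<^sub>R e \<notin> \<omega>}"
  have ne: "?Z \<noteq> {}"
  proof (cases "x \<in> \<omega>")
    case True then show ?thesis using exits width(1) less_imp_le by blast
  next
    case False then show ?thesis by (auto intro!: exI[of _ 0])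
  qed
  have bb: "bdd_below ?Z" by (rule bdd_belowI[of _ 0]) auto
  have "?Z = {0..} \<inter> (\<lambda>t. x - t *\<^sub>R e) -` (- \<omega>)" by auto
  moreover have "closed ((\<lambda>t. x - t *\<^sub>R e) -` (- \<omega>))"
    by (rule closed_vimage) (use open_om in \<open>auto intro!: continuous_intros\<close>)
  ultimately have cl: "closed ?Z" by (metis closed_Int closed_real_atLeast)
  have "exitlen e x \<in> ?Z" unfolding exitlen_def by (rule closed_contains_Inf[OF ne bb cl])
  then show 1: "0 \<le> exitlen e x" "x - exitlen e x *\<^sub>R e \<notin> \<omega>" by auto
  show 2: "exitlen e x \<le> t" if "0 \<le> t" "x - t *\<^sub>R e \<notin> \<omega>" for t
    unfolding exitlen_def by (rule cInf_lower[OF _ bb]) (use that in auto)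
  show "x - t *\<^sub>R e \<in> \<omega>" if "0 \<le> t" "t < exitlen e x" using 2[of t] that by force
  show "exitlen e x \<le> width" if "x \<in> \<omega>" using 2[of width] exits[OF that] width(1) by simp
  show "0 < exitlen e x" if "x \<in> \<omega>" using 1 that by (cases "exitlen e x = 0") auto
qed

lemma exitpt_frontier: "x \<in> \<omega> \<Longrightarrow> exitpt e x \<in> frontier \<omega>"
proof -
  assume x: "x \<in> \<omega>"
  have "((\<lambda>t. x - t *\<^sub>R e) \<longlongrightarrow> exitpt e x) (at_left (exitlen e x))"
    unfolding exitpt_def by (intro tendsto_intros)
  moreover have "\<forall>\<^sub>F t in at_left (exitlen e x). x - t *\<^sub>R e \<in> closure \<omega>"
    using eventually_at_left_real[OF exitlen_props(6)[OF x]]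
  proof eventually_elim
    case (elim t)
    then have "x - t *\<^sub>R e \<in> \<omega>" using exitlen_props(3)[of t x] by simp
    then show ?case using closure_subset by blast
  qed
  ultimately have "exitpt e x \<in> closure \<omega>"
    by (intro Lim_in_closed_set[of "closure \<omega>" _ "at_left (exitlen e x)"]) auto
  then show ?thesis using exitlen_props(2) open_om by (simp add: frontier_def interior_open exitpt_def)
qed

lemma exitlen_shift:
  assumes "0 \<le> t" "t < exitlen e x" shows "exitlen e (x - t *\<^sub>R e) = exitlen e x - t"
proof (rule antisym)
  show "exitlen e (x - t *\<^sub>R e) \<le> exitlen e x - t"
    by (rule exitlen_props(4)) (use assms exitlen_props(2)[of x] in \<open>auto simp: algebra_simps\<close>)
  have "exitlen e x \<le> exitlen e (x - t *\<^sub>R e) + t"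
    by (rule exitlen_props(4)) (use assms exitlen_props(1,2)[of "x - t *\<^sub>R e"] in \<open>auto simp: algebra_simps\<close>)
  then show "exitlen e x - t \<le> exitlen e (x - t *\<^sub>R e)" by simp
qed

lemma exitpt_shift:
  assumes "0 \<le> t" "t < exitlen e x" shows "exitpt e (x - t *\<^sub>R e) = exitpt e x"
  by (simp add: exitpt_def exitlen_shift[OF assms] algebra_simps)

text \<open>For \<open>c \<ge> 0\<close> the sublevel set is the sum of a compact segment and the
  closed complement of \<omega>, hence closed.\<close>

lemma exitlen_measurable: "exitlen e \<in> borel_measurable borel"
proof (rule borel_measurableI_le)
  fix c :: real
  show "{x \<in> space borel. exitlen e x \<le> c} \<in> sets borel"
  proof (cases "c \<ge> 0")
    case True
    have "{x \<in> space borel. exitlen e x \<le> c} = {x + y |x y. x \<in> (\<lambda>t. t *\<^sub>R e) ` {0..c} \<and> y \<in> - \<omega>}" (is "?L = ?R")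
    proof safe
      fix x assume "exitlen e x \<le> c"
      then show "\<exists>u v. x = u + v \<and> u \<in> (\<lambda>t. t *\<^sub>R e) ` {0..c} \<and> v \<in> - \<omega>"
        using exitlen_props(1,2)[of x]
        by (intro exI[of _ "exitlen e x *\<^sub>R e"] exI[of _ "x - exitlen e x *\<^sub>R e"]) auto
    next
      fix t y assume t: "t \<in> {0..c}" and y: "y \<notin> \<omega>"
      have "exitlen e (t *\<^sub>R e + y) \<le> t" by (rule exitlen_props(4)) (use t y in auto)
      then show "exitlen e (t *\<^sub>R e + y) \<le> c" using t by simp
    qed auto
    moreover have "?R = (\<Union>x\<in>(\<lambda>t. t *\<^sub>R e) ` {0..c}. \<Union>y\<in>- \<omega>. {x + y})" by blast
    moreover have "closed (\<Union>x\<in>(\<lambda>t. t *\<^sub>R e) ` {0..c}. \<Union>y\<in>- \<omega>. {x + y})"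
    proof (rule compact_closed_sums)
      show "compact ((\<lambda>t. t *\<^sub>R e) ` {0..c})" by (intro compact_continuous_image continuous_intros) auto
      show "closed (- \<omega>)" using open_om by auto
    qed
    ultimately have "closed {x \<in> space borel. exitlen e x \<le> c}" by (simp only:)
    then show ?thesis by simp
  next
    case False
    then have "{x \<in> space borel. exitlen e x \<le> c} = {}"
      using order_trans[OF exitlen_props(1)] by blast
    then show ?thesis by (metis sets.empty_sets)
  qed
qed

lemma exitpt_measurable: "exitpt e \<in> borel \<rightarrow>\<^sub>M borel"
  unfolding exitpt_def[abs_def] using exitlen_measurable by measurable

definition tube_const where "tube_const = 4 * pi * (width + 2)"

text \<open>The preimage of \<open>A\<close> under the exit map is swept by segments of length at
  most \<open>width\<close> issuing from \<open>A \<inter> frontier \<omega>\<close>. So the image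
  of area is at most \<open>tube_const\<close> times arc length, which replaces a change of
  variables in charts.\<close>

lemma exit_integral_le:
  fixes h :: "real^2 \<Rightarrow> ennreal"
  assumes h [measurable]: "h \<in> borel_measurable borel"
  shows "(\<integral>\<^sup>+x. indicator \<omega> x * h (exitpt e x) \<partial>lborel) \<le> ennreal tube_const * (\<integral>\<^sup>+x. h x \<partial>arc_length \<omega>)"
proof -
  note [measurable] = exitpt_measurable
  have om [measurable]: "\<omega> \<in> sets borel" using open_om by simp
  let ?N = "distr (vol \<omega>) borel (exitpt e)"
  let ?N' = "scale_measure (ennreal tube_const) (distr (arc_length \<omega>) borel (\<lambda>x. x))"
  note [measurable] = ident_measurable_arc_length
  have em [measurable]: "exitpt e \<in> vol \<omega> \<rightarrow>\<^sub>M borel" by (rule measurable_restrict_space1) simp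
  have "?N \<le> ?N'"
  proof (subst le_measure)
    show "\<forall>A\<in>sets ?N. emeasure ?N A \<le> emeasure ?N' A"
    proof
      fix A assume "A \<in> sets ?N"
      then have A [measurable]: "A \<in> sets borel" by simp
      have "emeasure ?N A = emeasure (vol \<omega>) (exitpt e -` A \<inter> space (vol \<omega>))"
        by (rule emeasure_distr) auto
      also have "\<dots> = emeasure lborel (exitpt e -` A \<inter> \<omega>)"
        by (subst emeasure_restrict_space) (auto simp: space_restrict_space)
      also have "\<dots> \<le> ennreal (4 * pi * (width + 2)) * hausdorff1_outer (A \<inter> frontier \<omega>)"
      proof (rule tube_measure_hausdorff1[OF e less_imp_le[OF width(1)]])
        fix x assume x: "x \<in> exitpt e -` A \<inter> \<omega>"
        then have "exitpt e x \<in> A \<inter> frontier \<omega>" using exitpt_frontier by auto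
        moreover have "x = exitpt e x + exitlen e x *\<^sub>R e" by (simp add: exitpt_def)
        ultimately show "\<exists>q\<in>A \<inter> frontier \<omega>. \<exists>t. 0 \<le> t \<and> t \<le> width \<and> x = q + t *\<^sub>R e"
          using exitlen_props(1,5) x by blast
      qed
      also have "hausdorff1_outer (A \<inter> frontier \<omega>) = emeasure hausdorff1 (A \<inter> frontier \<omega>)"
        by (rule emeasure_hausdorff1[symmetric]) simp
      also have "\<dots> = emeasure (arc_length \<omega>) (A \<inter> frontier \<omega>)"
        unfolding arc_length_def by (rule emeasure_restrict_space[symmetric]) auto
      also have "\<dots> = emeasure (distr (arc_length \<omega>) borel (\<lambda>x. x)) A"
        by (subst emeasure_distr) (auto simp: space_arc_length)
      finally show "emeasure ?N A \<le> emeasure ?N' A" by (simp add: tube_const_def)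
    qed
  qed simp
  have "(\<integral>\<^sup>+x. indicator \<omega> x * h (exitpt e x) \<partial>lborel) = (\<integral>\<^sup>+x. h (exitpt e x) \<partial>vol \<omega>)"
    by (subst nn_integral_restrict_space) (auto simp: mult.commute)
  also have "\<dots> = (\<integral>\<^sup>+x. h x \<partial>?N)" by (rule nn_integral_distr[symmetric]) auto
  also have "\<dots> \<le> (\<integral>\<^sup>+x. h x \<partial>?N')" by (rule nn_integral_mono_measure[OF _ \<open>?N \<le> ?N'\<close>]) simp
  also have "\<dots> = ennreal tube_const * (\<integral>\<^sup>+x. h x \<partial>distr (arc_length \<omega>) borel (\<lambda>x. x))"
    by (rule nn_integral_scale_measure) simp
  also have "(\<integral>\<^sup>+x. h x \<partial>distr (arc_length \<omega>) borel (\<lambda>x. x)) = (\<integral>\<^sup>+x. h x \<partial>arc_length \<omega>)"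
    by (rule nn_integral_distr) auto
  finally show ?thesis .
qed

end
end

section \<open>Poincare inequalities on strips\<close>

context lipschitz_domain
begin

text \<open>The value at \<open>x\<close> is compared with the value at the exit point. The boundary
  term is handled by \<open>exit_integral_le\<close>; in the derivative term Fubini and translation
  invariance produce a second factor \<open>r\<close>. Since segments towards the exit stay in
  \<open>S\<close>, only the derivative on \<open>S\<close> enters.\<close>

lemma strip_slice:
  fixes F :: "real^2 \<Rightarrow> real" and k :: "real^2 \<Rightarrow> real"
  assumes e: "norm e = 1" and S: "S \<in> sets borel" "S \<subseteq> \<omega>"
    and left: "\<And>x t. x \<in> S \<Longrightarrow> 0 \<le> t \<Longrightarrow> t < exitlen e x \<Longrightarrow> x - t *\<^sub>R e \<in> S"
    and r: "\<And>x. x \<in> S \<Longrightarrow> exitlen e x \<le> r" "0 \<le> r"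
    and F: "continuous_on UNIV F" "continuous_on UNIV k"
    and d: "\<And>x t. ((\<lambda>t. F (x - t *\<^sub>R e)) has_real_derivative - k (x - t *\<^sub>R e)) (at t)"
  shows "(\<integral>\<^sup>+x. indicator S x * ennreal ((F x)\<^sup>2) \<partial>lborel) \<le>
     ennreal (2 * tube_const) * (\<integral>\<^sup>+x. ennreal ((F x)\<^sup>2) \<partial>arc_length \<omega>) +
     ennreal (2 * r\<^sup>2) * (\<integral>\<^sup>+x. indicator S x * ennreal ((k x)\<^sup>2) \<partial>lborel)"
proof -
  have [measurable]: "F \<in> borel_measurable borel" "k \<in> borel_measurable borel"
    using F by (auto intro: borel_measurable_continuous_onI)
  note [measurable] = S(1) exitpt_measurable[OF e]
  have [measurable]: "\<omega> \<in> sets borel" using open_om by simp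
  define \<kappa> where "\<kappa> y = indicator S y * ennreal ((k y)\<^sup>2)" for y
  have [measurable]: "\<kappa> \<in> borel_measurable borel" unfolding \<kappa>_def by measurable
  have pt: "indicator S x * ennreal ((F x)\<^sup>2) \<le> 2 * (indicator \<omega> x * ennreal ((F (exitpt e x))\<^sup>2)) +
      ennreal (2 * r) * (\<integral>\<^sup>+t. indicator {0..r} t * \<kappa> (x - t *\<^sub>R e) \<partial>lborel)" for x
  proof (cases "x \<in> S")
    case True
    let ?l = "exitlen e x"
    have l: "0 \<le> ?l" by (rule exitlen_props(1)[OF e])
    have kc: "continuous_on UNIV (\<lambda>t. - k (x - t *\<^sub>R e))"
      by (intro continuous_intros continuous_on_compose2[OF F(2)]) auto
    have 1: "ennreal ((F (x - ?l *\<^sub>R e) - F (x - 0 *\<^sub>R e))\<^sup>2) \<le> ennreal ?l * (\<integral>\<^sup>+t. indicator {0..<?l} t * ennreal ((- k (x - t *\<^sub>R e))\<^sup>2) \<partial>lborel)"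
      by (rule FTC_square[OF d kc l])
    also have "\<dots> \<le> ennreal r * (\<integral>\<^sup>+t. indicator {0..r} t * \<kappa> (x - t *\<^sub>R e) \<partial>lborel)"
    proof (rule mult_mono[OF ennreal_leI[OF r(1)[OF True]] nn_integral_mono])
      fix t :: real
      show "indicator {0..<?l} t * ennreal ((- k (x - t *\<^sub>R e))\<^sup>2) \<le> indicator {0..r} t * \<kappa> (x - t *\<^sub>R e)"
        using left[OF True, of t] r(1)[OF True] by (auto simp: indicator_def \<kappa>_def)
    qed auto
    finally have 2: "ennreal ((F (exitpt e x) - F x)\<^sup>2) \<le> ennreal r * (\<integral>\<^sup>+t. indicator {0..r} t * \<kappa> (x - t *\<^sub>R e) \<partial>lborel)"
      by (simp add: exitpt_def)
    have "(F x)\<^sup>2 \<le> 2 * (F (exitpt e x))\<^sup>2 + 2 * (F (exitpt e x) - F x)\<^sup>2"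
      using sum_squares_bound[of "F (exitpt e x)" "F x - F (exitpt e x)"] by (simp add: power2_eq_square algebra_simps)
    then have "ennreal ((F x)\<^sup>2) \<le> ennreal (2 * (F (exitpt e x))\<^sup>2 + 2 * (F (exitpt e x) - F x)\<^sup>2)" by (rule ennreal_leI)
    also have "\<dots> = 2 * ennreal ((F (exitpt e x))\<^sup>2) + 2 * ennreal ((F (exitpt e x) - F x)\<^sup>2)"
      by (simp add: ennreal_plus ennreal_mult')
    also have "\<dots> \<le> 2 * ennreal ((F (exitpt e x))\<^sup>2) + 2 * (ennreal r * (\<integral>\<^sup>+t. indicator {0..r} t * \<kappa> (x - t *\<^sub>R e) \<partial>lborel))"
      by (intro add_left_mono mult_left_mono 2) auto
    finally show ?thesis using True S(2) r(2) by (auto simp: ennreal_mult' mult.assoc)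
  qed simp
  have "(\<integral>\<^sup>+x. indicator S x * ennreal ((F x)\<^sup>2) \<partial>lborel) \<le> (\<integral>\<^sup>+x. 2 * (indicator \<omega> x * ennreal ((F (exitpt e x))\<^sup>2)) +
      ennreal (2 * r) * (\<integral>\<^sup>+t. indicator {0..r} t * \<kappa> (x - t *\<^sub>R e) \<partial>lborel) \<partial>lborel)"
    by (intro nn_integral_mono pt)
  also have "\<dots> = 2 * (\<integral>\<^sup>+x. indicator \<omega> x * ennreal ((F (exitpt e x))\<^sup>2) \<partial>lborel) +
      ennreal (2 * r) * (\<integral>\<^sup>+x. (\<integral>\<^sup>+t. indicator {0..r} t * \<kappa> (x - t *\<^sub>R e) \<partial>lborel) \<partial>lborel)"
    by (subst nn_integral_add; (subst nn_integral_cmult)?; (subst nn_integral_cmult)?) measurable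
  also have "(\<integral>\<^sup>+x. (\<integral>\<^sup>+t. indicator {0..r} t * \<kappa> (x - t *\<^sub>R e) \<partial>lborel) \<partial>lborel)
      = (\<integral>\<^sup>+t. (\<integral>\<^sup>+x. indicator {0..r} t * \<kappa> (x - t *\<^sub>R e) \<partial>lborel) \<partial>lborel)"
    by (rule lborel_pair.Fubini'[symmetric]) measurable
  also have "\<dots> = (\<integral>\<^sup>+t. indicator {0..r} t * (\<integral>\<^sup>+x. \<kappa> x \<partial>lborel) \<partial>lborel)"
  proof (rule nn_integral_cong)
    fix t :: real
    have "(\<integral>\<^sup>+x. indicator {0..r} t * \<kappa> (x - t *\<^sub>R e) \<partial>lborel) = indicator {0..r} t * (\<integral>\<^sup>+x. \<kappa> (x + - (t *\<^sub>R e)) \<partial>lborel)"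
      by (subst nn_integral_cmult) simp_all
    then show "(\<integral>\<^sup>+x. indicator {0..r} t * \<kappa> (x - t *\<^sub>R e) \<partial>lborel) = indicator {0..r} t * (\<integral>\<^sup>+x. \<kappa> x \<partial>lborel)"
      by (subst (asm) nn_integral_translation) simp_all
  qed
  also have "\<dots> = ennreal r * (\<integral>\<^sup>+x. \<kappa> x \<partial>lborel)"
    using r(2) by (subst nn_integral_multc) simp_all
  also have "2 * (\<integral>\<^sup>+x. indicator \<omega> x * ennreal ((F (exitpt e x))\<^sup>2) \<partial>lborel) + ennreal (2 * r) * (ennreal r * (\<integral>\<^sup>+x. \<kappa> x \<partial>lborel)) \<le>
    2 * (ennreal tube_const * (\<integral>\<^sup>+x. ennreal ((F x)\<^sup>2) \<partial>arc_length \<omega>)) + ennreal (2 * r) * (ennreal r * (\<integral>\<^sup>+x. \<kappa> x \<partial>lborel))"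
    by (intro add_right_mono mult_left_mono exit_integral_le[OF e]) auto
  also have "\<dots> = ennreal (2 * tube_const) * (\<integral>\<^sup>+x. ennreal ((F x)\<^sup>2) \<partial>arc_length \<omega>) + ennreal (2 * r\<^sup>2) * (\<integral>\<^sup>+x. \<kappa> x \<partial>lborel)"
    using r(2) by (simp add: ennreal_mult' mult.assoc power2_eq_square)
  finally show ?thesis unfolding \<kappa>_def .
qed

text \<open>\<open>strip_slice\<close> at each height, integrated along the axis. Only the
  derivative in the direction \<open>(e, 0)\<close> occurs, since the segments stay at constant
  height.\<close>

lemma strip_test:
  assumes e: "norm e = 1" and S: "S \<in> sets borel" "S \<subseteq> \<omega>"
    and left: "\<And>x t. x \<in> S \<Longrightarrow> 0 \<le> t \<Longrightarrow> t < exitlen e x \<Longrightarrow> x - t *\<^sub>R e \<in> S"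
    and r: "\<And>x. x \<in> S \<Longrightarrow> exitlen e x \<le> r" "0 \<le> r"
    and \<phi>: "\<phi> \<in> C1c UNIV" "C1_grad \<phi> G"
  shows "(L2_norm (vol (S \<times> UNIV)) \<phi>)\<^sup>2 \<le> 2 * tube_const * (L2_norm (surface \<omega>) \<phi>)\<^sup>2 +
     2 * r\<^sup>2 * (L2_norm (vol (S \<times> UNIV)) (\<lambda>x. G x \<bullet> (e, 0)))\<^sup>2"
proof -
  interpret A: sigma_finite_measure "arc_length \<omega>" by (rule sigma_finite_arc_length)
  interpret AP: pair_sigma_finite "arc_length \<omega>" "lborel :: real measure" ..
  note C = C1_gradD[OF \<phi>(2)]
  note [measurable] = C(5,6) S(1)
  have tc: "tube_const \<ge> 0" using width(1) e by (simp add: tube_const_def)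
  have SU [measurable]: "S \<times> UNIV \<in> sets (borel :: ((real^2) \<times> real) measure)"
    unfolding borel_prod[symmetric] by (intro pair_measureI) auto
  have SO: "S \<times> UNIV \<subseteq> \<Omega>" using S(2) by (auto simp: waveguide_def)
  have OB: "\<Omega> \<in> sets borel" using open_waveguide by simp
  define k where "k x = G x \<bullet> (e, 0)" for x
  have kc: "continuous_on UNIV k" unfolding k_def using C(1) by (intro continuous_intros)
  then have [measurable]: "k \<in> borel_measurable borel" by (rule borel_measurable_continuous_onI)
  have km: "k \<in> borel_measurable (vol \<Omega>)" by (rule measurable_restrict_space1) simp
  have kL: "k \<in> L2 (vol \<Omega>)"
    using L2_bound(1)[OF C1c_L2(2)[OF \<phi>], of k 1] Cauchy_Schwarz_ineq2[of "G _" "(e, 0)"] e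
      km by (auto simp: k_def norm_Pair)
  note LS = L2_vol_subset[OF C1c_L2(1)[OF \<phi>] SO SU OB] L2_vol_subset[OF kL SO SU OB]
  have fub: "(\<integral>\<^sup>+x. ennreal ((norm (f x))\<^sup>2) \<partial>vol (S \<times> UNIV)) = (\<integral>\<^sup>+s. \<integral>\<^sup>+x. indicator S x * ennreal ((f (x, s))\<^sup>2) \<partial>lborel \<partial>lborel)"
    if [measurable]: "f \<in> borel_measurable borel" for f :: "(real^2) \<times> real \<Rightarrow> real"
  proof -
    have "(\<integral>\<^sup>+x. ennreal ((norm (f x))\<^sup>2) \<partial>vol (S \<times> UNIV)) = (\<integral>\<^sup>+x. indicator (S \<times> UNIV) x * ennreal ((f x)\<^sup>2) \<partial>(lborel \<Otimes>\<^sub>M lborel))"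
      by (subst nn_integral_restrict_space) (auto simp: lborel_prod mult.commute)
    also have "\<dots> = (\<integral>\<^sup>+s. \<integral>\<^sup>+x. indicator (S \<times> UNIV) (x, s) * ennreal ((f (x, s))\<^sup>2) \<partial>lborel \<partial>lborel)"
    proof (rule lborel_pair.nn_integral_snd[symmetric])
      have "(\<lambda>x. indicator (S \<times> UNIV) x * ennreal ((f x)\<^sup>2)) \<in> borel_measurable borel" by measurable
      then show "(\<lambda>x. indicator (S \<times> UNIV) x * ennreal ((f x)\<^sup>2)) \<in> borel_measurable (lborel \<Otimes>\<^sub>M lborel)"
        by (simp add: lborel_prod)
    qed
    also have "\<dots> = (\<integral>\<^sup>+s. \<integral>\<^sup>+x. indicator S x * ennreal ((f (x, s))\<^sup>2) \<partial>lborel \<partial>lborel)"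
      by (intro nn_integral_cong) (auto simp: indicator_def)
    finally show ?thesis .
  qed
  have ms: "(\<lambda>s. \<integral>\<^sup>+x. indicator S x * ennreal ((f (x, s))\<^sup>2) \<partial>lborel) \<in> borel_measurable borel"
    if [measurable]: "f \<in> borel_measurable borel" for f :: "(real^2) \<times> real \<Rightarrow> real"
  proof -
    have "f \<in> borel_measurable (borel \<Otimes>\<^sub>M borel)" by (simp add: borel_prod)
    then show ?thesis by measurable
  qed
  have "(\<integral>\<^sup>+x. ennreal ((norm (\<phi> x))\<^sup>2) \<partial>vol (S \<times> UNIV)) = (\<integral>\<^sup>+s. \<integral>\<^sup>+x. indicator S x * ennreal ((\<phi> (x, s))\<^sup>2) \<partial>lborel \<partial>lborel)"
    by (rule fub) simp
  also have "\<dots> \<le> (\<integral>\<^sup>+s. ennreal (2 * tube_const) * (\<integral>\<^sup>+x. ennreal ((\<phi> (x, s))\<^sup>2) \<partial>arc_length \<omega>) +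
      ennreal (2 * r\<^sup>2) * (\<integral>\<^sup>+x. indicator S x * ennreal ((k (x, s))\<^sup>2) \<partial>lborel) \<partial>lborel)"
  proof (intro nn_integral_mono strip_slice[OF e S left r])
    fix s
    show "continuous_on UNIV (\<lambda>x. \<phi> (x, s))" "continuous_on UNIV (\<lambda>x. k (x, s))"
      by (intro continuous_on_compose2[OF C(3)] continuous_on_compose2[OF kc] continuous_intros; simp)+
    fix x t
    have "((\<lambda>t. \<phi> (x - t *\<^sub>R e, s)) has_derivative (\<lambda>h. G (x - t *\<^sub>R e, s) \<bullet> (- (h *\<^sub>R e), 0))) (at t)"
      by (rule has_derivative_compose[where f="\<lambda>t. (x - t *\<^sub>R e, s)", OF _ C(2)])
         (auto intro!: derivative_eq_intros)
    also have "(\<lambda>h. G (x - t *\<^sub>R e, s) \<bullet> (- (h *\<^sub>R e), 0)) = (*) (- k (x - t *\<^sub>R e, s))"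
      by (auto simp: k_def inner_prod_def)
    finally show "((\<lambda>t. \<phi> (x - t *\<^sub>R e, s)) has_real_derivative - k (x - t *\<^sub>R e, s)) (at t)"
      unfolding has_field_derivative_def .
  qed auto
  also have "\<dots> = ennreal (2 * tube_const) * (\<integral>\<^sup>+s. \<integral>\<^sup>+x. ennreal ((\<phi> (x, s))\<^sup>2) \<partial>arc_length \<omega> \<partial>lborel) +
      ennreal (2 * r\<^sup>2) * (\<integral>\<^sup>+s. \<integral>\<^sup>+x. indicator S x * ennreal ((k (x, s))\<^sup>2) \<partial>lborel \<partial>lborel)"
  proof -
    have p: "(\<lambda>(s, x). ennreal ((\<phi> (x, s))\<^sup>2)) \<in> borel_measurable (lborel \<Otimes>\<^sub>M arc_length \<omega>)"
    proof -
      have "(\<lambda>x. ennreal ((\<phi> x)\<^sup>2)) \<in> borel_measurable (arc_length \<omega> \<Otimes>\<^sub>M lborel)"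
        using borel_measurable_surface[of "\<lambda>x. ennreal ((\<phi> x)\<^sup>2)"] by (simp add: surface_def)
      then show ?thesis by (subst measurable_pair_swap_iff) (simp add: case_prod_beta split_beta')
    qed
    have [measurable]: "(\<lambda>s. \<integral>\<^sup>+x. ennreal ((\<phi> (x, s))\<^sup>2) \<partial>arc_length \<omega>) \<in> borel_measurable lborel"
      using A.borel_measurable_nn_integral[OF p] by simp
    note [measurable] = ms[of k]
    show ?thesis by (simp add: nn_integral_add nn_integral_cmult)
  qed
  also have "(\<integral>\<^sup>+s. \<integral>\<^sup>+x. ennreal ((\<phi> (x, s))\<^sup>2) \<partial>arc_length \<omega> \<partial>lborel) = (\<integral>\<^sup>+x. ennreal ((norm (\<phi> x))\<^sup>2) \<partial>surface \<omega>)"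
    using AP.nn_integral_snd[of "\<lambda>x. ennreal ((\<phi> x)\<^sup>2)"] borel_measurable_surface[of "\<lambda>x. ennreal ((\<phi> x)\<^sup>2)"]
    by (simp add: surface_def)
  also have "(\<integral>\<^sup>+s. \<integral>\<^sup>+x. indicator S x * ennreal ((k (x, s))\<^sup>2) \<partial>lborel \<partial>lborel) = (\<integral>\<^sup>+x. ennreal ((norm (k x))\<^sup>2) \<partial>vol (S \<times> UNIV))"
    by (rule fub[symmetric]) simp
  finally have "ennreal ((L2_norm (vol (S \<times> UNIV)) \<phi>)\<^sup>2) \<le> ennreal (2 * tube_const) * ennreal ((L2_norm (surface \<omega>) \<phi>)\<^sup>2) +
     ennreal (2 * r\<^sup>2) * ennreal ((L2_norm (vol (S \<times> UNIV)) k)\<^sup>2)"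
    unfolding L2_norm_sq_nn[OF LS(1)] L2_norm_sq_nn[OF LS(3)] L2_norm_sq_nn[OF C1c_L2(3)[OF \<phi>]] .
  then have "ennreal ((L2_norm (vol (S \<times> UNIV)) \<phi>)\<^sup>2) \<le> ennreal (2 * tube_const * (L2_norm (surface \<omega>) \<phi>)\<^sup>2 +
     2 * r\<^sup>2 * (L2_norm (vol (S \<times> UNIV)) k)\<^sup>2)"
    using tc by (simp add: ennreal_mult'[symmetric] ennreal_plus[symmetric] del: ennreal_plus)
  then show ?thesis using tc unfolding k_def[abs_def] by (subst (asm) ennreal_le_iff) auto
qed

lemma L2_lim_subset:
  fixes f :: "nat \<Rightarrow> (real^2) \<times> real \<Rightarrow> 'b::euclidean_space"
  assumes "\<And>n. f n \<in> L2 (vol \<Omega>)" "g \<in> L2 (vol \<Omega>)" "(\<lambda>n. L2_norm (vol \<Omega>) (\<lambda>x. f n x - g x)) \<longlonglongrightarrow> 0"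
    "Q \<subseteq> \<Omega>" "Q \<in> sets borel"
  shows "(\<lambda>n. L2_norm (vol Q) (\<lambda>x. f n x - g x)) \<longlonglongrightarrow> 0"
proof (rule tendsto_sandwich[OF _ _ tendsto_const assms(3)])
  have OB: "\<Omega> \<in> sets borel" using open_waveguide by simp
  show "\<forall>\<^sub>F n in sequentially. L2_norm (vol Q) (\<lambda>x. f n x - g x) \<le> L2_norm (vol \<Omega>) (\<lambda>x. f n x - g x)"
    by (intro always_eventually allI L2_vol_subset(2)[OF L2_diff[OF assms(1,2)] assms(4,5) OB])
qed simp

lemma L2_inner_const:
  fixes f :: "'a \<Rightarrow> 'b::euclidean_space"
  assumes "f \<in> L2 M" shows "(\<lambda>x. f x \<bullet> c) \<in> L2 M" "L2_norm M (\<lambda>x. f x \<bullet> c) \<le> norm c * L2_norm M f"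
proof -
  have m: "(\<lambda>x. f x \<bullet> c) \<in> borel_measurable M" using assms by (auto simp: L2_def)
  have "norm (f x \<bullet> c) \<le> norm c * norm (f x)" for x using Cauchy_Schwarz_ineq2[of "f x" c] by (simp add: mult.commute)
  from L2_bound[OF assms m AE_I2[OF this]] show "(\<lambda>x. f x \<bullet> c) \<in> L2 M" "L2_norm M (\<lambda>x. f x \<bullet> c) \<le> norm c * L2_norm M f" by auto
qed

text \<open>The boundary term of \<open>strip_test\<close> tends to zero with the traces of the
  approximants. The factor \<open>r\<^sup>2\<close> is what makes thin layers contribute
  little.\<close>

lemma strip_tr:
  assumes e: "norm e = 1" and S: "S \<in> sets borel" "S \<subseteq> \<omega>"
    and left: "\<And>x t. x \<in> S \<Longrightarrow> 0 \<le> t \<Longrightarrow> t < exitlen e x \<Longrightarrow> x - t *\<^sub>R e \<in> S"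
    and r: "\<And>x. x \<in> S \<Longrightarrow> exitlen e x \<le> r" "0 \<le> r"
    and t: "tr v g (\<lambda>x. 0)"
  shows "(L2_norm (vol (S \<times> UNIV)) v)\<^sup>2 \<le> 2 * r\<^sup>2 * (L2_norm (vol (S \<times> UNIV)) (\<lambda>x. g x \<bullet> (e, 0)))\<^sup>2"
proof -
  obtain \<phi> G where 1: "\<And>n::nat. \<phi> n \<in> C1c UNIV" "\<And>n. C1_grad (\<phi> n) (G n)"
    "(\<lambda>n. L2_norm (vol \<Omega>) (\<lambda>x. \<phi> n x - v x)) \<longlonglongrightarrow> 0"
    "(\<lambda>n. L2_norm (vol \<Omega>) (\<lambda>x. G n x - g x)) \<longlonglongrightarrow> 0"
    "(\<lambda>n. L2_norm (surface \<omega>) (\<lambda>x. \<phi> n x - 0)) \<longlonglongrightarrow> 0" by (rule trE[OF t]) (rule that)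
  have SU [measurable]: "S \<times> UNIV \<in> sets (borel :: ((real^2) \<times> real) measure)"
    unfolding borel_prod[symmetric] using S(1) by (intro pair_measureI) auto
  have SO: "S \<times> UNIV \<subseteq> \<Omega>" using S(2) by (auto simp: waveguide_def)
  have OB: "\<Omega> \<in> sets borel" using open_waveguide by simp
  note C = C1c_L2[OF 1(1,2)]
  note T = trD[OF t]
  have l1: "(\<lambda>n. L2_norm (vol (S \<times> UNIV)) (\<phi> n)) \<longlonglongrightarrow> L2_norm (vol (S \<times> UNIV)) v"
    by (rule L2_norm_tendsto[OF L2_vol_subset(1)[OF C(1) SO SU OB] L2_vol_subset(1)[OF T(1) SO SU OB]
        L2_lim_subset[OF C(1) T(1) 1(3) SO SU]])
  have "(\<lambda>n. L2_norm (vol \<Omega>) (\<lambda>x. G n x \<bullet> (e, 0) - g x \<bullet> (e, 0))) \<longlonglongrightarrow> 0"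
  proof (rule tendsto_sandwich[OF _ _ tendsto_const 1(4)])
    show "\<forall>\<^sub>F n in sequentially. L2_norm (vol \<Omega>) (\<lambda>x. G n x \<bullet> (e, 0) - g x \<bullet> (e, 0)) \<le> L2_norm (vol \<Omega>) (\<lambda>x. G n x - g x)"
      using L2_inner_const(2)[OF L2_diff[OF C(2) T(2)], of _ "(e, 0)"] e
      by (auto intro!: always_eventually simp: inner_diff_left norm_Pair)
  qed simp
  from L2_lim_subset[OF L2_inner_const(1)[OF C(2)] L2_inner_const(1)[OF T(2)] this SO SU]
  have l2: "(\<lambda>n. L2_norm (vol (S \<times> UNIV)) (\<lambda>x. G n x \<bullet> (e, 0))) \<longlonglongrightarrow> L2_norm (vol (S \<times> UNIV)) (\<lambda>x. g x \<bullet> (e, 0))"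
    by (rule L2_norm_tendsto[OF L2_vol_subset(1)[OF L2_inner_const(1)[OF C(2)] SO SU OB] L2_vol_subset(1)[OF L2_inner_const(1)[OF T(2)] SO SU OB]])
  have "(\<lambda>n. 2 * tube_const * (L2_norm (surface \<omega>) (\<lambda>x. \<phi> n x - 0))\<^sup>2 + 2 * r\<^sup>2 * (L2_norm (vol (S \<times> UNIV)) (\<lambda>x. G n x \<bullet> (e, 0)))\<^sup>2)
    \<longlonglongrightarrow> 2 * tube_const * 0\<^sup>2 + 2 * r\<^sup>2 * (L2_norm (vol (S \<times> UNIV)) (\<lambda>x. g x \<bullet> (e, 0)))\<^sup>2"
    by (intro tendsto_intros 1(5) l2)
  moreover have "(\<lambda>n. (L2_norm (vol (S \<times> UNIV)) (\<phi> n))\<^sup>2) \<longlonglongrightarrow> (L2_norm (vol (S \<times> UNIV)) v)\<^sup>2"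
    by (intro tendsto_intros l1)
  ultimately show ?thesis
    using LIMSEQ_le[of "\<lambda>n. (L2_norm (vol (S \<times> UNIV)) (\<phi> n))\<^sup>2"] strip_test[OF e S left r 1(1,2)] by fastforce
qed

lemma poincare:
  assumes "tr v g (\<lambda>x. 0)"
  shows "(L2_norm (vol \<Omega>) v)\<^sup>2 \<le> 2 * width\<^sup>2 * (L2_norm (vol \<Omega>) g)\<^sup>2"
proof -
  define e :: "real^2" where "e = axis 1 1"
  have e: "norm e = 1" by (simp add: e_def norm_axis_1)
  have "(L2_norm (vol (\<omega> \<times> UNIV)) v)\<^sup>2 \<le> 2 * width\<^sup>2 * (L2_norm (vol (\<omega> \<times> UNIV)) (\<lambda>x. g x \<bullet> (e, 0)))\<^sup>2"
    by (rule strip_tr[OF e _ _ _ _ _ assms]) (use open_om exitlen_props(3,5)[OF e] width(1) in auto)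
  also have "(L2_norm (vol (\<omega> \<times> UNIV)) (\<lambda>x. g x \<bullet> (e, 0)))\<^sup>2 \<le> (L2_norm (vol (\<omega> \<times> UNIV)) g)\<^sup>2"
    using L2_inner_const(2)[of g "vol (\<omega> \<times> UNIV)" "(e, 0)"] trD(2)[OF assms] e
    by (intro power_mono) (auto simp: waveguide_def norm_Pair)
  finally show ?thesis by (simp add: waveguide_def mult_left_mono)
qed

end

section \<open>Local compactness\<close>

text \<open>The Jacobian factor of a dilation by at least 1/2 is at most 2 per dimension.\<close>

lemma nn_integral_dilation_le:
  fixes f :: "'a::euclidean_space \<Rightarrow> ennreal"
  assumes [measurable]: "f \<in> borel_measurable borel" and t: "1/2 \<le> t"
  shows "(\<integral>\<^sup>+x. f (c + t *\<^sub>R x) \<partial>lborel) \<le> ennreal (2 ^ DIM('a)) * (\<integral>\<^sup>+x. f x \<partial>lborel)"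
proof -
  have "(\<integral>\<^sup>+x. f x \<partial>lborel) = (\<integral>\<^sup>+x. f x \<partial>density (distr lborel borel (\<lambda>x. c + t *\<^sub>R x)) (\<lambda>_. ennreal (\<bar>t\<bar> ^ DIM('a))))"
    using t by (subst lborel_affine[of t c]) auto
  also have "\<dots> = ennreal (\<bar>t\<bar> ^ DIM('a)) * (\<integral>\<^sup>+x. f (c + t *\<^sub>R x) \<partial>lborel)"
    by (subst nn_integral_density) (simp_all add: nn_integral_distr nn_integral_cmult)
  finally have eq: "(\<integral>\<^sup>+x. f x \<partial>lborel) = ennreal (\<bar>t\<bar> ^ DIM('a)) * (\<integral>\<^sup>+x. f (c + t *\<^sub>R x) \<partial>lborel)" .
  have "1 \<le> (2 * \<bar>t\<bar>) ^ DIM('a)" using t by (intro one_le_power) auto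
  then have "1 \<le> ennreal (2 ^ DIM('a)) * ennreal (\<bar>t\<bar> ^ DIM('a))"
    by (simp add: ennreal_mult'[symmetric] power_mult_distrib flip: ennreal_1)
  then have "1 * (\<integral>\<^sup>+x. f (c + t *\<^sub>R x) \<partial>lborel) \<le> (ennreal (2 ^ DIM('a)) * ennreal (\<bar>t\<bar> ^ DIM('a))) * (\<integral>\<^sup>+x. f (c + t *\<^sub>R x) \<partial>lborel)"
    by (intro mult_right_mono) auto
  then show ?thesis by (simp add: eq mult.assoc)
qed

text \<open>On the segment from \<open>x\<close> to \<open>y\<close>, the substitution in \<open>y\<close> is harmless for \<open>t \<ge> 1/2\<close>, and the
  substitution in \<open>x\<close> for \<open>t \<le> 1/2\<close>.\<close>

lemma segment_integral_le:
  fixes H :: "'a::euclidean_space \<Rightarrow> ennreal"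
  assumes [measurable]: "H \<in> borel_measurable borel" "Q \<in> sets borel"
  shows "(\<integral>\<^sup>+x. \<integral>\<^sup>+y. \<integral>\<^sup>+t. indicator Q x * indicator Q y * indicator {0..<1::real} t * H (x + t *\<^sub>R (y - x)) \<partial>lborel \<partial>lborel \<partial>lborel)
    \<le> emeasure lborel Q * (ennreal (2 ^ DIM('a)) * (\<integral>\<^sup>+z. H z \<partial>lborel))"
proof -
  let ?I = "ennreal (2 ^ DIM('a)) * (\<integral>\<^sup>+z. H z \<partial>lborel)"
  define W1 where "W1 x y t = indicator Q x * indicator {1/2..<1::real} t * H (x + t *\<^sub>R (y - x))" for x y t
  define W2 where "W2 x y t = indicator Q y * indicator {0..<1/2::real} t * H (x + t *\<^sub>R (y - x))" for x y t
  have [measurable]: "(\<lambda>(x, y, t). W1 x y t) \<in> borel_measurable (borel \<Otimes>\<^sub>M borel \<Otimes>\<^sub>M borel)"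
     "(\<lambda>(x, y, t). W2 x y t) \<in> borel_measurable (borel \<Otimes>\<^sub>M borel \<Otimes>\<^sub>M borel)"
    unfolding W1_def W2_def by measurable
  have half: "ennreal (1/2) * c + ennreal (1/2) * c = c" for c
  proof -
    have h: "ennreal (1/2) + ennreal (1/2) = ennreal (1/2 + 1/2)" by (rule ennreal_plus[symmetric]) auto
    show ?thesis unfolding distrib_right[symmetric] h by simp
  qed
  have "(\<integral>\<^sup>+x. \<integral>\<^sup>+y. \<integral>\<^sup>+t. W1 x y t \<partial>lborel \<partial>lborel \<partial>lborel) = (\<integral>\<^sup>+x. \<integral>\<^sup>+t. \<integral>\<^sup>+y. W1 x y t \<partial>lborel \<partial>lborel \<partial>lborel)"
    by (intro nn_integral_cong lborel_pair.Fubini') (simp add: W1_def)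
  also have "\<dots> \<le> (\<integral>\<^sup>+x. \<integral>\<^sup>+t. indicator Q x * (indicator {1/2..<1::real} t * ?I) \<partial>lborel \<partial>lborel)"
  proof (intro nn_integral_mono)
    fix x :: 'a and t :: real
    have "(\<integral>\<^sup>+y. W1 x y t \<partial>lborel) = indicator Q x * indicator {1/2..<1::real} t * (\<integral>\<^sup>+y. H (x + t *\<^sub>R (y - x)) \<partial>lborel)"
      unfolding W1_def by (rule nn_integral_cmult) simp
    also have "\<dots> \<le> indicator Q x * indicator {1/2..<1::real} t * ?I"
    proof (cases "1/2 \<le> t")
      case True
      have "(\<integral>\<^sup>+y. H (x + t *\<^sub>R (y - x)) \<partial>lborel) = (\<integral>\<^sup>+y. H ((x - t *\<^sub>R x) + t *\<^sub>R y) \<partial>lborel)"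
        by (simp add: algebra_simps)
      also have "\<dots> \<le> ?I" by (rule nn_integral_dilation_le[OF _ True]) simp
      finally show ?thesis by (intro mult_left_mono) auto
    qed simp
    finally show "(\<integral>\<^sup>+y. W1 x y t \<partial>lborel) \<le> indicator Q x * (indicator {1/2..<1::real} t * ?I)" by (simp add: mult.assoc)
  qed
  also have "\<dots> = emeasure lborel Q * (ennreal (1/2) * ?I)"
    by (simp add: nn_integral_cmult nn_integral_multc)
  finally have 1: "(\<integral>\<^sup>+x. \<integral>\<^sup>+y. \<integral>\<^sup>+t. W1 x y t \<partial>lborel \<partial>lborel \<partial>lborel) \<le> emeasure lborel Q * (ennreal (1/2) * ?I)" .
  have "(\<integral>\<^sup>+x. \<integral>\<^sup>+y. \<integral>\<^sup>+t. W2 x y t \<partial>lborel \<partial>lborel \<partial>lborel) = (\<integral>\<^sup>+y. \<integral>\<^sup>+x. \<integral>\<^sup>+t. W2 x y t \<partial>lborel \<partial>lborel \<partial>lborel)"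
    unfolding W2_def by (rule lborel_pair.Fubini'[symmetric]) measurable
  also have "\<dots> = (\<integral>\<^sup>+y. \<integral>\<^sup>+t. \<integral>\<^sup>+x. W2 x y t \<partial>lborel \<partial>lborel \<partial>lborel)"
    by (intro nn_integral_cong lborel_pair.Fubini') (simp add: W2_def)
  also have "\<dots> \<le> (\<integral>\<^sup>+y. \<integral>\<^sup>+t. indicator Q y * (indicator {0..<1/2::real} t * ?I) \<partial>lborel \<partial>lborel)"
  proof (intro nn_integral_mono)
    fix y :: 'a and t :: real
    have "(\<integral>\<^sup>+x. W2 x y t \<partial>lborel) = indicator Q y * indicator {0..<1/2::real} t * (\<integral>\<^sup>+x. H (x + t *\<^sub>R (y - x)) \<partial>lborel)"
      unfolding W2_def by (rule nn_integral_cmult) simp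
    also have "\<dots> \<le> indicator Q y * indicator {0..<1/2::real} t * ?I"
    proof (cases "t < 1/2")
      case True
      have "(\<integral>\<^sup>+x. H (x + t *\<^sub>R (y - x)) \<partial>lborel) = (\<integral>\<^sup>+x. H (t *\<^sub>R y + (1 - t) *\<^sub>R x) \<partial>lborel)"
        by (simp add: algebra_simps)
      also have "\<dots> \<le> ?I" by (rule nn_integral_dilation_le) (use True in simp_all)
      finally show ?thesis by (intro mult_left_mono) auto
    qed simp
    finally show "(\<integral>\<^sup>+x. W2 x y t \<partial>lborel) \<le> indicator Q y * (indicator {0..<1/2::real} t * ?I)" by (simp add: mult.assoc)
  qed
  also have "\<dots> = emeasure lborel Q * (ennreal (1/2) * ?I)"
    by (simp add: nn_integral_cmult nn_integral_multc)
  finally have 2: "(\<integral>\<^sup>+x. \<integral>\<^sup>+y. \<integral>\<^sup>+t. W2 x y t \<partial>lborel \<partial>lborel \<partial>lborel) \<le> emeasure lborel Q * (ennreal (1/2) * ?I)" .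
  have "(\<integral>\<^sup>+x. \<integral>\<^sup>+y. \<integral>\<^sup>+t. indicator Q x * indicator Q y * indicator {0..<1::real} t * H (x + t *\<^sub>R (y - x)) \<partial>lborel \<partial>lborel \<partial>lborel)
    \<le> (\<integral>\<^sup>+x. \<integral>\<^sup>+y. \<integral>\<^sup>+t. W1 x y t + W2 x y t \<partial>lborel \<partial>lborel \<partial>lborel)"
    by (intro nn_integral_mono) (auto simp: W1_def W2_def indicator_def)
  also have "\<dots> = (\<integral>\<^sup>+x. \<integral>\<^sup>+y. \<integral>\<^sup>+t. W1 x y t \<partial>lborel \<partial>lborel \<partial>lborel) + (\<integral>\<^sup>+x. \<integral>\<^sup>+y. \<integral>\<^sup>+t. W2 x y t \<partial>lborel \<partial>lborel \<partial>lborel)"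
  proof -
    have m1: "(\<lambda>x. \<integral>\<^sup>+y. \<integral>\<^sup>+t. W1 x y t \<partial>lborel \<partial>lborel) \<in> borel_measurable lborel" unfolding W1_def by measurable
    have m2: "(\<lambda>x. \<integral>\<^sup>+y. \<integral>\<^sup>+t. W2 x y t \<partial>lborel \<partial>lborel) \<in> borel_measurable lborel" unfolding W2_def by measurable
    have "(\<integral>\<^sup>+x. \<integral>\<^sup>+y. \<integral>\<^sup>+t. W1 x y t + W2 x y t \<partial>lborel \<partial>lborel \<partial>lborel)
      = (\<integral>\<^sup>+x. (\<integral>\<^sup>+y. \<integral>\<^sup>+t. W1 x y t \<partial>lborel \<partial>lborel) + (\<integral>\<^sup>+y. \<integral>\<^sup>+t. W2 x y t \<partial>lborel \<partial>lborel) \<partial>lborel)"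
      by (intro nn_integral_cong) (simp add: nn_integral_add)
    also have "\<dots> = (\<integral>\<^sup>+x. \<integral>\<^sup>+y. \<integral>\<^sup>+t. W1 x y t \<partial>lborel \<partial>lborel \<partial>lborel) + (\<integral>\<^sup>+x. \<integral>\<^sup>+y. \<integral>\<^sup>+t. W2 x y t \<partial>lborel \<partial>lborel \<partial>lborel)"
      by (rule nn_integral_add[OF m1 m2])
    finally show ?thesis .
  qed
  also have "\<dots> \<le> emeasure lborel Q * (ennreal (1/2) * ?I) + emeasure lborel Q * (ennreal (1/2) * ?I)"
    by (rule add_mono[OF 1 2])
  also have "\<dots> = emeasure lborel Q * ?I" unfolding distrib_left[of "emeasure lborel Q", symmetric] half ..
  finally show ?thesis .
qed

text \<open>The double integral of \<open>(\<phi> x - \<phi> y)\<^sup>2\<close> over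
  \<open>Q\<close> times \<open>Q\<close> expands into the square norm minus the squared integral,
  while each difference is an integral of the gradient along a segment in \<open>Q\<close>. The
  integral of \<phi> is kept on the right, because approximants of a function with vanishing mean
  have means that only tend to zero.\<close>

lemma poincare_wirtinger_C1:
  fixes \<phi> :: "'a::euclidean_space \<Rightarrow> real"
  assumes Q: "Q \<in> sets borel" "convex Q" "bounded Q" and D: "\<And>x y. x \<in> Q \<Longrightarrow> y \<in> Q \<Longrightarrow> norm (x - y) \<le> D" "0 \<le> D"
    and \<phi>: "C1_grad \<phi> G" and L: "\<phi> \<in> L2 (vol Q)" "G \<in> L2 (vol Q)"
  shows "2 * measure lborel Q * (L2_norm (vol Q) \<phi>)\<^sup>2 \<le> 2 * (LINT x|vol Q. \<phi> x)\<^sup>2 +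
     measure lborel Q * (2 ^ DIM('a) * D\<^sup>2) * (L2_norm (vol Q) G)\<^sup>2"
proof -
  note C = C1_gradD[OF \<phi>]
  note [measurable] = C(5,6) Q(1)
  define m where "m = measure lborel Q"
  have fin: "emeasure lborel Q < \<infinity>" using emeasure_bounded_finite[OF Q(3)] by simp
  have em: "emeasure lborel Q = ennreal m" unfolding m_def by (rule emeasure_eq_ennreal_measure) (use fin in auto)
  have m0: "m \<ge> 0" by (simp add: m_def)
  interpret F: finite_measure "vol Q"
    by (rule finite_measureI) (use fin in \<open>simp add: emeasure_restrict_space space_restrict_space less_top[symmetric]\<close>)
  have mm: "measure (vol Q) (space (vol Q)) = m"
    by (simp add: m_def space_restrict_space measure_restrict_space)
  then have mm': "measure (vol Q) Q = m" by (simp add: space_restrict_space)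
  define I where "I = (LINT x|vol Q. \<phi> x)"
  define J where "J = (L2_norm (vol Q) \<phi>)\<^sup>2"
  have i2: "integrable (vol Q) (\<lambda>x. (\<phi> x)\<^sup>2)" using L(1) by (simp add: L2_def)
  have i1: "integrable (vol Q) \<phi>"
  proof -
    have "(\<lambda>x. 1::real) \<in> L2 (vol Q)" by (simp add: L2_def)
    from L2_mult_integrable(1)[OF L(1) this] show ?thesis by simp
  qed
  have J: "(LINT x|vol Q. (\<phi> x)\<^sup>2) = J" by (simp add: J_def L2_norm_power2)
  have inner: "(\<integral>\<^sup>+y. ennreal ((\<phi> x - \<phi> y)\<^sup>2) \<partial>vol Q) = ennreal ((\<phi> x)\<^sup>2 * m - 2 * \<phi> x * I + J)" for x
  proof -
    have e: "(\<phi> x - \<phi> y)\<^sup>2 = (\<phi> x)\<^sup>2 - (2 * \<phi> x) * \<phi> y + (\<phi> y)\<^sup>2" for y by (simp add: power2_eq_square algebra_simps)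
    have "integrable (vol Q) (\<lambda>y. (\<phi> x - \<phi> y)\<^sup>2)" unfolding e using i1 i2 by simp
    then have "(\<integral>\<^sup>+y. ennreal ((\<phi> x - \<phi> y)\<^sup>2) \<partial>vol Q) = ennreal (LINT y|vol Q. (\<phi> x - \<phi> y)\<^sup>2)"
      by (rule nn_integral_eq_integral) simp
    also have "(LINT y|vol Q. (\<phi> x - \<phi> y)\<^sup>2) = (\<phi> x)\<^sup>2 * m - 2 * \<phi> x * I + J"
      unfolding e using i1 i2 by (simp add: J I_def mm mm' space_restrict_space mult.commute)
    finally show ?thesis .
  qed
  have nn: "0 \<le> (\<phi> x)\<^sup>2 * m - 2 * \<phi> x * I + J" for x
  proof -
    have e: "(\<phi> x - \<phi> y)\<^sup>2 = (\<phi> x)\<^sup>2 - (2 * \<phi> x) * \<phi> y + (\<phi> y)\<^sup>2" for y by (simp add: power2_eq_square algebra_simps)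
    have "0 \<le> (LINT y|vol Q. (\<phi> x - \<phi> y)\<^sup>2)" by simp
    also have "\<dots> = (\<phi> x)\<^sup>2 * m - 2 * \<phi> x * I + J"
      unfolding e using i1 i2 by (simp add: J I_def mm mm' space_restrict_space mult.commute)
    finally show ?thesis .
  qed
  have i3: "integrable (vol Q) (\<lambda>x. (\<phi> x)\<^sup>2 * m - 2 * \<phi> x * I + J)" using i1 i2 by auto
  have "(\<integral>\<^sup>+x. \<integral>\<^sup>+y. ennreal ((\<phi> x - \<phi> y)\<^sup>2) \<partial>vol Q \<partial>vol Q) = ennreal (LINT x|vol Q. (\<phi> x)\<^sup>2 * m - 2 * \<phi> x * I + J)"
    unfolding inner by (rule nn_integral_eq_integral[OF i3]) (use nn in auto)
  also have "(LINT x|vol Q. (\<phi> x)\<^sup>2 * m - 2 * \<phi> x * I + J) = (LINT x|vol Q. (\<phi> x)\<^sup>2) * m - 2 * I * I + J * m"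
    using i1 i2 by (simp add: mm mm' space_restrict_space I_def[symmetric] mult.commute)
  also have "\<dots> = 2 * m * J - 2 * I\<^sup>2" unfolding J by (simp add: power2_eq_square)
  finally have lhs: "(\<integral>\<^sup>+x. \<integral>\<^sup>+y. ennreal ((\<phi> x - \<phi> y)\<^sup>2) \<partial>vol Q \<partial>vol Q) = ennreal (2 * m * J - 2 * I\<^sup>2)" .
  define H where "H z = indicator Q z * ennreal ((norm (G z))\<^sup>2)" for z
  have [measurable]: "H \<in> borel_measurable borel" unfolding H_def by measurable
  have seg: "ennreal ((\<phi> x - \<phi> y)\<^sup>2) \<le> ennreal (D\<^sup>2) * (\<integral>\<^sup>+t. indicator {0..<1} t * H (x + t *\<^sub>R (y - x)) \<partial>lborel)"
    if x: "x \<in> Q" and y: "y \<in> Q" for x y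
  proof -
    let ?k = "\<lambda>t. G (x + t *\<^sub>R (y - x)) \<bullet> (y - x)"
    have "ennreal ((\<phi> (x + 1 *\<^sub>R (y - x)) - \<phi> (x + 0 *\<^sub>R (y - x)))\<^sup>2) \<le> ennreal 1 * (\<integral>\<^sup>+t. indicator {0..<1} t * ennreal ((?k t)\<^sup>2) \<partial>lborel)"
    proof (rule FTC_square)
      fix t
      have "((\<lambda>t. \<phi> (x + t *\<^sub>R (y - x))) has_derivative (\<lambda>h. G (x + t *\<^sub>R (y - x)) \<bullet> (h *\<^sub>R (y - x)))) (at t)"
        by (rule has_derivative_compose[where f="\<lambda>t. x + t *\<^sub>R (y - x)", OF _ C(2)])
           (auto intro!: derivative_eq_intros)
      also have "(\<lambda>h. G (x + t *\<^sub>R (y - x)) \<bullet> (h *\<^sub>R (y - x))) = (*) (?k t)" by (auto simp: mult.commute)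
      finally show "((\<lambda>t. \<phi> (x + t *\<^sub>R (y - x))) has_real_derivative ?k t) (at t)" unfolding has_field_derivative_def .
      show "continuous_on UNIV ?k" by (intro continuous_intros continuous_on_compose2[OF C(1)]) auto
    qed simp
    also have "ennreal 1 * (\<integral>\<^sup>+t. indicator {0..<1} t * ennreal ((?k t)\<^sup>2) \<partial>lborel)
        \<le> (\<integral>\<^sup>+t. ennreal (D\<^sup>2) * (indicator {0..<1} t * H (x + t *\<^sub>R (y - x))) \<partial>lborel)"
      unfolding ennreal_1 mult_1
    proof (rule nn_integral_mono)
      fix t :: real
      show "indicator {0..<1} t * ennreal ((?k t)\<^sup>2) \<le> ennreal (D\<^sup>2) * (indicator {0..<1} t * H (x + t *\<^sub>R (y - x)))"
      proof (cases "t \<in> {0..<1}")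
        case True
        have "x + t *\<^sub>R (y - x) = (1 - t) *\<^sub>R x + t *\<^sub>R y" by (simp add: algebra_simps)
        then have z: "x + t *\<^sub>R (y - x) \<in> Q" using convexD[OF Q(2) x y, of "1 - t" t] True by simp
        have "\<bar>?k t\<bar> \<le> norm (G (x + t *\<^sub>R (y - x))) * norm (y - x)" by (rule Cauchy_Schwarz_ineq2)
        also have "\<dots> \<le> norm (G (x + t *\<^sub>R (y - x))) * D" by (rule mult_left_mono[OF D(1)[OF y x]]) simp
        finally have "\<bar>?k t\<bar>\<^sup>2 \<le> (norm (G (x + t *\<^sub>R (y - x))) * D)\<^sup>2" by (rule power_mono) simp
        then have "ennreal ((?k t)\<^sup>2) \<le> ennreal (D\<^sup>2) * ennreal ((norm (G (x + t *\<^sub>R (y - x))))\<^sup>2)"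
          by (simp add: ennreal_mult'[symmetric] power_mult_distrib mult.commute ennreal_leI)
        then show ?thesis using True z by (simp add: H_def)
      qed simp
    qed
    also have "\<dots> = ennreal (D\<^sup>2) * (\<integral>\<^sup>+t. indicator {0..<1} t * H (x + t *\<^sub>R (y - x)) \<partial>lborel)"
      by (rule nn_integral_cmult) simp
    finally show ?thesis by (simp add: power2_commute[of "\<phi> x"])
  qed
  have HI: "(\<integral>\<^sup>+z. H z \<partial>lborel) = ennreal ((L2_norm (vol Q) G)\<^sup>2)"
    unfolding L2_norm_sq_nn[OF L(2), symmetric] H_def
    by (subst nn_integral_restrict_space) (auto simp: mult.commute)
  have "(\<integral>\<^sup>+x. \<integral>\<^sup>+y. ennreal ((\<phi> x - \<phi> y)\<^sup>2) \<partial>vol Q \<partial>vol Q)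
     = (\<integral>\<^sup>+x. indicator Q x * (\<integral>\<^sup>+y. indicator Q y * ennreal ((\<phi> x - \<phi> y)\<^sup>2) \<partial>lborel) \<partial>lborel)"
    by (subst nn_integral_restrict_space, simp, subst nn_integral_restrict_space) (simp_all add: mult.commute)
  also have "\<dots> \<le> (\<integral>\<^sup>+x. \<integral>\<^sup>+y. ennreal (D\<^sup>2) * (\<integral>\<^sup>+t. indicator Q x * indicator Q y * indicator {0..<1::real} t * H (x + t *\<^sub>R (y - x)) \<partial>lborel) \<partial>lborel \<partial>lborel)"
  proof (rule nn_integral_mono)
    fix x :: 'a
    have "indicator Q x * (\<integral>\<^sup>+y. indicator Q y * ennreal ((\<phi> x - \<phi> y)\<^sup>2) \<partial>lborel) =
       (\<integral>\<^sup>+y. indicator Q x * (indicator Q y * ennreal ((\<phi> x - \<phi> y)\<^sup>2)) \<partial>lborel)"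
      by (rule nn_integral_cmult[symmetric]) simp
    also have "\<dots> \<le> (\<integral>\<^sup>+y. ennreal (D\<^sup>2) * (\<integral>\<^sup>+t. indicator Q x * indicator Q y * indicator {0..<1::real} t * H (x + t *\<^sub>R (y - x)) \<partial>lborel) \<partial>lborel)"
      by (rule nn_integral_mono) (use seg[of x] in \<open>auto simp: indicator_def\<close>)
    finally show "indicator Q x * (\<integral>\<^sup>+y. indicator Q y * ennreal ((\<phi> x - \<phi> y)\<^sup>2) \<partial>lborel)
      \<le> (\<integral>\<^sup>+y. ennreal (D\<^sup>2) * (\<integral>\<^sup>+t. indicator Q x * indicator Q y * indicator {0..<1::real} t * H (x + t *\<^sub>R (y - x)) \<partial>lborel) \<partial>lborel)" .
  qed
  also have "\<dots> = ennreal (D\<^sup>2) * (\<integral>\<^sup>+x. \<integral>\<^sup>+y. \<integral>\<^sup>+t. indicator Q x * indicator Q y * indicator {0..<1::real} t * H (x + t *\<^sub>R (y - x)) \<partial>lborel \<partial>lborel \<partial>lborel)"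
    by (simp add: nn_integral_cmult)
  also have "\<dots> \<le> ennreal (D\<^sup>2) * (emeasure lborel Q * (ennreal (2 ^ DIM('a)) * (\<integral>\<^sup>+z. H z \<partial>lborel)))"
    by (intro mult_left_mono segment_integral_le) auto
  also have "\<dots> = ennreal (m * (2 ^ DIM('a) * D\<^sup>2) * (L2_norm (vol Q) G)\<^sup>2)"
    unfolding HI em using m0 by (simp add: ennreal_mult'[symmetric] mult_ac)
  finally have "ennreal (2 * m * J - 2 * I\<^sup>2) \<le> ennreal (m * (2 ^ DIM('a) * D\<^sup>2) * (L2_norm (vol Q) G)\<^sup>2)" unfolding lhs .
  then have "2 * m * J - 2 * I\<^sup>2 \<le> m * (2 ^ DIM('a) * D\<^sup>2) * (L2_norm (vol Q) G)\<^sup>2"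
    using m0 by (subst (asm) ennreal_le_iff) auto
  then show ?thesis by (simp add: m_def J_def I_def)
qed

text \<open>For positive \<open>h\<close> these are the half-open cubes of a grid, named by any of
  their points; two of them are equal or disjoint, so sums over cells count no point twice.\<close>

definition cell :: "real \<Rightarrow> 'a::euclidean_space \<Rightarrow> 'a set" where
  "cell h x = {y. \<forall>b\<in>Basis. \<lfloor>y \<bullet> b / h\<rfloor> = \<lfloor>x \<bullet> b / h\<rfloor>}"

lemma cell_self: "x \<in> cell h x" by (simp add: cell_def)

lemma cell_eq: "y \<in> cell h x \<Longrightarrow> cell h y = cell h x" by (auto simp: cell_def)

lemma cell_borel: "cell h x \<in> sets borel"
proof -
  have "cell h x = (\<Inter>b\<in>Basis. {y \<in> space borel. \<lfloor>y \<bullet> b / h\<rfloor> = \<lfloor>x \<bullet> b / h\<rfloor>})" by (auto simp: cell_def)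
  also have "\<dots> \<in> sets borel" by (intro sets.finite_INT) auto
  finally show ?thesis .
qed

lemma cell_interval:
  assumes "h > 0" shows "cell h x = {y. \<forall>b\<in>Basis. h * of_int \<lfloor>x \<bullet> b / h\<rfloor> \<le> y \<bullet> b \<and> y \<bullet> b < h * of_int \<lfloor>x \<bullet> b / h\<rfloor> + h}"
  using assms by (auto simp: cell_def floor_eq_iff field_simps)

lemma cell_convex: assumes "h > 0" shows "convex (cell h x)"
proof -
  have "cell h x = (\<Inter>b\<in>Basis. {y. b \<bullet> y \<ge> h * of_int \<lfloor>x \<bullet> b / h\<rfloor>} \<inter> {y. b \<bullet> y < h * of_int \<lfloor>x \<bullet> b / h\<rfloor> + h})"
    unfolding cell_interval[OF assms] by (auto simp: inner_commute)
  also have "convex \<dots>" by (intro convex_INT convex_Int convex_halfspace_ge convex_halfspace_lt)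
  finally show ?thesis .
qed

lemma cell_norm:
  fixes x :: "'a::euclidean_space"
  assumes "h > 0" "y \<in> cell h x" "z \<in> cell h x" shows "norm (y - z) \<le> real DIM('a) * h"
proof -
  have "norm (y - z) \<le> (\<Sum>b\<in>Basis. \<bar>(y - z) \<bullet> b\<bar>)" by (rule norm_le_l1)
  also have "\<dots> \<le> (\<Sum>b\<in>(Basis::'a set). h)"
    using assms(2,3) unfolding cell_interval[OF assms(1)]
    by (intro sum_mono) (force simp: inner_diff_left abs_le_iff)
  finally show ?thesis by simp
qed

lemma cell_bounded: fixes x :: "'a::euclidean_space" assumes "h > 0" shows "bounded (cell h x)"
  unfolding bounded_def using cell_norm[OF assms cell_self] by (auto simp: dist_norm)

lemma finite_cells:
  fixes K :: "'a::euclidean_space set"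
  assumes "bounded K" "h > 0" shows "finite (cell h ` K)"
proof -
  obtain R where R: "\<And>x. x \<in> K \<Longrightarrow> norm x \<le> R" using assms(1) by (auto simp: bounded_iff)
  define F where "F f = {y::'a. \<forall>b\<in>Basis. \<lfloor>y \<bullet> b / h\<rfloor> = (f b :: int)}" for f
  have "cell h ` K \<subseteq> F ` (Basis \<rightarrow>\<^sub>E {\<lfloor>- R / h\<rfloor>..\<lfloor>R / h\<rfloor>})"
  proof safe
    fix x assume x: "x \<in> K"
    have b: "\<lfloor>x \<bullet> b / h\<rfloor> \<in> {\<lfloor>- R / h\<rfloor>..\<lfloor>R / h\<rfloor>}" if "b \<in> Basis" for b
    proof -
      have "\<bar>x \<bullet> b\<bar> \<le> R" using Basis_le_norm[OF that, of x] R[OF x] by linarith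
      then have "- R / h \<le> x \<bullet> b / h" "x \<bullet> b / h \<le> R / h"
        using assms(2) by (intro divide_right_mono; linarith)+
      then show ?thesis by (simp only: atLeastAtMost_iff floor_mono simp_thms)
    qed
    have "cell h x = F (restrict (\<lambda>b. \<lfloor>x \<bullet> b / h\<rfloor>) Basis)" by (auto simp: F_def cell_def)
    moreover have "restrict (\<lambda>b. \<lfloor>x \<bullet> b / h\<rfloor>) Basis \<in> Basis \<rightarrow>\<^sub>E {\<lfloor>- R / h\<rfloor>..\<lfloor>R / h\<rfloor>}" using b by auto
    ultimately show "cell h x \<in> F ` (Basis \<rightarrow>\<^sub>E {\<lfloor>- R / h\<rfloor>..\<lfloor>R / h\<rfloor>})" by blast
  qed
  moreover have "finite (F ` (Basis \<rightarrow>\<^sub>E {\<lfloor>- R / h\<rfloor>..\<lfloor>R / h\<rfloor>}))" by (intro finite_imageI finite_PiE) auto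
  ultimately show ?thesis by (rule finite_subset)
qed

context lipschitz_domain
begin

text \<open>Passage to the limit in \<open>poincare_wirtinger_C1\<close>; dividing by twice the
  measure of \<open>Q\<close> turns \<open>2 ^ 3\<close> into 4. On a null set one cannot divide,
  but there the norm of \<open>u\<close> vanishes anyway.\<close>

lemma poincare_wirtinger_tr:
  assumes t: "tr u g f" and Q: "Q \<in> sets borel" "convex Q" "bounded Q" "Q \<subseteq> \<Omega>"
    and D: "\<And>x y. x \<in> Q \<Longrightarrow> y \<in> Q \<Longrightarrow> norm (x - y) \<le> D" "0 \<le> D"
    and mean: "(LINT x|vol Q. u x) = 0"
  shows "(L2_norm (vol Q) u)\<^sup>2 \<le> 4 * D\<^sup>2 * (L2_norm (vol Q) g)\<^sup>2"
proof -
  obtain \<phi> G where 1: "\<And>n::nat. \<phi> n \<in> C1c UNIV" "\<And>n. C1_grad (\<phi> n) (G n)"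
    "(\<lambda>n. L2_norm (vol \<Omega>) (\<lambda>x. \<phi> n x - u x)) \<longlonglongrightarrow> 0"
    "(\<lambda>n. L2_norm (vol \<Omega>) (\<lambda>x. G n x - g x)) \<longlonglongrightarrow> 0"
    "(\<lambda>n. L2_norm (surface \<omega>) (\<lambda>x. \<phi> n x - f x)) \<longlonglongrightarrow> 0" by (rule trE[OF t]) (rule that)
  have OB: "\<Omega> \<in> sets borel" using open_waveguide by simp
  note C = C1c_L2[OF 1(1,2)]
  note T = trD[OF t]
  have fin: "emeasure lborel Q < \<infinity>" using emeasure_bounded_finite[OF Q(3)] by simp
  interpret F: finite_measure "vol Q"
    by (rule finite_measureI) (use fin Q(1) in \<open>simp add: emeasure_restrict_space space_restrict_space less_top[symmetric]\<close>)
  have one: "(\<lambda>x. 1::real) \<in> L2 (vol Q)" by (simp add: L2_def)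
  note uQ = L2_vol_subset(1)[OF T(1) Q(4,1) OB]
  note pQ = L2_vol_subset(1)[OF C(1) Q(4,1) OB]
  note l = L2_lim_subset[OF C(1) T(1) 1(3) Q(4,1)]
  have l1: "(\<lambda>n. L2_norm (vol Q) (\<phi> n)) \<longlonglongrightarrow> L2_norm (vol Q) u"
    by (rule L2_norm_tendsto[OF pQ uQ l])
  have l2: "(\<lambda>n. L2_norm (vol Q) (G n)) \<longlonglongrightarrow> L2_norm (vol Q) g"
    by (rule L2_norm_tendsto[OF L2_vol_subset(1)[OF C(2) Q(4,1) OB] L2_vol_subset(1)[OF T(2) Q(4,1) OB] L2_lim_subset[OF C(2) T(2) 1(4) Q(4,1)]])
  have l3: "(\<lambda>n. LINT x|vol Q. \<phi> n x) \<longlonglongrightarrow> 0"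
    using L2_inner_tendsto[OF pQ uQ one l] mean by simp
  let ?m = "measure lborel Q"
  have "2 * ?m * (L2_norm (vol Q) u)\<^sup>2 \<le> 2 * 0\<^sup>2 + ?m * (2 ^ DIM((real^2) \<times> real) * D\<^sup>2) * (L2_norm (vol Q) g)\<^sup>2"
  proof (rule LIMSEQ_le)
    show "(\<lambda>n. 2 * ?m * (L2_norm (vol Q) (\<phi> n))\<^sup>2) \<longlonglongrightarrow> 2 * ?m * (L2_norm (vol Q) u)\<^sup>2"
      by (intro tendsto_intros l1)
    show "(\<lambda>n. 2 * (LINT x|vol Q. \<phi> n x)\<^sup>2 + ?m * (2 ^ DIM((real^2) \<times> real) * D\<^sup>2) * (L2_norm (vol Q) (G n))\<^sup>2)
      \<longlonglongrightarrow> 2 * 0\<^sup>2 + ?m * (2 ^ DIM((real^2) \<times> real) * D\<^sup>2) * (L2_norm (vol Q) g)\<^sup>2"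
      by (intro tendsto_intros l2 l3)
    show "\<exists>N. \<forall>n\<ge>N. 2 * ?m * (L2_norm (vol Q) (\<phi> n))\<^sup>2 \<le> 2 * (LINT x|vol Q. \<phi> n x)\<^sup>2 +
        ?m * (2 ^ DIM((real^2) \<times> real) * D\<^sup>2) * (L2_norm (vol Q) (G n))\<^sup>2"
      using poincare_wirtinger_C1[OF Q(1,2,3) D 1(2) pQ L2_vol_subset(1)[OF C(2) Q(4,1) OB]] by blast
  qed
  then have main: "?m * (L2_norm (vol Q) u)\<^sup>2 \<le> ?m * (4 * D\<^sup>2 * (L2_norm (vol Q) g)\<^sup>2)" by simp
  show ?thesis
  proof (cases "?m = 0")
    case False
    then have "?m > 0" by (simp add: less_le)
    then show ?thesis using main by simp
  next
    case True
    then have "emeasure lborel Q = 0" using fin by (simp add: emeasure_eq_ennreal_measure less_top[symmetric])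
    then have "AE x in lborel. x \<notin> Q" using Q(1) by (intro AE_not_in) auto
    then have "AE x in vol Q. u x = 0" using Q(1) by (subst AE_restrict_space_iff) auto
    then have "L2_norm (vol Q) u = 0" by (simp add: L2_norm_eq_0[OF uQ])
    then show ?thesis by simp
  qed
qed

text \<open>A quantitative form of local Rellich compactness: outside finitely many linear
  conditions the embedding is as small as desired, because the Poincare-Wirtinger constant of a cell
  is proportional to its squared diameter.\<close>

lemma grid_compactness:
  assumes K: "compact K" "K \<subseteq> \<Omega>" and \<epsilon>: "\<epsilon> > 0"
  obtains \<Q> where "finite \<Q>" "\<And>Q. Q \<in> \<Q> \<Longrightarrow> Q \<in> sets borel \<and> bounded Q \<and> Q \<subseteq> \<Omega>"
    "\<And>u g f. tr u g f \<Longrightarrow> \<forall>Q\<in>\<Q>. (LINT x|vol Q. u x) = 0 \<Longrightarrow>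
       (L2_norm (vol K) u)\<^sup>2 \<le> \<epsilon> * (L2_norm (vol \<Omega>) g)\<^sup>2"
proof -
  have OB: "\<Omega> \<in> sets borel" using open_waveguide by simp
  have KB: "K \<in> sets borel" using K(1) by (rule borel_compact)
  have "K \<inter> - \<Omega> = {}" using K(2) by blast
  then obtain d where d: "d > 0" "\<And>x y. x \<in> K \<Longrightarrow> y \<in> - \<Omega> \<Longrightarrow> d \<le> dist x y"
    using separate_compact_closed[OF K(1), of "- \<Omega>"] open_waveguide by (auto simp: closed_def)
  define n where "n = real DIM((real^2) \<times> real)"
  have n: "n > 0" by (simp add: n_def)
  \<comment> \<open>The diameter bound of a cell: the first bound keeps cells that meet
    \<open>K\<close> inside \<Omega>, the second makes the constant \<open>4 * D\<^sup>2\<close> at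
    most \<epsilon>.\<close>
  define D where "D = min (d / 2) (sqrt \<epsilon> / 2)"
  have D: "D > 0" "D < d" "4 * D\<^sup>2 \<le> \<epsilon>"
  proof -
    show "D > 0" "D < d" using d(1) \<epsilon> by (auto simp: D_def min_def)
    have "(2 * D)\<^sup>2 \<le> (sqrt \<epsilon>)\<^sup>2" using d(1) \<epsilon> by (intro power_mono) (auto simp: D_def min_def)
    then show "4 * D\<^sup>2 \<le> \<epsilon>" using \<epsilon> by (simp add: power_mult_distrib)
  qed
  define h where "h = D / n"
  have h: "h > 0" using D n by (simp add: h_def)
  have nh: "n * h = D" using n by (simp add: h_def)
  define \<Q> where "\<Q> = cell h ` K"
  have fin: "finite \<Q>" unfolding \<Q>_def by (rule finite_cells[OF compact_imp_bounded[OF K(1)] h])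
  have Q: "Q \<in> sets borel \<and> bounded Q \<and> Q \<subseteq> \<Omega>" if q: "Q \<in> \<Q>" for Q
  proof -
    obtain x where x: "x \<in> K" "Q = cell h x" using q unfolding \<Q>_def by blast
    have "y \<in> \<Omega>" if "y \<in> Q" for y
    proof (rule ccontr)
      assume "y \<notin> \<Omega>"
      then have "d \<le> dist x y" using d(2)[OF x(1)] by simp
      moreover have "dist x y \<le> D" using cell_norm[OF h cell_self, of y x] that x(2) nh by (simp add: dist_norm n_def)
      ultimately show False using D by simp
    qed
    then show ?thesis using cell_borel cell_bounded[OF h] x(2) by auto
  qed
  show ?thesis
  proof (rule that[OF fin Q])
    fix u g f assume t: "tr u g f" and mean: "\<forall>Q\<in>\<Q>. (LINT x|vol Q. u x) = 0"
    note T = trD[OF t]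
    have s: "(\<integral>\<^sup>+x. ennreal ((norm (v x))\<^sup>2) \<partial>vol A) = (\<integral>\<^sup>+x. ennreal ((norm (v x))\<^sup>2) * indicator A x \<partial>lborel)"
      if "A \<in> sets borel" for v :: "(real^2) \<times> real \<Rightarrow> 'z::euclidean_space" and A
      using that by (subst nn_integral_restrict_space) auto
    have vm: "(\<lambda>x. ennreal ((norm (v x))\<^sup>2) * indicator A x) \<in> borel_measurable lborel"
      if "v \<in> L2 (vol \<Omega>)" "A \<in> sets borel" "A \<subseteq> \<Omega>" for v :: "(real^2) \<times> real \<Rightarrow> 'z::euclidean_space" and A
    proof -
      have "(\<lambda>x. ennreal ((norm (v x))\<^sup>2)) \<in> borel_measurable (vol A)"
        using L2_vol_subset(1)[OF that(1,3,2) OB] by (auto simp: L2_def)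
      then show ?thesis using that(2) by (subst (asm) borel_measurable_restrict_space_iff_ennreal) auto
    qed
    \<comment> \<open>The cells may reach beyond \<open>K\<close>; being disjoint subsets of
      \<Omega>, their gradient terms still add up to at most the norm over \<Omega>.\<close>
    have disj: "(\<Sum>Q\<in>\<Q>. indicator Q x) \<le> (indicator \<Omega> x :: ennreal)" for x
    proof (cases "\<exists>Q\<in>\<Q>. x \<in> Q")
      case False
      then have "(\<Sum>Q\<in>\<Q>. indicator Q x) = (0::ennreal)" by (intro sum.neutral) auto
      then show ?thesis by simp
    next
      case True
      then obtain Q0 where Q0: "Q0 \<in> \<Q>" "x \<in> Q0" by blast
      have "Q0 = cell h x" using Q0 cell_eq by (auto simp: \<Q>_def)
      moreover have "Q = cell h x" if "Q \<in> \<Q>" "x \<in> Q" for Q using that cell_eq by (auto simp: \<Q>_def)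
      ultimately have "indicator Q x = (if Q = Q0 then 1 else 0::ennreal)" if "Q \<in> \<Q>" for Q
        using that Q0 by (auto simp: indicator_def)
      then have "(\<Sum>Q\<in>\<Q>. indicator Q x) = (\<Sum>Q\<in>\<Q>. if Q = Q0 then 1 else 0::ennreal)" by (intro sum.cong) auto
      also have "\<dots> = 1" using fin Q0(1) by simp
      finally show ?thesis using Q[OF Q0(1)] Q0(2) by auto
    qed
    have cov: "indicator K x \<le> (\<Sum>Q\<in>\<Q>. indicator Q x :: ennreal)" for x
    proof (cases "x \<in> K")
      case True
      have "(indicator (cell h x) x :: ennreal) \<le> (\<Sum>Q\<in>\<Q>. indicator Q x)"
        by (rule member_le_sum) (use fin True in \<open>auto simp: \<Q>_def\<close>)
      then show ?thesis using True cell_self[of x h] by simp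
    qed simp
    have "ennreal ((L2_norm (vol K) u)\<^sup>2) = (\<integral>\<^sup>+x. ennreal ((norm (u x))\<^sup>2) * indicator K x \<partial>lborel)"
      by (rule trans[OF L2_norm_sq_nn[OF L2_vol_subset(1)[OF T(1) K(2) KB OB], symmetric] s[OF KB]])
    also have "\<dots> \<le> (\<integral>\<^sup>+x. (\<Sum>Q\<in>\<Q>. ennreal ((norm (u x))\<^sup>2) * indicator Q x) \<partial>lborel)"
      unfolding sum_distrib_left[symmetric] by (intro nn_integral_mono mult_left_mono cov) auto
    also have "\<dots> = (\<Sum>Q\<in>\<Q>. \<integral>\<^sup>+x. ennreal ((norm (u x))\<^sup>2) * indicator Q x \<partial>lborel)"
      by (rule nn_integral_sum) (use vm[OF T(1)] Q in auto)
    also have "\<dots> \<le> (\<Sum>Q\<in>\<Q>. ennreal \<epsilon> * (\<integral>\<^sup>+x. ennreal ((norm (g x))\<^sup>2) * indicator Q x \<partial>lborel))"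
    proof (rule sum_mono)
      fix Q assume q: "Q \<in> \<Q>"
      then obtain x where x: "Q = cell h x" unfolding \<Q>_def by blast
      have qb: "Q \<in> sets borel" "bounded Q" "Q \<subseteq> \<Omega>" using Q[OF q] by auto
      have dq: "norm (y - z) \<le> D" if "y \<in> Q" "z \<in> Q" for y z
        using cell_norm[OF h, of y x z] that x nh by (simp add: n_def)
      have "(L2_norm (vol Q) u)\<^sup>2 \<le> 4 * D\<^sup>2 * (L2_norm (vol Q) g)\<^sup>2"
        by (rule poincare_wirtinger_tr[OF t qb(1) _ qb(2,3) dq _ bspec[OF mean q]]) (use cell_convex[OF h] x D in auto)
      also have "\<dots> \<le> \<epsilon> * (L2_norm (vol Q) g)\<^sup>2" using D(3) by (intro mult_right_mono) auto
      finally have "ennreal ((L2_norm (vol Q) u)\<^sup>2) \<le> ennreal \<epsilon> * ennreal ((L2_norm (vol Q) g)\<^sup>2)"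
        using \<epsilon> by (simp add: ennreal_mult'[symmetric] ennreal_leI)
      then show "(\<integral>\<^sup>+x. ennreal ((norm (u x))\<^sup>2) * indicator Q x \<partial>lborel) \<le> ennreal \<epsilon> * (\<integral>\<^sup>+x. ennreal ((norm (g x))\<^sup>2) * indicator Q x \<partial>lborel)"
        by (simp only: s[OF qb(1), symmetric] L2_norm_sq_nn[OF L2_vol_subset(1)[OF T(1) qb(3,1) OB]]
            L2_norm_sq_nn[OF L2_vol_subset(1)[OF T(2) qb(3,1) OB]])
    qed
    also have "\<dots> = ennreal \<epsilon> * (\<integral>\<^sup>+x. (\<Sum>Q\<in>\<Q>. ennreal ((norm (g x))\<^sup>2) * indicator Q x) \<partial>lborel)"
      unfolding sum_distrib_left[symmetric]
      by (subst nn_integral_sum[symmetric]) (use vm[OF T(2)] Q in \<open>auto simp: sum_distrib_left\<close>)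
    also have "\<dots> \<le> ennreal \<epsilon> * (\<integral>\<^sup>+x. ennreal ((norm (g x))\<^sup>2) * indicator \<Omega> x \<partial>lborel)"
      unfolding sum_distrib_left[symmetric] by (intro mult_left_mono nn_integral_mono disj) auto
    also have "\<dots> = ennreal (\<epsilon> * (L2_norm (vol \<Omega>) g)\<^sup>2)"
      unfolding s[OF OB, symmetric] L2_norm_sq_nn[OF T(2)] using \<epsilon> by (simp add: ennreal_mult')
    finally show "(L2_norm (vol K) u)\<^sup>2 \<le> \<epsilon> * (L2_norm (vol \<Omega>) g)\<^sup>2" using \<epsilon> by (subst (asm) ennreal_le_iff) auto
  qed
qed

end

section \<open>Energy forms and weak solutions\<close>

text \<open>The quadratic form of \<open>A\<^sup>\<bullet>(x', 1)\<close> is \<open>\<xi>\<^sub>1\<^sup>2 + \<xi>\<^sub>2\<^sup>2 + (\<xi>\<^sub>3 - x\<^sub>2\<xi>\<^sub>1 + x\<^sub>1\<xi>\<^sub>2)\<^sup>2\<close>.\<close>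

definition twist :: "real^2 \<Rightarrow> (real^2) \<times> real" where
  "twist x = (vector [- (x$2), x$1], 1)"

definition qform :: "real^2 \<Rightarrow> (real^2) \<times> real \<Rightarrow> (real^2) \<times> real \<Rightarrow> real" where
  "qform x \<xi> \<zeta> = fst \<xi> \<bullet> fst \<zeta> + (\<xi> \<bullet> twist x) * (\<zeta> \<bullet> twist x)"

lemma A_mat_qform: "(A_mat x t *v vec3 \<xi>) \<bullet> vec3 \<zeta> = t * qform x \<xi> \<zeta>"
  by (simp add: A_mat_def vec3_def qform_def twist_def matrix_vector_mult_def inner_vec_def sum_3 sum_2
      vector_3 vector_2 inner_prod_def power2_eq_square algebra_simps)

lemma norm_twist: "(norm (twist x))\<^sup>2 = 1 + (norm x)\<^sup>2"
  unfolding twist_def power2_norm_eq_inner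
  by (simp add: inner_prod_def inner_vec_def sum_2 vector_2 power2_eq_square)

lemma qform_add_left: "qform x (a + b) c = qform x a c + qform x b c"
  by (simp add: qform_def inner_add_left algebra_simps)

lemma qform_diff_left: "qform x (a - b) c = qform x a c - qform x b c"
  by (simp add: qform_def inner_diff_left algebra_simps)

lemma qform_scale_left: "qform x (s *\<^sub>R a) c = s * qform x a c"
  by (simp add: qform_def algebra_simps)

lemma qform_sym: "qform x a b = qform x b a"
  by (simp add: qform_def inner_commute mult.commute)

lemma qform_nonneg: "0 \<le> qform x a a"
  by (simp add: qform_def)

lemma qform_bound:
  assumes "norm x \<le> R" shows "\<bar>qform x a b\<bar> \<le> (2 + R\<^sup>2) * (norm a * norm b)"
proof -
  have R: "(norm x)\<^sup>2 \<le> R\<^sup>2" using assms by (intro power_mono) auto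
  have f: "norm (fst a) \<le> norm a" for a :: "(real^2) \<times> real" by (cases a) (simp add: norm_Pair)
  have "\<bar>fst a \<bullet> fst b\<bar> \<le> norm (fst a) * norm (fst b)" by (rule Cauchy_Schwarz_ineq2)
  also have "\<dots> \<le> norm a * norm b" by (intro mult_mono f) auto
  finally have 1: "\<bar>fst a \<bullet> fst b\<bar> \<le> norm a * norm b" .
  have "\<bar>(a \<bullet> twist x) * (b \<bullet> twist x)\<bar> \<le> (norm a * norm (twist x)) * (norm b * norm (twist x))"
    unfolding abs_mult by (intro mult_mono Cauchy_Schwarz_ineq2) auto
  also have "\<dots> = (1 + (norm x)\<^sup>2) * (norm a * norm b)"
    unfolding norm_twist[symmetric] by (simp add: power2_eq_square)
  also have "\<dots> \<le> (1 + R\<^sup>2) * (norm a * norm b)" using R by (intro mult_right_mono) auto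
  finally show ?thesis using 1 unfolding qform_def by (simp add: algebra_simps)
qed

text \<open>The form controls the first two components and \<open>l = a \<bullet> twist x\<close>
  exactly; the third component is \<open>l\<close> minus the inner product of the first two with a
  vector of length \<open>norm x\<close>.\<close>

lemma qform_coercive:
  assumes "norm x \<le> R" shows "(norm a)\<^sup>2 \<le> (2 + 2 * R\<^sup>2) * qform x a a"
proof -
  have R: "(norm x)\<^sup>2 \<le> R\<^sup>2" using assms by (intro power_mono) auto
  define l where "l = a \<bullet> twist x"
  define w where "w = fst (twist x)"
  have w: "(norm w)\<^sup>2 = (norm x)\<^sup>2"
    unfolding w_def twist_def power2_norm_eq_inner by (simp add: inner_vec_def sum_2 vector_2)
  have s: "snd a = l - fst a \<bullet> w" by (simp add: l_def w_def inner_prod_def twist_def)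
  have "(fst a \<bullet> w)\<^sup>2 \<le> (norm (fst a) * norm w)\<^sup>2"
    using Cauchy_Schwarz_ineq2[of "fst a" w] by (intro abs_le_square_iff[THEN iffD1]) auto
  also have "\<dots> \<le> (norm (fst a))\<^sup>2 * R\<^sup>2" using R w by (simp add: power_mult_distrib mult_left_mono)
  finally have 1: "(fst a \<bullet> w)\<^sup>2 \<le> (norm (fst a))\<^sup>2 * R\<^sup>2" .
  have "(snd a)\<^sup>2 \<le> 2 * l\<^sup>2 + 2 * (fst a \<bullet> w)\<^sup>2"
    unfolding s using sum_squares_bound[of l "- (fst a \<bullet> w)"] by (simp add: power2_eq_square algebra_simps)
  then have "(norm (fst a))\<^sup>2 + (snd a)\<^sup>2 \<le> (1 + 2 * R\<^sup>2) * (norm (fst a))\<^sup>2 + 2 * l\<^sup>2"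
    using 1 by (simp add: algebra_simps)
  also have "\<dots> \<le> (2 + 2 * R\<^sup>2) * ((norm (fst a))\<^sup>2 + l\<^sup>2)" by (simp add: algebra_simps)
  also have "(norm (fst a))\<^sup>2 + l\<^sup>2 = qform x a a"
    unfolding qform_def l_def power2_norm_eq_inner by (simp add: power2_eq_square)
  finally show ?thesis by (cases a) (simp add: norm_Pair)
qed

lemma continuous_twist: "continuous_on UNIV twist"
proof -
  have tw: "twist = (\<lambda>x. (\<chi> i. if i = 1 then - (x $ 2) else x $ 1, 1))"
    by (rule ext) (simp add: twist_def vec_eq_iff forall_2 vector_2)
  have "continuous_on UNIV (\<lambda>x::real^2. \<chi> i::2. if i = 1 then - (x $ 2) else x $ 1)"
  proof (rule continuous_on_vec_lambda)
    fix i :: 2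
    show "continuous_on UNIV (\<lambda>x::real^2. if i = 1 then - (x $ 2) else x $ 1)"
      by (cases "i = 1") (auto intro!: continuous_intros)
  qed
  then have "continuous_on UNIV (\<lambda>x::real^2. (\<chi> i::2. if i = 1 then - (x $ 2) else x $ 1, 1::real))"
    by (intro continuous_on_Pair continuous_on_const)
  then show ?thesis unfolding tw .
qed

lemma AE_snd:
  assumes "AE s in lborel. P (s::real)"
  shows "AE x in (lborel :: ((real^2) \<times> real) measure). P (snd x)"
proof -
  obtain N where N: "N \<in> null_sets lborel" "{s. \<not> P s} \<subseteq> N" using assms by (auto elim: AE_E3 simp: eventually_ae_filter)
  have "emeasure (lborel \<Otimes>\<^sub>M lborel) ((UNIV :: (real^2) set) \<times> N) = emeasure lborel (UNIV :: (real^2) set) * emeasure lborel N"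
    by (rule lborel.emeasure_pair_measure_Times) (use N in auto)
  also have "\<dots> = 0" using N by auto
  finally have "emeasure lborel ((UNIV :: (real^2) set) \<times> N) = 0" by (simp add: lborel_prod)
  moreover have "(UNIV :: (real^2) set) \<times> N \<in> sets (borel \<Otimes>\<^sub>M borel)" using N by (intro pair_measureI) auto
  then have "(UNIV :: (real^2) set) \<times> N \<in> sets lborel" unfolding borel_prod by simp
  ultimately have "(UNIV :: (real^2) set) \<times> N \<in> null_sets lborel" by auto
  from AE_not_in[OF this] show ?thesis by eventually_elim (use N(2) in auto)
qed

definition coef :: "(real \<Rightarrow> real) \<Rightarrow> real \<Rightarrow> real \<Rightarrow> bool" where
  "coef \<alpha> t B \<longleftrightarrow> \<alpha> \<in> borel_measurable borel \<and> 0 < t \<and> 0 \<le> B \<and> (AE s in lborel. t \<le> \<alpha> s) \<and> (AE s in lborel. \<alpha> s \<le> B)"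

section \<open>The energy as a bilinear form on gradient fields\<close>

context lipschitz_domain
begin

text \<open>Acts on vector fields instead of functions, so that it is bilinear on square-integrable
  fields and independent of the choice made by \<open>wgrad\<close>.\<close>

definition Bf where "Bf \<alpha> g h = (LINT x|vol \<Omega>. \<alpha> (snd x) * qform (fst x) (g x) (h x))"

lemma energy_form_Bf: "energy_form \<omega> \<alpha> u v = Bf \<alpha> (wgrad \<Omega> u) (wgrad \<Omega> v)"
  by (simp add: energy_form_def Bf_def A_mat_qform)

lemma norm_fst_le: assumes "x \<in> \<Omega>" shows "norm (fst x) \<le> width"
proof -
  have "2 * norm (fst x) < width" by (rule width(2)) (use assms in \<open>auto simp: waveguide_def\<close>)
  then show ?thesis using norm_ge_zero[of "fst x"] by linarith
qed

lemma qform_measurable: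
  assumes [measurable]: "\<alpha> \<in> borel_measurable borel" "g \<in> borel_measurable (vol \<Omega>)" "h \<in> borel_measurable (vol \<Omega>)"
  shows "(\<lambda>x. \<alpha> (snd x) * qform (fst x) (g x) (h x)) \<in> borel_measurable (vol \<Omega>)"
proof -
  have [measurable]: "twist \<in> borel_measurable borel" by (rule borel_measurable_continuous_onI[OF continuous_twist])
  have [measurable]: "(fst :: (real^2) \<times> real \<Rightarrow> _) \<in> borel_measurable borel" "(snd :: (real^2) \<times> real \<Rightarrow> _) \<in> borel_measurable borel"
    by (intro borel_measurable_continuous_onI continuous_intros)+
  have [measurable]: "(\<lambda>x. \<alpha> (snd x)) \<in> borel_measurable (vol \<Omega>)" "(\<lambda>x. twist (fst x)) \<in> borel_measurable (vol \<Omega>)"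
    by (intro measurable_restrict_space1, simp)+
  show ?thesis unfolding qform_def by measurable
qed

text \<open>The coefficient may change sign: the final comparison integrates the difference of two
  coefficients.\<close>

lemma Bf_integrable_gen:
  assumes a: "\<alpha> \<in> borel_measurable borel" "AE s in lborel. \<bar>\<alpha> s\<bar> \<le> B" "0 \<le> B" and g: "g \<in> L2 (vol \<Omega>)" and h: "h \<in> L2 (vol \<Omega>)"
  shows "integrable (vol \<Omega>) (\<lambda>x. \<alpha> (snd x) * qform (fst x) (g x) (h x))"
    "\<bar>Bf \<alpha> g h\<bar> \<le> B * (2 + width\<^sup>2) * (L2_norm (vol \<Omega>) g * L2_norm (vol \<Omega>) h)"
proof -
  let ?C = "B * (2 + width\<^sup>2)"
  have i: "integrable (vol \<Omega>) (\<lambda>x. norm (g x) * norm (h x))"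
    by (rule L2_mult_integrable(1)[OF L2_norm_fun[OF g] L2_norm_fun[OF h]])
  have ae: "AE x in vol \<Omega>. norm (\<alpha> (snd x) * qform (fst x) (g x) (h x)) \<le> norm (?C * (norm (g x) * norm (h x)))"
    unfolding AE_vol[OF open_waveguide]
    using AE_snd[OF a(2)]
  proof eventually_elim
    case (elim x)
    show ?case
    proof
      assume x: "x \<in> \<Omega>"
      have "\<bar>\<alpha> (snd x)\<bar> * \<bar>qform (fst x) (g x) (h x)\<bar> \<le> B * ((2 + width\<^sup>2) * (norm (g x) * norm (h x)))"
        using elim a(3) by (intro mult_mono qform_bound[OF norm_fst_le[OF x]]) auto
      then show "norm (\<alpha> (snd x) * qform (fst x) (g x) (h x)) \<le> norm (?C * (norm (g x) * norm (h x)))"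
        using a(3) by (simp add: abs_mult mult.assoc)
    qed
  qed
  have m: "(\<lambda>x. \<alpha> (snd x) * qform (fst x) (g x) (h x)) \<in> borel_measurable (vol \<Omega>)"
    by (rule qform_measurable[OF a(1)]) (use g h in \<open>auto simp: L2_def\<close>)
  show j: "integrable (vol \<Omega>) (\<lambda>x. \<alpha> (snd x) * qform (fst x) (g x) (h x))"
    by (rule Bochner_Integration.integrable_bound[OF integrable_mult_right[OF i, of ?C] m ae])
  have "\<bar>Bf \<alpha> g h\<bar> \<le> (LINT x|vol \<Omega>. \<bar>\<alpha> (snd x) * qform (fst x) (g x) (h x)\<bar>)"
    unfolding Bf_def by (rule integral_abs_bound)
  also have "\<dots> \<le> (LINT x|vol \<Omega>. ?C * (norm (g x) * norm (h x)))"
    by (rule integral_mono_AE) (use i j ae a(3) in auto)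
  also have "\<dots> = ?C * (LINT x|vol \<Omega>. norm (g x) * norm (h x))" by simp
  also have "\<dots> \<le> ?C * (L2_norm (vol \<Omega>) g * L2_norm (vol \<Omega>) h)"
    using L2_mult_integrable(2)[OF L2_norm_fun[OF g] L2_norm_fun[OF h]] a(3)
    by (intro mult_left_mono) (auto simp: L2_norm_sqnorm)
  finally show "\<bar>Bf \<alpha> g h\<bar> \<le> ?C * (L2_norm (vol \<Omega>) g * L2_norm (vol \<Omega>) h)" .
qed

lemma coef_abs: assumes "coef \<alpha> t B" shows "AE s in lborel. \<bar>\<alpha> s\<bar> \<le> B"
proof -
  have a: "AE s in lborel. t \<le> \<alpha> s" "AE s in lborel. \<alpha> s \<le> B" and t: "0 < t" using assms by (auto simp: coef_def)
  from a show ?thesis by eventually_elim (use t in auto)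
qed

lemma Bf_integrable:
  assumes a: "coef \<alpha> t B" and g: "g \<in> L2 (vol \<Omega>)" and h: "h \<in> L2 (vol \<Omega>)"
  shows "integrable (vol \<Omega>) (\<lambda>x. \<alpha> (snd x) * qform (fst x) (g x) (h x))"
    "\<bar>Bf \<alpha> g h\<bar> \<le> B * (2 + width\<^sup>2) * (L2_norm (vol \<Omega>) g * L2_norm (vol \<Omega>) h)"
  using Bf_integrable_gen[OF _ coef_abs[OF a] _ g h] a by (auto simp: coef_def)

lemma Bf_sym: "Bf \<alpha> g h = Bf \<alpha> h g"
  by (simp add: Bf_def qform_sym[of _ "g _"])

lemma Bf_add:
  assumes "coef \<alpha> t B" "g \<in> L2 (vol \<Omega>)" "g' \<in> L2 (vol \<Omega>)" "h \<in> L2 (vol \<Omega>)"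
  shows "Bf \<alpha> (\<lambda>x. g x + g' x) h = Bf \<alpha> g h + Bf \<alpha> g' h"
  using Bf_integrable(1)[OF assms(1,2,4)] Bf_integrable(1)[OF assms(1,3,4)]
  by (simp add: Bf_def qform_add_left distrib_left)

lemma Bf_scale: "Bf \<alpha> (\<lambda>x. c *\<^sub>R g x) h = c * Bf \<alpha> g h"
proof -
  have "(\<lambda>x. \<alpha> (snd x) * qform (fst x) (c *\<^sub>R g x) (h x)) = (\<lambda>x. c * (\<alpha> (snd x) * qform (fst x) (g x) (h x)))"
    by (simp add: qform_scale_left mult.left_commute)
  then show ?thesis by (simp add: Bf_def)
qed

lemma Bf_diff:
  assumes "coef \<alpha> t B" "g \<in> L2 (vol \<Omega>)" "g' \<in> L2 (vol \<Omega>)" "h \<in> L2 (vol \<Omega>)"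
  shows "Bf \<alpha> (\<lambda>x. g x - g' x) h = Bf \<alpha> g h - Bf \<alpha> g' h"
  using Bf_integrable(1)[OF assms(1,2,4)] Bf_integrable(1)[OF assms(1,3,4)]
  by (simp add: Bf_def qform_diff_left right_diff_distrib)

lemma
  shows Bf_add_right: "coef \<alpha> t B \<Longrightarrow> g \<in> L2 (vol \<Omega>) \<Longrightarrow> g' \<in> L2 (vol \<Omega>) \<Longrightarrow> h \<in> L2 (vol \<Omega>) \<Longrightarrow>
      Bf \<alpha> h (\<lambda>x. g x + g' x) = Bf \<alpha> h g + Bf \<alpha> h g'"
    and Bf_diff_right: "coef \<alpha> t B \<Longrightarrow> g \<in> L2 (vol \<Omega>) \<Longrightarrow> g' \<in> L2 (vol \<Omega>) \<Longrightarrow> h \<in> L2 (vol \<Omega>) \<Longrightarrow>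
      Bf \<alpha> h (\<lambda>x. g x - g' x) = Bf \<alpha> h g - Bf \<alpha> h g'"
    and Bf_scale_right: "Bf \<alpha> h (\<lambda>x. c *\<^sub>R g x) = c * Bf \<alpha> h g"
proof -
  have s: "Bf \<alpha> h k = Bf \<alpha> k h" for k by (rule Bf_sym)
  show "Bf \<alpha> h (\<lambda>x. g x + g' x) = Bf \<alpha> h g + Bf \<alpha> h g'"
    if "coef \<alpha> t B" "g \<in> L2 (vol \<Omega>)" "g' \<in> L2 (vol \<Omega>)" "h \<in> L2 (vol \<Omega>)"
    using Bf_add[OF that] s[of g] s[of g'] s[of "\<lambda>x. g x + g' x"] by presburger
  show "Bf \<alpha> h (\<lambda>x. g x - g' x) = Bf \<alpha> h g - Bf \<alpha> h g'"
    if "coef \<alpha> t B" "g \<in> L2 (vol \<Omega>)" "g' \<in> L2 (vol \<Omega>)" "h \<in> L2 (vol \<Omega>)"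
    using Bf_diff[OF that] s[of g] s[of g'] s[of "\<lambda>x. g x - g' x"] by presburger
  show "Bf \<alpha> h (\<lambda>x. c *\<^sub>R g x) = c * Bf \<alpha> h g"
    using Bf_scale[of \<alpha> c g h] s[of g] s[of "\<lambda>x. c *\<^sub>R g x"] by presburger
qed

lemma Bf_cong_AE:
  assumes "\<alpha> \<in> borel_measurable borel" "AE x in vol \<Omega>. g x = g' x" "AE x in vol \<Omega>. h x = h' x"
    and "g \<in> L2 (vol \<Omega>)" "g' \<in> L2 (vol \<Omega>)" "h \<in> L2 (vol \<Omega>)" "h' \<in> L2 (vol \<Omega>)"
  shows "Bf \<alpha> g h = Bf \<alpha> g' h'"
  unfolding Bf_def
proof (rule integral_cong_AE)
  show "AE x in vol \<Omega>. \<alpha> (snd x) * qform (fst x) (g x) (h x) = \<alpha> (snd x) * qform (fst x) (g' x) (h' x)"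
    using assms(2,3) by eventually_elim simp
qed (rule qform_measurable[OF assms(1)], use assms in \<open>auto simp: L2_def\<close>)+

text \<open>The lower ellipticity bound of \<open>A_mat x 1\<close> on \<Omega>, from
  \<open>qform_coercive\<close> with \<open>R = width\<close>.\<close>

definition ellip where "ellip = 1 / (2 + 2 * width\<^sup>2)"

lemma ellip_pos: "ellip > 0" by (simp add: ellip_def add_pos_nonneg)

lemma qform_ellip: "x \<in> \<Omega> \<Longrightarrow> ellip * (norm a)\<^sup>2 \<le> qform (fst x) a a"
proof -
  assume x: "x \<in> \<Omega>"
  have p: "2 + 2 * width\<^sup>2 > 0" by (simp add: add_pos_nonneg)
  show ?thesis using qform_coercive[OF norm_fst_le[OF x], of a] p by (simp add: ellip_def divide_le_eq mult.commute)
qed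

lemma Bf_coercive:
  assumes "coef \<alpha> t B" "g \<in> L2 (vol \<Omega>)"
  shows "t * ellip * (L2_norm (vol \<Omega>) g)\<^sup>2 \<le> Bf \<alpha> g g"
proof -
  have t: "t > 0" using assms(1) by (simp add: coef_def)
  have "t * ellip * (L2_norm (vol \<Omega>) g)\<^sup>2 = (LINT x|vol \<Omega>. t * ellip * (norm (g x))\<^sup>2)"
    by (simp add: L2_norm_power2)
  also have "\<dots> \<le> Bf \<alpha> g g"
    unfolding Bf_def
  proof (rule integral_mono_AE[OF _ Bf_integrable(1)[OF assms assms(2)]])
    show "integrable (vol \<Omega>) (\<lambda>x. t * ellip * (norm (g x))\<^sup>2)" using assms(2) by (simp add: L2_def)
    have "AE s in lborel. t \<le> \<alpha> s" using assms(1) by (simp add: coef_def)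
    from AE_snd[OF this]
    show "AE x in vol \<Omega>. t * ellip * (norm (g x))\<^sup>2 \<le> \<alpha> (snd x) * qform (fst x) (g x) (g x)"
      unfolding AE_vol[OF open_waveguide]
    proof eventually_elim
      case (elim x)
      show ?case
      proof
        assume x: "x \<in> \<Omega>"
        have "t * (ellip * (norm (g x))\<^sup>2) \<le> \<alpha> (snd x) * qform (fst x) (g x) (g x)"
          using elim t ellip_pos by (intro mult_mono qform_ellip[OF x]) auto
        then show "t * ellip * (norm (g x))\<^sup>2 \<le> \<alpha> (snd x) * qform (fst x) (g x) (g x)" by simp
      qed
    qed
  qed
  finally show ?thesis .
qed

lemma Bf_nonneg:
  assumes "coef \<alpha> t B" "g \<in> L2 (vol \<Omega>)" shows "0 \<le> Bf \<alpha> g g"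
proof (rule order_trans[OF _ Bf_coercive[OF assms]])
  show "0 \<le> t * ellip * (L2_norm (vol \<Omega>) g)\<^sup>2"
    using assms(1) ellip_pos by (simp add: coef_def)
qed

lemma Bf_square_add:
  assumes "coef \<alpha> t B" "g \<in> L2 (vol \<Omega>)" "h \<in> L2 (vol \<Omega>)"
  shows "Bf \<alpha> (\<lambda>x. g x + h x) (\<lambda>x. g x + h x) = Bf \<alpha> g g + 2 * Bf \<alpha> g h + Bf \<alpha> h h"
proof -
  note gh = L2_add[OF assms(2,3)]
  have "Bf \<alpha> (\<lambda>x. g x + h x) (\<lambda>x. g x + h x) = Bf \<alpha> g (\<lambda>x. g x + h x) + Bf \<alpha> h (\<lambda>x. g x + h x)"
    by (rule Bf_add[OF assms gh])
  also have "Bf \<alpha> g (\<lambda>x. g x + h x) = Bf \<alpha> g g + Bf \<alpha> g h"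
    by (rule Bf_add_right[OF assms(1,2,3,2)])
  also have "Bf \<alpha> h (\<lambda>x. g x + h x) = Bf \<alpha> g h + Bf \<alpha> h h"
    using Bf_add_right[OF assms(1,2,3,3)] Bf_sym[of \<alpha> g h] by presburger
  finally show ?thesis by simp
qed

section \<open>Weak solutions and the Dirichlet-to-Neumann map\<close>

definition weak_sol where
  "weak_sol \<alpha> u h f \<longleftrightarrow> tr u h f \<and> (\<forall>v k. tr v k (\<lambda>x. 0) \<longrightarrow> Bf \<alpha> h k = 0)"

text \<open>Dirichlet principle: a competitor differs from the solution by a function of zero trace,
  so the cross term vanishes and Pythagoras remains.\<close>

lemma weak_sol_minimal:
  assumes "coef \<alpha> t B" "weak_sol \<alpha> u h f" "tr G g f"
  shows "Bf \<alpha> h h \<le> Bf \<alpha> g g"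
proof -
  have u: "tr u h f" using assms(2) by (simp add: weak_sol_def)
  have z: "tr (\<lambda>x. G x - u x) (\<lambda>x. g x - h x) (\<lambda>x. 0)" using tr_diff[OF assms(3) u] by simp
  then have "Bf \<alpha> h (\<lambda>x. g x - h x) = 0" using assms(2) by (auto simp: weak_sol_def)
  then have "Bf \<alpha> g g = Bf \<alpha> h h + Bf \<alpha> (\<lambda>x. g x - h x) (\<lambda>x. g x - h x)"
    using Bf_square_add[OF assms(1) trD(2)[OF u] trD(2)[OF z]] by simp
  then show ?thesis using Bf_nonneg[OF assms(1) trD(2)[OF z]] by simp
qed

text \<open>First-order optimality without differentiation; \<open>s = b / (c + 1)\<close> has the
  sign of \<open>b\<close> and is small enough for the quadratic term to lose.\<close>

lemma quadratic_zero:
  fixes b c :: real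
  assumes "\<And>s. 2 * s * b \<le> s\<^sup>2 * c" "0 \<le> c" shows "b = 0"
proof (rule ccontr)
  assume "b \<noteq> 0"
  define s where "s = b / (c + 1)"
  have b: "b = s * (c + 1)" using assms(2) by (simp add: s_def)
  have "2 * s * (s * (c + 1)) \<le> s\<^sup>2 * c" using assms(1)[of s] b by simp
  then have "s\<^sup>2 * (c + 2) \<le> 0" by (simp add: power2_eq_square algebra_simps)
  moreover have "s \<noteq> 0" using \<open>b \<noteq> 0\<close> b by auto
  then have "s\<^sup>2 * (c + 2) > 0" using assms(2) by (intro mult_pos_pos) auto
  ultimately show False by simp
qed

text \<open>Direct method: project \<open>g\<close> onto the gradients of zero-trace functions in
  the energy norm. Minimising gradients are Cauchy by the parallelogram identity,
  \<open>poincare\<close> carries this over to the functions, and \<open>tr_closed\<close> keeps the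
  trace zero in the limit.\<close>

lemma weak_sol_exists:
  assumes a: "coef \<alpha> t B" and G: "tr G g f"
  obtains u h where "weak_sol \<alpha> u h f"
proof -
  have t: "t > 0" and B: "B \<ge> 0" using a by (auto simp: coef_def)
  define N where "N k = Bf \<alpha> (\<lambda>x. g x - k x) (\<lambda>x. g x - k x)" for k
  define V where "V = {N k |v k. tr v k (\<lambda>x. 0)}"
  define d where "d = Inf V"
  note gL = trD(2)[OF G]
  have N0: "0 \<le> N k" if "tr v k (\<lambda>x. 0)" for v k
    unfolding N_def by (rule Bf_nonneg[OF a L2_diff[OF gL trD(2)[OF that]]])
  have bb: "bdd_below V" unfolding V_def by (rule bdd_belowI[of _ 0]) (use N0 in auto)
  have ne: "V \<noteq> {}" unfolding V_def using tr_zero by blast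
  have dN: "d \<le> N k" if "tr v k (\<lambda>x. 0)" for v k
    unfolding d_def by (rule cInf_lower[OF _ bb]) (use that in \<open>auto simp: V_def\<close>)
  have "\<exists>v k. tr v k (\<lambda>x. 0) \<and> N k < d + inverse (real (Suc n))" for n
  proof -
    have "Inf V < d + inverse (real (Suc n))" by (simp add: d_def)
    then obtain y where "y \<in> V" "y < d + inverse (real (Suc n))" using cInf_less_iff[OF ne bb] by blast
    then show ?thesis by (auto simp: V_def)
  qed
  then obtain v where "\<And>n. \<exists>k. tr (v n) k (\<lambda>x. 0) \<and> N k < d + inverse (real (Suc n))" by metis
  then obtain k where k: "\<And>n. tr (v n) (k n) (\<lambda>x. 0)" "\<And>n. N (k n) < d + inverse (real (Suc n))" by metis
  note vL = trD(1)[OF k(1)] and kL = trD(2)[OF k(1)]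
  \<comment> \<open>Parallelogram identity: the midpoint of two admissible fields is admissible and
    has energy at least \<open>d\<close>, so twice the sum of the two excesses over \<open>d\<close>
    bounds the energy of the difference.\<close>
  have cau: "t * ellip * (L2_norm (vol \<Omega>) (\<lambda>x. k m x - k n x))\<^sup>2 \<le> 2 * inverse (real (Suc m)) + 2 * inverse (real (Suc n))" for m n
  proof -
    let ?a = "\<lambda>x. g x - k m x" and ?b = "\<lambda>x. g x - k n x"
    note aL = L2_diff[OF gL kL[of m]] and bL = L2_diff[OF gL kL[of n]]
    have mid: "tr (\<lambda>x. (1/2) * (v m x + v n x)) (\<lambda>x. (1/2) *\<^sub>R (k m x + k n x)) (\<lambda>x. 0)"
      using tr_scale[OF tr_add[OF k(1)[of m] k(1)[of n]], of "1/2"] by simp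
    have e1: "(\<lambda>x. g x - (1/2) *\<^sub>R (k m x + k n x)) = (\<lambda>x. (1/2) *\<^sub>R (?a x + ?b x))"
    proof (rule ext)
      fix x
      have 1: "?a x + ?b x = 2 *\<^sub>R g x - (k m x + k n x)" by (simp add: scaleR_2)
      show "g x - (1/2) *\<^sub>R (k m x + k n x) = (1/2) *\<^sub>R (?a x + ?b x)"
        unfolding 1 scaleR_right_diff_distrib by simp
    qed
    have "4 * N (\<lambda>x. (1/2) *\<^sub>R (k m x + k n x)) = Bf \<alpha> (\<lambda>x. ?a x + ?b x) (\<lambda>x. ?a x + ?b x)"
      unfolding N_def e1 Bf_scale Bf_scale_right by simp
    also have "\<dots> = Bf \<alpha> ?a ?a + 2 * Bf \<alpha> ?a ?b + Bf \<alpha> ?b ?b" by (rule Bf_square_add[OF a aL bL])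
    finally have s1: "Bf \<alpha> ?a ?a + 2 * Bf \<alpha> ?a ?b + Bf \<alpha> ?b ?b \<ge> 4 * d" using dN[OF mid] by simp
    have "Bf \<alpha> (\<lambda>x. k m x - k n x) (\<lambda>x. k m x - k n x) = Bf \<alpha> (\<lambda>x. ?b x + (-1) *\<^sub>R ?a x) (\<lambda>x. ?b x + (-1) *\<^sub>R ?a x)"
      by simp
    also have "\<dots> = Bf \<alpha> ?b ?b + 2 * Bf \<alpha> ?b (\<lambda>x. (-1) *\<^sub>R ?a x) + Bf \<alpha> (\<lambda>x. (-1) *\<^sub>R ?a x) (\<lambda>x. (-1) *\<^sub>R ?a x)"
      by (rule Bf_square_add[OF a bL L2_scaleR(1)[OF aL]])
    also have "Bf \<alpha> ?b (\<lambda>x. (-1) *\<^sub>R ?a x) = - Bf \<alpha> ?a ?b"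
      unfolding Bf_scale_right using Bf_sym[of \<alpha> ?a ?b] by linarith
    also have "Bf \<alpha> (\<lambda>x. (-1) *\<^sub>R ?a x) (\<lambda>x. (-1) *\<^sub>R ?a x) = Bf \<alpha> ?a ?a"
      unfolding Bf_scale Bf_scale_right by linarith
    finally have "Bf \<alpha> (\<lambda>x. k m x - k n x) (\<lambda>x. k m x - k n x) \<le> 2 * N (k m) + 2 * N (k n) - 4 * d"
      using s1 by (simp add: N_def)
    then show ?thesis
      using Bf_coercive[OF a L2_diff[OF kL[of m] kL[of n]]] k(2)[of m] k(2)[of n] by linarith
  qed
  have te: "t * ellip > 0" using t ellip_pos by simp
  have small: "\<exists>M. \<forall>m\<ge>M. \<forall>n\<ge>M. L2_norm (vol \<Omega>) (\<lambda>x. k m x - k n x) < e" if e: "e > 0" for e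
  proof -
    have "e\<^sup>2 * (t * ellip) / 4 > 0" using e te by simp
    then obtain M where M: "inverse (real (Suc M)) < e\<^sup>2 * (t * ellip) / 4" using reals_Archimedean by blast
    have "L2_norm (vol \<Omega>) (\<lambda>x. k m x - k n x) < e" if "m \<ge> M" "n \<ge> M" for m n
    proof -
      have "inverse (real (Suc m)) \<le> inverse (real (Suc M))" "inverse (real (Suc n)) \<le> inverse (real (Suc M))"
        using that by (auto intro!: le_imp_inverse_le)
      then have "t * ellip * (L2_norm (vol \<Omega>) (\<lambda>x. k m x - k n x))\<^sup>2 < t * ellip * e\<^sup>2"
        using cau[of m n] M by argo
      then have "(L2_norm (vol \<Omega>) (\<lambda>x. k m x - k n x))\<^sup>2 < e\<^sup>2"
        by (rule mult_less_cancel_left_pos[OF te, THEN iffD1])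
      then show ?thesis by (rule power2_less_imp_less) (use e in simp)
    qed
    then show ?thesis by blast
  qed
  obtain k' where k': "k' \<in> L2 (vol \<Omega>)" "(\<lambda>n. L2_norm (vol \<Omega>) (\<lambda>x. k n x - k' x)) \<longlonglongrightarrow> 0"
    by (rule L2_complete[OF kL small])
  have vsmall: "\<exists>M. \<forall>m\<ge>M. \<forall>n\<ge>M. L2_norm (vol \<Omega>) (\<lambda>x. v m x - v n x) < e" if e: "e > 0" for e
  proof -
    have W: "width > 0" by (rule width(1))
    obtain M where M: "\<And>m n. m \<ge> M \<Longrightarrow> n \<ge> M \<Longrightarrow> L2_norm (vol \<Omega>) (\<lambda>x. k m x - k n x) < e / (2 * width)"
      using small[of "e / (2 * width)"] e W by auto
    have "L2_norm (vol \<Omega>) (\<lambda>x. v m x - v n x) < e" if "m \<ge> M" "n \<ge> M" for m n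
    proof (rule power2_less_imp_less)
      have "tr (\<lambda>x. v m x - v n x) (\<lambda>x. k m x - k n x) (\<lambda>x. 0)" using tr_diff[OF k(1) k(1)] by simp
      from poincare[OF this] have "(L2_norm (vol \<Omega>) (\<lambda>x. v m x - v n x))\<^sup>2 \<le> 2 * width\<^sup>2 * (L2_norm (vol \<Omega>) (\<lambda>x. k m x - k n x))\<^sup>2" .
      also have "\<dots> \<le> 2 * width\<^sup>2 * (e / (2 * width))\<^sup>2"
        using M[OF that] by (intro mult_left_mono power_mono) auto
      also have "\<dots> < e\<^sup>2" using W e by (simp add: power_divide power_mult_distrib)
      finally show "(L2_norm (vol \<Omega>) (\<lambda>x. v m x - v n x))\<^sup>2 < e\<^sup>2" .
    qed (use e in simp)
    then show ?thesis by blast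
  qed
  obtain v' where v': "v' \<in> L2 (vol \<Omega>)" "(\<lambda>n. L2_norm (vol \<Omega>) (\<lambda>x. v n x - v' x)) \<longlonglongrightarrow> 0"
    by (rule L2_complete[OF vL vsmall])
  have z: "tr v' k' (\<lambda>x. 0)" by (rule tr_closed[OF k(1) v'(1) k'(1) v'(2) k'(2)])
  \<comment> \<open>Minimality is tested at the approximants, whose energy is known up to 1/(n+1);
    the inequality then passes to the limit.\<close>
  have orth: "Bf \<alpha> (\<lambda>x. g x - k' x) \<kappa> = 0" if w: "tr w \<kappa> (\<lambda>x. 0)" for w \<kappa>
  proof (rule quadratic_zero)
    note \<kappa>L = trD(2)[OF w]
    show "0 \<le> Bf \<alpha> \<kappa> \<kappa>" by (rule Bf_nonneg[OF a \<kappa>L])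
    fix s :: real
    have lim: "(\<lambda>n. Bf \<alpha> (\<lambda>x. g x - k n x) \<kappa>) \<longlonglongrightarrow> Bf \<alpha> (\<lambda>x. g x - k' x) \<kappa>"
    proof (rule LIM_zero_cancel, rule Lim_null_comparison)
      let ?C = "B * (2 + width\<^sup>2)"
      show "(\<lambda>n. ?C * (L2_norm (vol \<Omega>) (\<lambda>x. k n x - k' x) * L2_norm (vol \<Omega>) \<kappa>)) \<longlonglongrightarrow> 0"
        using tendsto_mult_left[OF tendsto_mult_right[OF k'(2), of "L2_norm (vol \<Omega>) \<kappa>"], of ?C] by simp
      have "Bf \<alpha> (\<lambda>x. g x - k n x) \<kappa> - Bf \<alpha> (\<lambda>x. g x - k' x) \<kappa> = - Bf \<alpha> (\<lambda>x. k n x - k' x) \<kappa>" for n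
        using Bf_diff[OF a gL kL[of n] \<kappa>L] Bf_diff[OF a gL k'(1) \<kappa>L] Bf_diff[OF a kL[of n] k'(1) \<kappa>L] by simp
      then show "\<forall>\<^sub>F n in sequentially. norm (Bf \<alpha> (\<lambda>x. g x - k n x) \<kappa> - Bf \<alpha> (\<lambda>x. g x - k' x) \<kappa>)
         \<le> ?C * (L2_norm (vol \<Omega>) (\<lambda>x. k n x - k' x) * L2_norm (vol \<Omega>) \<kappa>)"
        using Bf_integrable(2)[OF a L2_diff[OF kL k'(1)] \<kappa>L] by simp
    qed
    have "d \<le> d + inverse (real (Suc n)) - 2 * s * Bf \<alpha> (\<lambda>x. g x - k n x) \<kappa> + s\<^sup>2 * Bf \<alpha> \<kappa> \<kappa>" for n
    proof -
      have t': "tr (\<lambda>x. v n x + s * w x) (\<lambda>x. k n x + s *\<^sub>R \<kappa> x) (\<lambda>x. 0)"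
        using tr_add[OF k(1)[of n] tr_scale[OF w, of s]] by simp
      have e: "(\<lambda>x. g x - (k n x + s *\<^sub>R \<kappa> x)) = (\<lambda>x. (g x - k n x) + (- s) *\<^sub>R \<kappa> x)" by auto
      have "N (\<lambda>x. k n x + s *\<^sub>R \<kappa> x) = N (k n) + 2 * Bf \<alpha> (\<lambda>x. g x - k n x) (\<lambda>x. (- s) *\<^sub>R \<kappa> x) + Bf \<alpha> (\<lambda>x. (- s) *\<^sub>R \<kappa> x) (\<lambda>x. (- s) *\<^sub>R \<kappa> x)"
        unfolding N_def e by (rule Bf_square_add[OF a L2_diff[OF gL kL] L2_scaleR(1)[OF \<kappa>L]])
      also have "Bf \<alpha> (\<lambda>x. g x - k n x) (\<lambda>x. (- s) *\<^sub>R \<kappa> x) = - s * Bf \<alpha> (\<lambda>x. g x - k n x) \<kappa>"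
        by (rule Bf_scale_right)
      also have "Bf \<alpha> (\<lambda>x. (- s) *\<^sub>R \<kappa> x) (\<lambda>x. (- s) *\<^sub>R \<kappa> x) = s\<^sup>2 * Bf \<alpha> \<kappa> \<kappa>"
        unfolding Bf_scale Bf_scale_right by (simp add: power2_eq_square)
      finally show ?thesis using dN[OF t'] k(2)[of n] by simp
    qed
    moreover have "(\<lambda>n. d + inverse (real (Suc n)) - 2 * s * Bf \<alpha> (\<lambda>x. g x - k n x) \<kappa> + s\<^sup>2 * Bf \<alpha> \<kappa> \<kappa>) \<longlonglongrightarrow>
      d + 0 - 2 * s * Bf \<alpha> (\<lambda>x. g x - k' x) \<kappa> + s\<^sup>2 * Bf \<alpha> \<kappa> \<kappa>"
      by (intro tendsto_intros lim LIMSEQ_inverse_real_of_nat)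
    ultimately have "d \<le> d + 0 - 2 * s * Bf \<alpha> (\<lambda>x. g x - k' x) \<kappa> + s\<^sup>2 * Bf \<alpha> \<kappa> \<kappa>"
      by (intro LIMSEQ_le_const) auto
    then show "2 * s * Bf \<alpha> (\<lambda>x. g x - k' x) \<kappa> \<le> s\<^sup>2 * Bf \<alpha> \<kappa> \<kappa>" by simp
  qed
  have "tr (\<lambda>x. G x - v' x) (\<lambda>x. g x - k' x) f" using tr_diff[OF G z] by simp
  then have "weak_sol \<alpha> (\<lambda>x. G x - v' x) (\<lambda>x. g x - k' x) f" using orth by (auto simp: weak_sol_def)
  then show ?thesis by (rule that)
qed

text \<open>Settles both choices in \<open>DN\<close>. A solution exists, so the first choice is
  one; two extensions of the same \<open>g\<close> differ by a function of zero trace, so evaluating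
  at any extension gives a witness for the second.\<close>

lemma DN_props:
  assumes a: "coef \<alpha> t B" and f: "f \<in> Htilde \<omega>"
  obtains u h where "weak_sol \<alpha> u h f" "\<And>g G k. g \<in> Htilde \<omega> \<Longrightarrow> tr G k g \<Longrightarrow> DN \<omega> \<alpha> f g = Bf \<alpha> h k"
proof -
  have am: "\<alpha> \<in> borel_measurable borel" using a by (simp add: coef_def)
  have wg: "wgrad \<Omega> v \<in> L2 (vol \<Omega>)" if "v \<in> H1 \<Omega>" for v using wgrad_L2(2)[OF that open_waveguide] .
  have ef: "energy_form \<omega> \<alpha> u v = Bf \<alpha> h k" if "tr u h p" "tr v k q" for u h p v k q
    unfolding energy_form_Bf
    by (rule Bf_cong_AE[OF am tr_H1(2)[OF that(1)] tr_H1(2)[OF that(2)] wg[OF tr_H1(1)[OF that(1)]] trD(2)[OF that(1)]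
        wg[OF tr_H1(1)[OF that(2)]] trD(2)[OF that(2)]])
  obtain G where "has_trace \<omega> G f" using f by (auto simp: Htilde_def)
  from has_trace_tr[OF this] obtain u0 h0 where "weak_sol \<alpha> u0 h0 f" by (rule weak_sol_exists[OF a])
  then have 0: "tr u0 h0 f" "\<And>v k. tr v k (\<lambda>x. 0) \<Longrightarrow> Bf \<alpha> h0 k = 0" by (auto simp: weak_sol_def)
  have "weak_solution \<omega> \<alpha> f u0"
    unfolding weak_solution_def
  proof (intro conjI ballI impI)
    show "u0 \<in> H1 \<Omega>" "has_trace \<omega> u0 f" using tr_H1[OF 0(1)] by auto
    fix v assume "has_trace \<omega> v (\<lambda>_. 0)"
    from has_trace_tr[OF this] show "energy_form \<omega> \<alpha> u0 v = 0" using ef[OF 0(1)] 0(2) by simp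
  qed
  define u where "u = (SOME u. weak_solution \<omega> \<alpha> f u)"
  have ws: "weak_solution \<omega> \<alpha> f u"
    unfolding u_def by (rule someI[of "weak_solution \<omega> \<alpha> f" u0]) fact
  have u: "tr u (wgrad \<Omega> u) f" by (rule has_trace_tr) (use ws in \<open>simp add: weak_solution_def\<close>)
  have orth: "Bf \<alpha> (wgrad \<Omega> u) k = 0" if "tr v k (\<lambda>x. 0)" for v k
    using ws tr_H1[OF that] ef[OF u that] unfolding weak_solution_def by metis
  have "weak_sol \<alpha> u (wgrad \<Omega> u) f" unfolding weak_sol_def using u orth by blast
  moreover have "DN \<omega> \<alpha> f g = Bf \<alpha> (wgrad \<Omega> u) k" if g: "g \<in> Htilde \<omega>" and Gk: "tr G k g" for g G k
  proof -
    define P where "P \<Phi> \<longleftrightarrow> (\<forall>g \<in> Htilde \<omega>. \<forall>G \<in> H1 \<Omega>. has_trace \<omega> G g \<longrightarrow> \<Phi> g = energy_form \<omega> \<alpha> u G)" for \<Phi>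
    have "P (\<lambda>g. energy_form \<omega> \<alpha> u (SOME G. has_trace \<omega> G g))"
      unfolding P_def
    proof (intro ballI impI)
      fix g G assume "has_trace \<omega> G g"
      then have "has_trace \<omega> (SOME G. has_trace \<omega> G g) g" by (rule someI[of "\<lambda>G. has_trace \<omega> G g" G])
      define G' where "G' = (SOME G. has_trace \<omega> G g)"
      have t1: "tr G (wgrad \<Omega> G) g" by (rule has_trace_tr) fact
      have t2: "tr G' (wgrad \<Omega> G') g" unfolding G'_def by (rule has_trace_tr) fact
      have "Bf \<alpha> (wgrad \<Omega> u) (\<lambda>x. wgrad \<Omega> G x - wgrad \<Omega> G' x) = 0"
        by (rule orth) (use tr_diff[OF t1 t2] in simp)
      then have "Bf \<alpha> (wgrad \<Omega> u) (wgrad \<Omega> G) = Bf \<alpha> (wgrad \<Omega> u) (wgrad \<Omega> G')"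
        using Bf_diff_right[OF a trD(2)[OF t1] trD(2)[OF t2] trD(2)[OF u]] by simp
      then show "energy_form \<omega> \<alpha> u (SOME G. has_trace \<omega> G g) = energy_form \<omega> \<alpha> u G"
        unfolding G'_def[symmetric] by (simp add: energy_form_Bf)
    qed
    then have "P (SOME \<Phi>. P \<Phi>)" by (rule someI[of P])
    moreover have "DN \<omega> \<alpha> f = (SOME \<Phi>. P \<Phi>)" unfolding DN_def P_def u_def Let_def ..
    ultimately have "DN \<omega> \<alpha> f g = energy_form \<omega> \<alpha> u G" using g tr_H1[OF Gk] by (simp add: P_def)
    then show ?thesis using ef[OF u Gk] by simp
  qed
  ultimately show ?thesis by (rule that)
qed

text \<open>On the diagonal the map is the minimal energy. Equality will be used for one
  coefficient, the upper bound with the same field as a competitor for the other.\<close>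

lemma DN_energy:
  assumes a: "coef \<alpha> t B" and f: "f \<in> Htilde \<omega>"
  shows "weak_sol \<alpha> u h f \<Longrightarrow> DN \<omega> \<alpha> f f = Bf \<alpha> h h" "tr u h f \<Longrightarrow> DN \<omega> \<alpha> f f \<le> Bf \<alpha> h h"
proof -
  obtain v k where vk: "weak_sol \<alpha> v k f" "\<And>g G k'. g \<in> Htilde \<omega> \<Longrightarrow> tr G k' g \<Longrightarrow> DN \<omega> \<alpha> f g = Bf \<alpha> k k'"
    by (rule DN_props[OF a f]) (rule that)
  have v: "tr v k f" using vk(1) by (simp add: weak_sol_def)
  have D: "DN \<omega> \<alpha> f f = Bf \<alpha> k k" by (rule vk(2)[OF f v])
  show "DN \<omega> \<alpha> f f \<le> Bf \<alpha> h h" if "tr u h f" using weak_sol_minimal[OF a vk(1) that] D by simp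
  show "DN \<omega> \<alpha> f f = Bf \<alpha> h h" if "weak_sol \<alpha> u h f"
    using weak_sol_minimal[OF a vk(1), of u h] weak_sol_minimal[OF a that v] that D by (simp add: weak_sol_def)
qed

end

section \<open>Lipschitz coefficients on the line\<close>

text \<open>Gaussian elimination by induction on the equations: an equation with a nonzero pivot is
  solved for the unknown \<open>j0\<close>, which removes one equation and one unknown.\<close>

lemma kernel_exists:
  fixes A :: "'a \<Rightarrow> 'b \<Rightarrow> real"
  assumes "finite I" "finite J" "card I < card J"
  shows "\<exists>c. (\<exists>j\<in>J. c j \<noteq> 0) \<and> (\<forall>i\<in>I. (\<Sum>j\<in>J. c j * A i j) = 0)"
  using assms
proof (induction I arbitrary: J A rule: finite_induct)
  case empty
  then have "J \<noteq> {}" by auto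
  then obtain j where "j \<in> J" by blast
  then show ?case by (intro exI[of _ "\<lambda>_. 1"]) auto
next
  case (insert i I)
  show ?case
  proof (cases "\<forall>j\<in>J. A i j = 0")
    case True
    have "finite J" "card I < card J" using insert by auto
    from insert.IH[OF this, of A] obtain c where "\<exists>j\<in>J. c j \<noteq> 0" "\<forall>i\<in>I. (\<Sum>j\<in>J. c j * A i j) = 0" by blast
    then show ?thesis using True by (intro exI[of _ c]) auto
  next
    case False
    then obtain j0 where j0: "j0 \<in> J" "A i j0 \<noteq> 0" by blast
    define J' where "J' = J - {j0}"
    \<comment> \<open>The remaining rows after elimination of the unknown \<open>j0\<close> by means
      of row \<open>i\<close>.\<close>
    define A' where "A' i' j = A i' j - A i' j0 * A i j / A i j0" for i' j
    have J': "finite J'" "card I < card J'" "j0 \<notin> J'" "J = insert j0 J'"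
      using insert j0 by (auto simp: J'_def)
    obtain c where c: "\<exists>j\<in>J'. c j \<noteq> 0" "\<And>i. i \<in> I \<Longrightarrow> (\<Sum>j\<in>J'. c j * A' i j) = 0"
      using insert.IH[OF J'(1,2), of A'] by blast
    define d where "d j = (if j = j0 then - (\<Sum>j\<in>J'. c j * A i j) / A i j0 else c j)" for j
    have dJ: "d j = c j" if "j \<in> J'" for j using that J'(3) by (auto simp: d_def)
    have sum: "(\<Sum>j\<in>J. d j * A i' j) = d j0 * A i' j0 + (\<Sum>j\<in>J'. c j * A i' j)" for i'
      unfolding J'(4) using J'(1,3) by (simp add: dJ)
    have "(\<Sum>j\<in>J. d j * A i j) = 0" unfolding sum using j0(2) by (simp add: d_def)
    moreover have "(\<Sum>j\<in>J. d j * A i' j) = 0" if "i' \<in> I" for i'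
    proof -
      have "0 = (\<Sum>j\<in>J'. c j * A' i' j)" using c(2)[OF that] by simp
      also have "\<dots> = (\<Sum>j\<in>J'. c j * A i' j) - (\<Sum>j\<in>J'. (A i' j0 / A i j0) * (c j * A i j))"
        unfolding sum_subtractf[symmetric] by (intro sum.cong refl) (simp add: A'_def right_diff_distrib)
      also have "\<dots> = (\<Sum>j\<in>J'. c j * A i' j) - (A i' j0 / A i j0) * (\<Sum>j\<in>J'. c j * A i j)"
        by (simp add: sum_distrib_left)
      also have "\<dots> = (\<Sum>j\<in>J. d j * A i' j)" unfolding sum by (simp add: d_def)
      finally show ?thesis by simp
    qed
    moreover have "\<exists>j\<in>J. d j \<noteq> 0" using c(1) dJ J'(4) by auto
    ultimately show ?thesis by (intro exI[of _ d]) auto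
  qed
qed

section \<open>Radial bumps and test functions on the line\<close>

lemma vol_UNIV: "vol UNIV = lborel"
  by (rule measure_eqI) (auto simp: sets_restrict_space emeasure_restrict_space)

lemma frechet_real:
  fixes \<psi> :: "real \<Rightarrow> real" assumes "C1_grad \<psi> g" shows "frechet_derivative \<psi> (at x) 1 = g x"
  using C1_gradD(4)[OF assms] by simp

lemma C1_grad_real_deriv:
  fixes \<psi> :: "real \<Rightarrow> real" assumes "C1_grad \<psi> g" shows "(\<psi> has_real_derivative g x) (at x)"
  using C1_gradD(2)[OF assms, of x] by (simp add: has_field_derivative_def inner_real_def)

text \<open>Equal to 1 up to distance \<rho> and to 0 beyond sqrt 2 times \<rho>, for which 3/2 is
  used as a rational bound. The squared distance keeps it C1 at the centre.\<close>

definition bump :: "'a::euclidean_space \<Rightarrow> real \<Rightarrow> 'a \<Rightarrow> real" where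
  "bump c \<rho> x = sstep (2 - (norm (x - c))\<^sup>2 / \<rho>\<^sup>2)"

definition bump' :: "'a::euclidean_space \<Rightarrow> real \<Rightarrow> 'a \<Rightarrow> 'a" where
  "bump' c \<rho> x = sstep' (2 - (norm (x - c))\<^sup>2 / \<rho>\<^sup>2) *\<^sub>R (- (2 / \<rho>\<^sup>2)) *\<^sub>R (x - c)"

lemma bump_C1: "C1_grad (bump c \<rho>) (bump' c \<rho>)"
proof -
  have "C1_grad (\<lambda>x. 2 - (1 / \<rho>\<^sup>2) * (norm (x - c))\<^sup>2) (\<lambda>x. 0 - (1 / \<rho>\<^sup>2) *\<^sub>R (2 *\<^sub>R (x - c)))"
    by (intro C1_grad_diff C1_grad_const C1_grad_scale C1_grad_normsq)
  from C1_grad_compose[OF this sstep_deriv continuous_sstep']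
  show ?thesis by (simp add: bump_def[abs_def] bump'_def[abs_def])
qed

lemma bump_eq_1:
  assumes "\<rho> > 0" "norm (x - c) \<le> \<rho>" shows "bump c \<rho> x = 1" "bump' c \<rho> x = 0"
proof -
  have "(norm (x - c))\<^sup>2 \<le> \<rho>\<^sup>2" using assms by (intro power_mono) auto
  then have "1 \<le> 2 - (norm (x - c))\<^sup>2 / \<rho>\<^sup>2" using assms(1) by (simp add: divide_le_eq)
  then show "bump c \<rho> x = 1" "bump' c \<rho> x = 0" by (simp_all add: bump_def bump'_def sstep_eq_1)
qed

lemma bump_eq_0:
  assumes "\<rho> > 0" "3/2 * \<rho> \<le> norm (x - c)" shows "bump c \<rho> x = 0" "bump' c \<rho> x = 0"
proof -
  have "(3/2 * \<rho>)\<^sup>2 \<le> (norm (x - c))\<^sup>2" using assms by (intro power_mono) auto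
  then have "9/4 * \<rho>\<^sup>2 \<le> (norm (x - c))\<^sup>2" by (simp add: power_mult_distrib power_divide)
  then have "2 * \<rho>\<^sup>2 \<le> (norm (x - c))\<^sup>2" using zero_le_power2[of \<rho>] by linarith
  then have "2 - (norm (x - c))\<^sup>2 / \<rho>\<^sup>2 \<le> 0" using assms(1) by (simp add: le_divide_eq)
  then show "bump c \<rho> x = 0" "bump' c \<rho> x = 0" by (simp_all add: bump_def bump'_def sstep_eq_0)
qed

lemma bump_bounds: "0 \<le> bump c \<rho> x" "bump c \<rho> x \<le> 1"
  by (simp_all add: bump_def sstep_bounds)

lemma bump_C1c:
  assumes "\<rho> > 0" "cball c (3/2 * \<rho>) \<subseteq> \<Omega>" shows "bump c \<rho> \<in> C1c \<Omega>"
proof (rule C1c_I[OF bump_C1 compact_cball assms(2)])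
  show "bump c \<rho> x = 0" if "x \<notin> cball c (3/2 * \<rho>)" for x
    by (rule bump_eq_0(1)[OF assms(1)]) (use that in \<open>auto simp: dist_norm norm_minus_commute\<close>)
qed

lemma bump'_bounded:
  assumes "\<rho> > 0" obtains B where "B > 0" "\<And>x. norm (bump' c \<rho> x) \<le> B"
proof (rule bounded_compact_support[OF C1_gradD(1)[OF bump_C1] compact_cball])
  show "bump' c \<rho> x = 0" if "x \<notin> cball c (3/2 * \<rho>)" for x
    using bump_eq_0(2)[OF assms, of x c] that by (auto simp: dist_norm norm_minus_commute)
qed (rule that)

text \<open>To the right of the support the primitive equals the total integral, which is zero;
  hence it has compact support again.\<close>

lemma C1c_primitive:
  fixes \<psi> :: "real \<Rightarrow> real"
  assumes \<psi>: "\<psi> \<in> C1c {a<..<b}" and ab: "a < b" and 0: "(LINT x|lborel. \<psi> x) = 0"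
  obtains \<Psi> where "\<Psi> \<in> C1c {a<..<b}" "C1_grad \<Psi> \<psi>"
proof -
  obtain g where g: "C1_grad \<psi> g" using C1c_obtain[OF \<psi>] .
  note C = C1_gradD[OF g]
  obtain K where K: "compact K" "K \<subseteq> {a<..<b}" "\<And>x. x \<notin> K \<Longrightarrow> \<psi> x = 0" "\<And>x. x \<notin> K \<Longrightarrow> g x = 0"
    by (rule C1c_support[OF \<psi> g]) (rule that)
  obtain a' b' where ab': "a < a'" "a' \<le> b'" "b' < b" "K \<subseteq> {a'..b'}"
  proof (cases "K = {}")
    case True then show ?thesis using that[of "(a+b)/2" "(a+b)/2"] ab by auto
  next
    case False
    then have "Inf K \<in> K" "Sup K \<in> K" "K \<subseteq> {Inf K..Sup K}"
      using K(1) compact_imp_closed compact_imp_bounded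
      by (auto intro!: closed_contains_Inf closed_contains_Sup cInf_lower cSup_upper bounded_imp_bdd_below bounded_imp_bdd_above)
    moreover from this have "Inf K \<le> Sup K" "Inf K \<in> {a<..<b}" "Sup K \<in> {a<..<b}" using K(2) by auto
    ultimately show ?thesis using that[of "Inf K" "Sup K"] K(2) by auto
  qed
  define \<Psi> where "\<Psi> x = (LINT t:{..x}|lborel. \<psi> t)" for x
  have I: "integrable lborel \<psi>" by (rule integrable_compact_support[OF C(3) K(1,3)])
  have SI: "set_integrable lborel A \<psi>" if "A \<in> sets borel" for A
    using integrable_mult_indicator[OF _ I, of A] that by (simp add: set_integrable_def)
  have lo: "\<Psi> x = 0" if "x < a'" for x
  proof -
    have "\<psi> t = 0" if "t \<le> x" for t using K(3)[of t] ab'(4) that \<open>x < a'\<close> by force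
    then have "(\<lambda>t. indicator {..x} t *\<^sub>R \<psi> t) = (\<lambda>t. 0)" by (auto simp: indicator_def)
    then show ?thesis by (simp add: \<Psi>_def set_lebesgue_integral_def)
  qed
  have hi: "\<Psi> x = 0" if "b' < x" for x
  proof -
    have "\<psi> t = 0" if "t > x" for t using K(3)[of t] ab'(4) that \<open>b' < x\<close> by force
    then have "(\<lambda>t. indicator {..x} t *\<^sub>R \<psi> t) = \<psi>" by (auto simp: indicator_def fun_eq_iff not_le)
    then show ?thesis using 0 by (simp add: \<Psi>_def set_lebesgue_integral_def)
  qed
  have "(\<Psi> has_real_derivative \<psi> x) (at x)" for x
  proof -
    \<comment> \<open>A base point to the left of \<open>x\<close>: the primitive differs by a
      constant from an integral over a bounded interval with \<open>x\<close> in its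
      interior.\<close>
    define c where "c = x - 1"
    have e: "\<Psi> y = \<Psi> c + integral {c..y} \<psi>" if "c \<le> y" for y
    proof -
      have "{..y} = {..c} \<union> {c<..y}" using that by auto
      moreover have "(LINT t:{..c} \<union> {c<..y}|lborel. \<psi> t) = \<Psi> c + (LINT t:{c<..y}|lborel. \<psi> t)"
        unfolding \<Psi>_def by (rule set_integral_Un) (auto intro!: SI)
      ultimately have "\<Psi> y = \<Psi> c + (LINT t:{c<..y}|lborel. \<psi> t)" by (simp add: \<Psi>_def)
      also have "(LINT t:{c<..y}|lborel. \<psi> t) = (LINT t:{c..y}|lborel. \<psi> t)"
        unfolding set_lebesgue_integral_def
      proof (rule integral_cong_AE)
        show "AE t in lborel. indicator {c<..y} t *\<^sub>R \<psi> t = indicator {c..y} t *\<^sub>R \<psi> t"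
          using AE_lborel_singleton[of c] by eventually_elim (auto simp: indicator_def)
      qed (use C(5) in measurable)
      also have "\<dots> = integral {c..y} \<psi>" by (rule set_borel_integral_eq_integral(2)) (rule SI, simp)
      finally show ?thesis .
    qed
    have "((\<lambda>y. integral {c..y} \<psi>) has_real_derivative \<psi> x) (at x within {c..x+1})"
      by (rule integral_has_real_derivative) (auto simp: c_def intro: continuous_on_subset[OF C(3)])
    from DERIV_add[OF DERIV_const[of "\<Psi> c"] this]
    have "((\<lambda>y. \<Psi> c + integral {c..y} \<psi>) has_real_derivative \<psi> x) (at x within {c..x+1})" by simp
    then have "(\<Psi> has_real_derivative \<psi> x) (at x within {c..x+1})"
    proof (rule has_field_derivative_transform_within)
      show "(0::real) < 1" "x \<in> {c..x + 1}" by (simp_all add: c_def)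
      show "\<Psi> c + integral {c..y} \<psi> = \<Psi> y" if "y \<in> {c..x + 1}" for y using e[of y] that by simp
    qed
    then show ?thesis by (subst (asm) at_within_interior) (auto simp: c_def)
  qed
  then have "C1_grad \<Psi> \<psi>" by (rule C1_grad_real) (rule C(3))
  moreover have "\<Psi> \<in> C1c {a<..<b}"
    by (rule C1c_I[OF \<open>C1_grad \<Psi> \<psi>\<close> compact_Icc[of a' b']]) (use ab' lo hi in \<open>auto simp: not_le\<close>)
  ultimately show ?thesis using that by blast
qed

text \<open>Du Bois-Reymond: a test function of integral zero is a derivative of a test function.
  Subtracting a multiple of a fixed \<theta> of integral one reaches every test function, and the
  constant is the pairing of \<open>v\<close> with \<theta>.\<close>

lemma weak_derivative_zero_const:
  fixes v :: "real \<Rightarrow> real"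
  assumes ab: "a < b" and I: "\<And>K. compact K \<Longrightarrow> K \<subseteq> {a<..<b} \<Longrightarrow> set_integrable lborel K v"
    and 0: "\<And>\<psi> g. \<psi> \<in> C1c {a<..<b} \<Longrightarrow> C1_grad \<psi> g \<Longrightarrow> (LINT x|vol {a<..<b}. v x * g x) = 0"
  obtains c where "AE x in lborel. x \<in> {a<..<b} \<longrightarrow> v x = c"
proof -
  let ?U = "{a<..<b}"
  have O: "open ?U" by simp
  define \<rho> where "\<rho> = (b - a) / 4"
  have \<rho>: "\<rho> > 0" using ab by (simp add: \<rho>_def)
  define \<theta>0 where "\<theta>0 = bump ((a + b) / 2) \<rho>"
  have t0: "\<theta>0 \<in> C1c ?U" unfolding \<theta>0_def
    by (rule bump_C1c[OF \<rho>]) (use ab in \<open>auto simp: cball_eq_atLeastAtMost \<rho>_def field_simps\<close>)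
  obtain g0 where g0: "C1_grad \<theta>0 g0" using C1c_obtain[OF t0] .
  have int: "integrable lborel \<psi>" if p: "\<psi> \<in> C1c ?U" for \<psi> :: "real \<Rightarrow> real"
  proof -
    obtain g where g: "C1_grad \<psi> g" using C1c_obtain[OF p] .
    obtain K where "compact K" "K \<subseteq> ?U" "\<And>x. x \<notin> K \<Longrightarrow> \<psi> x = 0" "\<And>x. x \<notin> K \<Longrightarrow> g x = 0"
      by (rule C1c_support[OF p g]) (rule that)
    then show ?thesis using integrable_compact_support[OF C1_gradD(3)[OF g]] by blast
  qed
  define m where "m = (LINT x|lborel. \<theta>0 x)"
  have m: "m > 0"
  proof -
    have "2 * \<rho> = (LINT x|lborel. indicator {(a+b)/2 - \<rho>..(a+b)/2 + \<rho>} x)" using \<rho> by simp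
    also have "\<dots> \<le> m"
      unfolding m_def
    proof (rule integral_mono[OF _ int[OF t0]])
      show "integrable lborel (indicator {(a+b)/2 - \<rho>..(a+b)/2 + \<rho>} :: real \<Rightarrow> real)" using \<rho> by (intro integrable_real_indicator) auto
      fix x show "indicator {(a+b)/2 - \<rho>..(a+b)/2 + \<rho>} x \<le> \<theta>0 x"
        using bump_eq_1(1)[OF \<rho>, of x "(a+b)/2"] bump_bounds[of "(a+b)/2" \<rho> x] by (auto simp: \<theta>0_def indicator_def)
    qed
    finally show ?thesis using \<rho> by linarith
  qed
  define \<theta> where "\<theta> x = (1/m) * \<theta>0 x" for x
  have t: "\<theta> \<in> C1c ?U" unfolding \<theta>_def[abs_def] by (rule C1c_scale[OF t0])
  have t1: "(LINT x|lborel. \<theta> x) = 1" unfolding \<theta>_def using m by (simp add: m_def)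
  have times: "integrable (vol ?U) (\<lambda>x. w x * \<psi> x)" if w: "\<And>K. compact K \<Longrightarrow> K \<subseteq> ?U \<Longrightarrow> set_integrable lborel K w"
    and p: "\<psi> \<in> C1c ?U" for w \<psi> :: "real \<Rightarrow> real"
  proof -
    obtain g where g: "C1_grad \<psi> g" using C1c_obtain[OF p] .
    obtain K where "compact K" "K \<subseteq> ?U" "\<And>x. x \<notin> K \<Longrightarrow> \<psi> x = 0" "\<And>x. x \<notin> K \<Longrightarrow> g x = 0"
      by (rule C1c_support[OF p g]) (rule that)
    then show ?thesis using set_integrable_times_test[OF O w C1_gradD(3)[OF g]] by blast
  qed
  define c where "c = (LINT x|vol ?U. v x * \<theta> x)"
  have cI: "set_integrable lborel K (\<lambda>x. c)" if "compact K" for K :: "real set"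
    unfolding set_integrable_def by (rule borel_integrable_compact[OF that]) simp
  have "AE x in lborel. x \<in> ?U \<longrightarrow> v x - c = 0"
  proof (rule fundamental_lemma[OF O])
    show "set_integrable lborel K (\<lambda>x. v x - c)" if "compact K" "K \<subseteq> ?U" for K
      by (rule set_integral_diff(1)[OF I[OF that] cI[OF that(1)]])
    fix \<psi> assume p: "\<psi> \<in> C1c ?U"
    define q where "q = (LINT x|lborel. \<psi> x)"
    \<comment> \<open>Has integral zero, so its primitive is an admissible test function.\<close>
    define \<psi>0 where "\<psi>0 x = \<psi> x + (- q) * \<theta> x" for x
    have p0: "\<psi>0 \<in> C1c ?U" unfolding \<psi>0_def by (intro C1c_add p C1c_scale t)
    have "(LINT x|lborel. \<psi>0 x) = 0" unfolding \<psi>0_def using int[OF p] int[OF t] t1 by (simp add: q_def)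
    then obtain \<Psi> where "\<Psi> \<in> C1c ?U" "C1_grad \<Psi> \<psi>0" by (rule C1c_primitive[OF p0 ab])
    then have "0 = (LINT x|vol ?U. v x * \<psi>0 x)" by (rule 0[symmetric])
    also have "\<dots> = (LINT x|vol ?U. v x * \<psi> x) - q * c"
      using times[OF I p] times[OF I t] by (simp add: \<psi>0_def algebra_simps c_def)
    finally have 1: "(LINT x|vol ?U. v x * \<psi> x) = q * c" by simp
    have "(LINT x|vol ?U. c * \<psi> x) = c * (LINT x|vol ?U. \<psi> x)" by simp
    also have "(LINT x|vol ?U. \<psi> x) = q"
    proof -
      obtain g where g: "C1_grad \<psi> g" using C1c_obtain[OF p] .
      have "\<psi> x = 0" if "x \<notin> ?U" for x using C1c_support[OF p g] that by (metis subsetD)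
      then show ?thesis unfolding q_def by (intro LINT_vol_support O) auto
    qed
    finally have 2: "(LINT x|vol ?U. c * \<psi> x) = c * q" .
    have "integrable (vol ?U) (\<lambda>x. c * \<psi> x)" by (rule times[OF cI p])
    then show "(LINT x|vol ?U. (v x - c) * \<psi> x) = 0"
      using times[OF I p] 1 2 by (auto simp: left_diff_distrib)
  qed
  then have "AE x in lborel. x \<in> {a<..<b} \<longrightarrow> v x = c" by eventually_elim auto
  then show ?thesis by (rule that)
qed

text \<open>A primitive of the weak derivative is Lipschitz, and Fubini shows that it has the same
  weak derivative; the difference is constant. Applied to the difference of the coefficients, this
  yields an interval on which that difference keeps most of its size.\<close>

lemma weak_derivative_bounded_continuous:
  fixes v \<beta> :: "real \<Rightarrow> real"
  assumes ab: "a < b" and w: "has_weak_grad UNIV v \<beta>" and bd: "AE x in lborel. \<bar>\<beta> x\<bar> \<le> B" and B: "0 \<le> B"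
  obtains v' where "continuous_on UNIV v'" "AE x in lborel. x \<in> {a<..<b} \<longrightarrow> v x = v' x"
proof -
  let ?U = "{a<..<b}"
  have "\<beta> \<in> borel_measurable (vol UNIV)"
    by (rule weak_grad_measurable) (use has_weak_gradD(2)[OF w] in auto)
  then have [measurable]: "\<beta> \<in> borel_measurable borel" by (simp add: vol_UNIV)
  \<comment> \<open>Truncated and cut to the interval so that the bound holds at every point and the
    function is integrable; on the interval nothing changes up to a null set.\<close>
  define \<beta>1 where "\<beta>1 t = indicator {a..b} t * max (- B) (min B (\<beta> t))" for t
  have [measurable]: "\<beta>1 \<in> borel_measurable borel" unfolding \<beta>1_def by measurable
  have b1: "\<bar>\<beta>1 t\<bar> \<le> B * indicator {a..b} t" for t using B by (auto simp: \<beta>1_def indicator_def)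
  have \<beta>eq: "AE t in lborel. t \<in> {a..b} \<longrightarrow> \<beta>1 t = \<beta> t"
    using bd by eventually_elim (auto simp: \<beta>1_def)
  have Ii: "integrable lborel (\<lambda>t. B * indicator {a..b} t)"
    using ab by (intro integrable_mult_right integrable_real_indicator) auto
  have \<beta>1I: "integrable lborel \<beta>1"
    by (rule Bochner_Integration.integrable_bound[OF Ii]) (use b1 B in \<open>auto intro!: AE_I2\<close>)
  have \<beta>1S: "set_integrable lborel A \<beta>1" if "A \<in> sets borel" for A
    using integrable_mult_indicator[OF _ \<beta>1I, of A] that by (simp add: set_integrable_def)
  define A where "A x = (LINT t:{..x}|lborel. \<beta>1 t)" for x
  have Alip: "\<bar>A y - A x\<bar> \<le> B * (y - x)" if "x \<le> y" for x y
  proof -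
    have "{..y} = {..x} \<union> {x<..y}" using that by auto
    moreover have "(LINT t:{..x} \<union> {x<..y}|lborel. \<beta>1 t) = A x + (LINT t:{x<..y}|lborel. \<beta>1 t)"
      unfolding A_def by (rule set_integral_Un) (auto intro!: \<beta>1S)
    ultimately have "A y - A x = (LINT t:{x<..y}|lborel. \<beta>1 t)" by (simp add: A_def)
    also have "\<bar>\<dots>\<bar> \<le> (LINT t|lborel. \<bar>indicator {x<..y} t *\<^sub>R \<beta>1 t\<bar>)"
      unfolding set_lebesgue_integral_def by (rule integral_abs_bound)
    also have "\<dots> \<le> (LINT t|lborel. B * indicator {x<..y} t)"
    proof (rule integral_mono)
      show "integrable lborel (\<lambda>t. \<bar>indicator {x<..y} t *\<^sub>R \<beta>1 t\<bar>)"
        using \<beta>1S[of "{x<..y}"] by (auto simp: set_integrable_def)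
      show "integrable lborel (\<lambda>t. B * indicator {x<..y} t)"
        using that by (intro integrable_mult_right integrable_real_indicator) auto
      fix t show "\<bar>indicator {x<..y} t *\<^sub>R \<beta>1 t\<bar> \<le> B * indicator {x<..y} t"
        using order_trans[OF b1[of t], of B] B by (auto simp: indicator_def)
    qed
    also have "\<dots> = B * (y - x)" using that by simp
    finally show ?thesis .
  qed
  have "B-lipschitz_on UNIV A"
  proof (rule lipschitz_onI[OF _ B])
    fix x y :: real
    show "dist (A x) (A y) \<le> B * dist x y"
      using Alip[of x y] Alip[of y x] by (cases "x \<le> y") (auto simp: dist_real_def abs_minus_commute)
  qed
  then have Ac: "continuous_on UNIV A" by (rule lipschitz_on_continuous_on)
  have AI: "set_integrable lborel K A" if "compact K" for K
    unfolding set_integrable_def by (rule borel_integrable_compact[OF that continuous_on_subset[OF Ac]]) simp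
  obtain c where c: "AE x in lborel. x \<in> {a<..<b} \<longrightarrow> v x - A x = c"
  proof (rule weak_derivative_zero_const[OF ab])
    show "set_integrable lborel K (\<lambda>x. v x - A x)" if "compact K" "K \<subseteq> ?U" for K
      by (rule set_integral_diff(1)[OF has_weak_gradD(1)[OF w that(1) subset_UNIV] AI[OF that(1)]])
    fix \<psi> g assume p: "\<psi> \<in> C1c ?U" and g: "C1_grad \<psi> g"
    note C = C1_gradD[OF g]
    note [measurable] = C(5,6)
    obtain K where K: "compact K" "K \<subseteq> ?U" "\<And>x. x \<notin> K \<Longrightarrow> \<psi> x = 0" "\<And>x. x \<notin> K \<Longrightarrow> g x = 0"
      by (rule C1c_support[OF p g]) (rule that)
    have out: "\<psi> x = 0" "g x = 0" if "x \<notin> ?U" for x using K that by blast+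
    obtain Bg where Bg: "Bg > 0" "\<And>x. norm (g x) \<le> Bg" using bounded_compact_support[OF C(1) K(1,4)] by metis
    have pU: "\<psi> \<in> C1c UNIV" by (rule C1c_mono[OF p]) simp
    have vp: "(LINT x|lborel. v x * g x) = - (LINT x|lborel. \<beta> x * \<psi> x)"
      using has_weak_gradD(3)[OF w pU, of 1] by (simp add: frechet_real[OF g] vol_UNIV)
    have \<beta>\<psi>: "(LINT x|lborel. \<beta> x * \<psi> x) = (LINT x|lborel. \<beta>1 x * \<psi> x)"
    proof (rule integral_cong_AE)
      show "AE x in lborel. \<beta> x * \<psi> x = \<beta>1 x * \<psi> x" using \<beta>eq
      proof eventually_elim
        case (elim x) then show ?case using out(1)[of x] by (cases "x \<in> ?U") auto
      qed
    qed measurable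
    \<comment> \<open>Integrating in \<open>t\<close> first gives the primitive times
      \<open>g\<close>, integrating in \<open>x\<close> first gives minus the derivative times the
      test function.\<close>
    define F where "F t x = indicator {t..} x * (\<beta>1 t * g x)" for t x :: real
    have [measurable]: "(\<lambda>(t, x). F t x) \<in> borel_measurable (lborel \<Otimes>\<^sub>M lborel)"
    proof -
      have "(\<lambda>(t, x). F t x) = (\<lambda>p. (if fst p \<le> snd p then 1 else 0) * (\<beta>1 (fst p) * g (snd p)))"
        by (auto simp: F_def indicator_def fun_eq_iff)
      also have "\<dots> \<in> borel_measurable (lborel \<Otimes>\<^sub>M lborel)" by measurable
      finally show ?thesis .
    qed
    have FI: "integrable (lborel \<Otimes>\<^sub>M lborel) (\<lambda>(t, x). F t x)"
    proof (rule Bochner_Integration.integrable_bound)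
      show "integrable (lborel \<Otimes>\<^sub>M lborel) (\<lambda>p. (B * Bg) * indicator ({a..b} \<times> {a..b}) p :: real)"
      proof (intro integrable_mult_right integrable_real_indicator)
        have "emeasure (lborel \<Otimes>\<^sub>M lborel) ({a..b} \<times> {a..b}) = emeasure lborel {a..b} * emeasure lborel {a..b}"
          by (rule lborel.emeasure_pair_measure_Times) auto
        also have "\<dots> < \<infinity>" using ab by (simp add: ennreal_mult_less_top)
        finally show "emeasure (lborel \<Otimes>\<^sub>M lborel) ({a..b} \<times> {a..b}) < \<infinity>" .
      qed (intro pair_measureI; simp)
      show "AE p in lborel \<Otimes>\<^sub>M lborel. norm (case p of (t, x) \<Rightarrow> F t x) \<le> norm ((B * Bg) * indicator ({a..b} \<times> {a..b}) p :: real)"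
      proof (rule AE_I2)
        fix p :: "real \<times> real"
        obtain t x where p': "p = (t, x)" by (cases p)
        have "\<bar>F t x\<bar> \<le> \<bar>\<beta>1 t\<bar> * \<bar>g x\<bar>" by (simp add: F_def abs_mult indicator_def)
        also have "\<dots> \<le> (B * indicator {a..b} t) * (Bg * indicator {a..b} x)"
          by (rule mult_mono[OF b1]) (use Bg out(2)[of x] B in \<open>auto simp: indicator_def\<close>)
        also have "\<dots> = (B * Bg) * indicator ({a..b} \<times> {a..b}) (t, x)" by (simp add: indicator_def)
        finally show "norm (case p of (t, x) \<Rightarrow> F t x) \<le> norm ((B * Bg) * indicator ({a..b} \<times> {a..b}) p :: real)"
          using B Bg(1) by (simp add: p')
      qed
    qed measurable
    have "(LINT x|lborel. LINT t|lborel. F t x) = (LINT t|lborel. LINT x|lborel. F t x)"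
      by (rule lborel_pair.Fubini_integral[OF FI])
    also have "(LINT x|lborel. LINT t|lborel. F t x) = (LINT x|lborel. A x * g x)"
    proof (rule Bochner_Integration.integral_cong[OF refl])
      fix x
      have "(LINT t|lborel. F t x) = (LINT t|lborel. (indicator {..x} t *\<^sub>R \<beta>1 t) * g x)"
        by (rule Bochner_Integration.integral_cong) (auto simp: F_def indicator_def)
      also have "\<dots> = A x * g x" by (simp add: A_def set_lebesgue_integral_def)
      finally show "(LINT t|lborel. F t x) = A x * g x" .
    qed
    also have "(LINT t|lborel. LINT x|lborel. F t x) = (LINT t|lborel. - (\<beta>1 t * \<psi> t))"
    proof (rule Bochner_Integration.integral_cong[OF refl])
      fix t
      \<comment> \<open>An end point beyond the support, chosen so that the interval from
        \<open>t\<close> is not reversed when \<open>t > b\<close>.\<close>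
      define T where "T = max t b"
      have "(LINT x|lborel. F t x) = \<beta>1 t * (LINT x|lborel. indicator {t..} x * g x)"
        unfolding F_def by (subst integral_mult_right_zero[symmetric]) (simp add: mult.left_commute)
      also have "(LINT x|lborel. indicator {t..} x * g x) = (LINT x|lborel. indicator {t..T} x *\<^sub>R g x)"
      proof (rule Bochner_Integration.integral_cong[OF refl])
        fix x :: real
        have "g x = 0" if "b < x" using out(2)[of x] that by simp
        then show "indicator {t..} x * g x = indicator {t..T} x *\<^sub>R g x" by (cases "b < x") (auto simp: indicator_def T_def)
      qed
      also have "\<dots> = \<psi> T - \<psi> t"
        by (rule integral_FTC_atLeastAtMost)
           (auto simp: T_def has_real_derivative_iff_has_vector_derivative[symmetric]
             intro: has_field_derivative_at_within C1_grad_real_deriv[OF g] continuous_on_subset[OF C(1)])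
      also have "\<psi> T = 0" by (rule out) (simp add: T_def)
      finally show "(LINT x|lborel. F t x) = - (\<beta>1 t * \<psi> t)" by simp
    qed
    finally have Ag: "(LINT x|lborel. A x * g x) = - (LINT t|lborel. \<beta>1 t * \<psi> t)" by simp
    have i1: "integrable (vol UNIV) (\<lambda>x. v x * g x)"
      by (rule set_integrable_times_test[OF open_UNIV has_weak_gradD(1)[OF w] C(1) K(1) subset_UNIV K(4)])
    have i2: "integrable (vol UNIV) (\<lambda>x. A x * g x)"
      by (rule set_integrable_times_test[OF open_UNIV AI C(1) K(1) subset_UNIV K(4)])
    have "(LINT x|vol ?U. (v x - A x) * g x) = (LINT x|lborel. (v x - A x) * g x)"
      by (rule LINT_vol_support) (use out in auto)
    also have "\<dots> = (LINT x|lborel. v x * g x) - (LINT x|lborel. A x * g x)"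
      using i1 i2 by (simp add: left_diff_distrib vol_UNIV)
    also have "\<dots> = 0" by (simp add: vp \<beta>\<psi> Ag)
    finally show "(LINT x|vol ?U. (v x - A x) * g x) = 0" .
  qed
  have "continuous_on UNIV (\<lambda>x. A x + c)" using Ac by (intro continuous_intros)
  moreover have "AE x in lborel. x \<in> {a<..<b} \<longrightarrow> v x = A x + c" using c by eventually_elim auto
  ultimately show ?thesis by (rule that)
qed

section \<open>Smallness from finitely many vanishing means\<close>

lemma C1c_lipschitz:
  assumes "\<phi> \<in> C1c UNIV"
  obtains L where "L > 0" "\<And>x y. \<bar>\<phi> x - \<phi> y\<bar> \<le> L * norm (x - y)"
proof -
  obtain g where g: "C1_grad \<phi> g" using C1c_obtain[OF assms] .
  note C = C1_gradD[OF g]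
  obtain K where K: "compact K" "K \<subseteq> UNIV" "\<And>x. x \<notin> K \<Longrightarrow> \<phi> x = 0" "\<And>x. x \<notin> K \<Longrightarrow> g x = 0"
    by (rule C1c_support[OF assms g]) (rule that)
  obtain L where L: "L > 0" "\<And>x. norm (g x) \<le> L" using bounded_compact_support[OF C(1) K(1,4)] by metis
  have "norm (\<phi> x - \<phi> y) \<le> L * norm (x - y)" for x y
  proof (rule differentiable_bound[of UNIV])
    fix z show "(\<phi> has_derivative (\<lambda>v. g z \<bullet> v)) (at z within UNIV)" using C(2) by simp
    show "onorm ((\<bullet>) (g z)) \<le> L"
    proof (rule onorm_le)
      fix v
      have "norm (g z \<bullet> v) \<le> norm (g z) * norm v" using Cauchy_Schwarz_ineq2[of "g z" v] by simp
      also have "\<dots> \<le> L * norm v" by (rule mult_right_mono[OF L(2)]) simp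
      finally show "norm (g z \<bullet> v) \<le> L * norm v" .
    qed
  qed auto
  then show ?thesis using that L(1) by simp
qed

context lipschitz_domain
begin

text \<open>The Slobodeckij quotient is bounded by the squared Lipschitz constant, arc length is
  finite, and only heights in a bounded interval contribute.\<close>

lemma C1c_Htilde:
  assumes "\<phi> \<in> C1c UNIV" shows "\<phi> \<in> Htilde \<omega>"
proof -
  obtain g where g: "C1_grad \<phi> g" using C1c_obtain[OF assms] .
  note C = C1_gradD[OF g]
  obtain K where K: "compact K" "K \<subseteq> UNIV" "\<And>x. x \<notin> K \<Longrightarrow> \<phi> x = 0" "\<And>x. x \<notin> K \<Longrightarrow> g x = 0"
    by (rule C1c_support[OF assms g]) (rule that)
  obtain B where B: "B > 0" "\<And>x. norm (\<phi> x) \<le> B" using bounded_compact_support[OF C(3) K(1,3)] by metis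
  obtain L where L: "L > 0" "\<And>x y. \<bar>\<phi> x - \<phi> y\<bar> \<le> L * norm (x - y)" by (rule C1c_lipschitz[OF assms]) (rule that)
  have "bounded (snd ` K)" using K(1) by (intro compact_imp_bounded compact_continuous_image continuous_intros)
  then obtain R where R: "\<And>x. x \<in> K \<Longrightarrow> \<bar>snd x\<bar> \<le> R" by (auto simp: bounded_iff)
  interpret F: finite_measure "arc_length \<omega>" by (rule finite_arc_length)
  define m where "m = measure (arc_length \<omega>) (space (arc_length \<omega>))"
  have em: "emeasure (arc_length \<omega>) (space (arc_length \<omega>)) = ennreal m" by (simp add: m_def F.emeasure_eq_measure)
  have m: "m \<ge> 0" by (simp add: m_def)
  have z: "\<phi> (x, s) = 0" if "\<not> \<bar>s\<bar> \<le> R" for x s using K(3)[of "(x, s)"] R[of "(x, s)"] that by auto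
  have slice: "Hhalf_norm_sq \<omega> (\<lambda>x'. \<phi> (x', s)) \<le> ennreal (B\<^sup>2 * m + L\<^sup>2 * m * m) * indicator {-R..R} s" for s
  proof (cases "\<bar>s\<bar> \<le> R")
    case False
    then show ?thesis by (simp add: Hhalf_norm_sq_def z)
  next
    case True
    have 1: "(\<integral>\<^sup>+x. ennreal ((\<phi> (x, s))\<^sup>2) \<partial>arc_length \<omega>) \<le> (\<integral>\<^sup>+x. ennreal (B\<^sup>2) \<partial>arc_length \<omega>)"
      using B(2) by (intro nn_integral_mono ennreal_leI) (metis abs_ge_zero power2_abs power_mono real_norm_def)
    have q: "(\<phi> (x, s) - \<phi> (y, s))\<^sup>2 / (dist x y)\<^sup>2 \<le> L\<^sup>2" for x y
    proof (cases "x = y")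
      case False
      have "\<bar>\<phi> (x, s) - \<phi> (y, s)\<bar> \<le> L * dist x y"
        using L(2)[of "(x, s)" "(y, s)"] by (simp add: dist_norm norm_Pair)
      then have "\<bar>\<phi> (x, s) - \<phi> (y, s)\<bar>\<^sup>2 \<le> (L * dist x y)\<^sup>2" by (intro power_mono) auto
      then show ?thesis using False by (simp add: divide_le_eq power_mult_distrib)
    qed simp
    have 2: "(\<integral>\<^sup>+x. (\<integral>\<^sup>+y. ennreal ((\<phi> (x, s) - \<phi> (y, s))\<^sup>2 / (dist x y)\<^sup>2) \<partial>arc_length \<omega>) \<partial>arc_length \<omega>)
      \<le> (\<integral>\<^sup>+x. (\<integral>\<^sup>+y. ennreal (L\<^sup>2) \<partial>arc_length \<omega>) \<partial>arc_length \<omega>)"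
      by (intro nn_integral_mono ennreal_leI q)
    have "Hhalf_norm_sq \<omega> (\<lambda>x'. \<phi> (x', s)) \<le> ennreal (B\<^sup>2) * ennreal m + ennreal (L\<^sup>2) * ennreal m * ennreal m"
      using add_mono[OF 1 2] by (simp add: Hhalf_norm_sq_def em mult.assoc)
    also have "\<dots> = ennreal (B\<^sup>2 * m + L\<^sup>2 * m * m)" using m by (simp add: ennreal_mult' ennreal_plus)
    finally show ?thesis using True by (simp add: abs_le_iff)
  qed
  have "(\<integral>\<^sup>+s. Hhalf_norm_sq \<omega> (\<lambda>x'. \<phi> (x', s)) \<partial>lborel) \<le> (\<integral>\<^sup>+s. ennreal (B\<^sup>2 * m + L\<^sup>2 * m * m) * indicator {-R..R} s \<partial>lborel)"
    by (intro nn_integral_mono slice)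
  also have "\<dots> < \<infinity>" by (subst nn_integral_cmult_indicator) (auto simp: emeasure_lborel_Icc_eq ennreal_mult_less_top)
  finally have fin: "(\<integral>\<^sup>+s. Hhalf_norm_sq \<omega> (\<lambda>x'. \<phi> (x', s)) \<partial>lborel) < \<infinity>" .
  have "\<phi> \<in> borel_measurable (surface \<omega>)" by (rule borel_measurable_surface[OF C(5)])
  then have "\<phi> \<in> L2_Hhalf \<omega>" using fin by (simp add: L2_Hhalf_def)
  then show ?thesis unfolding Htilde_def using tr_H1[OF tr_test[OF assms g]] by blast
qed

lemma bsupp_subset:
  assumes "closed C" "\<And>x. x \<notin> C \<Longrightarrow> f x = 0" shows "bsupp \<omega> f \<subseteq> C"
proof
  fix x assume x: "x \<in> bsupp \<omega> f"
  show "x \<in> C"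
  proof (rule ccontr)
    assume "x \<notin> C"
    then have "open (- C) \<and> x \<in> - C" using assms(1) by auto
    moreover have "AE y in surface \<omega>. y \<in> - C \<longrightarrow> f y = 0" using assms(2) by auto
    ultimately show False using x unfolding bsupp_def by blast
  qed
qed

lemma Htilde_norm_le:
  assumes "tr u g f" shows "Htilde_norm \<omega> f \<le> sqrt ((L2_norm (vol \<Omega>) u)\<^sup>2 + (L2_norm (vol \<Omega>) g)\<^sup>2)"
proof -
  have "Htilde_norm \<omega> f \<le> H1_norm \<Omega> u"
    unfolding Htilde_norm_def
  proof (rule cInf_lower)
    show "H1_norm \<Omega> u \<in> {H1_norm \<Omega> G |G. G \<in> H1 \<Omega> \<and> has_trace \<omega> G f}" using tr_H1[OF assms] by blast
    show "bdd_below {H1_norm \<Omega> G |G. G \<in> H1 \<Omega> \<and> has_trace \<omega> G f}"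
      by (rule bdd_belowI[of _ 0]) (auto simp: H1_norm_def)
  qed
  then show ?thesis by (simp add: H1_norm_eq[OF tr_weak_grad[OF assms] trD(2)[OF assms]])
qed

lemma L2_norm_sq_vol:
  fixes v :: "(real^2) \<times> real \<Rightarrow> 'b::euclidean_space"
  assumes v: "v \<in> L2 (vol \<Omega>)" and A: "A \<subseteq> \<Omega>" "A \<in> sets borel"
  shows "ennreal ((L2_norm (vol A) v)\<^sup>2) = (\<integral>\<^sup>+x. ennreal ((norm (v x))\<^sup>2) * indicator A x \<partial>lborel)"
    "(\<lambda>x. ennreal ((norm (v x))\<^sup>2) * indicator A x) \<in> borel_measurable lborel"
proof -
  have OB: "\<Omega> \<in> sets borel" using open_waveguide by simp
  note L = L2_vol_subset(1)[OF v A OB]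
  show "ennreal ((L2_norm (vol A) v)\<^sup>2) = (\<integral>\<^sup>+x. ennreal ((norm (v x))\<^sup>2) * indicator A x \<partial>lborel)"
    unfolding L2_norm_sq_nn[OF L, symmetric] using A(2) by (subst nn_integral_restrict_space) auto
  have "(\<lambda>x. ennreal ((norm (v x))\<^sup>2)) \<in> borel_measurable (vol A)" using L by (auto simp: L2_def)
  then show "(\<lambda>x. ennreal ((norm (v x))\<^sup>2) * indicator A x) \<in> borel_measurable lborel"
    using A(2) by (subst (asm) borel_measurable_restrict_space_iff_ennreal) auto
qed

text \<open>The directions come from compactness of the frontier and are fixed before
  \<open>r\<close>; hence the thickness of the layer can later be chosen in terms of their
  number.\<close>

lemma layer_cover:
  obtains E where "finite E" "\<And>e. e \<in> E \<Longrightarrow> norm e = 1"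
    "\<And>r. r > 0 \<Longrightarrow> \<exists>K. compact K \<and> K \<subseteq> \<omega> \<and> \<omega> \<subseteq> K \<union> (\<Union>e\<in>E. {x \<in> \<omega>. exitlen e x < r})"
proof -
  define good where "good U e \<longleftrightarrow> open U \<and> norm (e::real^2) = 1 \<and> (\<forall>q \<rho>. q \<in> U \<longrightarrow> q \<in> frontier \<omega> \<longrightarrow> \<rho> > 0 \<longrightarrow>
      (\<exists>W. open W \<and> q \<in> W \<and> (\<forall>x\<in>W \<inter> \<omega>. \<exists>t. 0 < t \<and> t < \<rho> \<and> x - t *\<^sub>R e \<notin> closure \<omega>)))" for U e
  have "\<exists>U e. p \<in> U \<and> good U e" if "p \<in> frontier \<omega>" for p
  proof -
    obtain U e where 1: "open U" "p \<in> U" "norm (e::real^2) = 1"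
      "\<And>q \<rho>. q \<in> U \<Longrightarrow> q \<in> frontier \<omega> \<Longrightarrow> \<rho> > 0 \<Longrightarrow>
        \<exists>W. open W \<and> q \<in> W \<and> (\<forall>x\<in>W \<inter> \<omega>. \<exists>t. 0 < t \<and> t < \<rho> \<and> x - t *\<^sub>R e \<notin> closure \<omega>)"
      by (rule exterior_directions[OF open_om lipschitz_om \<open>p \<in> frontier \<omega>\<close>]) (rule that)
    then have "good U e" unfolding good_def by blast
    then show ?thesis using 1(2) by blast
  qed
  then obtain U where "\<And>p. p \<in> frontier \<omega> \<Longrightarrow> \<exists>e. p \<in> U p \<and> good (U p) e" by metis
  then obtain e where Ue: "\<And>p. p \<in> frontier \<omega> \<Longrightarrow> p \<in> U p \<and> good (U p) (e p)" by metis
  have "compact (frontier \<omega>)" using bounded_om by (rule compact_frontier_bounded)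
  then obtain F where F: "F \<subseteq> frontier \<omega>" "finite F" "frontier \<omega> \<subseteq> (\<Union>p\<in>F. U p)"
    by (rule compactE_image[of _ "frontier \<omega>" U]) (use Ue in \<open>auto simp: good_def\<close>)
  show ?thesis
  proof (rule that[of "e ` F"])
    show "finite (e ` F)" using F(2) by simp
    show "norm d = 1" if "d \<in> e ` F" for d using that F(1) Ue by (auto simp: good_def)
    fix r :: real assume r: "r > 0"
    \<comment> \<open>An open neighbourhood of the frontier in which every point of \<omega> is
      close to its exit in some direction; what it leaves of the closure is compact inside
      \<omega>.\<close>
    define V where "V = \<Union>{W. open W \<and> (\<exists>d\<in>e ` F. \<forall>x\<in>W \<inter> \<omega>. exitlen d x < r)}"
    have "open V" unfolding V_def by (rule open_Union) auto
    have "q \<in> V" if q: "q \<in> frontier \<omega>" for q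
    proof -
      obtain p where p: "p \<in> F" "q \<in> U p" using F(3) q by blast
      then have g: "good (U p) (e p)" using Ue F(1) by blast
      then have "\<forall>q \<rho>. q \<in> U p \<longrightarrow> q \<in> frontier \<omega> \<longrightarrow> \<rho> > 0 \<longrightarrow>
        (\<exists>W. open W \<and> q \<in> W \<and> (\<forall>x\<in>W \<inter> \<omega>. \<exists>t. 0 < t \<and> t < \<rho> \<and> x - t *\<^sub>R e p \<notin> closure \<omega>))"
        unfolding good_def by (elim conjE)
      from this[rule_format, OF p(2) q r] obtain W where W: "open W" "q \<in> W"
        "\<forall>x\<in>W \<inter> \<omega>. \<exists>t. 0 < t \<and> t < r \<and> x - t *\<^sub>R e p \<notin> closure \<omega>"
        by (elim exE conjE) (rule that)
      have ne: "norm (e p) = 1" using g unfolding good_def by (elim conjE)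
      have "exitlen (e p) x < r" if "x \<in> W \<inter> \<omega>" for x
      proof -
        obtain t where t: "0 < t" "t < r" "x - t *\<^sub>R e p \<notin> closure \<omega>" using bspec[OF W(3) \<open>x \<in> W \<inter> \<omega>\<close>] by (elim exE conjE) (rule that)
        then have "x - t *\<^sub>R e p \<notin> \<omega>" using closure_subset by blast
        then show ?thesis using exitlen_props(4)[OF ne, of t x] t by simp
      qed
      then show ?thesis unfolding V_def using W(1,2) p(1) by blast
    qed
    then have fV: "frontier \<omega> \<subseteq> V" by blast
    define K where "K = closure \<omega> - V"
    have "compact K" unfolding K_def using bounded_om \<open>open V\<close> by (intro compact_diff) (auto simp: compact_closure)
    moreover have "K \<subseteq> \<omega>" using fV by (auto simp: K_def frontier_def interior_open[OF open_om])
    moreover have "\<omega> \<subseteq> K \<union> (\<Union>d\<in>e ` F. {x \<in> \<omega>. exitlen d x < r})"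
    proof
      fix x assume x: "x \<in> \<omega>"
      show "x \<in> K \<union> (\<Union>d\<in>e ` F. {x \<in> \<omega>. exitlen d x < r})"
      proof (cases "x \<in> V")
        case True
        then obtain W d where "x \<in> W" "d \<in> e ` F" "\<forall>x\<in>W \<inter> \<omega>. exitlen d x < r" unfolding V_def by blast
        then show ?thesis using x by blast
      next
        case False
        then show ?thesis using x closure_subset by (auto simp: K_def)
      qed
    qed
    ultimately show "\<exists>K. compact K \<and> K \<subseteq> \<omega> \<and> \<omega> \<subseteq> K \<union> (\<Union>d\<in>e ` F. {x \<in> \<omega>. exitlen d x < r})" by blast
  qed
qed

text \<open>Near \<open>\<partial>\<omega>\<close> this is the strip inequality, away from it the Poincare-Wirtinger inequality on a fine grid.\<close>

lemma smallness:
  assumes m: "\<And>t. (m has_real_derivative m' t) (at t)" "continuous_on UNIV m'"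
    and b: "\<And>t. \<bar>m t\<bar> \<le> 1" "\<And>t. \<bar>m' t\<bar> \<le> B"
    and J: "compact J" "\<And>t. t \<in> J \<Longrightarrow> m t = 1" and \<epsilon>: "\<epsilon> > 0"
  obtains \<Q> where "finite \<Q>" "\<And>Q. Q \<in> \<Q> \<Longrightarrow> Q \<in> sets borel \<and> bounded Q \<and> Q \<subseteq> \<Omega>"
    "\<And>u g f. tr u g f \<Longrightarrow> (\<And>x. m (snd x) * f x = 0) \<Longrightarrow> \<forall>Q\<in>\<Q>. (LINT x|vol Q. u x) = 0 \<Longrightarrow>
       (L2_norm (vol (\<omega> \<times> J)) u)\<^sup>2 \<le> \<epsilon> * (L2_norm (vol \<Omega>) g)\<^sup>2"
proof -
  obtain E where E: "finite E" "\<And>e. e \<in> E \<Longrightarrow> norm e = 1"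
    "\<And>r. r > 0 \<Longrightarrow> \<exists>K. compact K \<and> K \<subseteq> \<omega> \<and> \<omega> \<subseteq> K \<union> (\<Union>e\<in>E. {x \<in> \<omega>. exitlen e x < r})"
    by (rule layer_cover) (rule that)
  define N where "N = real (card E)"
  \<comment> \<open>Each of the \<open>N\<close> strips contributes at most
    \<open>2 * r\<^sup>2\<close> times the squared gradient norm, together at most \<epsilon>/2; the
    added 1 covers the case of no strips.\<close>
  define r where "r = sqrt (\<epsilon> / (4 * (N + 1)))"
  have N: "N \<ge> 0" by (simp add: N_def)
  have r: "r > 0" using \<epsilon> N by (simp add: r_def)
  have Nr: "N * (2 * r\<^sup>2) \<le> \<epsilon> / 2"
  proof -
    have "r\<^sup>2 = \<epsilon> / (4 * (N + 1))" using \<epsilon> N by (simp add: r_def)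
    then have "N * (2 * r\<^sup>2) = (N / (N + 1)) * (\<epsilon> / 2)" using N by (simp add: field_simps)
    also have "\<dots> \<le> 1 * (\<epsilon> / 2)" using N \<epsilon> by (intro mult_right_mono) auto
    finally show ?thesis by simp
  qed
  obtain K where K: "compact K" "K \<subseteq> \<omega>" "\<omega> \<subseteq> K \<union> (\<Union>e\<in>E. {x \<in> \<omega>. exitlen e x < r})" using E(3)[OF r] by blast
  have KJ: "compact (K \<times> J)" "K \<times> J \<subseteq> \<Omega>" using K J(1) by (auto intro: compact_Times simp: waveguide_def)
  have e2: "\<epsilon> / 2 > 0" using \<epsilon> by simp
  obtain \<Q> where Q: "finite \<Q>" "\<And>Q. Q \<in> \<Q> \<Longrightarrow> Q \<in> sets borel \<and> bounded Q \<and> Q \<subseteq> \<Omega>"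
    "\<And>u g f. tr u g f \<Longrightarrow> \<forall>Q\<in>\<Q>. (LINT x|vol Q. u x) = 0 \<Longrightarrow>
       (L2_norm (vol (K \<times> J)) u)\<^sup>2 \<le> \<epsilon> / 2 * (L2_norm (vol \<Omega>) g)\<^sup>2"
    by (rule grid_compactness[OF KJ e2]) (rule that)
  have OB: "\<Omega> \<in> sets borel" using open_waveguide by simp
  show ?thesis
  proof (rule that[OF Q(1,2)])
    fix u g f assume t: "tr u g f" and z: "\<And>x. m (snd x) * f x = 0" and mean: "\<forall>Q\<in>\<Q>. (LINT x|vol Q. u x) = 0"
    define w where "w x = m (snd x) * u x" for x
    define k where "k x = m (snd x) *\<^sub>R g x + u x *\<^sub>R (0, m' (snd x))" for x
    have b1: "\<bar>m t\<bar> \<le> max 1 B" "\<bar>m' t\<bar> \<le> max 1 B" for t using b(1)[of t] b(2)[of t] by auto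
    \<comment> \<open>The cut-off \<open>m\<close> vanishes where the datum lives and is 1 on
      \<open>J\<close>: the product has zero trace and agrees with \<open>u\<close> on the part that
      is to be estimated.\<close>
    have tw: "tr w k (\<lambda>x. 0)" using tr_mult[OF t m b1] z by (simp add: w_def[abs_def] k_def[abs_def])
    note T = trD[OF t] and Tw = trD[OF tw]
    let ?g2 = "(L2_norm (vol \<Omega>) g)\<^sup>2"
    define S where "S e = {x \<in> \<omega>. exitlen e x < r}" for e
    have SB: "S e \<in> sets borel" if "e \<in> E" for e
    proof -
      have "exitlen e \<in> borel_measurable borel" by (rule exitlen_measurable[OF E(2)[OF that]])
      then have "{x \<in> space borel. exitlen e x < r} \<in> sets borel" by measurable
      moreover have "S e = \<omega> \<inter> {x \<in> space borel. exitlen e x < r}" by (auto simp: S_def)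
      ultimately show ?thesis using open_om by auto
    qed
    have SU: "S e \<times> UNIV \<in> sets (borel :: ((real^2) \<times> real) measure)" "S e \<times> UNIV \<subseteq> \<Omega>" if "e \<in> E" for e
      using SB[OF that] unfolding borel_prod[symmetric] by (auto intro: pair_measureI simp: waveguide_def S_def)
    have JB: "J \<in> sets borel" using J(1) by (rule borel_compact)
    have OJ: "\<omega> \<times> J \<in> sets (borel :: ((real^2) \<times> real) measure)" "\<omega> \<times> J \<subseteq> \<Omega>"
      using JB open_om unfolding borel_prod[symmetric] by (auto intro!: pair_measureI simp: waveguide_def)
    have KJB: "K \<times> J \<in> sets borel" using KJ(1) by (rule borel_compact)
    have strip: "(L2_norm (vol (S e \<times> UNIV)) w)\<^sup>2 \<le> 2 * r\<^sup>2 * ?g2" if e: "e \<in> E" for e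
    proof -
      have ne: "norm e = 1" by (rule E(2)[OF e])
      have "(L2_norm (vol (S e \<times> UNIV)) w)\<^sup>2 \<le> 2 * r\<^sup>2 * (L2_norm (vol (S e \<times> UNIV)) (\<lambda>x. k x \<bullet> (e, 0)))\<^sup>2"
      proof (rule strip_tr[OF ne SB[OF e] _ _ _ _ tw])
        show "S e \<subseteq> \<omega>" by (auto simp: S_def)
        show "x - t *\<^sub>R e \<in> S e" if "x \<in> S e" "0 \<le> t" "t < exitlen e x" for x t
          using that exitlen_props(3)[OF ne, of t x] exitlen_shift[OF ne, of t x] by (auto simp: S_def)
      qed (use r in \<open>auto simp: S_def\<close>)
      also have "\<dots> \<le> 2 * r\<^sup>2 * ?g2"
      proof (intro mult_left_mono power_mono)
        have kL: "(\<lambda>x. k x \<bullet> (e, 0)) \<in> L2 (vol \<Omega>)" by (rule L2_inner_const(1)[OF Tw(2)])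
        have "L2_norm (vol (S e \<times> UNIV)) (\<lambda>x. k x \<bullet> (e, 0)) \<le> L2_norm (vol \<Omega>) (\<lambda>x. k x \<bullet> (e, 0))"
          by (rule L2_vol_subset(2)[OF kL SU(2,1)[OF e] OB])
        also have "\<dots> \<le> L2_norm (vol \<Omega>) g"
        proof (rule L2_norm_mono_AE(2)[OF T(2)])
          show "(\<lambda>x. k x \<bullet> (e, 0)) \<in> borel_measurable (vol \<Omega>)" using kL by (simp add: L2_def)
          show "AE x in vol \<Omega>. norm (k x \<bullet> (e, 0)) \<le> norm (g x)"
          proof (rule AE_I2)
            fix x
            \<comment> \<open>The gradient of \<open>m\<close> is axial and hence orthogonal to
              \<open>(e, 0)\<close>. The strip inequality therefore sees only \<open>g\<close>, and
              no term in \<open>u\<close> comes back from the cut-off.\<close>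
            have "norm (k x \<bullet> (e, 0)) = \<bar>m (snd x)\<bar> * \<bar>g x \<bullet> (e, 0)\<bar>"
              by (simp add: k_def inner_add_left abs_mult)
            also have "\<dots> \<le> 1 * (norm (g x) * norm (e, 0::real))"
              by (intro mult_mono b Cauchy_Schwarz_ineq2) auto
            finally show "norm (k x \<bullet> (e, 0)) \<le> norm (g x)" using ne by (simp add: norm_Pair)
          qed
        qed
        finally show "L2_norm (vol (S e \<times> UNIV)) (\<lambda>x. k x \<bullet> (e, 0)) \<le> L2_norm (vol \<Omega>) g" .
      qed auto
      finally show ?thesis .
    qed
    \<comment> \<open>The strips may overlap, so their sum is only an upper bound; this is how their
      number enters.\<close>
    have pt: "ennreal ((norm (u x))\<^sup>2) * indicator (\<omega> \<times> J) x \<le> ennreal ((norm (u x))\<^sup>2) * indicator (K \<times> J) x +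
      (\<Sum>e\<in>E. ennreal ((norm (w x))\<^sup>2) * indicator (S e \<times> UNIV) x)" for x
    proof (cases "x \<in> \<omega> \<times> J \<and> x \<notin> K \<times> J")
      case True
      then have "fst x \<in> \<omega>" "fst x \<notin> K" "snd x \<in> J" by auto
      then obtain e where e: "e \<in> E" "fst x \<in> S e" using K(3) by (auto simp: S_def)
      have "ennreal ((norm (u x))\<^sup>2) = ennreal ((norm (w x))\<^sup>2) * indicator (S e \<times> UNIV) x"
        using e(2) J(2)[OF \<open>snd x \<in> J\<close>] by (cases x) (auto simp: w_def)
      also have "\<dots> \<le> (\<Sum>e\<in>E. ennreal ((norm (w x))\<^sup>2) * indicator (S e \<times> UNIV) x)"
        by (rule member_le_sum[OF e(1)]) (use E(1) in auto)
      finally show ?thesis using True by simp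
    next
      case False
      then have "(indicator (\<omega> \<times> J) x :: ennreal) \<le> indicator (K \<times> J) x" by (auto simp: indicator_def)
      then show ?thesis by (intro add_increasing2 mult_left_mono) auto
    qed
    have "ennreal ((L2_norm (vol (\<omega> \<times> J)) u)\<^sup>2) = (\<integral>\<^sup>+x. ennreal ((norm (u x))\<^sup>2) * indicator (\<omega> \<times> J) x \<partial>lborel)"
      by (rule L2_norm_sq_vol(1)[OF T(1) OJ(2,1)])
    also have "\<dots> \<le> (\<integral>\<^sup>+x. ennreal ((norm (u x))\<^sup>2) * indicator (K \<times> J) x +
      (\<Sum>e\<in>E. ennreal ((norm (w x))\<^sup>2) * indicator (S e \<times> UNIV) x) \<partial>lborel)"
      by (intro nn_integral_mono pt)
    also have "\<dots> = (\<integral>\<^sup>+x. ennreal ((norm (u x))\<^sup>2) * indicator (K \<times> J) x \<partial>lborel) +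
      (\<integral>\<^sup>+x. (\<Sum>e\<in>E. ennreal ((norm (w x))\<^sup>2) * indicator (S e \<times> UNIV) x) \<partial>lborel)"
      by (rule nn_integral_add[OF L2_norm_sq_vol(2)[OF T(1) KJ(2) KJB] borel_measurable_sum])
         (rule L2_norm_sq_vol(2)[OF Tw(1) SU(2,1)])
    also have "(\<integral>\<^sup>+x. (\<Sum>e\<in>E. ennreal ((norm (w x))\<^sup>2) * indicator (S e \<times> UNIV) x) \<partial>lborel) =
      (\<Sum>e\<in>E. \<integral>\<^sup>+x. ennreal ((norm (w x))\<^sup>2) * indicator (S e \<times> UNIV) x \<partial>lborel)"
      by (rule nn_integral_sum) (rule L2_norm_sq_vol(2)[OF Tw(1) SU(2,1)])
    also have "\<dots> = (\<Sum>e\<in>E. ennreal ((L2_norm (vol (S e \<times> UNIV)) w)\<^sup>2))"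
      by (intro sum.cong refl L2_norm_sq_vol(1)[OF Tw(1) SU(2,1), symmetric])
    also have "(\<integral>\<^sup>+x. ennreal ((norm (u x))\<^sup>2) * indicator (K \<times> J) x \<partial>lborel) = ennreal ((L2_norm (vol (K \<times> J)) u)\<^sup>2)"
      by (rule L2_norm_sq_vol(1)[OF T(1) KJ(2) KJB, symmetric])
    also have "ennreal ((L2_norm (vol (K \<times> J)) u)\<^sup>2) + (\<Sum>e\<in>E. ennreal ((L2_norm (vol (S e \<times> UNIV)) w)\<^sup>2))
      = ennreal ((L2_norm (vol (K \<times> J)) u)\<^sup>2 + (\<Sum>e\<in>E. (L2_norm (vol (S e \<times> UNIV)) w)\<^sup>2))"
      by (simp add: sum_ennreal ennreal_plus sum_nonneg)
    finally have "(L2_norm (vol (\<omega> \<times> J)) u)\<^sup>2 \<le> (L2_norm (vol (K \<times> J)) u)\<^sup>2 + (\<Sum>e\<in>E. (L2_norm (vol (S e \<times> UNIV)) w)\<^sup>2)"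
      by (subst (asm) ennreal_le_iff) (auto intro!: add_nonneg_nonneg sum_nonneg)
    also have "\<dots> \<le> \<epsilon> / 2 * ?g2 + (\<Sum>e\<in>E. 2 * r\<^sup>2 * ?g2)"
      by (intro add_mono sum_mono strip Q(3)[OF t mean])
    also have "\<dots> = \<epsilon> / 2 * ?g2 + (N * (2 * r\<^sup>2)) * ?g2" by (simp add: N_def)
    also have "\<dots> \<le> \<epsilon> / 2 * ?g2 + \<epsilon> / 2 * ?g2" using Nr by (intro add_left_mono mult_right_mono) auto
    finally show "(L2_norm (vol (\<omega> \<times> J)) u)\<^sup>2 \<le> \<epsilon> * ?g2" by simp
  qed
qed

text \<open>Poincare along the axis: on every line parallel to it the function starts from zero at
  \<open>s0 - \<rho>\<close> and lives on an interval of length \<open>2 * \<rho>\<close>. The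
  constant involves neither \<omega> nor the cut-off, as the normalisation requires.\<close>

lemma axial_test:
  assumes \<phi>: "\<phi> \<in> C1c UNIV" "C1_grad \<phi> G" and z: "\<And>x. \<rho> \<le> \<bar>snd x - s0\<bar> \<Longrightarrow> \<phi> x = 0" and \<rho>: "\<rho> > 0"
  shows "L2_norm (vol \<Omega>) \<phi> \<le> 2 * \<rho> * L2_norm (vol \<Omega>) G"
proof -
  note C = C1_gradD[OF \<phi>(2)]
  note [measurable] = C(5,6)
  have om [measurable]: "\<omega> \<in> sets borel" using open_om by simp
  have O [measurable]: "\<Omega> \<in> sets borel" using open_waveguide by simp
  have slice: "(\<integral>\<^sup>+s. ennreal ((\<phi> (x, s))\<^sup>2) \<partial>lborel) \<le> ennreal ((2 * \<rho>)\<^sup>2) * (\<integral>\<^sup>+s. ennreal ((norm (G (x, s)))\<^sup>2) \<partial>lborel)" for x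
  proof -
    define k where "k s = snd (G (x, s))" for s
    have kc: "continuous_on UNIV k" unfolding k_def
      by (intro continuous_intros continuous_on_compose2[OF C(1)]) auto
    then have [measurable]: "k \<in> borel_measurable borel" by (rule borel_measurable_continuous_onI)
    define I where "I = (\<integral>\<^sup>+s. ennreal ((k s)\<^sup>2) \<partial>lborel)"
    have pt: "ennreal ((\<phi> (x, s))\<^sup>2) \<le> (ennreal (2 * \<rho>) * I) * indicator {s0 - \<rho>..s0 + \<rho>} s" for s
    proof (cases "s \<in> {s0 - \<rho>..s0 + \<rho>}")
      case True
      let ?l = "s - (s0 - \<rho>)"
      have l: "0 \<le> ?l" "?l \<le> 2 * \<rho>" using True by auto
      have d: "((\<lambda>t. \<phi> (x, s0 - \<rho> + t)) has_real_derivative k (s0 - \<rho> + t)) (at t)" for t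
      proof -
        have "((\<lambda>t. \<phi> (x, s0 - \<rho> + t)) has_derivative (\<lambda>h. G (x, s0 - \<rho> + t) \<bullet> (0, h))) (at t)"
          by (rule has_derivative_compose[where f="\<lambda>t. (x, s0 - \<rho> + t)", OF _ C(2)])
             (auto intro!: derivative_eq_intros)
        also have "(\<lambda>h. G (x, s0 - \<rho> + t) \<bullet> (0, h)) = (*) (k (s0 - \<rho> + t))"
          by (auto simp: k_def inner_prod_def)
        finally show ?thesis unfolding has_field_derivative_def .
      qed
      have "ennreal ((\<phi> (x, s0 - \<rho> + ?l) - \<phi> (x, s0 - \<rho> + 0))\<^sup>2) \<le> ennreal ?l * (\<integral>\<^sup>+t. indicator {0..<?l} t * ennreal ((k (s0 - \<rho> + t))\<^sup>2) \<partial>lborel)"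
        by (rule FTC_square[OF d _ l(1)]) (intro continuous_on_compose2[OF kc] continuous_intros; simp)
      also have "\<dots> \<le> ennreal (2 * \<rho>) * (\<integral>\<^sup>+t. ennreal ((k (t + (s0 - \<rho>)))\<^sup>2) \<partial>lborel)"
        by (intro mult_mono ennreal_leI l nn_integral_mono) (auto simp: indicator_def add.commute)
      also have "(\<integral>\<^sup>+t. ennreal ((k (t + (s0 - \<rho>)))\<^sup>2) \<partial>lborel) = I"
        unfolding I_def by (rule nn_integral_translation) simp
      finally show ?thesis using True z[of "(x, s0 - \<rho>)"] \<rho> by simp
    next
      case False
      then have "\<phi> (x, s) = 0" by (intro z) auto
      then show ?thesis by simp
    qed
    have "(\<integral>\<^sup>+s. ennreal ((\<phi> (x, s))\<^sup>2) \<partial>lborel) \<le> (\<integral>\<^sup>+s. (ennreal (2 * \<rho>) * I) * indicator {s0 - \<rho>..s0 + \<rho>} s \<partial>lborel)"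
      by (intro nn_integral_mono pt)
    also have "\<dots> = (ennreal (2 * \<rho>) * I) * ennreal (2 * \<rho>)"
      using \<rho> by (subst nn_integral_cmult_indicator) (auto simp: emeasure_lborel_Icc_eq)
    also have "\<dots> = ennreal ((2 * \<rho>)\<^sup>2) * I"
      using \<rho> by (simp add: power2_eq_square ennreal_mult' mult_ac)
    also have "\<dots> \<le> ennreal ((2 * \<rho>)\<^sup>2) * (\<integral>\<^sup>+s. ennreal ((norm (G (x, s)))\<^sup>2) \<partial>lborel)"
    proof -
      have "(k s)\<^sup>2 \<le> (norm (G (x, s)))\<^sup>2" for s
        by (cases "G (x, s)") (simp add: k_def norm_Pair)
      then show ?thesis unfolding I_def by (intro mult_left_mono nn_integral_mono ennreal_leI) auto
    qed
    finally show ?thesis .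
  qed
  have fub: "(\<integral>\<^sup>+x. ennreal ((norm (f x))\<^sup>2) \<partial>vol \<Omega>) = (\<integral>\<^sup>+x. indicator \<omega> x * (\<integral>\<^sup>+s. ennreal ((norm (f (x, s)))\<^sup>2) \<partial>lborel) \<partial>lborel)"
    if [measurable]: "f \<in> borel_measurable borel" for f :: "(real^2) \<times> real \<Rightarrow> 'b::euclidean_space"
  proof -
    have m: "(\<lambda>x. indicator \<Omega> x * ennreal ((norm (f x))\<^sup>2)) \<in> borel_measurable (lborel \<Otimes>\<^sub>M lborel)"
    proof -
      have "(\<lambda>x. indicator \<Omega> x * ennreal ((norm (f x))\<^sup>2)) \<in> borel_measurable borel" by measurable
      then show ?thesis by (simp add: lborel_prod)
    qed
    have f2: "f \<in> borel_measurable (borel \<Otimes>\<^sub>M borel)" by (simp add: borel_prod)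
    have "(\<integral>\<^sup>+x. ennreal ((norm (f x))\<^sup>2) \<partial>vol \<Omega>) = (\<integral>\<^sup>+x. indicator \<Omega> x * ennreal ((norm (f x))\<^sup>2) \<partial>(lborel \<Otimes>\<^sub>M lborel))"
      by (subst nn_integral_restrict_space) (auto simp: lborel_prod mult.commute)
    also have "\<dots> = (\<integral>\<^sup>+x. \<integral>\<^sup>+s. indicator \<Omega> (x, s) * ennreal ((norm (f (x, s)))\<^sup>2) \<partial>lborel \<partial>lborel)"
      by (rule lborel.nn_integral_fst[OF m, symmetric])
    also have "\<dots> = (\<integral>\<^sup>+x. \<integral>\<^sup>+s. indicator \<omega> x * ennreal ((norm (f (x, s)))\<^sup>2) \<partial>lborel \<partial>lborel)"
      by (intro nn_integral_cong) (auto simp: indicator_def waveguide_def)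
    also have "\<dots> = (\<integral>\<^sup>+x. indicator \<omega> x * (\<integral>\<^sup>+s. ennreal ((norm (f (x, s)))\<^sup>2) \<partial>lborel) \<partial>lborel)"
      by (intro nn_integral_cong nn_integral_cmult) (use f2 in measurable)
    finally show ?thesis .
  qed
  have "(\<integral>\<^sup>+x. ennreal ((norm (\<phi> x))\<^sup>2) \<partial>vol \<Omega>) = (\<integral>\<^sup>+x. indicator \<omega> x * (\<integral>\<^sup>+s. ennreal ((norm (\<phi> (x, s)))\<^sup>2) \<partial>lborel) \<partial>lborel)"
    by (rule fub) simp
  also have "\<dots> \<le> (\<integral>\<^sup>+x. ennreal ((2 * \<rho>)\<^sup>2) * (indicator \<omega> x * (\<integral>\<^sup>+s. ennreal ((norm (G (x, s)))\<^sup>2) \<partial>lborel)) \<partial>lborel)"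
    by (rule nn_integral_mono) (use slice in \<open>auto simp: indicator_def\<close>)
  also have "\<dots> = ennreal ((2 * \<rho>)\<^sup>2) * (\<integral>\<^sup>+x. ennreal ((norm (G x))\<^sup>2) \<partial>vol \<Omega>)"
  proof -
    have "G \<in> borel_measurable (borel \<Otimes>\<^sub>M borel)" by (simp add: borel_prod)
    then show ?thesis by (subst fub) (simp_all add: nn_integral_cmult)
  qed
  finally have "ennreal ((L2_norm (vol \<Omega>) \<phi>)\<^sup>2) \<le> ennreal ((2 * \<rho> * L2_norm (vol \<Omega>) G)\<^sup>2)"
    unfolding L2_norm_sq_nn[OF C1c_L2(1)[OF \<phi>]] L2_norm_sq_nn[OF C1c_L2(2)[OF \<phi>]]
    by (simp add: power_mult_distrib ennreal_mult')
  then have "(L2_norm (vol \<Omega>) \<phi>)\<^sup>2 \<le> (2 * \<rho> * L2_norm (vol \<Omega>) G)\<^sup>2" by (subst (asm) ennreal_le_iff) auto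
  then show ?thesis by (rule power2_le_imp_le) (use \<rho> in simp)
qed

lemma axial_poincare:
  assumes t: "tr u g f" and m: "\<And>t. (m has_real_derivative m' t) (at t)" "continuous_on UNIV m'"
    and b: "\<And>t. \<bar>m t\<bar> \<le> B" "\<And>t. \<bar>m' t\<bar> \<le> B" and z: "\<And>t. \<rho> \<le> \<bar>t - s0\<bar> \<Longrightarrow> m t = 0" and \<rho>: "\<rho> > 0"
  shows "L2_norm (vol \<Omega>) (\<lambda>x. m (snd x) * u x) \<le> 2 * \<rho> * L2_norm (vol \<Omega>) (\<lambda>x. m (snd x) *\<^sub>R g x + u x *\<^sub>R (0, m' (snd x)))"
proof -
  obtain \<phi> G where 1: "(\<lambda>x. m (snd x) * u x) \<in> L2 (vol \<Omega>)"
    "(\<lambda>x. m (snd x) *\<^sub>R g x + u x *\<^sub>R (0, m' (snd x))) \<in> L2 (vol \<Omega>)" "(\<lambda>x. m (snd x) * f x) \<in> L2 (surface \<omega>)"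
    "\<And>n::nat. (\<lambda>x. m (snd x) * \<phi> n x) \<in> C1c UNIV"
    "\<And>n. C1_grad (\<lambda>x. m (snd x) * \<phi> n x) (\<lambda>x. m (snd x) *\<^sub>R G n x + \<phi> n x *\<^sub>R (0, m' (snd x)))"
    "(\<lambda>n. L2_norm (vol \<Omega>) (\<lambda>x. m (snd x) * \<phi> n x - m (snd x) * u x)) \<longlonglongrightarrow> 0"
    "(\<lambda>n. L2_norm (vol \<Omega>) (\<lambda>x. m (snd x) *\<^sub>R G n x + \<phi> n x *\<^sub>R (0, m' (snd x)) -
        (m (snd x) *\<^sub>R g x + u x *\<^sub>R (0, m' (snd x))))) \<longlonglongrightarrow> 0"
    "(\<lambda>n. L2_norm (surface \<omega>) (\<lambda>x. m (snd x) * \<phi> n x - m (snd x) * f x)) \<longlonglongrightarrow> 0"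
    by (rule tr_mult_approx[OF t m b]) (rule that)
  have "(\<lambda>n. 2 * \<rho> * L2_norm (vol \<Omega>) (\<lambda>x. m (snd x) *\<^sub>R G n x + \<phi> n x *\<^sub>R (0, m' (snd x))))
      \<longlonglongrightarrow> 2 * \<rho> * L2_norm (vol \<Omega>) (\<lambda>x. m (snd x) *\<^sub>R g x + u x *\<^sub>R (0, m' (snd x)))"
    by (intro tendsto_intros L2_norm_tendsto[OF C1c_L2(2)[OF 1(4,5)] 1(2,7)])
  moreover have "(\<lambda>n. L2_norm (vol \<Omega>) (\<lambda>x. m (snd x) * \<phi> n x)) \<longlonglongrightarrow> L2_norm (vol \<Omega>) (\<lambda>x. m (snd x) * u x)"
    by (rule L2_norm_tendsto[OF C1c_L2(1)[OF 1(4,5)] 1(1,6)])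
  moreover have "L2_norm (vol \<Omega>) (\<lambda>x. m (snd x) * \<phi> n x) \<le> 2 * \<rho> * L2_norm (vol \<Omega>) (\<lambda>x. m (snd x) *\<^sub>R G n x + \<phi> n x *\<^sub>R (0, m' (snd x)))" for n
    by (rule axial_test[OF 1(4,5) _ \<rho>]) (use z in auto)
  ultimately show ?thesis by (intro LIMSEQ_le) auto
qed

end

section \<open>Localised boundary data\<close>

lemma open_AE_empty:
  fixes W :: "'a::euclidean_space set"
  assumes "open W" "AE x in lborel. x \<notin> W" shows "W = {}"
proof -
  have "W \<in> null_sets lborel" using assms by (subst AE_iff_null_sets) auto
  then have "negligible W" by (simp add: negligible_iff_null_sets null_sets_completionI)
  then show ?thesis using open_not_negligible[OF assms(1)] by blast
qed

lemma datum_C1c: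
  assumes "\<rho> > 0" "P \<in> C1c UNIV" "C1_grad P P'"
  shows "(\<lambda>x. bump p \<rho> (fst x) * P (snd x)) \<in> C1c UNIV"
    "C1_grad (\<lambda>x. bump p \<rho> (fst x) * P (snd x)) (\<lambda>x. bump p \<rho> (fst x) *\<^sub>R (0, P' (snd x)) + P (snd x) *\<^sub>R (bump' p \<rho> (fst x), 0))"
proof -
  show g: "C1_grad (\<lambda>x. bump p \<rho> (fst x) * P (snd x)) (\<lambda>x. bump p \<rho> (fst x) *\<^sub>R (0, P' (snd x)) + P (snd x) *\<^sub>R (bump' p \<rho> (fst x), 0))"
    by (rule C1_grad_mult[OF C1_grad_fst[OF bump_C1] C1_grad_snd[OF assms(3)]])
  obtain K where K: "compact K" "K \<subseteq> UNIV" "\<And>x. x \<notin> K \<Longrightarrow> P x = 0" "\<And>x. x \<notin> K \<Longrightarrow> P' x = 0"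
    by (rule C1c_support[OF assms(2,3)]) (rule that)
  show "(\<lambda>x. bump p \<rho> (fst x) * P (snd x)) \<in> C1c UNIV"
  proof (rule C1c_I[OF g compact_Times[OF compact_cball K(1)] subset_UNIV])
    fix x assume x: "x \<notin> cball p (3/2 * \<rho>) \<times> K"
    show "bump p \<rho> (fst x) * P (snd x) = 0"
    proof (cases "snd x \<in> K")
      case True
      then have "3/2 * \<rho> \<le> norm (fst x - p)" using x by (cases x) (auto simp: dist_norm norm_minus_commute)
      from bump_eq_0(1)[OF assms(1) this] show ?thesis by simp
    qed (simp add: K(3))
  qed
qed

context lipschitz_domain
begin

text \<open>If \<open>w\<close> and its gradient vanished, the explicit extension of the datum would
  itself have zero trace. Where the bump is 1 this extension depends on the axial variable alone, so
  the strip inequality makes it vanish near \<open>p\<close>, although it equals \<open>P\<close>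
  there.\<close>

lemma nontrivial_trace:
  assumes p: "p \<in> frontier \<omega>" and \<rho>: "\<rho> > 0" and P: "P \<in> C1c UNIV" "C1_grad P P'" "P s \<noteq> 0"
    and t: "tr w g (\<lambda>x. bump p \<rho> (fst x) * P (snd x))" and 0: "L2_norm (vol \<Omega>) w = 0" "L2_norm (vol \<Omega>) g = 0"
  shows False
proof -
  define \<phi> where "\<phi> x = bump p \<rho> (fst x) * P (snd x)" for x
  define G where "G x = bump p \<rho> (fst x) *\<^sub>R (0, P' (snd x)) + P (snd x) *\<^sub>R (bump' p \<rho> (fst x), 0)" for x
  note d = datum_C1c[OF \<rho> P(1,2), of p, folded \<phi>_def[abs_def] G_def[abs_def]]
  have "AE x in vol \<Omega>. w x = 0" "AE x in vol \<Omega>. g x = 0"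
    using L2_norm_eq_0[OF trD(1)[OF t]] L2_norm_eq_0[OF trD(2)[OF t]] 0 by auto
  from tr_cong_AE[OF t this(1) _ this(2)] have "tr (\<lambda>x. 0) (\<lambda>x. 0) \<phi>" by (simp add: \<phi>_def[abs_def])
  from tr_diff[OF tr_test[OF d] this] have z: "tr \<phi> G (\<lambda>x. 0)" by simp
  obtain U e where U: "open U" "p \<in> U" "norm (e::real^2) = 1"
    "\<And>q \<rho>. q \<in> U \<Longrightarrow> q \<in> frontier \<omega> \<Longrightarrow> \<rho> > 0 \<Longrightarrow>
        \<exists>W. open W \<and> q \<in> W \<and> (\<forall>x\<in>W \<inter> \<omega>. \<exists>t. 0 < t \<and> t < \<rho> \<and> x - t *\<^sub>R e \<notin> closure \<omega>)"
    by (rule exterior_directions[OF open_om lipschitz_om p]) (rule that)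
  note e = U(3)
  have "\<rho> / 2 > 0" using \<rho> by simp
  from U(4)[OF U(2) p this] obtain W where W: "open W" "p \<in> W"
    "\<forall>x\<in>W \<inter> \<omega>. \<exists>t. 0 < t \<and> t < \<rho>/2 \<and> x - t *\<^sub>R e \<notin> closure \<omega>" by (elim exE conjE) (rule that)
  have "p \<in> closure \<omega>" using p by (simp add: frontier_def)
  moreover have "open (W \<inter> ball p (\<rho>/2))" "p \<in> W \<inter> ball p (\<rho>/2)" using W \<rho> by auto
  ultimately obtain x0 where x0: "x0 \<in> \<omega>" "x0 \<in> W" "x0 \<in> ball p (\<rho>/2)"
    using open_Int_closure_eq_empty[of "W \<inter> ball p (\<rho>/2)" \<omega>] by blast
  have "x0 \<in> W \<inter> \<omega>" using x0 by blast
  from bspec[OF W(3) this] obtain t where t: "0 < t" "t < \<rho>/2" "x0 - t *\<^sub>R e \<notin> closure \<omega>"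
    by (elim exE conjE) (rule that)
  \<comment> \<open>An open nonempty part of \<open>S\<close>, needed because \<open>S\<close> is
    only Borel and could a priori be a null set.\<close>
  define U0 where "U0 = \<omega> \<inter> ball p \<rho> \<inter> (\<lambda>x. x - t *\<^sub>R e) -` (ball p \<rho> \<inter> - closure \<omega>)"
  have "open ((\<lambda>x. x - t *\<^sub>R e) -` (ball p \<rho> \<inter> - closure \<omega>))"
    by (rule open_vimage) (auto intro!: continuous_intros open_Int simp: open_Compl simp del: closure_complement)
  then have oU0: "open U0" unfolding U0_def using open_om by (intro open_Int) auto
  have "dist p (x0 - t *\<^sub>R e) \<le> dist p x0 + dist x0 (x0 - t *\<^sub>R e)" by (rule dist_triangle)
  also have "\<dots> < \<rho>" using x0(3) t e by (simp add: dist_norm)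
  finally have x0U: "x0 \<in> U0" using x0 t \<rho> by (auto simp: U0_def)
  \<comment> \<open>By convexity of the ball the whole segment to the exit point stays where the
    bump equals 1.\<close>
  define S where "S = {x \<in> \<omega> \<inter> ball p \<rho>. exitpt e x \<in> ball p \<rho>}"
  have seg: "x - r *\<^sub>R e \<in> ball p \<rho>" if "x \<in> ball p \<rho>" "x - l *\<^sub>R e \<in> ball p \<rho>" "0 \<le> r" "r \<le> l" "0 < l" for x r l
  proof -
    have "(1 - r/l) *\<^sub>R x + (r/l) *\<^sub>R (x - l *\<^sub>R e) \<in> ball p \<rho>"
      by (rule convexD[OF convex_ball that(1,2)]) (use that in auto)
    also have "(1 - r/l) *\<^sub>R x + (r/l) *\<^sub>R (x - l *\<^sub>R e) = x - r *\<^sub>R e"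
      using that(5) by (simp add: algebra_simps)
    finally show ?thesis .
  qed
  have US: "U0 \<subseteq> S"
  proof
    fix x assume x: "x \<in> U0"
    then have "x - t *\<^sub>R e \<notin> \<omega>" using closure_subset by (auto simp: U0_def)
    then have "exitlen e x \<le> t" using exitlen_props(4)[OF e, of t x] t by simp
    then have "exitpt e x \<in> ball p \<rho>" unfolding exitpt_def
      using seg[of x t "exitlen e x"] x t exitlen_props(1)[OF e, of x] by (simp add: U0_def)
    then show "x \<in> S" using x by (simp add: S_def U0_def)
  qed
  have SB: "S \<in> sets borel"
  proof -
    have "exitpt e -` ball p \<rho> \<inter> space borel \<in> sets borel"
      by (rule measurable_sets[OF exitpt_measurable[OF e]]) simp
    moreover have "S = \<omega> \<inter> ball p \<rho> \<inter> (exitpt e -` ball p \<rho> \<inter> space borel)" by (auto simp: S_def)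
    ultimately show ?thesis using open_om by auto
  qed
  have SU: "S \<times> UNIV \<in> sets (borel :: ((real^2) \<times> real) measure)" "S \<times> UNIV \<subseteq> \<Omega>"
    using SB unfolding borel_prod[symmetric] by (auto intro: pair_measureI simp: waveguide_def S_def)
  have OB: "\<Omega> \<in> sets borel" using open_waveguide by simp
  have "(L2_norm (vol (S \<times> UNIV)) \<phi>)\<^sup>2 \<le> 2 * width\<^sup>2 * (L2_norm (vol (S \<times> UNIV)) (\<lambda>x. G x \<bullet> (e, 0)))\<^sup>2"
  proof (rule strip_tr[OF e SB _ _ _ _ z])
    show "S \<subseteq> \<omega>" by (auto simp: S_def)
    show "x - r *\<^sub>R e \<in> S" if x: "x \<in> S" and r: "0 \<le> r" "r < exitlen e x" for x r
    proof -
      have "exitpt e (x - r *\<^sub>R e) = exitpt e x" by (rule exitpt_shift[OF e r])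
      moreover have "x - r *\<^sub>R e \<in> \<omega>" by (rule exitlen_props(3)[OF e r])
      moreover have "x - r *\<^sub>R e \<in> ball p \<rho>"
        using seg[of x "exitlen e x" r] x r unfolding S_def exitpt_def by simp
      ultimately show ?thesis using x by (simp add: S_def)
    qed
    show "exitlen e x \<le> width" if "x \<in> S" for x using exitlen_props(5)[OF e] that by (simp add: S_def)
  qed (use width(1) in simp)
  \<comment> \<open>On \<open>S\<close> the bump is constant and the remaining factor is axial, so
    the derivative in the direction \<open>(e, 0)\<close> vanishes.\<close>
  also have "L2_norm (vol (S \<times> UNIV)) (\<lambda>x. G x \<bullet> (e, 0)) = L2_norm (vol (S \<times> (UNIV::real set))) (\<lambda>x. 0::real)"
    unfolding L2_norm_def
  proof (intro arg_cong[of _ _ sqrt] Bochner_Integration.integral_cong refl)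
    fix x :: "(real^2) \<times> real" assume "x \<in> space (vol (S \<times> UNIV))"
    then have "norm (fst x - p) \<le> \<rho>" using SU(1) by (auto simp: space_restrict_space S_def dist_norm norm_minus_commute)
    then have "bump' p \<rho> (fst x) = 0" by (rule bump_eq_1(2)[OF \<rho>])
    then show "(norm (G x \<bullet> (e, 0)))\<^sup>2 = (norm (0::real))\<^sup>2" by (simp add: G_def)
  qed
  finally have "L2_norm (vol (S \<times> UNIV)) \<phi> = 0" by simp
  then have "AE x in vol (S \<times> UNIV). \<phi> x = 0"
    using L2_norm_eq_0[OF L2_vol_subset(1)[OF trD(1)[OF z] SU(2,1) OB]] by simp
  then have ae: "AE x in lborel. x \<in> S \<times> UNIV \<longrightarrow> \<phi> x = 0" using SU(1) by (subst (asm) AE_restrict_space_iff) auto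
  define V where "V = U0 \<times> {s. P s \<noteq> 0}"
  have "open {s. P s \<noteq> 0}" by (rule open_Collect_neq) (auto intro: C1_gradD(3)[OF P(2)])
  then have "open V" unfolding V_def by (intro open_Times oU0)
  moreover have "AE x in lborel. x \<notin> V" using ae
  proof eventually_elim
    case (elim x)
    show ?case
    proof
      assume x: "x \<in> V"
      then have "x \<in> S \<times> UNIV" using US by (auto simp: V_def)
      then have "\<phi> x = 0" using elim by simp
      moreover have "norm (fst x - p) \<le> \<rho>" using x by (auto simp: V_def U0_def dist_norm norm_minus_commute)
      then have "bump p \<rho> (fst x) = 1" by (rule bump_eq_1(1)[OF \<rho>])
      ultimately show False using x by (auto simp: \<phi>_def V_def)
    qed
  qed
  ultimately have "V = {}" by (rule open_AE_empty)
  then show False using x0U P(3) by (auto simp: V_def)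
qed

section \<open>Energy away from the support of the data\<close>

lemma Bf_coef_mono:
  assumes a: "a \<in> borel_measurable borel" "AE s in lborel. \<bar>a s\<bar> \<le> A" "0 \<le> A"
    and b: "b \<in> borel_measurable borel" "AE s in lborel. \<bar>b s\<bar> \<le> A'" "0 \<le> A'"
    and le: "AE s in lborel. a s \<le> b s" and h: "h \<in> L2 (vol \<Omega>)"
  shows "Bf a h h \<le> Bf b h h"
  unfolding Bf_def
proof (rule integral_mono_AE[OF Bf_integrable_gen(1)[OF a h h] Bf_integrable_gen(1)[OF b h h]])
  show "AE x in vol \<Omega>. a (snd x) * qform (fst x) (h x) (h x) \<le> b (snd x) * qform (fst x) (h x) (h x)"
    unfolding AE_vol[OF open_waveguide] using AE_snd[OF le]
    by eventually_elim (auto intro!: mult_right_mono qform_nonneg)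
qed

lemma Bf_coef_lin:
  assumes a: "a \<in> borel_measurable borel" "AE s in lborel. \<bar>a s\<bar> \<le> A" "0 \<le> A"
    and b: "b \<in> borel_measurable borel" "AE s in lborel. \<bar>b s\<bar> \<le> A'" "0 \<le> A'" and h: "h \<in> L2 (vol \<Omega>)"
  shows "Bf (\<lambda>s. c * a s + d * b s) h h = c * Bf a h h + d * Bf b h h"
proof -
  have "Bf (\<lambda>s. c * a s + d * b s) h h = (LINT x|vol \<Omega>. c * (a (snd x) * qform (fst x) (h x) (h x)) + d * (b (snd x) * qform (fst x) (h x) (h x)))"
    unfolding Bf_def by (simp add: algebra_simps)
  also have "\<dots> = c * Bf a h h + d * Bf b h h"
    using Bf_integrable_gen(1)[OF a h h] Bf_integrable_gen(1)[OF b h h] by (simp add: Bf_def)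
  finally show ?thesis .
qed

text \<open>The equation is tested with \<open>\<eta>\<^sup>2 u\<close>, whose trace vanishes
  because \<eta> kills the datum. Young's inequality absorbs the cross term into half of the
  localised energy, leaving \<open>u\<close> only where \<eta> varies.\<close>

lemma caccioppoli:
  assumes a: "coef \<alpha> t B" and u: "weak_sol \<alpha> u h f"
    and \<eta>: "\<And>s. (\<eta> has_real_derivative \<eta>' s) (at s)" "continuous_on UNIV \<eta>'"
    and b: "\<And>s. \<bar>\<eta> s\<bar> \<le> 1" "\<And>s. \<bar>\<eta>' s\<bar> \<le> C"
    and z: "\<And>x. \<eta> (snd x) * f x = 0" and J: "compact J" "\<And>s. s \<notin> J \<Longrightarrow> \<eta>' s = 0"
  shows "Bf (\<lambda>s. (\<eta> s)\<^sup>2) h h \<le> 4 * B * C\<^sup>2 / t * (L2_norm (vol (\<omega> \<times> J)) u)\<^sup>2"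
proof -
  have t0: "t > 0" and B: "B \<ge> 0" and am: "\<alpha> \<in> borel_measurable borel" using a by (auto simp: coef_def)
  have C: "C \<ge> 0" using b(2)[of 0] by linarith
  have tu: "tr u h f" and orth: "\<And>v k. tr v k (\<lambda>x. 0) \<Longrightarrow> Bf \<alpha> h k = 0" using u by (auto simp: weak_sol_def)
  have \<eta>c: "continuous_on UNIV \<eta>" by (rule C1_gradD(3)[OF C1_grad_real[OF \<eta>]])
  have m: "((\<lambda>s. (\<eta> s)\<^sup>2) has_real_derivative 2 * \<eta> s * \<eta>' s) (at s)" for s
    by (rule derivative_eq_intros \<eta>(1) refl)+ simp
  have mc: "continuous_on UNIV (\<lambda>s. 2 * \<eta> s * \<eta>' s)" by (intro continuous_intros \<eta>c \<eta>(2))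
  have bm: "\<bar>(\<eta> s)\<^sup>2\<bar> \<le> 1" for s using b(1)[of s] by (simp add: abs_square_le_1)
  have bm1: "\<bar>(\<eta> s)\<^sup>2\<bar> \<le> 1 + 2 * C" for s using bm[of s] C by linarith
  have bm2: "\<bar>2 * \<eta> s * \<eta>' s\<bar> \<le> 1 + 2 * C" for s
  proof -
    have "\<bar>\<eta> s\<bar> * \<bar>\<eta>' s\<bar> \<le> 1 * C" by (intro mult_mono b) auto
    then show ?thesis by (simp add: abs_mult)
  qed
  define k where "k x = (\<eta> (snd x))\<^sup>2 *\<^sub>R h x + u x *\<^sub>R (0, 2 * \<eta> (snd x) * \<eta>' (snd x))" for x
  have "tr (\<lambda>x. (\<eta> (snd x))\<^sup>2 * u x) k (\<lambda>x. (\<eta> (snd x))\<^sup>2 * f x)"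
    unfolding k_def[abs_def] by (rule tr_mult[OF tu m mc bm1 bm2])
  moreover have "(\<lambda>x. (\<eta> (snd x))\<^sup>2 * f x) = (\<lambda>x. 0)" using z by (auto simp: power2_eq_square)
  ultimately have tk: "tr (\<lambda>x. (\<eta> (snd x))\<^sup>2 * u x) k (\<lambda>x. 0)" by simp
  note hL = trD(2)[OF tu] and kL = trD(2)[OF tk] and uL = trD(1)[OF tu]
  have OB: "\<Omega> \<in> sets borel" using open_waveguide by simp
  have OJ: "\<omega> \<times> J \<in> sets (borel :: ((real^2) \<times> real) measure)" "\<omega> \<times> J \<subseteq> \<Omega>"
    using borel_compact[OF J(1)] open_om unfolding borel_prod[symmetric] by (auto intro!: pair_measureI simp: waveguide_def)
  have uJ: "(L2_norm (vol (\<omega> \<times> J)) u)\<^sup>2 = (LINT x|vol \<Omega>. indicator (\<omega> \<times> J) x * (u x)\<^sup>2)"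
  proof -
    have "(L2_norm (vol (\<omega> \<times> J)) u)\<^sup>2 = (LINT x|lborel. indicator (\<omega> \<times> J) x *\<^sub>R (u x)\<^sup>2)"
      unfolding L2_norm_power2 by (subst integral_restrict_space) (use OJ(1) in auto)
    also have "\<dots> = (LINT x|lborel. indicator \<Omega> x *\<^sub>R (indicator (\<omega> \<times> J) x * (u x)\<^sup>2))"
      by (rule Bochner_Integration.integral_cong) (use OJ(2) in \<open>auto simp: indicator_def\<close>)
    finally show ?thesis by (subst LINT_vol[OF open_waveguide])
  qed
  have uI: "integrable (vol \<Omega>) (\<lambda>x. indicator (\<omega> \<times> J) x * (u x)\<^sup>2)"
  proof -
    have "integrable (vol \<Omega>) (\<lambda>x. (u x)\<^sup>2)" using uL by (simp add: L2_def)
    moreover have "\<omega> \<times> J \<in> sets (vol \<Omega>)"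
      using OJ by (auto simp: sets_restrict_space intro!: image_eqI[of _ _ "\<omega> \<times> J"])
    ultimately show ?thesis using integrable_mult_indicator[of "\<omega> \<times> J" "vol \<Omega>" "\<lambda>x. (u x)\<^sup>2"] by simp
  qed
  have \<eta>2: "(\<lambda>s. (\<eta> s)\<^sup>2) \<in> borel_measurable borel" by (intro borel_measurable_continuous_onI continuous_intros \<eta>c)
  have i1: "integrable (vol \<Omega>) (\<lambda>x. (\<eta> (snd x))\<^sup>2 * qform (fst x) (h x) (h x))"
    by (rule Bf_integrable_gen(1)[OF \<eta>2 _ _ hL hL, of 1]) (use bm in auto)
  have at: "AE s in lborel. t \<le> \<alpha> s \<and> \<alpha> s \<le> B" using a unfolding coef_def by auto
  have "t / 2 * Bf (\<lambda>s. (\<eta> s)\<^sup>2) h h = (LINT x|vol \<Omega>. t / 2 * ((\<eta> (snd x))\<^sup>2 * qform (fst x) (h x) (h x)))"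
    using i1 by (simp add: Bf_def)
  also have "\<dots> \<le> (LINT x|vol \<Omega>. \<alpha> (snd x) * qform (fst x) (h x) (k x) + 2 * B * C\<^sup>2 * (indicator (\<omega> \<times> J) x * (u x)\<^sup>2))"
  proof (rule integral_mono_AE)
    show "integrable (vol \<Omega>) (\<lambda>x. t / 2 * ((\<eta> (snd x))\<^sup>2 * qform (fst x) (h x) (h x)))" using i1 by simp
    show "integrable (vol \<Omega>) (\<lambda>x. \<alpha> (snd x) * qform (fst x) (h x) (k x) + 2 * B * C\<^sup>2 * (indicator (\<omega> \<times> J) x * (u x)\<^sup>2))"
      by (intro Bochner_Integration.integrable_add integrable_mult_right uI Bf_integrable(1)[OF a hL kL])
    show "AE x in vol \<Omega>. t / 2 * ((\<eta> (snd x))\<^sup>2 * qform (fst x) (h x) (h x))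
      \<le> \<alpha> (snd x) * qform (fst x) (h x) (k x) + 2 * B * C\<^sup>2 * (indicator (\<omega> \<times> J) x * (u x)\<^sup>2)"
      unfolding AE_vol[OF open_waveguide] using AE_snd[OF at]
    proof eventually_elim
      case (elim x)
      show ?case
      proof
        assume x: "x \<in> \<Omega>"
        let ?e = "\<eta> (snd x)" and ?e' = "\<eta>' (snd x)" and ?q = "qform (fst x) (h x) (h x)" and ?l = "h x \<bullet> twist (fst x)"
        let ?\<alpha> = "\<alpha> (snd x)"
        have al: "t \<le> ?\<alpha>" "?\<alpha> \<le> B" "0 \<le> ?\<alpha>" using elim t0 by auto
        have lq: "?l\<^sup>2 \<le> ?q" by (simp add: qform_def power2_eq_square)
        \<comment> \<open>The gradient of the cut-off is axial and the last component of
          \<open>twist\<close> is 1, so the cross term pairs it with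
          \<open>h x \<bullet> twist (fst x)\<close> only, whose square is part of the form.\<close>
        have e1: "qform (fst x) (h x) (k x) = ?e\<^sup>2 * ?q + u x * (2 * ?e * ?e') * ?l"
          by (simp add: k_def qform_def twist_def inner_add_left inner_add_right inner_prod_def algebra_simps)
        \<comment> \<open>The weights leave exactly half of the localised form; after comparison of
          \<alpha> with \<open>t\<close> and \<open>B\<close> this is the origin of
          \<open>4 * B * C\<^sup>2 / t\<close>.\<close>
        have "- (u x * (2 * ?e * ?e') * ?l) \<le> (1/2) * (?e\<^sup>2 * ?l\<^sup>2) + 2 * (?e'\<^sup>2 * (u x)\<^sup>2)"
          using sum_squares_bound[of "?e * ?l" "- (2 * (?e' * u x))"] by (simp add: power2_eq_square algebra_simps)
        also have "\<dots> \<le> (1/2) * (?e\<^sup>2 * ?q) + 2 * (C\<^sup>2 * (indicator (\<omega> \<times> J) x * (u x)\<^sup>2))"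
        proof (intro add_mono mult_left_mono lq)
          show "?e'\<^sup>2 * (u x)\<^sup>2 \<le> C\<^sup>2 * (indicator (\<omega> \<times> J) x * (u x)\<^sup>2)"
          proof (cases "snd x \<in> J")
            case True
            then have "x \<in> \<omega> \<times> J" using x by (auto simp: waveguide_def)
            moreover have "?e'\<^sup>2 \<le> C\<^sup>2" using b(2)[of "snd x"] by (simp add: abs_le_square_iff[symmetric] C)
            ultimately show ?thesis by (simp add: mult_right_mono)
          next
            case False
            then show ?thesis using J(2) by simp
          qed
        qed auto
        finally have "(1/2) * (?e\<^sup>2 * ?q) \<le> qform (fst x) (h x) (k x) + 2 * (C\<^sup>2 * (indicator (\<omega> \<times> J) x * (u x)\<^sup>2))"
          unfolding e1 by linarith
        then have "?\<alpha> * ((1/2) * (?e\<^sup>2 * ?q)) \<le> ?\<alpha> * (qform (fst x) (h x) (k x) + 2 * (C\<^sup>2 * (indicator (\<omega> \<times> J) x * (u x)\<^sup>2)))"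
          using al(3) by (rule mult_left_mono)
        moreover have "t * ((1/2) * (?e\<^sup>2 * ?q)) \<le> ?\<alpha> * ((1/2) * (?e\<^sup>2 * ?q))"
          by (rule mult_right_mono[OF al(1)]) (simp add: qform_nonneg)
        moreover have "?\<alpha> * (2 * (C\<^sup>2 * (indicator (\<omega> \<times> J) x * (u x)\<^sup>2))) \<le> B * (2 * (C\<^sup>2 * (indicator (\<omega> \<times> J) x * (u x)\<^sup>2)))"
          by (rule mult_right_mono[OF al(2)]) simp
        ultimately show "t / 2 * (?e\<^sup>2 * ?q) \<le> ?\<alpha> * qform (fst x) (h x) (k x) + 2 * B * C\<^sup>2 * (indicator (\<omega> \<times> J) x * (u x)\<^sup>2)"
          by (simp add: algebra_simps)
      qed
    qed
  qed
  also have "\<dots> = Bf \<alpha> h k + 2 * B * C\<^sup>2 * (L2_norm (vol (\<omega> \<times> J)) u)\<^sup>2"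
    using uI Bf_integrable(1)[OF a hL kL] by (simp add: uJ Bf_def)
  also have "Bf \<alpha> h k = 0" by (rule orth[OF tk])
  finally show ?thesis using t0 by (simp add: field_simps)
qed

lemma weak_sol_scale:
  assumes "weak_sol \<alpha> u h f" shows "weak_sol \<alpha> (\<lambda>x. c * u x) (\<lambda>x. c *\<^sub>R h x) (\<lambda>x. c * f x)"
  using assms tr_scale[of u h f c] by (auto simp: weak_sol_def Bf_scale)

lemma weak_sol_add:
  assumes a: "coef \<alpha> t B" and "weak_sol \<alpha> u h f" "weak_sol \<alpha> u' h' f'"
  shows "weak_sol \<alpha> (\<lambda>x. u x + u' x) (\<lambda>x. h x + h' x) (\<lambda>x. f x + f' x)"
proof -
  have t: "tr u h f" "tr u' h' f'" using assms by (auto simp: weak_sol_def)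
  have "Bf \<alpha> (\<lambda>x. h x + h' x) k = 0" if "tr v k (\<lambda>x. 0)" for v k
    using Bf_add[OF a trD(2)[OF t(1)] trD(2)[OF t(2)] trD(2)[OF that]] assms that by (auto simp: weak_sol_def)
  then show ?thesis unfolding weak_sol_def using tr_add[OF t] by blast
qed

lemma weak_sol_sum:
  assumes a: "coef \<alpha> t B" and "finite A" and "\<And>i. i \<in> A \<Longrightarrow> weak_sol \<alpha> (u i) (h i) (f i)"
  shows "weak_sol \<alpha> (\<lambda>x. \<Sum>i\<in>A. c i * u i x) (\<lambda>x. \<Sum>i\<in>A. c i *\<^sub>R h i x) (\<lambda>x. \<Sum>i\<in>A. c i * f i x)"
  using assms(2,3)
proof (induction A rule: finite_induct)
  case empty
  have "weak_sol \<alpha> (\<lambda>x. 0) (\<lambda>x. 0) (\<lambda>x. 0)"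
    using tr_zero Bf_scale[of \<alpha> 0 "\<lambda>x. 0"] by (auto simp: weak_sol_def)
  then show ?case by simp
next
  case (insert i A)
  then show ?case using weak_sol_add[OF a weak_sol_scale[of \<alpha> "u i" "h i" "f i" "c i"]] by simp
qed

end

section \<open>The stability estimate\<close>

lemma disjoint_bumps:
  fixes s0 r :: real and n :: nat
  assumes "r > 0"
  obtains c \<sigma> where "\<sigma> > 0" "\<And>j s. j \<le> n \<Longrightarrow> r \<le> \<bar>s - s0\<bar> \<Longrightarrow> bump (c j) \<sigma> s = 0"
    "\<And>i j. i \<le> n \<Longrightarrow> j \<le> n \<Longrightarrow> bump (c j) \<sigma> (c i) = (if i = j then 1 else 0 :: real)"
proof -
  \<comment> \<open>The n + 1 centres split the interval of length \<open>2 * r\<close> into n + 2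
    equal gaps, so the extreme centres also keep distance \<open>d\<close> from its ends.\<close>
  define d where "d = 2 * r / (real n + 2)"
  have d: "d > 0" using assms by (simp add: d_def)
  have dn: "d * (real n + 2) = 2 * r" by (simp add: d_def)
  define c where "c j = s0 - r + d * (real j + 1)" for j :: nat
  \<comment> \<open>Supports then have radius at most d/2: they reach neither another centre nor the
    ends of the interval.\<close>
  define \<sigma> where "\<sigma> = d / 3"
  have \<sigma>: "\<sigma> > 0" using d by (simp add: \<sigma>_def)
  have 1: "bump (c j) \<sigma> s = 0" if "j \<le> n" "r \<le> \<bar>s - s0\<bar>" for j s
  proof (rule bump_eq_0(1)[OF \<sigma>])
    have "d * (real j + 1) \<le> d * (real n + 1)" using that(1) d by (intro mult_left_mono) auto
    then have u: "d * (real j + 1) \<le> 2 * r - d" using dn by (simp add: algebra_simps)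
    have l: "d \<le> d * (real j + 1)" using d by simp
    have "d \<le> \<bar>s - c j\<bar>" using that(2) u l unfolding c_def by linarith
    then show "3/2 * \<sigma> \<le> norm (s - c j)" using d by (simp add: \<sigma>_def)
  qed
  have 2: "bump (c j) \<sigma> (c i) = (if i = j then 1 else 0)" for i j
  proof (cases "i = j")
    case True then show ?thesis using bump_eq_1(1)[OF \<sigma>, of "c j" "c j"] \<sigma> by simp
  next
    case False
    have "c i - c j = d * (real i - real j)" by (simp add: c_def algebra_simps)
    then have "\<bar>c i - c j\<bar> = d * \<bar>real i - real j\<bar>" using d by (simp add: abs_mult)
    moreover have "1 \<le> \<bar>real i - real j\<bar>" using False by linarith
    ultimately have "d \<le> \<bar>c i - c j\<bar>" using d by simp
    then have "3/2 * \<sigma> \<le> norm (c i - c j)" using d by (simp add: \<sigma>_def)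
    from bump_eq_0(1)[OF \<sigma> this] show ?thesis using False by simp
  qed
  show ?thesis by (rule that[OF \<sigma> 1 2])
qed

context lipschitz_domain
begin

text \<open>There is one more bump than there are means, hence a nontrivial combination of bumps whose solution
  has vanishing means.\<close>

lemma concentrated_solution:
  assumes a: "coef \<alpha> t B" and p: "p \<in> frontier \<omega>" and \<rho>: "\<rho> > 0" and r: "r > 0"
    and Q: "finite \<Q>" "\<And>Q. Q \<in> \<Q> \<Longrightarrow> Q \<in> sets borel \<and> bounded Q \<and> Q \<subseteq> \<Omega>"
  obtains P P' s u h where "P \<in> C1c UNIV" "C1_grad P P'" "P s \<noteq> 0" "\<And>s. r \<le> \<bar>s - s0\<bar> \<Longrightarrow> P s = 0"
    "weak_sol \<alpha> u h (\<lambda>x. bump p \<rho> (fst x) * P (snd x))" "\<forall>Q\<in>\<Q>. (LINT x|vol Q. u x) = 0"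
proof -
  define n where "n = card \<Q>"
  obtain c \<sigma> where c: "\<sigma> > 0" "\<And>j s. j \<le> n \<Longrightarrow> r \<le> \<bar>s - s0\<bar> \<Longrightarrow> bump (c j) \<sigma> s = 0"
    "\<And>i j. i \<le> n \<Longrightarrow> j \<le> n \<Longrightarrow> bump (c j) \<sigma> (c i) = (if i = j then 1 else 0 :: real)"
    by (rule disjoint_bumps[OF r]) (rule that)
  have bC: "bump (c j) \<sigma> \<in> C1c UNIV" for j by (rule bump_C1c[OF c(1)]) simp
  have "\<exists>u h. weak_sol \<alpha> u h (\<lambda>x. bump p \<rho> (fst x) * bump (c j) \<sigma> (snd x))" for j
    using weak_sol_exists[OF a tr_test[OF datum_C1c[OF \<rho> bC bump_C1]]] by metis
  then obtain u where "\<And>j. \<exists>h. weak_sol \<alpha> (u j) h (\<lambda>x. bump p \<rho> (fst x) * bump (c j) \<sigma> (snd x))" by metis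
  then obtain h where uh: "\<And>j. weak_sol \<alpha> (u j) (h j) (\<lambda>x. bump p \<rho> (fst x) * bump (c j) \<sigma> (snd x))" by metis
  have "card \<Q> < card {..n}" by (simp add: n_def)
  from kernel_exists[OF Q(1) _ this, of "\<lambda>Q j. LINT x|vol Q. u j x"]
  obtain k where k: "\<exists>j\<in>{..n}. k j \<noteq> 0" "\<And>Q. Q \<in> \<Q> \<Longrightarrow> (\<Sum>j\<in>{..n}. k j * (LINT x|vol Q. u j x)) = 0" by auto
  define P where "P s = (\<Sum>j\<in>{..n}. k j * bump (c j) \<sigma> s)" for s
  define P' where "P' s = (\<Sum>j\<in>{..n}. k j *\<^sub>R bump' (c j) \<sigma> s)" for s
  have g: "C1_grad P P'" unfolding P_def[abs_def] P'_def[abs_def] by (intro C1_grad_sum C1_grad_scale bump_C1)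
  have z: "P s = 0" if "r \<le> \<bar>s - s0\<bar>" for s using c(2) that by (simp add: P_def)
  have PC: "P \<in> C1c UNIV"
    by (rule C1c_I[OF g compact_cball[of s0 r] subset_UNIV]) (use z in \<open>auto simp: dist_real_def abs_minus_commute\<close>)
  obtain j where j: "j \<le> n" "k j \<noteq> 0" using k(1) by auto
  have "P (c j) = (\<Sum>i\<in>{..n}. if i = j then k i else 0)"
    unfolding P_def by (intro sum.cong refl) (use c(3) j in auto)
  also have "\<dots> = k j" using j by simp
  finally have nz: "P (c j) \<noteq> 0" using j by simp
  have "weak_sol \<alpha> (\<lambda>x. \<Sum>j\<in>{..n}. k j * u j x) (\<lambda>x. \<Sum>j\<in>{..n}. k j *\<^sub>R h j x)
      (\<lambda>x. \<Sum>j\<in>{..n}. k j * (bump p \<rho> (fst x) * bump (c j) \<sigma> (snd x)))"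
    by (rule weak_sol_sum[OF a _ uh]) simp
  also have "(\<lambda>x. \<Sum>j\<in>{..n}. k j * (bump p \<rho> (fst x) * bump (c j) \<sigma> (snd x))) = (\<lambda>x. bump p \<rho> (fst x) * P (snd x))"
    by (simp add: P_def sum_distrib_left mult.left_commute)
  finally have ws: "weak_sol \<alpha> (\<lambda>x. \<Sum>j\<in>{..n}. k j * u j x) (\<lambda>x. \<Sum>j\<in>{..n}. k j *\<^sub>R h j x) (\<lambda>x. bump p \<rho> (fst x) * P (snd x))" .
  have "(LINT x|vol Q. (\<Sum>j\<in>{..n}. k j * u j x)) = 0" if q: "Q \<in> \<Q>" for Q
  proof -
    have Qb: "Q \<in> sets borel" "bounded Q" "Q \<subseteq> \<Omega>" using Q(2)[OF q] by auto
    have fin: "emeasure lborel Q < \<infinity>" using emeasure_bounded_finite[OF Qb(2)] by simp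
    interpret F: finite_measure "vol Q"
      by (rule finite_measureI) (use fin Qb(1) in \<open>simp add: emeasure_restrict_space space_restrict_space less_top[symmetric]\<close>)
    have one: "(\<lambda>x. 1::real) \<in> L2 (vol Q)" by (simp add: L2_def)
    have OB: "\<Omega> \<in> sets borel" using open_waveguide by simp
    have "integrable (vol Q) (u j)" for j
    proof -
      have "tr (u j) (h j) (\<lambda>x. bump p \<rho> (fst x) * bump (c j) \<sigma> (snd x))" using uh by (simp add: weak_sol_def)
      from L2_mult_integrable(1)[OF L2_vol_subset(1)[OF trD(1)[OF this] Qb(3,1) OB] one] show ?thesis by simp
    qed
    then have "(LINT x|vol Q. (\<Sum>j\<in>{..n}. k j * u j x)) = (\<Sum>j\<in>{..n}. k j * (LINT x|vol Q. u j x))" by simp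
    then show ?thesis using k(2)[OF q] by simp
  qed
  then have "\<forall>Q\<in>\<Q>. (LINT x|vol Q. (\<Sum>j\<in>{..n}. k j * u j x)) = 0" by blast
  from that[OF PC g nz z ws this] show ?thesis .
qed

text \<open>The asymmetric core: the coefficient that is larger near \<open>s0\<close> supplies the
  solution, and the same field is a competitor for the other one. The case of the opposite sign is
  obtained by exchanging the coefficients.\<close>

lemma DN_difference_lower_bound:
  assumes a1: "coef \<alpha>1 t B" and a2: "coef \<alpha>2 t B" and \<Delta>: "\<Delta> > 0" "AE s in lborel. \<bar>\<alpha>1 s - \<alpha>2 s\<bar> \<le> \<Delta>"
    and \<delta>: "0 < \<delta>" "\<delta> \<le> 1" "AE s in lborel. \<bar>s - s0\<bar> < \<delta> \<longrightarrow> \<Delta> / 2 \<le> \<alpha>1 s - \<alpha>2 s"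
    and p: "p \<in> frontier \<omega>" and \<rho>: "\<rho> > 0"
  obtains P P' where "P \<in> C1c UNIV" "C1_grad P P'" "\<And>s. \<delta> \<le> \<bar>s - s0\<bar> \<Longrightarrow> P s = 0"
    "Htilde_norm \<omega> (\<lambda>x. bump p \<rho> (fst x) * P (snd x)) \<le> 1"
    "ellip / 80 * \<Delta> \<le> DN \<omega> \<alpha>1 (\<lambda>x. bump p \<rho> (fst x) * P (snd x)) (\<lambda>x. bump p \<rho> (fst x) * P (snd x)) -
       DN \<omega> \<alpha>2 (\<lambda>x. bump p \<rho> (fst x) * P (snd x)) (\<lambda>x. bump p \<rho> (fst x) * P (snd x))"
proof -
  have t: "t > 0" and B: "B \<ge> 0" using a1 by (auto simp: coef_def)
  \<comment> \<open>Nested scales around \<open>s0\<close>: the datum lives within \<delta>/4,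
    \<zeta> is 1 up to \<delta>/2 and 0 from 3\<delta>/4 on, and the gap between the coefficients is
    known up to \<delta>. The set \<open>J\<close> is where \<zeta> varies; \<open>m\<close>
    vanishes on the scale of the datum and is 1 on \<open>J\<close>.\<close>
  define \<zeta> where "\<zeta> = bump s0 (\<delta> / 2)"
  define \<zeta>' where "\<zeta>' = bump' s0 (\<delta> / 2)"
  define \<eta> where "\<eta> s = 1 - \<zeta> s" for s
  define \<eta>' where "\<eta>' s = 0 - \<zeta>' s" for s
  define m where "m s = 1 - bump s0 (\<delta> / 4) s" for s
  define m' where "m' s = 0 - bump' s0 (\<delta> / 4) s" for s
  define J where "J = {s. \<delta> / 2 \<le> \<bar>s - s0\<bar> \<and> \<bar>s - s0\<bar> \<le> 3/4 * \<delta>}"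
  have d2: "\<delta> / 2 > 0" "\<delta> / 4 > 0" using \<delta> by auto
  obtain C where "C > 0" "\<And>s. norm (bump' s0 (\<delta> / 2) s) \<le> C" by (rule bump'_bounded[OF d2(1)]) (rule that)
  then have C: "C > 0" "\<And>s. norm (\<zeta>' s) \<le> C" by (auto simp: \<zeta>'_def)
  obtain Cm where Cm: "Cm > 0" "\<And>s. norm (bump' s0 (\<delta> / 4) s) \<le> Cm" by (rule bump'_bounded[OF d2(2)]) (rule that)
  have cz: "C1_grad \<zeta> \<zeta>'" unfolding \<zeta>_def \<zeta>'_def by (rule bump_C1)
  have c\<eta>: "C1_grad \<eta> \<eta>'" unfolding \<eta>_def[abs_def] \<eta>'_def[abs_def] by (rule C1_grad_diff[OF C1_grad_const cz])
  have cm: "C1_grad m m'" unfolding m_def[abs_def] m'_def[abs_def] by (rule C1_grad_diff[OF C1_grad_const bump_C1])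
  note dz = C1_grad_real_deriv[OF cz] C1_gradD(1)[OF cz]
  note d\<eta> = C1_grad_real_deriv[OF c\<eta>] C1_gradD(1)[OF c\<eta>]
  note dm = C1_grad_real_deriv[OF cm] C1_gradD(1)[OF cm]
  have z01: "0 \<le> \<zeta> s" "\<zeta> s \<le> 1" for s unfolding \<zeta>_def by (rule bump_bounds)+
  have b\<eta>: "\<bar>\<eta> s\<bar> \<le> 1" for s using z01[of s] by (simp add: \<eta>_def)
  have b\<eta>': "\<bar>\<eta>' s\<bar> \<le> C" for s using C(2)[of s] by (simp add: \<eta>'_def)
  have bm: "\<bar>m s\<bar> \<le> 1" for s using bump_bounds[of s0 "\<delta>/4" s] by (simp add: m_def)
  have bm': "\<bar>m' s\<bar> \<le> Cm" for s using Cm(2)[of s] by (simp add: m'_def)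
  have Jc: "compact J"
  proof -
    have "J = cball s0 (3/4 * \<delta>) - ball s0 (\<delta> / 2)" by (auto simp: J_def dist_real_def abs_minus_commute)
    then show ?thesis by (simp add: compact_diff)
  qed
  have Jm: "m s = 1" if "s \<in> J" for s
  proof -
    have "3/2 * (\<delta> / 4) \<le> norm (s - s0)" using that \<delta>(1) by (simp add: J_def)
    from bump_eq_0(1)[OF d2(2) this] show ?thesis by (simp add: m_def)
  qed
  have in1: "\<zeta> s = 1" "\<zeta>' s = 0" if "\<bar>s - s0\<bar> \<le> \<delta> / 2" for s
    using bump_eq_1[OF d2(1), of s s0] that by (simp_all add: \<zeta>_def \<zeta>'_def)
  have out0: "\<zeta> s = 0" "\<zeta>' s = 0" if "3/4 * \<delta> \<le> \<bar>s - s0\<bar>" for s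
    using bump_eq_0[OF d2(1), of s s0] that by (simp_all add: \<zeta>_def \<zeta>'_def)
  have offJ: "\<zeta>' s = 0" if "s \<notin> J" for s
    using that in1(2)[of s] out0(2)[of s] unfolding J_def by (metis (mono_tags, lifting) linear mem_Collect_eq)
  have m0: "m s = 0" if "\<bar>s - s0\<bar> \<le> \<delta> / 4" for s
    using bump_eq_1(1)[OF d2(2), of s s0] that by (simp add: m_def)
  define K where "K = 4 * B * C\<^sup>2 / t"
  have K: "K \<ge> 0" using B t by (simp add: K_def)
  \<comment> \<open>The first bound makes the energy outside at most \<open>ellip / 8\<close> times
    \<open>H\<^sup>2\<close>, the second keeps the term with the derivative of \<zeta> in the
    gradient of the cut-off below \<open>H\<close>.\<close>
  define \<epsilon> where "\<epsilon> = min (ellip / (8 * (K + 1))) (1 / C\<^sup>2)"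
  have \<epsilon>: "\<epsilon> > 0" using ellip_pos K C(1) by (simp add: \<epsilon>_def)
  have \<epsilon>1: "K * \<epsilon> \<le> ellip / 8"
  proof -
    have "K * \<epsilon> \<le> (K + 1) * (ellip / (8 * (K + 1)))"
      using K \<epsilon> by (intro mult_mono) (auto simp: \<epsilon>_def)
    also have "\<dots> = ellip / 8" using K by (simp add: field_simps)
    finally show ?thesis .
  qed
  have \<epsilon>2: "C\<^sup>2 * \<epsilon> \<le> 1"
  proof -
    have "C\<^sup>2 * \<epsilon> \<le> C\<^sup>2 * (1 / C\<^sup>2)" by (intro mult_left_mono) (auto simp: \<epsilon>_def)
    then show ?thesis using C(1) by simp
  qed
  obtain \<Q> where Q: "finite \<Q>" "\<And>Q. Q \<in> \<Q> \<Longrightarrow> Q \<in> sets borel \<and> bounded Q \<and> Q \<subseteq> \<Omega>"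
    "\<And>u g f. tr u g f \<Longrightarrow> (\<And>x. m (snd x) * f x = 0) \<Longrightarrow> \<forall>Q\<in>\<Q>. (LINT x|vol Q. u x) = 0 \<Longrightarrow>
       (L2_norm (vol (\<omega> \<times> J)) u)\<^sup>2 \<le> \<epsilon> * (L2_norm (vol \<Omega>) g)\<^sup>2"
  proof (rule smallness[OF dm bm bm' Jc Jm \<epsilon>])
    fix \<Q>
    assume 1: "finite \<Q>" and 2: "\<And>Q. Q \<in> \<Q> \<Longrightarrow> Q \<in> sets borel \<and> bounded Q \<and> Q \<subseteq> \<Omega>"
      and 3: "\<And>u g f. tr u g f \<Longrightarrow> (\<And>x. m (snd x) * f x = 0) \<Longrightarrow> \<forall>Q\<in>\<Q>. (LINT x|vol Q. u x) = 0 \<Longrightarrow>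
       (L2_norm (vol (\<omega> \<times> J)) u)\<^sup>2 \<le> \<epsilon> * (L2_norm (vol \<Omega>) g)\<^sup>2"
    show thesis by (rule that[OF 1 2 3])
  qed
  obtain P P' s u h where P: "P \<in> C1c UNIV" "C1_grad P P'" "P s \<noteq> 0" "\<And>s. \<delta> / 4 \<le> \<bar>s - s0\<bar> \<Longrightarrow> P s = 0"
    and u: "weak_sol \<alpha>1 u h (\<lambda>x. bump p \<rho> (fst x) * P (snd x))" and mean: "\<forall>Q\<in>\<Q>. (LINT x|vol Q. u x) = 0"
    by (rule concentrated_solution[where ?s0.0 = s0, OF a1 p \<rho> d2(2) Q(1,2)]) (assumption, rule that)
  define f where "f x = bump p \<rho> (fst x) * P (snd x)" for x
  have ws: "weak_sol \<alpha>1 u h f" using u by (simp add: f_def[abs_def])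
  have tu: "tr u h f" using ws by (simp add: weak_sol_def)
  have f\<eta>: "\<eta> (snd x) * f x = 0" for x
    using in1(1)[of "snd x"] P(4)[of "snd x"] \<delta>(1) by (cases "\<bar>snd x - s0\<bar> \<le> \<delta> / 4") (auto simp: \<eta>_def f_def)
  have fm: "m (snd x) * f x = 0" for x
    using m0[of "snd x"] P(4)[of "snd x"] by (cases "\<bar>snd x - s0\<bar> \<le> \<delta> / 4") (auto simp: f_def)
  have f\<zeta>: "\<zeta> (snd x) * f x = f x" for x using f\<eta>[of x] by (simp add: \<eta>_def algebra_simps)
  define H where "H = L2_norm (vol \<Omega>) h"
  have H0: "H \<ge> 0" by (simp add: H_def)
  have small: "(L2_norm (vol (\<omega> \<times> J)) u)\<^sup>2 \<le> \<epsilon> * H\<^sup>2"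
    unfolding H_def by (rule Q(3)[OF tu fm mean])
  have hL: "h \<in> L2 (vol \<Omega>)" and uL: "u \<in> L2 (vol \<Omega>)" using trD[OF tu] by auto
  have \<eta>'J: "\<eta>' s = 0" if "s \<notin> J" for s using offJ[OF that] by (simp add: \<eta>'_def)
  have off: "Bf (\<lambda>s. (\<eta> s)\<^sup>2) h h \<le> ellip / 8 * H\<^sup>2"
  proof -
    have "Bf (\<lambda>s. (\<eta> s)\<^sup>2) h h \<le> K * (L2_norm (vol (\<omega> \<times> J)) u)\<^sup>2"
      unfolding K_def by (rule caccioppoli[OF a1 ws d\<eta> b\<eta> b\<eta>' f\<eta> Jc \<eta>'J])
    also have "\<dots> \<le> K * (\<epsilon> * H\<^sup>2)" by (rule mult_left_mono[OF small K])
    also have "\<dots> \<le> ellip / 8 * H\<^sup>2" unfolding mult.assoc[symmetric] by (rule mult_right_mono[OF \<epsilon>1]) simp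
    finally show ?thesis .
  qed
  define k where "k x = \<zeta> (snd x) *\<^sub>R h x + u x *\<^sub>R (0, \<zeta>' (snd x))" for x
  have b\<zeta>: "\<bar>\<zeta> s\<bar> \<le> 1 + C" "\<bar>\<zeta>' s\<bar> \<le> 1 + C" for s using z01[of s] C(2)[of s] C(1) by auto
  have tk: "tr (\<lambda>x. \<zeta> (snd x) * u x) k f"
    using tr_mult[OF tu dz b\<zeta>] by (simp add: f\<zeta> k_def[abs_def])
  have OB: "\<Omega> \<in> sets borel" using open_waveguide by simp
  have OJ: "\<omega> \<times> J \<in> sets (borel :: ((real^2) \<times> real) measure)" "\<omega> \<times> J \<subseteq> \<Omega>"
    using borel_compact[OF Jc] open_om unfolding borel_prod[symmetric] by (auto intro!: pair_measureI simp: waveguide_def)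
  have kH: "L2_norm (vol \<Omega>) k \<le> 2 * H"
  proof -
    have [measurable]: "h \<in> borel_measurable (vol \<Omega>)" "u \<in> borel_measurable (vol \<Omega>)" "k \<in> borel_measurable (vol \<Omega>)"
      using hL uL trD(2)[OF tk] by (auto simp: L2_def)
    have zm: "(\<lambda>x. \<zeta> (snd x)) \<in> borel_measurable (vol \<Omega>)"
      by (intro measurable_restrict_space1) (use borel_measurable_continuous_onI[OF C1_gradD(3)[OF C1_grad_snd[OF cz]]] in simp)
    note [measurable] = zm
    have 1: "(\<lambda>x. \<zeta> (snd x) *\<^sub>R h x) \<in> L2 (vol \<Omega>)" "L2_norm (vol \<Omega>) (\<lambda>x. \<zeta> (snd x) *\<^sub>R h x) \<le> H"
      unfolding H_def using z01 by (auto intro!: L2_norm_mono_AE[OF hL] AE_I2 simp: mult_left_le_one_le)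
    \<comment> \<open>The part of the gradient that contains the derivative of \<zeta>; it lives on
      \<open>J\<close>, where \<open>u\<close> is small.\<close>
    define q where "q x = k x - \<zeta> (snd x) *\<^sub>R h x" for x
    have qL: "q \<in> L2 (vol \<Omega>)" unfolding q_def by (rule L2_diff[OF trD(2)[OF tk] 1(1)])
    have qb: "norm (q x) \<le> C * norm (u x) \<and> (x \<notin> \<omega> \<times> J \<longrightarrow> x \<in> \<Omega> \<longrightarrow> q x = 0)" for x
    proof -
      have q: "q x = u x *\<^sub>R (0, \<zeta>' (snd x))" by (simp add: q_def k_def)
      have "norm (q x) = \<bar>u x\<bar> * \<bar>\<zeta>' (snd x)\<bar>" unfolding q by (simp add: norm_Pair abs_mult)
      also have "\<dots> \<le> \<bar>u x\<bar> * C" using C(2)[of "snd x"] by (intro mult_left_mono) auto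
      finally show ?thesis using offJ[of "snd x"]
        by (cases "snd x \<in> J") (auto simp: q waveguide_def mult.commute zero_prod_def)
    qed
    have "ennreal ((L2_norm (vol \<Omega>) q)\<^sup>2) = (\<integral>\<^sup>+x. ennreal ((norm (q x))\<^sup>2) * indicator \<Omega> x \<partial>lborel)"
      by (rule L2_norm_sq_vol(1)[OF qL order_refl OB])
    also have "\<dots> \<le> (\<integral>\<^sup>+x. ennreal (C\<^sup>2) * (ennreal ((norm (u x))\<^sup>2) * indicator (\<omega> \<times> J) x) \<partial>lborel)"
    proof (rule nn_integral_mono)
      fix x
      show "ennreal ((norm (q x))\<^sup>2) * indicator \<Omega> x \<le> ennreal (C\<^sup>2) * (ennreal ((norm (u x))\<^sup>2) * indicator (\<omega> \<times> J) x)"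
      proof (cases "x \<in> \<omega> \<times> J")
        case True
        have "(norm (q x))\<^sup>2 \<le> (C * norm (u x))\<^sup>2" using qb[of x] by (intro power_mono) auto
        then show ?thesis using True OJ(2) by (auto simp: power_mult_distrib ennreal_mult'[symmetric] ennreal_leI)
      next
        case False
        then show ?thesis using qb[of x] by (auto simp: indicator_def)
      qed
    qed
    also have "\<dots> = ennreal (C\<^sup>2) * ennreal ((L2_norm (vol (\<omega> \<times> J)) u)\<^sup>2)"
      unfolding L2_norm_sq_vol(1)[OF uL OJ(2,1)] by (rule nn_integral_cmult) (rule L2_norm_sq_vol(2)[OF uL OJ(2,1)])
    also have "\<dots> = ennreal (C\<^sup>2 * (L2_norm (vol (\<omega> \<times> J)) u)\<^sup>2)" by (simp add: ennreal_mult')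
    finally have "(L2_norm (vol \<Omega>) q)\<^sup>2 \<le> C\<^sup>2 * (L2_norm (vol (\<omega> \<times> J)) u)\<^sup>2" by (subst (asm) ennreal_le_iff) auto
    also have "\<dots> \<le> C\<^sup>2 * (\<epsilon> * H\<^sup>2)" by (rule mult_left_mono[OF small]) simp
    also have "\<dots> \<le> 1 * H\<^sup>2" unfolding mult.assoc[symmetric] by (rule mult_right_mono[OF \<epsilon>2]) simp
    also have "\<dots> = H\<^sup>2" by (rule mult_1_left)
    finally have 2: "L2_norm (vol \<Omega>) q \<le> H" by (rule power2_le_imp_le[OF _ H0])
    have "L2_norm (vol \<Omega>) k = L2_norm (vol \<Omega>) (\<lambda>x. \<zeta> (snd x) *\<^sub>R h x + q x)" by (simp add: q_def)
    also have "\<dots> \<le> L2_norm (vol \<Omega>) (\<lambda>x. \<zeta> (snd x) *\<^sub>R h x) + L2_norm (vol \<Omega>) q"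
      by (rule L2_norm_triangle[OF 1(1) qL])
    finally show ?thesis using 1(2) 2 by simp
  qed
  have zu: "L2_norm (vol \<Omega>) (\<lambda>x. \<zeta> (snd x) * u x) \<le> 4 * H"
  proof -
    have "L2_norm (vol \<Omega>) (\<lambda>x. \<zeta> (snd x) * u x) \<le> 2 * (3/4 * \<delta>) * L2_norm (vol \<Omega>) k"
      unfolding k_def[abs_def] by (rule axial_poincare[OF tu dz b\<zeta> out0(1)]) (use \<delta>(1) in auto)
    \<comment> \<open>Here \<open>\<delta> \<le> 1\<close> makes the axial Poincare constant
      absolute.\<close>
    also have "\<dots> \<le> 2 * (2 * H)" using \<delta> H0 by (intro mult_mono kH) auto
    finally show ?thesis by simp
  qed
  \<comment> \<open>Both norms of the cut-off solution are bounded by multiples of \<open>H\<close>,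
    so \<open>H = 0\<close> would contradict the nonzero datum.\<close>
  have Hpos: "H > 0"
  proof (rule ccontr)
    assume "\<not> H > 0"
    then have "H = 0" using H0 by simp
    then have "L2_norm (vol \<Omega>) (\<lambda>x. \<zeta> (snd x) * u x) = 0" "L2_norm (vol \<Omega>) k = 0"
      using zu kH by (simp_all add: antisym)
    then show False using nontrivial_trace[OF p \<rho> P(1,2,3) tk[unfolded f_def[abs_def]]] by blast
  qed
  \<comment> \<open>Normalises the cut-off solution: its norm is at most \<open>4 * H\<close>, that
    of its gradient at most \<open>2 * H\<close>, and 4^2 + 2^2 = 20.\<close>
  define \<kappa> where "\<kappa> = 1 / (sqrt 20 * H)"
  have \<kappa>: "\<kappa> > 0" using Hpos by (simp add: \<kappa>_def)
  have \<kappa>2: "\<kappa>\<^sup>2 * H\<^sup>2 = 1 / 20" using Hpos by (simp add: \<kappa>_def power_divide power_mult_distrib)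
  define P1 where "P1 s = \<kappa> * P s" for s
  define P1' where "P1' s = \<kappa> *\<^sub>R P' s" for s
  have P1: "P1 \<in> C1c UNIV" "C1_grad P1 P1'"
    unfolding P1_def[abs_def] P1'_def[abs_def] by (rule C1c_scale[OF P(1)], rule C1_grad_scale[OF P(2)])
  define f1 where "f1 x = bump p \<rho> (fst x) * P1 (snd x)" for x
  have f1: "f1 = (\<lambda>x. \<kappa> * f x)" by (auto simp: f1_def f_def P1_def)
  have f1H: "f1 \<in> Htilde \<omega>" unfolding f1_def[abs_def] by (rule C1c_Htilde[OF datum_C1c(1)[OF \<rho> P1]])
  have norm1: "Htilde_norm \<omega> f1 \<le> 1"
  proof -
    have "Htilde_norm \<omega> f1 \<le> sqrt ((L2_norm (vol \<Omega>) (\<lambda>x. \<kappa> * (\<zeta> (snd x) * u x)))\<^sup>2 + (L2_norm (vol \<Omega>) (\<lambda>x. \<kappa> *\<^sub>R k x))\<^sup>2)"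
      unfolding f1 by (rule Htilde_norm_le[OF tr_scale[OF tk]])
    also have "L2_norm (vol \<Omega>) (\<lambda>x. \<kappa> * (\<zeta> (snd x) * u x)) = \<kappa> * L2_norm (vol \<Omega>) (\<lambda>x. \<zeta> (snd x) * u x)"
      using L2_scaleR(2)[OF trD(1)[OF tk], of \<kappa>] \<kappa> by simp
    also have "L2_norm (vol \<Omega>) (\<lambda>x. \<kappa> *\<^sub>R k x) = \<kappa> * L2_norm (vol \<Omega>) k"
      using L2_scaleR(2)[OF trD(2)[OF tk], of \<kappa>] \<kappa> by simp
    also have "sqrt ((\<kappa> * L2_norm (vol \<Omega>) (\<lambda>x. \<zeta> (snd x) * u x))\<^sup>2 + (\<kappa> * L2_norm (vol \<Omega>) k)\<^sup>2) \<le>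
        sqrt ((\<kappa> * (4 * H))\<^sup>2 + (\<kappa> * (2 * H))\<^sup>2)"
      using \<kappa> by (intro real_sqrt_le_mono add_mono power_mono mult_left_mono zu kH) auto
    also have "(\<kappa> * (4 * H))\<^sup>2 + (\<kappa> * (2 * H))\<^sup>2 = 20 * (\<kappa>\<^sup>2 * H\<^sup>2)" by (simp add: power_mult_distrib)
    also have "\<dots> = 1" unfolding \<kappa>2 by simp
    finally show ?thesis by simp
  qed
  have w1: "weak_sol \<alpha>1 (\<lambda>x. \<kappa> * u x) (\<lambda>x. \<kappa> *\<^sub>R h x) f1" unfolding f1 by (rule weak_sol_scale[OF ws])
  have t1: "tr (\<lambda>x. \<kappa> * u x) (\<lambda>x. \<kappa> *\<^sub>R h x) f1" using w1 by (simp add: weak_sol_def)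
  have D1: "DN \<omega> \<alpha>1 f1 f1 = \<kappa>\<^sup>2 * Bf \<alpha>1 h h"
    using DN_energy(1)[OF a1 f1H w1] by (simp add: Bf_scale Bf_scale_right power2_eq_square)
  have D2: "DN \<omega> \<alpha>2 f1 f1 \<le> \<kappa>\<^sup>2 * Bf \<alpha>2 h h"
    using DN_energy(2)[OF a2 f1H t1] by (simp add: Bf_scale Bf_scale_right power2_eq_square)
  note coefs = coef_abs[OF a1] coef_abs[OF a2]
  have am: "\<alpha>1 \<in> borel_measurable borel" "\<alpha>2 \<in> borel_measurable borel" using a1 a2 by (auto simp: coef_def)
  have \<eta>m: "(\<lambda>s. (\<eta> s)\<^sup>2) \<in> borel_measurable borel"
    by (intro borel_measurable_continuous_onI continuous_intros C1_gradD(3)[OF c\<eta>])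
  have \<eta>b: "AE s in lborel. \<bar>(\<eta> s)\<^sup>2\<bar> \<le> 1" using b\<eta> by (simp add: abs_square_le_1)
  have one: "AE s in lborel. \<bar>1::real\<bar> \<le> 1" by simp
  \<comment> \<open>A pointwise lower bound for the difference of the coefficients: near
    \<open>s0\<close> it follows from the gap \<Delta>/2, and further out \<eta> is 1 and the
    left-hand coefficient is -\<Delta>.\<close>
  have "\<Delta> / 2 * Bf (\<lambda>s. 1) h h + (- 3/2 * \<Delta>) * Bf (\<lambda>s. (\<eta> s)\<^sup>2) h h = Bf (\<lambda>s. \<Delta> / 2 * 1 + (- 3/2 * \<Delta>) * (\<eta> s)\<^sup>2) h h"
    by (rule Bf_coef_lin[OF _ one _ \<eta>m \<eta>b _ hL, symmetric]) auto
  also have "\<dots> \<le> Bf (\<lambda>s. 1 * \<alpha>1 s + (-1) * \<alpha>2 s) h h"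
  proof (rule Bf_coef_mono[OF _ _ _ _ _ _ _ hL])
    show "(\<lambda>s. \<Delta> / 2 * 1 + (- 3/2 * \<Delta>) * (\<eta> s)\<^sup>2) \<in> borel_measurable borel" using \<eta>m by measurable
    show "(\<lambda>s. 1 * \<alpha>1 s + (-1) * \<alpha>2 s) \<in> borel_measurable borel" using am by measurable
    show "AE s in lborel. \<bar>\<Delta> / 2 * 1 + (- 3/2 * \<Delta>) * (\<eta> s)\<^sup>2\<bar> \<le> 2 * \<Delta>"
    proof (rule AE_I2)
      fix s
      have "0 \<le> (\<eta> s)\<^sup>2" "(\<eta> s)\<^sup>2 \<le> 1" using b\<eta>[of s] by (auto simp: abs_square_le_1)
      then have q: "0 \<le> \<Delta> * (\<eta> s)\<^sup>2" "\<Delta> * (\<eta> s)\<^sup>2 \<le> \<Delta> * 1"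
        using \<Delta>(1) by (simp, intro mult_left_mono) auto
      have "\<Delta> / 2 * 1 + (- 3/2 * \<Delta>) * (\<eta> s)\<^sup>2 = \<Delta> / 2 - 3/2 * (\<Delta> * (\<eta> s)\<^sup>2)" by simp
      then show "\<bar>\<Delta> / 2 * 1 + (- 3/2 * \<Delta>) * (\<eta> s)\<^sup>2\<bar> \<le> 2 * \<Delta>" using \<Delta>(1) q by linarith
    qed
    show "AE s in lborel. \<bar>1 * \<alpha>1 s + (-1) * \<alpha>2 s\<bar> \<le> \<Delta>" using \<Delta>(2) by simp
    show "AE s in lborel. \<Delta> / 2 * 1 + (- 3/2 * \<Delta>) * (\<eta> s)\<^sup>2 \<le> 1 * \<alpha>1 s + (-1) * \<alpha>2 s"
      using \<Delta>(2) \<delta>(3)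
    proof eventually_elim
      case (elim s)
      show ?case
      proof (cases "\<bar>s - s0\<bar> < \<delta>")
        case True
        have "0 \<le> \<Delta> * (\<eta> s)\<^sup>2" using \<Delta>(1) by simp
        then show ?thesis using elim(2) True by simp
      next
        case False
        then have "\<eta> s = 1" using out0(1)[of s] \<delta>(1) by (simp add: \<eta>_def)
        then show ?thesis using elim(1) by (simp add: abs_le_iff)
      qed
    qed
  qed (use \<Delta>(1) in auto)
  also have "\<dots> = 1 * Bf \<alpha>1 h h + (-1) * Bf \<alpha>2 h h"
    by (rule Bf_coef_lin[OF am(1) coefs(1) B am(2) coefs(2) B hL])
  finally have lower: "\<Delta> / 2 * Bf (\<lambda>s. 1) h h - 3/2 * \<Delta> * Bf (\<lambda>s. (\<eta> s)\<^sup>2) h h \<le> Bf \<alpha>1 h h - Bf \<alpha>2 h h" by simp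
  have "coef (\<lambda>s. 1) 1 1" by (simp add: coef_def)
  from Bf_coercive[OF this hL] have q1: "ellip * H\<^sup>2 \<le> Bf (\<lambda>s. 1) h h" by (simp add: H_def)
  have "\<Delta> / 2 * (ellip * H\<^sup>2) - 3/2 * \<Delta> * (ellip / 8 * H\<^sup>2) \<le> Bf \<alpha>1 h h - Bf \<alpha>2 h h"
  proof -
    have "\<Delta> / 2 * (ellip * H\<^sup>2) \<le> \<Delta> / 2 * Bf (\<lambda>s. 1) h h" using \<Delta>(1) q1 by (intro mult_left_mono) auto
    moreover have "3/2 * \<Delta> * Bf (\<lambda>s. (\<eta> s)\<^sup>2) h h \<le> 3/2 * \<Delta> * (ellip / 8 * H\<^sup>2)" using \<Delta>(1) off by (intro mult_left_mono) auto
    ultimately show ?thesis using lower by linarith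
  qed
  moreover have "0 \<le> \<Delta> * (ellip * H\<^sup>2)" using \<Delta>(1) ellip_pos by simp
  \<comment> \<open>Since 1/2 - 3/16 = 5/16 is at least 1/4; together with the factor 1/20 of the
    normalisation this gives 1/80.\<close>
  ultimately have "\<Delta> / 4 * ellip * H\<^sup>2 \<le> Bf \<alpha>1 h h - Bf \<alpha>2 h h" by simp
  then have "\<kappa>\<^sup>2 * (\<Delta> / 4 * ellip * H\<^sup>2) \<le> \<kappa>\<^sup>2 * (Bf \<alpha>1 h h - Bf \<alpha>2 h h)" by (intro mult_left_mono) auto
  also have "\<kappa>\<^sup>2 * (\<Delta> / 4 * ellip * H\<^sup>2) = (\<kappa>\<^sup>2 * H\<^sup>2) * (\<Delta> / 4 * ellip)" by (simp add: mult_ac)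
  also have "\<dots> = ellip / 80 * \<Delta>" unfolding \<kappa>2 by simp
  finally have "ellip / 80 * \<Delta> \<le> DN \<omega> \<alpha>1 f1 f1 - DN \<omega> \<alpha>2 f1 f1" using D1 D2 by (simp add: right_diff_distrib)
  moreover have "P1 s = 0" if "\<delta> \<le> \<bar>s - s0\<bar>" for s using P(4)[of s] that \<delta>(1) by (simp add: P1_def)
  ultimately show ?thesis using that[OF P1] norm1 by (simp add: f1_def[abs_def])
qed

end

section \<open>From a single datum to the operator norm\<close>

lemma W1infD:
  assumes "\<alpha> \<in> W1inf"
  obtains B \<beta> where "\<alpha> \<in> borel_measurable borel" "0 \<le> B" "AE s in lborel. \<bar>\<alpha> s\<bar> \<le> B" "has_weak_grad UNIV \<alpha> \<beta>"
    "AE s in lborel. \<bar>\<beta> s\<bar> \<le> B"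
proof -
  from assms obtain \<beta> where b: "\<alpha> \<in> borel_measurable borel" "Linf_norm \<alpha> < \<infinity>" "has_weak_grad UNIV \<alpha> \<beta>" "Linf_norm \<beta> < \<infinity>"
    by (auto simp: W1inf_def)
  have bd: "\<exists>B\<ge>0. AE s in lborel. \<bar>f s\<bar> \<le> B" if fin: "Linf_norm f < \<infinity>" for f
  proof -
    obtain B where B: "Linf_norm f \<le> ereal B"
      using fin by (cases "Linf_norm f") auto
    have "AE s in lborel. ereal \<bar>f s\<bar> \<le> Linf_norm f" unfolding Linf_norm_def by (rule esssup_AE)
    then have "AE s in lborel. \<bar>f s\<bar> \<le> max B 0"
    proof eventually_elim
      case (elim s)
      then have "ereal \<bar>f s\<bar> \<le> ereal B" using B order_trans by blast
      then show ?case by simp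
    qed
    then show ?thesis by (intro exI[of _ "max B 0"]) auto
  qed
  obtain B1 where B1: "B1 \<ge> 0" "AE s in lborel. \<bar>\<alpha> s\<bar> \<le> B1" using bd[OF b(2)] by blast
  obtain B2 where B2: "B2 \<ge> 0" "AE s in lborel. \<bar>\<beta> s\<bar> \<le> B2" using bd[OF b(4)] by blast
  have "AE s in lborel. \<bar>\<alpha> s\<bar> \<le> max B1 B2" using B1(2) by eventually_elim auto
  moreover have "AE s in lborel. \<bar>\<beta> s\<bar> \<le> max B1 B2" using B2(2) by eventually_elim auto
  moreover have "0 \<le> max B1 B2" using B1(1) by simp
  ultimately show ?thesis using that[OF b(1) _ _ b(3)] by blast
qed

context lipschitz_domain
begin

text \<open>A supremum over the empty set would be minus infinity in the extended reals; the zero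
  function is admissible both as datum and as test function.\<close>

lemma op_norm_nonneg: "0 \<le> op_norm \<omega> (Htilde_supp \<omega> \<Gamma>) T"
proof -
  have zC: "(\<lambda>x. 0) \<in> C1c UNIV" by (rule C1c_I[OF C1_grad_const, of "{}"]) auto
  have zH: "(\<lambda>x. 0) \<in> Htilde \<omega>" by (rule C1c_Htilde[OF zC])
  have "bsupp \<omega> (\<lambda>x. 0) \<subseteq> {}" by (rule bsupp_subset) auto
  then have zV: "(\<lambda>x. 0) \<in> Htilde_supp \<omega> \<Gamma>" using zH by (auto simp: Htilde_supp_def)
  have n: "Htilde_norm \<omega> (\<lambda>x. 0) \<le> 1" using Htilde_norm_le[OF tr_zero] by simp
  have "0 \<le> ereal \<bar>T (\<lambda>x. 0) (\<lambda>x. 0)\<bar>" by simp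
  also have "\<dots> \<le> dual_norm \<omega> (T (\<lambda>x. 0))" unfolding dual_norm_def by (rule SUP_upper) (use zH n in simp)
  also have "\<dots> \<le> op_norm \<omega> (Htilde_supp \<omega> \<Gamma>) T" unfolding op_norm_def by (rule SUP_upper) (use zV n in simp)
  finally show ?thesis .
qed

text \<open>Testing on the diagonal: the datum has norm at most one and is itself an admissible test
  function.\<close>

lemma op_norm_ge:
  assumes "f \<in> Htilde_supp \<omega> \<Gamma>" "Htilde_norm \<omega> f \<le> 1" "c \<le> \<bar>T f f\<bar>"
  shows "ereal c \<le> op_norm \<omega> (Htilde_supp \<omega> \<Gamma>) T"
proof -
  have "ereal c \<le> ereal \<bar>T f f\<bar>" using assms(3) by simp
  also have "\<dots> \<le> dual_norm \<omega> (T f)" unfolding dual_norm_def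
    by (rule SUP_upper) (use assms in \<open>simp add: Htilde_supp_def\<close>)
  also have "\<dots> \<le> op_norm \<omega> (Htilde_supp \<omega> \<Gamma>) T" unfolding op_norm_def by (rule SUP_upper) (use assms in simp)
  finally show ?thesis .
qed

lemma stability:
  assumes L: "L > 0" and \<gamma>: "openin (top_of_set (frontier \<omega>)) \<gamma>" "\<gamma> \<noteq> {}"
    and W: "\<alpha>1 \<in> W1inf" "\<alpha>2 \<in> W1inf" and eq: "AE s in lborel. \<bar>s\<bar> > L \<longrightarrow> \<alpha>1 s = \<alpha>2 s"
    and t: "0 < t" "AE s in lborel. \<alpha>1 s \<ge> t" "AE s in lborel. \<alpha>2 s \<ge> t"
  shows "Linf_norm (\<lambda>s. \<alpha>1 s - \<alpha>2 s) \<le> ereal (80 / ellip) * op_norm \<omega> (Htilde_supp \<omega> (\<gamma> \<times> {-2*L<..<2*L}))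
     (\<lambda>f g. DN \<omega> \<alpha>1 f g - DN \<omega> \<alpha>2 f g)" (is "?N \<le> ereal ?C * ?op")
\<comment> \<open>The construction of a datum needs a genuine gap between the coefficients;
  otherwise the right-hand side is nonnegative.\<close>
proof (cases "?N \<le> 0")
  case True
  have "0 \<le> ereal ?C * ?op" using ellip_pos by (intro ereal_0_le_mult op_norm_nonneg) auto
  then show ?thesis using True by (rule order_trans[rotated])
next
  case False
  obtain B1 \<beta>1 where b1: "\<alpha>1 \<in> borel_measurable borel" "0 \<le> B1" "AE s in lborel. \<bar>\<alpha>1 s\<bar> \<le> B1" "has_weak_grad UNIV \<alpha>1 \<beta>1"
    "AE s in lborel. \<bar>\<beta>1 s\<bar> \<le> B1" by (rule W1infD[OF W(1)]) (rule that)
  obtain B2 \<beta>2 where b2: "\<alpha>2 \<in> borel_measurable borel" "0 \<le> B2" "AE s in lborel. \<bar>\<alpha>2 s\<bar> \<le> B2" "has_weak_grad UNIV \<alpha>2 \<beta>2"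
    "AE s in lborel. \<bar>\<beta>2 s\<bar> \<le> B2" by (rule W1infD[OF W(2)]) (rule that)
  define B where "B = B1 + B2"
  have B: "B \<ge> 0" using b1 b2 by (simp add: B_def)
  have "AE s in lborel. \<alpha>1 s \<le> B" using b1(3) by eventually_elim (use b2(2) in \<open>simp add: B_def\<close>)
  then have a1: "coef \<alpha>1 t B" using b1(1) t B by (simp add: coef_def)
  have "AE s in lborel. \<alpha>2 s \<le> B" using b2(3) by eventually_elim (use b1(2) in \<open>simp add: B_def\<close>)
  then have a2: "coef \<alpha>2 t B" using b2(1) t B by (simp add: coef_def)
  define D where "D s = \<alpha>1 s - \<alpha>2 s" for s
  have Dm: "(\<lambda>s. ereal \<bar>D s\<bar>) \<in> borel_measurable lborel" unfolding D_def using b1(1) b2(1) by measurable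
  have "AE s in lborel. ereal \<bar>D s\<bar> \<le> ereal B" using b1(3) b2(3) by eventually_elim (simp add: D_def B_def)
  from esssup_I[OF Dm this] have NB: "?N \<le> ereal B" by (simp add: Linf_norm_def D_def[abs_def])
  obtain \<Delta> where \<Delta>: "?N = ereal \<Delta>" "\<Delta> > 0" using NB False by (cases ?N) auto
  have "AE s in lborel. ereal \<bar>D s\<bar> \<le> ?N" unfolding Linf_norm_def D_def by (rule esssup_AE)
  then have D\<Delta>: "AE s in lborel. \<bar>D s\<bar> \<le> \<Delta>" unfolding \<Delta>(1) by simp
  have wD: "has_weak_grad UNIV D (\<lambda>s. \<beta>1 s - \<beta>2 s)"
    unfolding D_def[abs_def] by (rule has_weak_grad_diff[OF open_UNIV b1(4) b2(4)])
  have "AE s in lborel. \<bar>\<beta>1 s - \<beta>2 s\<bar> \<le> B" using b1(5) b2(5) by eventually_elim (simp add: B_def)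
  moreover have "-2*L < 2*L" using L by simp
  ultimately obtain v where v: "continuous_on UNIV v" "AE s in lborel. s \<in> {-2*L<..<2*L} \<longrightarrow> D s = v s"
    using weak_derivative_bounded_continuous[OF _ wD _ B, of "-2*L" "2*L"] by blast
  \<comment> \<open>The threshold 3/4 leaves a loss of 1/4 to the modulus of continuity, so that
    half of \<Delta> survives near \<open>s0\<close>.\<close>
  have nae: "\<not> (AE s in lborel. \<bar>D s\<bar> \<le> 3/4 * \<Delta>)"
  proof
    assume "AE s in lborel. \<bar>D s\<bar> \<le> 3/4 * \<Delta>"
    then have "AE s in lborel. ereal \<bar>D s\<bar> \<le> ereal (3/4 * \<Delta>)" by simp
    from esssup_I[OF Dm this] have "?N \<le> ereal (3/4 * \<Delta>)" by (simp add: Linf_norm_def D_def[abs_def])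
    then show False using \<Delta> by simp
  qed
  have "\<exists>s0. \<bar>s0\<bar> \<le> L \<and> 3/4 * \<Delta> < \<bar>v s0\<bar>"
  proof (rule ccontr)
    assume no: "\<not> (\<exists>s0. \<bar>s0\<bar> \<le> L \<and> 3/4 * \<Delta> < \<bar>v s0\<bar>)"
    have "AE s in lborel. \<bar>D s\<bar> \<le> 3/4 * \<Delta>" using eq v(2)
    proof eventually_elim
      case (elim s)
      show ?case
      proof (cases "\<bar>s\<bar> \<le> L")
        case True
        then have "D s = v s" using elim(2) L by (auto simp: abs_le_iff)
        then show ?thesis using no True by force
      next
        case False
        then show ?thesis using elim(1) \<Delta>(2) by (simp add: D_def)
      qed
    qed
    then show False using nae by blast
  qed
  then obtain s0 where s0: "\<bar>s0\<bar> \<le> L" "3/4 * \<Delta> < \<bar>v s0\<bar>" by blast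
  have "isCont v s0" using v(1) by (simp add: continuous_on_eq_continuous_at)
  then obtain d where d: "d > 0" "\<And>s. \<bar>s - s0\<bar> < d \<Longrightarrow> \<bar>v s - v s0\<bar> < \<Delta> / 4"
    using \<Delta>(2) unfolding continuous_at_eps_delta dist_real_def by (metis zero_less_divide_iff zero_less_numeral)
  \<comment> \<open>Below \<open>d\<close> for continuity, at most 1 for the axial Poincare
    constant, and below \<open>L\<close> so that the datum stays in the interval from -2L to 2L
    although \<open>s0\<close> may be an end point of the interval from -L to L.\<close>
  define \<delta> where "\<delta> = min d (min 1 L) / 2"
  have \<delta>: "\<delta> > 0" "\<delta> \<le> 1" "\<delta> < L" "\<delta> < d" using d(1) L by (auto simp: \<delta>_def min_def)
  obtain p where p: "p \<in> \<gamma>" using \<gamma>(2) by blast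
  obtain O' where O': "open O'" "\<gamma> = frontier \<omega> \<inter> O'" using \<gamma>(1) by (auto simp: openin_open)
  have pf: "p \<in> frontier \<omega>" "p \<in> O'" using p O'(2) by auto
  obtain R where R: "R > 0" "cball p R \<subseteq> O'" using O'(1) pf(2) open_contains_cball by blast
  \<comment> \<open>The bump reaches at most 3/4 of \<open>R\<close>, so on the frontier its support
    lies in \<gamma>.\<close>
  define \<rho> where "\<rho> = R / 2"
  have \<rho>: "\<rho> > 0" "cball p (3/2 * \<rho>) \<subseteq> O'" using R by (auto simp: \<rho>_def intro: order_trans[OF _ R(2)])
  have supp: "(\<lambda>x. bump p \<rho> (fst x) * P (snd x)) \<in> Htilde_supp \<omega> (\<gamma> \<times> {-2*L<..<2*L})"
    if P: "P \<in> C1c UNIV" "C1_grad P P'" "\<And>s. \<delta> \<le> \<bar>s - s0\<bar> \<Longrightarrow> P s = 0" for P P'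
  proof -
    have 1: "(\<lambda>x. bump p \<rho> (fst x) * P (snd x)) \<in> Htilde \<omega>" by (rule C1c_Htilde[OF datum_C1c(1)[OF \<rho>(1) P(1,2)]])
    have 2: "bsupp \<omega> (\<lambda>x. bump p \<rho> (fst x) * P (snd x)) \<subseteq> cball p (3/2 * \<rho>) \<times> cball s0 \<delta>"
    proof (rule bsupp_subset)
      show "closed (cball p (3/2 * \<rho>) \<times> cball s0 \<delta>)" by (intro closed_Times closed_cball)
      fix x assume x: "x \<notin> cball p (3/2 * \<rho>) \<times> cball s0 \<delta>"
      show "bump p \<rho> (fst x) * P (snd x) = 0"
      proof (cases "\<delta> \<le> \<bar>snd x - s0\<bar>")
        case True
        then show ?thesis using P(3) by simp
      next
        case False
        then have "3/2 * \<rho> \<le> norm (fst x - p)"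
          using x by (cases x) (auto simp: dist_norm dist_real_def norm_minus_commute abs_minus_commute)
        from bump_eq_0(1)[OF \<rho>(1) this] show ?thesis by simp
      qed
    qed
    have 3: "bsupp \<omega> (\<lambda>x. bump p \<rho> (fst x) * P (snd x)) \<subseteq> frontier \<omega> \<times> UNIV" by (auto simp: bsupp_def)
    have "s \<in> {-2*L<..<2*L}" if "s \<in> cball s0 \<delta>" for s
    proof -
      have "\<bar>s - s0\<bar> \<le> \<delta>" using that by (simp add: dist_real_def abs_minus_commute)
      then show ?thesis using s0(1) \<delta>(3) by auto
    qed
    then have "bsupp \<omega> (\<lambda>x. bump p \<rho> (fst x) * P (snd x)) \<subseteq> \<gamma> \<times> {-2*L<..<2*L}"
      using 2 3 \<rho>(2) O'(2) by blast
    then show ?thesis using 1 by (simp add: Htilde_supp_def)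
  qed
  have near: "AE s in lborel. \<bar>s - s0\<bar> < \<delta> \<longrightarrow> D s = v s \<and> \<bar>v s - v s0\<bar> < \<Delta> / 4" using v(2)
  proof eventually_elim
    case (elim s)
    show ?case
    proof
      assume s: "\<bar>s - s0\<bar> < \<delta>"
      then have "s \<in> {-2*L<..<2*L}" using s0(1) \<delta>(3) by auto
      then show "D s = v s \<and> \<bar>v s - v s0\<bar> < \<Delta> / 4" using elim d(2)[of s] s \<delta>(4) by simp
    qed
  qed
  have main: "ereal (ellip / 80 * \<Delta>) \<le> ?op"
  proof (cases "v s0 > 0")
    case True
    have gt: "AE s in lborel. \<bar>s - s0\<bar> < \<delta> \<longrightarrow> \<Delta> / 2 \<le> \<alpha>1 s - \<alpha>2 s" using near
    proof eventually_elim
      case (elim s)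
      show ?case
      proof
        assume "\<bar>s - s0\<bar> < \<delta>"
        then have "D s = v s" "\<bar>v s - v s0\<bar> < \<Delta> / 4" using elim by auto
        then show "\<Delta> / 2 \<le> \<alpha>1 s - \<alpha>2 s" using True s0(2) unfolding D_def by linarith
      qed
    qed
    obtain P P' where P: "P \<in> C1c UNIV" "C1_grad P P'" "\<And>s. \<delta> \<le> \<bar>s - s0\<bar> \<Longrightarrow> P s = 0"
      and n: "Htilde_norm \<omega> (\<lambda>x. bump p \<rho> (fst x) * P (snd x)) \<le> 1"
      and l: "ellip / 80 * \<Delta> \<le> DN \<omega> \<alpha>1 (\<lambda>x. bump p \<rho> (fst x) * P (snd x)) (\<lambda>x. bump p \<rho> (fst x) * P (snd x)) -
         DN \<omega> \<alpha>2 (\<lambda>x. bump p \<rho> (fst x) * P (snd x)) (\<lambda>x. bump p \<rho> (fst x) * P (snd x))"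
      by (rule DN_difference_lower_bound[OF a1 a2 \<Delta>(2) D\<Delta>[unfolded D_def] \<delta>(1,2) gt pf(1) \<rho>(1)]) (rule that)
    show ?thesis by (rule op_norm_ge[OF supp[OF P] n]) (assumption, rule order_trans[OF l abs_ge_self])
  next
    case False
    have gt: "AE s in lborel. \<bar>s - s0\<bar> < \<delta> \<longrightarrow> \<Delta> / 2 \<le> \<alpha>2 s - \<alpha>1 s" using near
    proof eventually_elim
      case (elim s)
      show ?case
      proof
        assume "\<bar>s - s0\<bar> < \<delta>"
        then have "D s = v s" "\<bar>v s - v s0\<bar> < \<Delta> / 4" using elim by auto
        then show "\<Delta> / 2 \<le> \<alpha>2 s - \<alpha>1 s" using False s0(2) unfolding D_def by linarith
      qed
    qed
    have D': "AE s in lborel. \<bar>\<alpha>2 s - \<alpha>1 s\<bar> \<le> \<Delta>" using D\<Delta> by eventually_elim (simp add: D_def abs_minus_commute)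
    obtain P P' where P: "P \<in> C1c UNIV" "C1_grad P P'" "\<And>s. \<delta> \<le> \<bar>s - s0\<bar> \<Longrightarrow> P s = 0"
      and n: "Htilde_norm \<omega> (\<lambda>x. bump p \<rho> (fst x) * P (snd x)) \<le> 1"
      and l: "ellip / 80 * \<Delta> \<le> DN \<omega> \<alpha>2 (\<lambda>x. bump p \<rho> (fst x) * P (snd x)) (\<lambda>x. bump p \<rho> (fst x) * P (snd x)) -
         DN \<omega> \<alpha>1 (\<lambda>x. bump p \<rho> (fst x) * P (snd x)) (\<lambda>x. bump p \<rho> (fst x) * P (snd x))"
      by (rule DN_difference_lower_bound[OF a2 a1 \<Delta>(2) D' \<delta>(1,2) gt pf(1) \<rho>(1)]) (rule that)
    show ?thesis by (rule op_norm_ge[OF supp[OF P] n]) (assumption, use l in linarith)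
  qed
  have "?N = ereal ?C * ereal (ellip / 80 * \<Delta>)" using \<Delta>(1) ellip_pos by simp
  also have "\<dots> \<le> ereal ?C * ?op" using main ellip_pos by (intro ereal_mult_left_mono) auto
  finally show ?thesis .
qed

end

theorem theorem3p1:
  fixes \<omega> :: "(real^2) set" and L M :: real
  assumes "open \<omega>" and "connected \<omega>" and "\<omega> \<noteq> {}" and "bounded \<omega>" and "lipschitz_boundary \<omega>"
    and "L > 0" and "M > 0"
  shows "\<exists>C>0. \<forall>\<gamma> \<alpha>\<^sub>1 \<alpha>\<^sub>2. \<forall>t\<^sub>0 > 0.
    openin (top_of_set (frontier \<omega>)) \<gamma> \<longrightarrow> \<gamma> \<noteq> {} \<longrightarrow>
    \<alpha>\<^sub>1 \<in> W1inf \<longrightarrow> \<alpha>\<^sub>2 \<in> W1inf \<longrightarrow>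
    (AE s in lborel. \<bar>s\<bar> > L \<longrightarrow> \<alpha>\<^sub>1 s = \<alpha>\<^sub>2 s) \<longrightarrow>
    (AE s in lborel. \<alpha>\<^sub>1 s \<ge> t\<^sub>0) \<longrightarrow> (AE s in lborel. \<alpha>\<^sub>2 s \<ge> t\<^sub>0) \<longrightarrow>
    W1inf_norm \<alpha>\<^sub>1 \<le> ereal M \<longrightarrow> W1inf_norm \<alpha>\<^sub>2 \<le> ereal M \<longrightarrow>
    Linf_norm (\<lambda>s. \<alpha>\<^sub>1 s - \<alpha>\<^sub>2 s)
      \<le> ereal C * op_norm \<omega> (Htilde_supp \<omega> (\<gamma> \<times> {-2*L<..<2*L}))
          (\<lambda>f g. DN \<omega> \<alpha>\<^sub>1 f g - DN \<omega> \<alpha>\<^sub>2 f g)"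
proof -
  interpret lipschitz_domain \<omega> using assms by unfold_locales
  show ?thesis
  proof (intro exI[of _ "80 / ellip"] conjI allI impI)
    \<comment> \<open>The witness is built from \<open>width\<close> and so from \<omega>; it is
      fixed before \<gamma>, the coefficients and \<open>t\<^sub>0\<close>.\<close>
    show "80 / ellip > 0" using ellip_pos by simp
  qed (rule stability[OF \<open>L > 0\<close>])
qed

end
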